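(* Let $M$ be a countable transitive model of $\mathrm{ZFC}+\neg\mathrm{CH}$. Then there exists (in $M$) a c.c.c. iterated forcing notion $\mathbb P_{\omega_1}$ of $\omega_1$ steps with finite supports such that, whenever $G$ is $\mathbb P_{\omega_1}$-generic over $M$, there exists an almost disjoint family $\mathcal A$ such that $$M[G]\vDash |\mathcal A|=\omega_1,\ \mathcal A \text{ is MAD, and } \operatorname{CL}(\Psi(\mathcal A)) \text{ is pseudocompact}.$$
   Context: An almost disjoint family is an infinite collection of infinite subsets of $\omega$ whose pairwise intersections are finite; it is MAD if it is maximal under inclusion among almost disjoint families. For an almost disjoint family $\mathcal A$, the Isbell-Mrówka space $\Psi(\mathcal A)$ is the set $\mathcal A\cup\omega$ topologized so that $\omega$ is open and discrete and $\{\{A\}\cup(A\setminus n): n\in\omega\}$ is a local base at $A\in\mathcal A$. For a topological space $X$, $\operatorname{CL}(X)$ is the set of nonempty closed subsets of $X$ with the Vietoris topology, whose base consists of the sets $\langle U_0,\dots,U_n\rangle=\{F\in \operatorname{CL}(X): F\subseteq\bigcup_{i\le n}U_i \text{ and } F\cap U_i\ne\emptyset \text{ for all } i\le n\}$, with $U_0,\dots,U_n$ open in $X$. A space is pseudocompact if every continuous function from it to $\mathbb R$ is bounded. *)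

theory Defs
  imports "HOL-Library.Countable_Set_Type"
begin

section \<open>Hereditarily countable sets\<close>

text \<open>
  The initial algebra of the countable powerset functor is the class of hereditarily countable
  sets: membership is well-founded and extensional, and every countable collection of
  hereditarily countable sets is one. Each countable transitive model of set theory is contained
  in this class, together with its forcing posets, names, generic filters and generic extensions,
  so countable transitive models are exactly the countable transitive subsets of the type
  below that satisfy the axioms.
\<close>

datatype hc = HC "hc cset"

primrec elts :: "hc \<Rightarrow> hc set" where
  "elts (HC X) = rcset X"

definition hset :: "hc set \<Rightarrow> hc" where
  "hset X = HC (acset X)"

lemma countable_elts: "countable (elts x)"
  by (cases x) (use rcset in auto)

lemma elts_hset: "countable X \<Longrightarrow> elts (hset X) = X"
  by (simp add: hset_def)

lemma hc_extensionality: "elts x = elts y \<longleftrightarrow> x = y"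
  by (cases x; cases y) (simp add: rcset_inject)

lemma wf_elts: "wf {(x, y). x \<in> elts y}"
proof (unfold wf_def, intro allI impI)
  fix P :: "hc \<Rightarrow> bool" and x
  assume step: "\<forall>x. (\<forall>y. (y, x) \<in> {(x, y). x \<in> elts y} \<longrightarrow> P y) \<longrightarrow> P x"
  show "P x"
  proof (induction x)
    case (HC X)
    then show ?case using step by auto
  qed
qed

definition hempty :: hc where
  "hempty = hset {}"

definition hsucc :: "hc \<Rightarrow> hc" where
  "hsucc x = hset (insert x (elts x))"

definition hpair :: "hc \<Rightarrow> hc \<Rightarrow> hc" where
  "hpair x y = hset {hset {x}, hset {x, y}}"

lemma hpair_inject: "hpair x y = hpair x' y' \<longleftrightarrow> x = x' \<and> y = y'"
proof
  assume "hpair x y = hpair x' y'"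
  then have "{hset {x}, hset {x, y}} = {hset {x'}, hset {x', y'}}"
    unfolding hpair_def by (metis elts_hset countable_finite finite.emptyI finite.insertI)
  moreover have "hset {a, b} = hset {c, d} \<longleftrightarrow> {a, b} = {c, d}" for a b c d
    by (metis elts_hset countable_finite finite.emptyI finite.insertI)
  then have "hset {a} = hset {c, d} \<longleftrightarrow> {a} = {c, d}" "hset {a} = hset {c} \<longleftrightarrow> a = c"
    "hset {c, d} = hset {a} \<longleftrightarrow> {c, d} = {a}" "hset {a, b} = hset {c, d} \<longleftrightarrow> {a, b} = {c, d}" for a b c d
    by (metis insert_absorb2 singleton_insert_inj_eq)+
  ultimately show "x = x' \<and> y = y'"
    by (simp add: doubleton_eq_iff) (metis doubleton_eq_iff insert_absorb2)
qed simp

definition hprod :: "hc set \<Rightarrow> hc set \<Rightarrow> hc set" where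
  "hprod X Y = {hpair x y | x y. x \<in> X \<and> y \<in> Y}"

primrec hnat :: "nat \<Rightarrow> hc" where
  "hnat 0 = hempty"
| "hnat (Suc n) = hsucc (hnat n)"

definition homega :: hc where
  "homega = hset (range hnat)"

definition hordinal :: "hc \<Rightarrow> bool" where
  "hordinal a \<longleftrightarrow> (\<forall>x\<in>elts a. elts x \<subseteq> elts a) \<and> (\<forall>x\<in>elts a. \<forall>y\<in>elts x. elts y \<subseteq> elts x)"

definition hlimit :: "hc \<Rightarrow> bool" where
  "hlimit a \<longleftrightarrow> hordinal a \<and> a \<noteq> hempty \<and> (\<forall>x\<in>elts a. hsucc x \<in> elts a)"

definition hfun :: "hc \<Rightarrow> hc set \<Rightarrow> bool" where
  "hfun f X \<longleftrightarrow> (\<forall>z\<in>elts f. \<exists>x\<in>X. \<exists>y. z = hpair x y) \<and> (\<forall>x\<in>X. \<exists>!y. hpair x y \<in> elts f)"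

definition happ :: "hc \<Rightarrow> hc \<Rightarrow> hc"  (infixl \<open>\<cdot>\<close> 95) where
  "f \<cdot> x = (THE y. hpair x y \<in> elts f)"

definition hrestrict :: "hc \<Rightarrow> hc \<Rightarrow> hc" where
  "hrestrict f a = hset {z \<in> elts f. \<exists>x\<in>elts a. \<exists>y. z = hpair x y}"


section \<open>Truth in a transitive model\<close>

text \<open>Formulas of the language of set theory with named variables; they are needed
  for the axiom schemas of ZFC.\<close>

datatype fm = Mem nat nat | Eq nat nat | Neg fm | Conj fm fm | Exi nat fm

primrec sat :: "hc set \<Rightarrow> (nat \<Rightarrow> hc) \<Rightarrow> fm \<Rightarrow> bool" where
  "sat M s (Mem i j) \<longleftrightarrow> s i \<in> elts (s j)"
| "sat M s (Eq i j) \<longleftrightarrow> s i = s j"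
| "sat M s (Neg p) \<longleftrightarrow> \<not> sat M s p"
| "sat M s (Conj p q) \<longleftrightarrow> sat M s p \<and> sat M s q"
| "sat M s (Exi i p) \<longleftrightarrow> (\<exists>x\<in>M. sat M (s(i := x)) p)"

definition transitive_class :: "hc set \<Rightarrow> bool" where
  "transitive_class M \<longleftrightarrow> (\<forall>x\<in>M. elts x \<subseteq> M)"

definition extensionality_axiom_in :: "hc set \<Rightarrow> bool" where
  "extensionality_axiom_in M \<longleftrightarrow>
    (\<forall>x\<in>M. \<forall>y\<in>M. (\<forall>z\<in>M. z \<in> elts x \<longleftrightarrow> z \<in> elts y) \<longrightarrow> x = y)"

definition foundation_axiom_in :: "hc set \<Rightarrow> bool" where
  "foundation_axiom_in M \<longleftrightarrow>
    (\<forall>x\<in>M. (\<exists>y\<in>M. y \<in> elts x) \<longrightarrow>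
     (\<exists>y\<in>M. y \<in> elts x \<and> \<not> (\<exists>z\<in>M. z \<in> elts x \<and> z \<in> elts y)))"

definition pairing_axiom_in :: "hc set \<Rightarrow> bool" where
  "pairing_axiom_in M \<longleftrightarrow>
    (\<forall>x\<in>M. \<forall>y\<in>M. \<exists>z\<in>M. x \<in> elts z \<and> y \<in> elts z)"

definition union_axiom_in :: "hc set \<Rightarrow> bool" where
  "union_axiom_in M \<longleftrightarrow>
    (\<forall>F\<in>M. \<exists>U\<in>M. \<forall>y\<in>M. \<forall>x\<in>M. x \<in> elts y \<and> y \<in> elts F \<longrightarrow> x \<in> elts U)"

definition power_set_axiom_in :: "hc set \<Rightarrow> bool" where
  "power_set_axiom_in M \<longleftrightarrow>
    (\<forall>x\<in>M. \<exists>y\<in>M. \<forall>z\<in>M. (\<forall>w\<in>M. w \<in> elts z \<longrightarrow> w \<in> elts x) \<longrightarrow> z \<in> elts y)"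

definition infinity_axiom_in :: "hc set \<Rightarrow> bool" where
  "infinity_axiom_in M \<longleftrightarrow>
    (\<exists>x\<in>M. (\<exists>e\<in>M. e \<in> elts x \<and> \<not> (\<exists>z\<in>M. z \<in> elts e)) \<and>
     (\<forall>y\<in>M. y \<in> elts x \<longrightarrow>
       (\<exists>t\<in>M. t \<in> elts x \<and> (\<forall>w\<in>M. w \<in> elts t \<longleftrightarrow> w \<in> elts y \<or> w = y))))"

text \<open>In the schemas, the assignment \<open>s\<close> supplies arbitrary parameters from the model.
  Separation uses variable 0 for the element; Replacement uses 0 for the argument
  and 1 for the value.\<close>

definition separation_schema_in :: "hc set \<Rightarrow> bool" where
  "separation_schema_in M \<longleftrightarrow>
    (\<forall>\<phi> s. (\<forall>i. s i \<in> M) \<longrightarrow> (\<forall>a\<in>M. \<exists>b\<in>M. \<forall>x\<in>M.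
     x \<in> elts b \<longleftrightarrow> x \<in> elts a \<and> sat M (s(0 := x)) \<phi>))"

definition replacement_schema_in :: "hc set \<Rightarrow> bool" where
  "replacement_schema_in M \<longleftrightarrow>
    (\<forall>\<phi> s. (\<forall>i. s i \<in> M) \<longrightarrow> (\<forall>a\<in>M.
     (\<forall>x\<in>M. x \<in> elts a \<longrightarrow> (\<exists>!y. y \<in> M \<and> sat M (s(0 := x, 1 := y)) \<phi>)) \<longrightarrow>
     (\<exists>b\<in>M. \<forall>x\<in>M. x \<in> elts a \<longrightarrow> (\<exists>y\<in>M. y \<in> elts b \<and> sat M (s(0 := x, 1 := y)) \<phi>))))"

definition choice_axiom_in :: "hc set \<Rightarrow> bool" where
  "choice_axiom_in M \<longleftrightarrow>
    (\<forall>F\<in>M. (\<forall>x\<in>M. x \<in> elts F \<longrightarrow> (\<exists>z\<in>M. z \<in> elts x)) \<and>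
       (\<forall>x\<in>M. \<forall>y\<in>M. x \<in> elts F \<and> y \<in> elts F \<and> x \<noteq> y \<longrightarrow>
         \<not> (\<exists>z\<in>M. z \<in> elts x \<and> z \<in> elts y)) \<longrightarrow>
     (\<exists>c\<in>M. \<forall>x\<in>M. x \<in> elts F \<longrightarrow> (\<exists>!z. z \<in> M \<and> z \<in> elts x \<and> z \<in> elts c)))"

definition models_ZFC :: "hc set \<Rightarrow> bool" where
  "models_ZFC M \<longleftrightarrow>
    extensionality_axiom_in M \<and>
    foundation_axiom_in M \<and>
    pairing_axiom_in M \<and>
    union_axiom_in M \<and>
    power_set_axiom_in M \<and>
    infinity_axiom_in M \<and>
    separation_schema_in M \<and>
    replacement_schema_in M \<and>
    choice_axiom_in M"

text \<open>
  From here on, a predicate with suffix \<open>_in\<close> and first argument \<open>M\<close> is the relativization of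
  the corresponding notion to \<open>M\<close>, for \<open>M\<close> a transitive model of ZFC: every unbounded quantifier
  (over subsets, functions, families, open sets, ...) ranges over \<open>M\<close>. Bounded quantifiers, over
  the members of an element of \<open>M\<close>, and the pairing, ordinal, natural-number and
  function-application notions above need no relativization because \<open>M\<close> is transitive.
  Sets of type \<open>hc set\<close> passed as arguments are definable subcollections of \<open>M\<close>
  which are sets in \<open>M\<close>.
\<close>

definition fun_in :: "hc set \<Rightarrow> hc \<Rightarrow> hc set \<Rightarrow> hc set \<Rightarrow> bool" where
  "fun_in M f X Y \<longleftrightarrow> f \<in> M \<and> hfun f X \<and> (\<forall>x\<in>X. f \<cdot> x \<in> Y)"

definition equipollent_in :: "hc set \<Rightarrow> hc set \<Rightarrow> hc set \<Rightarrow> bool" where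
  "equipollent_in M X Y \<longleftrightarrow> (\<exists>f. fun_in M f X Y \<and> bij_betw (\<lambda>x. f \<cdot> x) X Y)"

definition finite_in :: "hc set \<Rightarrow> hc set \<Rightarrow> bool" where
  "finite_in M X \<longleftrightarrow> (\<exists>n. equipollent_in M (elts (hnat n)) X)"

definition countable_in :: "hc set \<Rightarrow> hc set \<Rightarrow> bool" where
  "countable_in M X \<longleftrightarrow> (\<exists>f. fun_in M f X (elts homega) \<and> inj_on (\<lambda>x. f \<cdot> x) X)"

definition omega1_in :: "hc set \<Rightarrow> hc \<Rightarrow> bool" where
  "omega1_in M k \<longleftrightarrow> k \<in> M \<and> hordinal k \<and> \<not> countable_in M (elts k) \<and>
    (\<forall>a\<in>elts k. countable_in M (elts a))"

definition CH_in :: "hc set \<Rightarrow> bool" where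
  "CH_in M \<longleftrightarrow> (\<exists>k. omega1_in M k \<and> equipollent_in M {x \<in> M. elts x \<subseteq> elts homega} (elts k))"


section \<open>Forcing\<close>

definition forcing_poset :: "hc \<Rightarrow> hc \<Rightarrow> hc \<Rightarrow> bool" where
  "forcing_poset P le one \<longleftrightarrow>
    one \<in> elts P \<and> elts le \<subseteq> hprod (elts P) (elts P) \<and>
    (\<forall>p\<in>elts P. hpair p p \<in> elts le) \<and>
    (\<forall>p\<in>elts P. \<forall>q\<in>elts P. \<forall>r\<in>elts P.
      hpair p q \<in> elts le \<and> hpair q r \<in> elts le \<longrightarrow> hpair p r \<in> elts le) \<and>
    (\<forall>p\<in>elts P. hpair p one \<in> elts le)"

definition generic :: "hc set \<Rightarrow> hc \<Rightarrow> hc \<Rightarrow> hc set \<Rightarrow> bool" where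
  "generic M P le G \<longleftrightarrow>
    G \<subseteq> elts P \<and> G \<noteq> {} \<and>
    (\<forall>p\<in>G. \<forall>q\<in>elts P. hpair p q \<in> elts le \<longrightarrow> q \<in> G) \<and>
    (\<forall>p\<in>G. \<forall>q\<in>G. \<exists>r\<in>G. hpair r p \<in> elts le \<and> hpair r q \<in> elts le) \<and>
    (\<forall>D\<in>M. elts D \<subseteq> elts P \<and> (\<forall>p\<in>elts P. \<exists>d\<in>elts D. hpair d p \<in> elts le) \<longrightarrow>
      G \<inter> elts D \<noteq> {})"

definition ccc_in :: "hc set \<Rightarrow> hc \<Rightarrow> hc \<Rightarrow> bool" where
  "ccc_in M P le \<longleftrightarrow>
    (\<forall>A\<in>M. elts A \<subseteq> elts P \<and>
      (\<forall>p\<in>elts A. \<forall>q\<in>elts A. p \<noteq> q \<longrightarrow>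
        \<not> (\<exists>r\<in>elts P. hpair r p \<in> elts le \<and> hpair r q \<in> elts le)) \<longrightarrow>
      countable_in M (elts A))"

inductive pname :: "hc \<Rightarrow> hc \<Rightarrow> bool" for P where
  "(\<forall>z\<in>elts t. \<exists>s p. z = hpair s p \<and> p \<in> elts P \<and> pname P s) \<Longrightarrow> pname P t"

function val :: "hc set \<Rightarrow> hc \<Rightarrow> hc" where
  "val G t = hset ((\<lambda>s. val G s) ` {s. \<exists>p\<in>G. hpair s p \<in> elts t})"
  by auto
termination
proof (relation "inv_image ({(x, y). x \<in> elts y}\<^sup>+) snd", goal_cases)
  case 1
  show ?case by (intro wf_inv_image wf_trancl wf_elts)
next
  case (2 G t s)
  then obtain p where p: "hpair s p \<in> elts t" by blast
  have "s \<in> elts (hset {s})" "hset {s} \<in> elts (hpair s p)"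
    by (simp_all add: hpair_def elts_hset)
  with p have "(s, t) \<in> {(x, y). x \<in> elts y}\<^sup>+"
    by (meson CollectI case_prodI trancl.intros)
  then show ?case by simp
qed

declare val.simps [simp del]

definition generic_ext :: "hc set \<Rightarrow> hc \<Rightarrow> hc set \<Rightarrow> hc set" where
  "generic_ext M P G = val G ` {t \<in> M. pname P t}"

text \<open>The forcing relation for statements \<open>\<Phi>\<close> about the values of names. It is used below only
  for \<open>\<Phi>\<close> with bounded quantifiers, so \<open>\<Phi>\<close> needs no relativization to the generic extension.\<close>

definition forces :: "hc set \<Rightarrow> hc \<Rightarrow> hc \<Rightarrow> hc \<Rightarrow> ((hc \<Rightarrow> hc) \<Rightarrow> bool) \<Rightarrow> bool" where
  "forces M P le p \<Phi> \<longleftrightarrow> (\<forall>G. generic M P le G \<and> p \<in> G \<longrightarrow> \<Phi> (val G))"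

definition poset_name :: "hc set \<Rightarrow> hc \<Rightarrow> hc \<Rightarrow> hc \<Rightarrow> hc \<Rightarrow> hc \<Rightarrow> hc \<Rightarrow> bool" where
  "poset_name M P le one Q Qle Qone \<longleftrightarrow>
    Q \<in> M \<and> pname P Q \<and> Qle \<in> M \<and> pname P Qle \<and> Qone \<in> M \<and> pname P Qone \<and>
    (\<exists>r. hpair Qone r \<in> elts Q) \<and>
    forces M P le one (\<lambda>v. forcing_poset (v Q) (v Qle) (v Qone))"

text \<open>
  Finite-support iterations of length \<open>d\<close> in \<open>M\<close>, as in Kunen's textbook (1980), Chapter VIII:
  \<open>P \<cdot> x\<close>, \<open>Ple \<cdot> x\<close>, \<open>Pone \<cdot> x\<close> is the poset at stage \<open>x \<le> d\<close> and \<open>Q \<cdot> x\<close>, \<open>Qle \<cdot> x\<close>,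
  \<open>Qone \<cdot> x\<close> are the names for the iterand at \<open>x < d\<close>. Coordinates of conditions are taken
  from the domain of the name of the iterand, which makes each \<open>P \<cdot> x\<close> a set.
\<close>

definition fs_iteration_in ::
    "hc set \<Rightarrow> hc \<Rightarrow> hc \<Rightarrow> hc \<Rightarrow> hc \<Rightarrow> hc \<Rightarrow> hc \<Rightarrow> hc \<Rightarrow> bool" where
  "fs_iteration_in M d P Ple Pone Q Qle Qone \<longleftrightarrow>
    d \<in> M \<and> hordinal d \<and>
    (\<forall>f\<in>{P, Ple, Pone}. f \<in> M \<and> hfun f (elts (hsucc d))) \<and>
    (\<forall>f\<in>{Q, Qle, Qone}. f \<in> M \<and> hfun f (elts d)) \<and>
    (\<forall>x\<in>elts (hsucc d).
      forcing_poset (P \<cdot> x) (Ple \<cdot> x) (Pone \<cdot> x) \<and>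
      hfun (Pone \<cdot> x) (elts x) \<and> (\<forall>y\<in>elts x. Pone \<cdot> x \<cdot> y = Qone \<cdot> y)) \<and>
    (\<forall>x\<in>elts d. poset_name M (P \<cdot> x) (Ple \<cdot> x) (Pone \<cdot> x) (Q \<cdot> x) (Qle \<cdot> x) (Qone \<cdot> x)) \<and>
    elts (P \<cdot> hempty) = {hempty} \<and>
    (\<forall>x\<in>elts d.
      (\<forall>p\<in>M. p \<in> elts (P \<cdot> hsucc x) \<longleftrightarrow>
        hfun p (elts (hsucc x)) \<and> hrestrict p x \<in> elts (P \<cdot> x) \<and>
        (\<exists>r. hpair (p \<cdot> x) r \<in> elts (Q \<cdot> x)) \<and>
        forces M (P \<cdot> x) (Ple \<cdot> x) (hrestrict p x) (\<lambda>v. v (p \<cdot> x) \<in> elts (v (Q \<cdot> x)))) \<and>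
      (\<forall>p\<in>elts (P \<cdot> hsucc x). \<forall>q\<in>elts (P \<cdot> hsucc x).
        hpair p q \<in> elts (Ple \<cdot> hsucc x) \<longleftrightarrow>
          hpair (hrestrict p x) (hrestrict q x) \<in> elts (Ple \<cdot> x) \<and>
          forces M (P \<cdot> x) (Ple \<cdot> x) (hrestrict p x)
            (\<lambda>v. hpair (v (p \<cdot> x)) (v (q \<cdot> x)) \<in> elts (v (Qle \<cdot> x))))) \<and>
    (\<forall>x\<in>elts (hsucc d). hlimit x \<longrightarrow>
      (\<forall>p\<in>M. p \<in> elts (P \<cdot> x) \<longleftrightarrow>
        hfun p (elts x) \<and> (\<forall>y\<in>elts x. hrestrict p y \<in> elts (P \<cdot> y)) \<and>
        finite_in M {y \<in> elts x. p \<cdot> y \<noteq> Qone \<cdot> y}) \<and>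
      (\<forall>p\<in>elts (P \<cdot> x). \<forall>q\<in>elts (P \<cdot> x).
        hpair p q \<in> elts (Ple \<cdot> x) \<longleftrightarrow>
          (\<forall>y\<in>elts x. hpair (hrestrict p y) (hrestrict q y) \<in> elts (Ple \<cdot> y))))"


section \<open>Almost disjoint families, Isbell-Mrowka spaces and hyperspaces in a model\<close>

definition almost_disjoint_in :: "hc set \<Rightarrow> hc \<Rightarrow> bool" where
  "almost_disjoint_in M A \<longleftrightarrow> A \<in> M \<and> \<not> finite_in M (elts A) \<and>
    (\<forall>a\<in>elts A. elts a \<subseteq> elts homega \<and> \<not> finite_in M (elts a)) \<and>
    (\<forall>a\<in>elts A. \<forall>b\<in>elts A. a \<noteq> b \<longrightarrow> finite_in M (elts a \<inter> elts b))"

definition MAD_in :: "hc set \<Rightarrow> hc \<Rightarrow> bool" where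
  "MAD_in M A \<longleftrightarrow> almost_disjoint_in M A \<and>
    (\<forall>B\<in>M. almost_disjoint_in M B \<and> elts A \<subseteq> elts B \<longrightarrow> B = A)"

text \<open>A topological space in \<open>M\<close> is given by its points and its collection of open sets.
  The union of a family and the set of naturals is automatically disjoint, as members of
  almost disjoint families are infinite.\<close>

definition Psi_points :: "hc \<Rightarrow> hc set" where
  "Psi_points A = elts A \<union> elts homega"

definition Psi_opens_in :: "hc set \<Rightarrow> hc \<Rightarrow> hc set" where
  "Psi_opens_in M A = {U \<in> M. elts U \<subseteq> Psi_points A \<and>
    (\<forall>a \<in> elts U \<inter> elts A. \<exists>n. {a} \<union> (elts a - elts (hnat n)) \<subseteq> elts U)}"

definition CL_in :: "hc set \<Rightarrow> hc set \<Rightarrow> hc set \<Rightarrow> hc set" where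
  "CL_in M X T = {F \<in> M. elts F \<noteq> {} \<and> elts F \<subseteq> X \<and> (\<exists>U\<in>T. elts U = X - elts F)}"

definition vietoris_basic :: "hc set \<Rightarrow> nat \<Rightarrow> (nat \<Rightarrow> hc) \<Rightarrow> hc set" where
  "vietoris_basic C n U = {F \<in> C. elts F \<subseteq> (\<Union>i\<le>n. elts (U i)) \<and>
    (\<forall>i\<le>n. elts F \<inter> elts (U i) \<noteq> {})}"

text \<open>The tuples \<open>U 0, \<dots>, U n\<close> need no relativization: finite sequences of elements of a
  transitive model of ZFC belong to the model.\<close>

definition vietoris_opens_in :: "hc set \<Rightarrow> hc set \<Rightarrow> hc set \<Rightarrow> hc set" where
  "vietoris_opens_in M X T = {W \<in> M. elts W \<subseteq> CL_in M X T \<and>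
    (\<forall>F\<in>elts W. \<exists>n U. (\<forall>i\<le>n. U i \<in> T) \<and>
      F \<in> vietoris_basic (CL_in M X T) n U \<and> vietoris_basic (CL_in M X T) n U \<subseteq> elts W)}"

text \<open>The real line of \<open>M\<close> is, up to isomorphism, the unique complete ordered field of \<open>M\<close>.\<close>

definition complete_ordered_field_in ::
    "hc set \<Rightarrow> hc \<Rightarrow> hc \<Rightarrow> hc \<Rightarrow> hc \<Rightarrow> hc \<Rightarrow> hc \<Rightarrow> bool" where
  "complete_ordered_field_in M R add mul zero one lt \<longleftrightarrow>
    (let K = elts R;
         plus = (\<lambda>x y. add \<cdot> hpair x y);
         times = (\<lambda>x y. mul \<cdot> hpair x y);
         less = (\<lambda>x y. hpair x y \<in> elts lt)
     in R \<in> M \<and> fun_in M add (hprod K K) K \<and> fun_in M mul (hprod K K) K \<and>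
        lt \<in> M \<and> elts lt \<subseteq> hprod K K \<and> zero \<in> K \<and> one \<in> K \<and> zero \<noteq> one \<and>
        (\<forall>x\<in>K. \<forall>y\<in>K. \<forall>z\<in>K.
          plus (plus x y) z = plus x (plus y z) \<and> plus x y = plus y x \<and>
          times (times x y) z = times x (times y z) \<and> times x y = times y x \<and>
          times x (plus y z) = plus (times x y) (times x z)) \<and>
        (\<forall>x\<in>K. plus x zero = x \<and> times x one = x) \<and>
        (\<forall>x\<in>K. \<exists>y\<in>K. plus x y = zero) \<and>
        (\<forall>x\<in>K. x \<noteq> zero \<longrightarrow> (\<exists>y\<in>K. times x y = one)) \<and>
        (\<forall>x\<in>K. \<not> less x x) \<and>
        (\<forall>x\<in>K. \<forall>y\<in>K. \<forall>z\<in>K. less x y \<and> less y z \<longrightarrow> less x z) \<and>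
        (\<forall>x\<in>K. \<forall>y\<in>K. less x y \<or> x = y \<or> less y x) \<and>
        (\<forall>x\<in>K. \<forall>y\<in>K. \<forall>z\<in>K. less x y \<longrightarrow> less (plus x z) (plus y z)) \<and>
        (\<forall>x\<in>K. \<forall>y\<in>K. less zero x \<and> less zero y \<longrightarrow> less zero (times x y)) \<and>
        (\<forall>S\<in>M. elts S \<subseteq> K \<and> elts S \<noteq> {} \<and> (\<exists>b\<in>K. \<forall>s\<in>elts S. \<not> less b s) \<longrightarrow>
          (\<exists>l\<in>K. (\<forall>s\<in>elts S. \<not> less l s) \<and>
            (\<forall>b\<in>K. (\<forall>s\<in>elts S. \<not> less b s) \<longrightarrow> \<not> less b l))))"

definition order_opens_in :: "hc set \<Rightarrow> hc \<Rightarrow> hc \<Rightarrow> hc set" where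
  "order_opens_in M R lt = {V \<in> M. elts V \<subseteq> elts R \<and>
    (\<forall>x\<in>elts V. \<exists>a\<in>elts R. \<exists>b\<in>elts R.
      hpair a x \<in> elts lt \<and> hpair x b \<in> elts lt \<and>
      {y \<in> elts R. hpair a y \<in> elts lt \<and> hpair y b \<in> elts lt} \<subseteq> elts V)}"

definition continuous_in ::
    "hc set \<Rightarrow> hc set \<Rightarrow> hc set \<Rightarrow> hc set \<Rightarrow> hc set \<Rightarrow> hc \<Rightarrow> bool" where
  "continuous_in M X T Y S f \<longleftrightarrow> fun_in M f X Y \<and>
    (\<forall>V\<in>S. \<exists>U\<in>T. elts U = {x \<in> X. f \<cdot> x \<in> elts V})"

definition pseudocompact_in :: "hc set \<Rightarrow> hc set \<Rightarrow> hc set \<Rightarrow> bool" where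
  "pseudocompact_in M X T \<longleftrightarrow>
    (\<exists>R add mul zero one lt. complete_ordered_field_in M R add mul zero one lt \<and>
      (\<forall>f. continuous_in M X T (elts R) (order_opens_in M R lt) f \<longrightarrow>
        (\<exists>a\<in>elts R. \<exists>b\<in>elts R. \<forall>x\<in>X.
          \<not> hpair (f \<cdot> x) a \<in> elts lt \<and> \<not> hpair b (f \<cdot> x) \<in> elts lt)))"

end

theory Submission
  imports Defs Complex_Main
begin

text \<open>
  The iteration is trivial except for its first step, which adds \<open>\<omega>\<^sub>1\<close> subsets of \<open>\<omega>\<close> by finite conditions;
  a condition freezes the intersections of the sets that it mentions. Every real of the extension lies in the
  extension by the first \<open>\<delta>\<close> sets for some countable \<open>\<delta>\<close>, and the other sets are generic over that model:
  they realize some pattern from every family of patterns that can avoid finitely many of the earlier sets.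
  Hence the family is MAD.

  The finite subsets of \<open>\<omega>\<close> are dense in the hyperspace, so an unbounded continuous function would be unbounded
  on a sequence of finite sets \<open>F\<^sub>n\<close>. Some subsequence converges pointwise to a set \<open>z\<close>. The closed set consisting
  of \<open>z\<close>, its limit points and all members of the family that meet infinitely many of the sets \<open>F\<^sub>n - z\<close> is an
  accumulation point of the sequence: maximality makes the sets \<open>F\<^sub>n\<close> eventually fit into every open set
  around it, and genericity makes them hit finitely many of the members at once. This contradicts continuity.
\<close>

text \<open>The main obstacle is that every construction has to take place inside \<open>M\<close>
  or its extension, where only definable subcollections are sets. Definability is therefore treated
  as a closure property of predicates of assignments, and few lemmas ever mention a formula. The
  extension is shown to satisfy pairing, union, power set and separation; where choice or
  replacement would be natural in it, enumerations from the ground model and bounded definitions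
  take their place. The chain condition, the preservation of \<open>\<omega>\<^sub>1\<close> and the
  capture of reals all come from one reflection principle: for a suitable countable \<delta>, a
  condition can be replaced by one supported in \<delta>. What makes this work is an extra row. A
  condition is first extended so that some row with index below \<delta> contains every number it
  mentions; after that its restriction to \<delta> retains all information about compatibility. The
  set with index \<delta> itself is the first one that is generic over the intermediate model, and
  it is the witness both for maximality and for absorbing a sequence of finite sets.\<close>

notation iff (infixr "<->" 25)

section \<open>Definability over a class\<close>

text \<open>Every variable index of the formula, free or bound, lies strictly below this number, so
  any index from it on is fresh.\<close>

primrec fm_bound :: "fm => nat" where
  "fm_bound (Mem i j) = Suc (i + j)"
| "fm_bound (Eq i j) = Suc (i + j)"
| "fm_bound (Neg p) = fm_bound p"
| "fm_bound (Conj p q) = fm_bound p + fm_bound q"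
| "fm_bound (Exi i p) = Suc (i + fm_bound p)"

lemma sat_cong: "(\<And>i. i < fm_bound \<phi> ==> s i = t i) ==> sat M s \<phi> <-> sat M t \<phi>"
proof (induction \<phi> arbitrary: s t)
  case (Neg p)
  have "sat M s p <-> sat M t p"
    by (rule Neg.IH) (use Neg.prems in simp)
  then show ?case by simp
next
  case (Conj p q)
  have "sat M s p <-> sat M t p" "sat M s q <-> sat M t q"
    by (rule Conj.IH; use Conj.prems in simp)+
  then show ?case by simp
next
  case (Exi i p)
  have "sat M (s(i := x)) p <-> sat M (t(i := x)) p" for x
    by (rule Exi.IH) (use Exi.prems in simp)
  then show ?case by simp
qed simp_all

text \<open>The new bound variable exceeds \<open>r j\<close> for all variables \<open>j\<close> of
  the body, so nothing is captured even if the renaming is not injective.\<close>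

primrec fm_rename :: "fm => (nat => nat) => fm" where
  "fm_rename (Mem i j) r = Mem (r i) (r j)"
| "fm_rename (Eq i j) r = Eq (r i) (r j)"
| "fm_rename (Neg p) r = Neg (fm_rename p r)"
| "fm_rename (Conj p q) r = Conj (fm_rename p r) (fm_rename q r)"
| "fm_rename (Exi i p) r =
    (let k = Suc (\<Sum>j<fm_bound p. r j) in Exi k (fm_rename p (r(i := k))))"

lemma sat_rename: "sat M s (fm_rename \<phi> r) <-> sat M (\<lambda>i. s (r i)) \<phi>"
proof (induction \<phi> arbitrary: s r)
  case (Exi i p)
  define k where "k = Suc (\<Sum>j<fm_bound p. r j)"
  have fresh: "r j \<noteq> k" if "j < fm_bound p" for j
    using member_le_sum[of j "{..<fm_bound p}" r] that by (auto simp: k_def)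
  have "sat M (\<lambda>j. (s(k := x)) ((r(i := k)) j)) p <-> sat M ((\<lambda>j. s (r j))(i := x)) p" for x
    by (rule sat_cong) (use fresh in auto)
  then show ?case by (simp add: Exi.IH flip: k_def)
qed simp_all

definition interleave :: "(nat => 'a) => (nat => 'a) => nat => 'a" where
  "interleave s a n = (if even n then s (n div 2) else a (n div 2))"

lemma interleave_simps [simp]:
  "interleave s a (2 * i) = s i" "interleave s a (Suc (2 * i)) = a i" "interleave s a 0 = s 0"
  by (simp_all add: interleave_def)

lemma interleave_upd: "interleave (s(0 := x)) a = (interleave s a)(0 := x)"
  by (auto simp: interleave_def fun_eq_iff elim!: evenE)

text \<open>A predicate of assignments is definable over \<open>M\<close> if it is given by a formula with
  parameters; the assignment supplies the even variables and the parameters the odd ones.\<close>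

definition dfn :: "hc set => ((nat => hc) => bool) => bool" where
  "dfn M P <-> (\<exists>\<phi> a. range a \<subseteq> M \<and> (\<forall>s. range s \<subseteq> M --> (P s <-> sat M (interleave s a) \<phi>)))"

text \<open>Variable 0 stands for the value and the arguments move up by one; the same shift
  represents a bound variable in the quantifier rules.\<close>

definition dff :: "hc set => ((nat => hc) => hc) => bool" where
  "dff M f <-> (\<forall>s. range s \<subseteq> M --> f s \<in> M) \<and> dfn M (\<lambda>s. s 0 = f (\<lambda>i. s (Suc i)))"

named_theorems dfi

lemma dfn_cong: "(\<And>s. range s \<subseteq> M ==> P s <-> Q s) ==> dfn M P <-> dfn M Q"
  unfolding dfn_def by (metis (no_types, lifting))

lemma dfn_not [dfi]: "dfn M P ==> dfn M (\<lambda>s. \<not> P s)"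
  unfolding dfn_def by (metis sat.simps(3))

lemma dfn_conj [dfi]:
  assumes "dfn M P" "dfn M Q"
  shows "dfn M (\<lambda>s. P s \<and> Q s)"
proof -
  obtain \<phi> a where a: "range a \<subseteq> M" "\<And>s. range s \<subseteq> M ==> P s <-> sat M (interleave s a) \<phi>"
    using assms(1) unfolding dfn_def by metis
  obtain \<psi> b where b: "range b \<subseteq> M" "\<And>s. range s \<subseteq> M ==> Q s <-> sat M (interleave s b) \<psi>"
    using assms(2) unfolding dfn_def by metis
  define c where "c = interleave a b"
  \<comment> \<open>The parameters of both formulas are interleaved into \<open>c\<close>: parameter
    k of the first becomes number 2k, parameter k of the second number 2k + 1.\<close>
  define r1 where "r1 n = (if even n then n else Suc (2 * (2 * (n div 2))))" for n :: nat
  define r2 where "r2 n = (if even n then n else Suc (2 * Suc (2 * (n div 2))))" for n :: nat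
  have "interleave s c (r1 n) = interleave s a n" "interleave s c (r2 n) = interleave s b n" for s n
    by (cases "even n"; force simp: c_def r1_def r2_def interleave_def elim!: evenE oddE)+
  then have "P s \<and> Q s <-> sat M (interleave s c) (Conj (fm_rename \<phi> r1) (fm_rename \<psi> r2))"
    if "range s \<subseteq> M" for s
    using a(2)[OF that] b(2)[OF that] by (simp add: sat_rename)
  moreover have "range c \<subseteq> M" using a(1) b(1) by (auto simp: c_def interleave_def)
  ultimately show ?thesis unfolding dfn_def by blast
qed

text \<open>The parameters form an infinite sequence, so infinitely many variables can be replaced
  by constants of \<open>M\<close> at once. This is how an outer assignment is frozen.\<close>

lemma dfn_subst:
  assumes "dfn M Q" "\<And>i. (\<exists>j. g i = (\<lambda>e. e j)) \<or> (\<exists>c\<in>M. g i = (\<lambda>e. c))"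
  shows "dfn M (\<lambda>e. Q (\<lambda>i. g i e))"
proof -
  obtain \<phi> a where a: "range a \<subseteq> M" "\<And>s. range s \<subseteq> M ==> Q s <-> sat M (interleave s a) \<phi>"
    using assms(1) unfolding dfn_def by metis
  define v where "v i = (\<exists>j. g i = (\<lambda>e. e j))" for i
  define j where "j i = (SOME j. g i = (\<lambda>e. e j))" for i
  \<comment> \<open>Where \<open>g i\<close> is a variable, \<open>a 0\<close> is a filler that
    keeps the parameters in \<open>M\<close>.\<close>
  define d where "d i = (if v i then a 0 else (SOME c. c \<in> M \<and> g i = (\<lambda>e. c)))" for i
  have j: "g i = (\<lambda>e. e (j i))" if "v i" for i
    unfolding j_def by (rule someI_ex) (use that v_def in auto)
  have d: "d i \<in> M \<and> (\<not> v i --> g i = (\<lambda>e. d i))" for i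
  proof (cases "v i")
    case False
    then have "\<exists>c. c \<in> M \<and> g i = (\<lambda>e. c)" using assms(2)[of i] v_def by auto
    from someI_ex[OF this] show ?thesis using False by (simp add: d_def)
  qed (use a(1) d_def in auto)
  define c where "c = interleave a d"
  define r where "r n = (if even n then if v (n div 2) then 2 * j (n div 2) else Suc (2 * Suc (2 * (n div 2)))
    else Suc (2 * (2 * (n div 2))))" for n
  have "interleave e c (r n) = interleave (\<lambda>i. g i e) a n" for e n
    using j[of "n div 2"] d[of "n div 2"]
    by (cases "even n"; cases "v (n div 2)") (auto simp: c_def r_def interleave_def elim!: evenE oddE)
  moreover have "range (\<lambda>i. g i e) \<subseteq> M" if e: "range e \<subseteq> M" for e
  proof (rule image_subsetI)
    fix i show "g i e \<in> M"
      using j[of i] d[of i] e by (cases "v i") auto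
  qed
  ultimately have "Q (\<lambda>i. g i e) <-> sat M (interleave e c) (fm_rename \<phi> r)" if "range e \<subseteq> M" for e
    using a(2)[of "\<lambda>i. g i e"] that by (simp add: sat_rename)
  moreover have "range c \<subseteq> M" using a(1) d by (auto simp: c_def interleave_def)
  ultimately show ?thesis unfolding dfn_def by blast
qed

lemma dfn_shift: "dfn M Q ==> dfn M (\<lambda>e. Q (\<lambda>i. e (r i)))"
  by (rule dfn_subst[of M Q "\<lambda>i e. e (r i)"]) auto

lemma range_case_nat: "range s \<subseteq> M ==> x \<in> M ==> range (case_nat x s) \<subseteq> M"
  by (force split: nat.splits)

lemma dfn_ex [dfi]:
  assumes "dfn M (\<lambda>s. P (\<lambda>i. s (Suc i)) (s 0))"
  shows "dfn M (\<lambda>s. \<exists>x\<in>M. P s x)"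
proof -
  obtain \<phi> a where a: "range a \<subseteq> M" "\<And>s. range s \<subseteq> M ==>
      P (\<lambda>i. s (Suc i)) (s 0) <-> sat M (interleave s a) \<phi>"
    using assms(1) unfolding dfn_def by metis
  \<comment> \<open>\<open>k\<close> is even, hence not a parameter, and lies beyond all variables
    of the formula. Argument 0 moves there, and the other arguments, at even positions, move down by
    two.\<close>
  define k where "k = 2 * fm_bound \<phi>"
  define r where "r n = (if n = 0 then k else if even n then n - 2 else n)" for n
  have "P s x <-> sat M ((interleave s a)(k := x)) (fm_rename \<phi> r)" if "range s \<subseteq> M" "x \<in> M" for s x
  proof -
    have "P s x <-> sat M (interleave (case_nat x s) a) \<phi>"
      using a(2)[OF range_case_nat[OF that]] by simp
    also have "\<dots> <-> sat M (\<lambda>n. ((interleave s a)(k := x)) (r n)) \<phi>"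
    proof (rule sat_cong)
      fix n assume n: "n < fm_bound \<phi>"
      consider "n = 0" | m where "n = 2 * Suc m" | "odd n"
        by (metis evenE not0_implies_Suc mult_0_right)
      then show "interleave (case_nat x s) a n = ((interleave s a)(k := x)) (r n)"
        by cases (use n in \<open>auto simp: r_def k_def interleave_def\<close>)
    qed
    finally show ?thesis by (simp add: sat_rename)
  qed
  then have "(\<exists>x\<in>M. P s x) <-> sat M (interleave s a) (Exi k (fm_rename \<phi> r))" if "range s \<subseteq> M" for s
    using that by simp
  then show ?thesis using a(1) unfolding dfn_def by blast
qed

lemma dfn_disj [dfi]:
  assumes "dfn M P" "dfn M Q" shows "dfn M (\<lambda>s. P s \<or> Q s)"
proof -
  have "dfn M (\<lambda>s. \<not> (\<not> P s \<and> \<not> Q s))"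
    by (intro dfn_not dfn_conj assms)
  then show ?thesis by simp
qed

lemma dfn_imp [dfi]:
  assumes "dfn M P" "dfn M Q" shows "dfn M (\<lambda>s. P s --> Q s)"
  unfolding imp_conv_disj by (intro dfn_not dfn_disj assms)

lemma dfn_iff [dfi]: "dfn M P ==> dfn M Q ==> dfn M (\<lambda>s. P s <-> Q s)"
  unfolding iff_conv_conj_imp by (intro dfn_conj dfn_imp)

lemma dfn_all [dfi]:
  assumes "dfn M (\<lambda>s. P (\<lambda>i. s (Suc i)) (s 0))"
  shows "dfn M (\<lambda>s. \<forall>x\<in>M. P s x)"
proof -
  have "dfn M (\<lambda>s. \<not> (\<exists>x\<in>M. \<not> P s x))"
    by (rule dfn_not, rule dfn_ex, rule dfn_not, rule assms)
  then show ?thesis by simp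
qed

lemma dfn_nonempty: "dfn M P ==> M \<noteq> {}"
  unfolding dfn_def by auto

lemma dfn_mem_vars: "M \<noteq> {} ==> dfn M (\<lambda>s. s i \<in> elts (s j))"
proof -
  assume "M \<noteq> {}"
  then obtain c where "c \<in> M" by blast
  then show ?thesis unfolding dfn_def
    by (intro exI[of _ "Mem (2 * i) (2 * j)"] exI[of _ "\<lambda>_. c"]) auto
qed

lemma dfn_eq_vars: "M \<noteq> {} ==> dfn M (\<lambda>s. s i = s j)"
proof -
  assume "M \<noteq> {}"
  then obtain c where "c \<in> M" by blast
  then show ?thesis unfolding dfn_def
    by (intro exI[of _ "Eq (2 * i) (2 * j)"] exI[of _ "\<lambda>_. c"]) auto
qed

lemma dfn_const:
  assumes "M \<noteq> {}" shows "dfn M (\<lambda>s. b)"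
proof -
  have "dfn M (\<lambda>s. s 0 = s 0 \<and> b)"
  proof (cases b)
    case True then show ?thesis using dfn_eq_vars[OF assms, of 0 0] by simp
  next
    case False then show ?thesis using dfn_not[OF dfn_eq_vars[OF assms, of 0 0]] by simp
  qed
  then show ?thesis by simp
qed

lemma dffI:
  assumes "\<And>s. range s \<subseteq> M ==> f s \<in> M" "dfn M (\<lambda>s. s 0 = f (\<lambda>i. s (Suc i)))"
  shows "dff M f"
  using assms unfolding dff_def by blast

lemma dff_closed: "dff M f ==> range s \<subseteq> M ==> f s \<in> M"
  unfolding dff_def by blast

lemma dff_var:
  assumes "M \<noteq> {}" shows "dff M (\<lambda>s. s i)"
  unfolding dff_def using dfn_eq_vars[OF assms] by auto

lemma dff_elem:
  assumes "c \<in> M" shows "dff M (\<lambda>s. c)"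
proof (rule dffI)
  define g where "g i = (if i = (0 :: nat) then (\<lambda>e. e (0 :: nat)) else (\<lambda>e. c))" for i
  have "dfn M (\<lambda>e. g 0 e = g 1 e)"
  proof (rule dfn_subst[of M "\<lambda>s. s 0 = s 1" g])
    fix i show "(\<exists>j. g i = (\<lambda>e. e j)) \<or> (\<exists>c\<in>M. g i = (\<lambda>e. c))"
      using assms by (cases "i = 0") (auto simp: g_def)
  qed (use dfn_eq_vars assms in auto)
  then show "dfn M (\<lambda>s. s 0 = c)" by (simp add: g_def)
qed (rule assms)

lemma dff_nonempty: "dff M f ==> M \<noteq> {}"
  unfolding dff_def using dfn_nonempty by blast

text \<open>The value is introduced by an existential quantifier over \<open>M\<close>; every
  substitution of a definable term for a variable rests on this.\<close>

lemma dfn_let: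
  assumes "dff M f" "dfn M (\<lambda>s. P (\<lambda>i. s (Suc i)) (s 0))"
  shows "dfn M (\<lambda>s. P s (f s))"
proof -
  have "dfn M (\<lambda>s. \<exists>x\<in>M. x = f s \<and> P s x)"
    by (rule dfn_ex, rule dfn_conj) (use assms dff_def in auto)
  moreover have "(\<exists>x\<in>M. x = f s \<and> P s x) <-> P s (f s)" if "range s \<subseteq> M" for s
    using dff_closed[OF assms(1) that] by blast
  ultimately show ?thesis by (subst dfn_cong[of M _ "\<lambda>s. \<exists>x\<in>M. x = f s \<and> P s x"]) auto
qed

lemma dff_shift:
  assumes "dff M f" shows "dff M (\<lambda>s. f (\<lambda>i. s (r i)))"
proof (rule dffI)
  show "f (\<lambda>i. s (r i)) \<in> M" if "range s \<subseteq> M" for s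
    by (rule dff_closed[OF assms]) (use that in auto)
  have "dfn M (\<lambda>s. s 0 = f (\<lambda>i. s (Suc i)))" using assms dff_def by blast
  from dfn_shift[OF this, of "case_nat 0 (\<lambda>i. Suc (r i))"]
  show "dfn M (\<lambda>s. s 0 = f (\<lambda>i. s (Suc (r i))))" by simp
qed

text \<open>With the composition rules it is enough to check later notions at variables such as
  \<open>s 0\<close> and \<open>s 1\<close>; arbitrary definable arguments follow.\<close>

lemma dfn_comp1:
  assumes "dfn M (\<lambda>s. Q (s 0))" "dff M f"
  shows "dfn M (\<lambda>s. Q (f s))"
  by (rule dfn_let[OF assms(2), where P = "\<lambda>s. Q"]) (rule assms(1))

lemma dfn_comp2:
  assumes "dfn M (\<lambda>s. Q (s 0) (s 1))" "dff M f" "dff M g"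
  shows "dfn M (\<lambda>s. Q (f s) (g s))"
proof (rule dfn_let[OF assms(2), where P = "\<lambda>s x. Q x (g s)"],
    rule dfn_let[OF dff_shift[OF assms(3)], where P = "\<lambda>s. Q (s 0)"])
  show "dfn M (\<lambda>s. Q (s (Suc 0)) (s 0))"
    using dfn_shift[OF assms(1), of "\<lambda>i. 1 - i"] by simp
qed

lemma dfn_comp3:
  assumes "dfn M (\<lambda>s. Q (s 0) (s 1) (s 2))" "dff M f" "dff M g" "dff M h"
  shows "dfn M (\<lambda>s. Q (f s) (g s) (h s))"
proof (rule dfn_let[OF assms(2), where P = "\<lambda>s x. Q x (g s) (h s)"],
    rule dfn_let[OF dff_shift[OF assms(3)], where P = "\<lambda>s x. Q (s 0) x (h (\<lambda>i. s (Suc i)))"],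
    rule dfn_let[OF dff_shift[OF assms(4)], where P = "\<lambda>s. Q (s (Suc 0)) (s 0)"])
  show "dfn M (\<lambda>s. Q (s (Suc (Suc 0))) (s (Suc 0)) (s 0))"
    using dfn_shift[OF assms(1), of "\<lambda>i. 2 - i"] by (simp add: numeral_2_eq_2)
qed

lemma dff_comp1:
  assumes "dff M (\<lambda>s. h (s 0))" "dff M f" shows "dff M (\<lambda>s. h (f s))"
proof (rule dffI)
  show "h (f s) \<in> M" if "range s \<subseteq> M" for s
    using dff_closed[OF assms(1), of "\<lambda>_. f s"] dff_closed[OF assms(2) that] by auto
  have "dfn M (\<lambda>s. s 0 = h (s 1))" using assms(1) by (simp add: dff_def)
  from dfn_comp2[OF this dff_var[OF dff_nonempty[OF assms(1)]] dff_shift[OF assms(2)]]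
  show "dfn M (\<lambda>s. s 0 = h (f (\<lambda>i. s (Suc i))))" .
qed

lemma dff_comp2:
  assumes "dff M (\<lambda>s. h (s 0) (s 1))" "dff M f" "dff M g" shows "dff M (\<lambda>s. h (f s) (g s))"
proof (rule dffI)
  show "h (f s) (g s) \<in> M" if "range s \<subseteq> M" for s
    using dff_closed[OF assms(1), of "case_nat (f s) (case_nat (g s) s)"] dff_closed[OF assms(2) that]
      dff_closed[OF assms(3) that] by (simp add: range_case_nat that)
  have "dfn M (\<lambda>s. s 0 = h (s 1) (s 2))" using assms(1) by (simp add: dff_def numeral_2_eq_2)
  from dfn_comp3[OF this dff_var[OF dff_nonempty[OF assms(1)]] dff_shift[OF assms(2)] dff_shift[OF assms(3)]]
  show "dfn M (\<lambda>s. s 0 = h (f (\<lambda>i. s (Suc i))) (g (\<lambda>i. s (Suc i))))" .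
qed

section \<open>Transitive models\<close>

declare elts_hset [simp] countable_elts [simp] countable_image [simp] countable_UN [simp]

lemma countable_elts_Collect [simp]:
  "countable {x \<in> elts a. P x}" "countable {x. x \<in> elts a \<and> P x}"
  by (rule countable_subset[OF _ countable_elts[of a]], blast)+

lemma elts_sep: "X = hset {x \<in> elts a. P x} ==> elts X = {x \<in> elts a. P x}" by simp

lemma hset_elts [simp]: "hset (elts x) = x"
  by (subst hc_extensionality[symmetric]) simp

lemma elts_hempty [simp]: "elts hempty = {}"
  by (simp add: hempty_def)

lemma elts_eq_empty [simp]: "elts x = {} <-> x = hempty"
  using hc_extensionality[of x hempty] by simp

lemma elts_hsucc [simp]: "elts (hsucc x) = insert x (elts x)"
  by (simp add: hsucc_def)

lemma elts_hpair [simp]: "elts (hpair x y) = {hset {x}, hset {x, y}}"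
  by (simp add: hpair_def)

lemmas hc_eqI = hc_extensionality[THEN iffD1]

declare hpair_inject [simp]

lemma elts_induct: "(\<And>x. (\<And>y. y \<in> elts x ==> P y) ==> P x) ==> P x"
  using wf_induct[OF wf_elts, of P x] by auto

lemma elts_irrefl [simp]: "x \<notin> elts x"
  using wf_elts by (metis (mono_tags, lifting) case_prodI mem_Collect_eq wf_not_refl)

lemma elts_asym: "x \<in> elts y ==> y \<notin> elts x"
  using wf_elts by (metis (mono_tags, lifting) case_prodI mem_Collect_eq wf_asym)

lemma hsucc_inject [simp]: "hsucc x = hsucc y <-> x = y"
proof
  assume "hsucc x = hsucc y"
  then have "insert x (elts x) = insert y (elts y)" by (metis elts_hsucc)
  then have "x = y \<or> x \<in> elts y" "x = y \<or> y \<in> elts x" by (auto simp: set_eq_iff)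
  then show "x = y" using elts_asym[of x y] by fast
qed simp

lemma hsucc_neq_hempty [simp]: "hsucc x \<noteq> hempty"
  by (metis elts_hempty elts_hsucc insert_not_empty)

lemma elts_hnat: "elts (hnat n) = hnat ` {..<n}"
  by (induction n) (auto simp: lessThan_Suc)

lemma finite_elts_hnat: "finite (elts (hnat n))" by (simp add: elts_hnat)

lemma elts_homega [simp]: "elts homega = range hnat"
  by (simp add: homega_def)

lemma hnat_inject [simp]: "hnat m = hnat n <-> m = n"
proof
  assume "hnat m = hnat n"
  then show "m = n"
    by (induction m arbitrary: n) (metis hnat.simps hsucc_inject hsucc_neq_hempty not0_implies_Suc)+
qed simp

lemma hnat_mem [simp]: "hnat m \<in> elts (hnat n) <-> m < n"
  by (auto simp: elts_hnat)

definition hun :: "hc => hc => hc" where "hun x y = hset (elts x \<union> elts y)"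
definition hUn :: "hc => hc" where "hUn x = hset (\<Union> (elts ` elts x))"
definition hprd :: "hc => hc => hc" where "hprd x y = hset (hprod (elts x) (elts y))"

lemma elts_hun [simp]: "elts (hun x y) = elts x \<union> elts y" by (simp add: hun_def)
lemma elts_hUn [simp]: "elts (hUn x) = \<Union> (elts ` elts x)" by (simp add: hUn_def)

lemma hprod_image: "hprod X Y = (\<lambda>(x, y). hpair x y) ` (X \<times> Y)"
  by (auto simp: hprod_def)

lemma elts_hprd [simp]: "elts (hprd x y) = hprod (elts x) (elts y)"
  by (simp add: hprd_def hprod_image)

lemma hpair_in_hprod [simp]: "hpair x y \<in> hprod X Y <-> x \<in> X \<and> y \<in> Y"
  by (auto simp: hprod_def)

text \<open>Replacement and choice are left out deliberately: generic extensions are shown to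
  satisfy exactly these assumptions, so everything proved here serves on both sides of the
  forcing.\<close>

locale tm =
  fixes M :: "hc set"
  assumes nonempty: "M \<noteq> {}"
    and trans: "x \<in> M ==> elts x \<subseteq> M"
    and pair_ex: "x \<in> M ==> y \<in> M ==> \<exists>z\<in>M. x \<in> elts z \<and> y \<in> elts z"
    and union_ex: "x \<in> M ==> \<exists>u\<in>M. \<forall>y\<in>elts x. elts y \<subseteq> elts u"
    and power_ex: "x \<in> M ==> \<exists>y\<in>M. \<forall>z\<in>M. elts z \<subseteq> elts x --> z \<in> elts y"
    and sep: "a \<in> M ==> dfn M (\<lambda>s. P (s 0)) ==> hset {x \<in> elts a. P x} \<in> M"
begin

lemma env_closed: "range s \<subseteq> M ==> s i \<in> M" for s :: "nat => hc"
  by auto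

lemma transD: "y \<in> elts x ==> x \<in> M ==> y \<in> M"
  using trans by blast

lemmas var [dfi] = dff_var[OF nonempty]
lemmas bool_const [dfi] = dfn_const[OF nonempty]
lemmas elem [dfi] = dff_elem[of _ M]

lemma mem [dfi]: "dff M f ==> dff M g ==> dfn M (\<lambda>s. f s \<in> elts (g s))"
  by (rule dfn_comp2[where Q = "\<lambda>x y. x \<in> elts y"]) (rule dfn_mem_vars[OF nonempty])

lemma eq [dfi]: "dff M f ==> dff M g ==> dfn M (\<lambda>s. f s = g s)"
  by (rule dfn_comp2[where Q = "\<lambda>x y. x = y"]) (rule dfn_eq_vars[OF nonempty])

lemma bex [dfi]:
  assumes "dff M f" "dfn M (\<lambda>s. P (\<lambda>i. s (Suc i)) (s 0))"
  shows "dfn M (\<lambda>s. \<exists>x\<in>elts (f s). P s x)"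
proof -
  have "dfn M (\<lambda>s. \<exists>x\<in>M. x \<in> elts (f s) \<and> P s x)"
    by (intro dfn_ex dfn_conj mem var dff_shift[OF assms(1)] assms(2))
  moreover have "(\<exists>x\<in>M. x \<in> elts (f s) \<and> P s x) <-> (\<exists>x\<in>elts (f s). P s x)" if "range s \<subseteq> M" for s
    using dff_closed[OF assms(1) that] transD by blast
  ultimately show ?thesis by (subst dfn_cong) (auto)
qed

lemma ball [dfi]:
  assumes "dff M f" "dfn M (\<lambda>s. P (\<lambda>i. s (Suc i)) (s 0))"
  shows "dfn M (\<lambda>s. \<forall>x\<in>elts (f s). P s x)"
proof -
  have "dfn M (\<lambda>s. \<not> (\<exists>x\<in>elts (f s). \<not> P s x))"
    by (intro dfn_not bex assms)
  then show ?thesis by simp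
qed

lemma subset [dfi]: 
  assumes "dff M f" "dff M g" shows "dfn M (\<lambda>s. elts (f s) \<subseteq> elts (g s))"
  unfolding subset_eq by (intro ball mem assms var dff_shift[OF assms(2)])

lemmas dfn_rules = bex ball dfn_conj dfn_disj dfn_iff dfn_not dfn_imp eq subset mem

text \<open>By transitivity and extensionality a value in \<open>M\<close> is pinned down by its
  members in \<open>M\<close>, so definability of membership in the value suffices.\<close>

lemma dff_ext:
  assumes "\<And>s. range s \<subseteq> M ==> f s \<in> M" "dfn M (\<lambda>s. s 0 \<in> elts (f (\<lambda>i. s (Suc i))))"
  shows "dff M f"
proof (rule dffI[OF assms(1)])
  have "dfn M (\<lambda>s. s 0 \<in> elts (f (\<lambda>i. s (Suc (Suc i)))))"
    using dfn_shift[OF assms(2), of "case_nat 0 (\<lambda>i. Suc (Suc i))"] by simp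
  then have "dfn M (\<lambda>s. \<forall>w\<in>M. w \<in> elts (s 0) <-> w \<in> elts (f (\<lambda>i. s (Suc i))))"
    by - (rule dfn_all, rule dfn_iff, rule mem, (rule var)+, assumption)
  moreover have "(\<forall>w\<in>M. w \<in> elts (s 0) <-> w \<in> elts (f (\<lambda>i. s (Suc i)))) <-> s 0 = f (\<lambda>i. s (Suc i))"
    if "range s \<subseteq> M" for s
  proof -
    have "s 0 \<in> M" "f (\<lambda>i. s (Suc i)) \<in> M" using that by (auto intro!: assms(1))
    then show ?thesis using trans by (metis hc_extensionality subset_antisym subset_iff)
  qed
  ultimately show "dfn M (\<lambda>s. s 0 = f (\<lambda>i. s (Suc i)))"
    by (subst dfn_cong) auto
qed

lemma hset_sub_closed:
  assumes "a \<in> M" "dfn M (\<lambda>s. P (s 0))" "\<And>x. P x ==> x \<in> elts a"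
  shows "hset {x. P x} \<in> M"
proof -
  have "{x. P x} = {x \<in> elts a. P x}" using assms(3) by auto
  then show ?thesis using sep[OF assms(1,2)] by simp
qed

lemma dff_sep [dfi]:
  assumes f: "dff M f" and P: "dfn M (\<lambda>s. P (\<lambda>i. s (Suc i)) (s 0))"
  shows "dff M (\<lambda>s. hset {x \<in> elts (f s). P s x})"
proof (rule dff_ext)
  fix s :: "nat => hc" assume s: "range s \<subseteq> M"
  show "hset {x \<in> elts (f s). P s x} \<in> M"
  proof (rule sep)
    show "f s \<in> M" using dff_closed[OF f s] .
    \<comment> \<open>The outer variables become constants, which leaves a predicate of the
      separated element alone.\<close>
    have "dfn M (\<lambda>e. (\<lambda>t. P (\<lambda>i. t (Suc i)) (t 0)) (\<lambda>i. (if i = 0 then (\<lambda>e. e 0) else (\<lambda>e. s (i - 1))) e))"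
      by (rule dfn_subst[OF P]) (use s in auto)
    then show "dfn M (\<lambda>e. P s (e 0))" by simp
  qed
next
  have "dfn M (\<lambda>s. P (\<lambda>i. s (Suc i)) (s 0))" by (rule P)
  then have "dfn M (\<lambda>s. s 0 \<in> elts (f (\<lambda>i. s (Suc i))) \<and> P (\<lambda>i. s (Suc i)) (s 0))"
    by (intro dfn_conj mem var dff_shift[OF f])
  then show "dfn M (\<lambda>s. s 0 \<in> elts (hset {x \<in> elts (f (\<lambda>i. s (Suc i))). P (\<lambda>i. s (Suc i)) x}))"
    by simp
qed

lemma pair_closed: "x \<in> M ==> y \<in> M ==> hset {x, y} \<in> M"
proof -
  assume xy: "x \<in> M" "y \<in> M"
  then obtain z where z: "z \<in> M" "x \<in> elts z" "y \<in> elts z" using pair_ex by blast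
  have "hset {w. w = x \<or> w = y} \<in> M"
    by (rule hset_sub_closed[OF z(1)]) (use xy z in \<open>auto intro!: dfi\<close>)
  moreover have "{w. w = x \<or> w = y} = {x, y}" by auto
  ultimately show ?thesis by simp
qed

lemma dff_pair [dfi]: "dff M f ==> dff M g ==> dff M (\<lambda>s. hset {f s, g s})"
proof (rule dff_comp2[where h = "\<lambda>x y. hset {x, y}"])
  show "dff M (\<lambda>s. hset {s 0, s 1})"
    by (rule dff_ext) (use pair_closed in \<open>auto intro!: dfi simp: env_closed\<close>)
qed

lemma dff_single [dfi]: "dff M f ==> dff M (\<lambda>s. hset {f s})"
  using dff_pair[of f f] by simp

lemma dff_hpair [dfi]: "dff M f ==> dff M g ==> dff M (\<lambda>s. hpair (f s) (g s))"
  unfolding hpair_def by (intro dfi)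

lemmas dff_rules = dff_hpair dff_single elem var

lemma dff_hUn [dfi]: "dff M f ==> dff M (\<lambda>s. hUn (f s))"
proof (rule dff_comp1[where h = hUn])
  show "dff M (\<lambda>s. hUn (s 0))"
  proof (rule dff_ext)
    fix s :: "nat => hc" assume "range s \<subseteq> M"
    then have s: "s 0 \<in> M" by auto
    then obtain u where u: "u \<in> M" "\<forall>y\<in>elts (s 0). elts y \<subseteq> elts u" using union_ex by blast
    have "hset {x. \<exists>y\<in>elts (s 0). x \<in> elts y} \<in> M"
      by (rule hset_sub_closed[OF u(1)]) (use s u in \<open>auto intro!: dfi\<close>)
    moreover have "{x. \<exists>y\<in>elts (s 0). x \<in> elts y} = \<Union> (elts ` elts (s 0))" by auto
    ultimately show "hUn (s 0) \<in> M" by (simp add: hUn_def)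
  next
    show "dfn M (\<lambda>s. s 0 \<in> elts (hUn (s (Suc 0))))"
      by simp (intro dfi)
  qed
qed

lemma dff_hun [dfi]: "dff M f ==> dff M g ==> dff M (\<lambda>s. hun (f s) (g s))"
proof -
  have "hun x y = hUn (hset {x, y})" for x y by (simp add: hun_def hUn_def)
  then show "dff M f ==> dff M g ==> dff M (\<lambda>s. hun (f s) (g s))" by (simp add: dfi)
qed

lemma dff_hsucc [dfi]: "dff M f ==> dff M (\<lambda>s. hsucc (f s))"
proof -
  have "hsucc x = hun (hset {x}) x" for x by (simp add: hsucc_def hun_def)
  then show "dff M f ==> dff M (\<lambda>s. hsucc (f s))" by (simp add: dfi)
qed

definition pw :: "hc => hc" where "pw x = hset {z \<in> M. elts z \<subseteq> elts x}"

lemma pw: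
  assumes "x \<in> M" shows "pw x \<in> M" "elts (pw x) = {z \<in> M. elts z \<subseteq> elts x}"
proof -
  obtain y where y: "y \<in> M" "\<forall>z\<in>M. elts z \<subseteq> elts x --> z \<in> elts y" using power_ex[OF assms] by blast
  then have e: "{z \<in> M. elts z \<subseteq> elts x} = {z \<in> elts y. elts z \<subseteq> elts x}" using transD by auto
  have "hset {z \<in> elts y. elts z \<subseteq> elts x} \<in> M"
    by (rule sep[OF y(1)]) (intro dfi assms)
  then show "pw x \<in> M" "elts (pw x) = {z \<in> M. elts z \<subseteq> elts x}" by (simp_all add: pw_def e)
qed

lemma dff_pw [dfi]: "dff M f ==> dff M (\<lambda>s. pw (f s))"
proof (rule dff_comp1[where h = pw])
  have "dfn M (\<lambda>s. s 0 \<in> elts (pw (s 1))) <-> dfn M (\<lambda>s. elts (s 0) \<subseteq> elts (s 1))"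
    by (rule dfn_cong) (auto simp: pw env_closed)
  then show "dff M (\<lambda>s. pw (s 0))"
    by (intro dff_ext) (use pw in \<open>auto intro!: dfi simp: env_closed\<close>)
qed

lemma hempty_closed [simp]: "hempty \<in> M"
proof -
  obtain c where "c \<in> M" using nonempty by blast
  then have "hset {x \<in> elts c. False} \<in> M" by (rule sep) (intro dfi)
  then show ?thesis by (simp add: hempty_def)
qed

lemma dff_const_closed: "dff M (\<lambda>s. c) ==> c \<in> M"
  using nonempty dff_closed[of M "\<lambda>s. c" "\<lambda>_. SOME x. x \<in> M"] some_in_eq by auto

lemma dff_apply2: "dff M (\<lambda>s. h (s 0) (s 1)) ==> x \<in> M ==> y \<in> M ==> h x y \<in> M"
  by (rule dff_const_closed, rule dff_comp2[where h = h]) (auto intro: elem)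

lemma hpair_closed [simp]: "hpair x y \<in> M <-> x \<in> M \<and> y \<in> M"
proof
  assume "hpair x y \<in> M"
  then have "hset {x, y} \<in> M" using transD[of "hset {x, y}" "hpair x y"] by simp
  then show "x \<in> M \<and> y \<in> M" using transD[of _ "hset {x, y}"] by auto
next
  assume "x \<in> M \<and> y \<in> M"
  then show "hpair x y \<in> M"
    unfolding hpair_def using pair_closed[of x x] by (intro pair_closed) auto
qed

lemma hun_closed [simp]: "x \<in> M ==> y \<in> M ==> hun x y \<in> M"
  by (rule dff_const_closed) (rule dff_hun; rule elem)

lemma hUn_closed [simp]: "x \<in> M ==> hUn x \<in> M"
  by (rule dff_const_closed) (rule dff_hUn; rule elem)

lemma hsucc_closed [simp]: "x \<in> M ==> hsucc x \<in> M"
  by (rule dff_const_closed) (rule dff_hsucc; rule elem)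

lemma single_closed [simp]: "x \<in> M ==> hset {x} \<in> M"
  using pair_closed[of x x] by simp

text \<open>Kuratowski pairs lie two power sets above the union of the factors, and the product is
  separated from there.\<close>

lemma hprd_closed [simp]:
  assumes xy: "x \<in> M" "y \<in> M" shows "hprd x y \<in> M"
proof -
  have u: "hun x y \<in> M" "pw (hun x y) \<in> M" by (simp_all add: xy pw(1))
  have D: "dfn M (\<lambda>s. \<exists>a\<in>elts x. \<exists>b\<in>elts y. s 0 = hpair a b)"
    by (intro bex eq dff_hpair var elem xy)
  have S: "z \<in> elts (pw (pw (hun x y)))" if "\<exists>a\<in>elts x. \<exists>b\<in>elts y. z = hpair a b" for z
  proof -
    obtain a b where ab: "a \<in> elts x" "b \<in> elts y" "z = hpair a b" using \<open>\<exists>a\<in>elts x. \<exists>b\<in>elts y. z = hpair a b\<close> by blast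
    then have M: "a \<in> M" "b \<in> M" using xy transD by blast+
    have "hset {a} \<in> M" "hset {a, b} \<in> M" using pair_closed[of a b] M by simp_all
    then have "hset {a} \<in> elts (pw (hun x y))" "hset {a, b} \<in> elts (pw (hun x y))"
      using ab by (simp_all add: pw(2)[OF u(1)])
    moreover have "z \<in> M" using M ab(3) by simp
    ultimately show "z \<in> elts (pw (pw (hun x y)))"
      by (simp add: pw(2)[OF u(2)] ab(3))
  qed
  have "hset {z. \<exists>a\<in>elts x. \<exists>b\<in>elts y. z = hpair a b} \<in> M"
    by (rule hset_sub_closed[OF pw(1)[OF u(2)] D S])
  moreover have "{z. \<exists>a\<in>elts x. \<exists>b\<in>elts y. z = hpair a b} = hprod (elts x) (elts y)"
    by (auto simp: hprod_def)
  ultimately show ?thesis by (simp add: hprd_def)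
qed

lemma dff_hprd [dfi]: "dff M f ==> dff M g ==> dff M (\<lambda>s. hprd (f s) (g s))"
proof (rule dff_comp2[where h = hprd])
  have "dfn M (\<lambda>s. \<exists>a\<in>elts (s 1). \<exists>b\<in>elts (s 2). s 0 = hpair a b)" by (intro dfi)
  then have "dfn M (\<lambda>s. s 0 \<in> elts (hprd (s 1) (s 2)))"
    by (subst dfn_cong) (auto simp: hprod_def)
  then show "dff M (\<lambda>s. hprd (s 0) (s 1))"
    by (intro dff_ext) (auto intro!: hprd_closed simp: numeral_2_eq_2 env_closed)
qed

end

section \<open>Canonical names and ordinal arithmetic by recursion on membership\<close>

function hcheck :: "hc => hc => hc" where
  "hcheck o1 x = hset ((\<lambda>y. hpair (hcheck o1 y) o1) ` elts x)"
  by pat_completeness simp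
termination
  by (relation "inv_image {(x, y). x \<in> elts y} snd") (simp_all add: wf_elts)

declare hcheck.simps [simp del]

text \<open>Ordinal addition: m + x is the union of m and {m + y | y < x}. Arithmetic is defined on
  all sets so that its definability over a model is an instance of the general recursion
  principle.\<close>

function hadd :: "hc => hc => hc" where
  "hadd m x = hun m (hset ((\<lambda>y. hadd m y) ` elts x))"
  by pat_completeness simp
termination
  by (relation "inv_image {(x, y). x \<in> elts y} snd") (simp_all add: wf_elts)

declare hadd.simps [simp del]

function hmul :: "hc => hc => hc" where
  "hmul m x = hUn (hset ((\<lambda>y. hadd (hmul m y) m) ` elts x))"
  by pat_completeness simp
termination
  by (relation "inv_image {(x, y). x \<in> elts y} snd") (simp_all add: wf_elts)

declare hmul.simps [simp del]

text \<open>Ordinal powers of 2: the union of {0} with all 2^y + 2^y for y below x. The parameter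
  slot gives it the shape to which \<open>recursion\<close> applies.\<close>

function hpow2 :: "hc => hc => hc" where
  "hpow2 a x = hun (hsucc hempty) (hUn (hset ((\<lambda>y. hadd (hpow2 a y) (hpow2 a y)) ` elts x)))"
  by pat_completeness simp
termination
  by (relation "inv_image {(x, y). x \<in> elts y} snd") (simp_all add: wf_elts)

declare hpow2.simps [simp del]

lemma countable_hprod [simp]: "countable A ==> countable B ==> countable (hprod A B)"
  by (simp add: hprod_image)

lemma range_case_nat2: "range s \<subseteq> M ==> x \<in> M ==> y \<in> M ==> range (case_nat x (case_nat y s)) \<subseteq> M"
  by (intro range_case_nat)

context tm
begin

lemma dfn_inst2:
  assumes "dfn M (\<lambda>s. P (\<lambda>i. s (Suc (Suc i))) (s 1) (s 0))" "range s \<subseteq> M"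
  shows "dfn M (\<lambda>e. P s (e 1) (e 0))"
proof -
  have "dfn M (\<lambda>e. (\<lambda>t. P (\<lambda>i. t (Suc (Suc i))) (t 1) (t 0))
      (\<lambda>i. (if i = 0 then (\<lambda>e. e 0) else if i = 1 then (\<lambda>e. e 1) else (\<lambda>e. s (i - 2))) e))"
    by (rule dfn_subst[OF assms(1)]) (use assms(2) in auto)
  then show ?thesis by simp
qed

end

section \<open>The axioms of ZFC in terms of definability\<close>

locale zfc = tm +
  assumes homega_closed [simp]: "homega \<in> M"
    and repl: "a \<in> M ==> dfn M (\<lambda>s. Q (s 0) (s 1)) ==>
      (\<And>x. x \<in> elts a ==> \<exists>!y. y \<in> M \<and> Q x y) ==> \<exists>b\<in>M. \<forall>x\<in>elts a. \<exists>y\<in>elts b. Q x y"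
    and ac: "F \<in> M ==> (\<And>x. x \<in> elts F ==> elts x \<noteq> {}) ==>
      (\<And>x y. x \<in> elts F ==> y \<in> elts F ==> x \<noteq> y ==> elts x \<inter> elts y = {}) ==>
      \<exists>c\<in>M. \<forall>x\<in>elts F. \<exists>!z. z \<in> elts x \<and> z \<in> elts c"

text \<open>A bounded formula by which omega is separated from the set provided by the axiom of
  infinity. Well-foundedness makes it exact: a descent through predecessors must end at 0.\<close>

definition is_nat :: "hc => bool" where
  "is_nat n <-> (\<forall>m\<in>elts (hsucc n). m = hempty \<or> (\<exists>k\<in>elts m. m = hsucc k))"

lemma is_nat_iff: "is_nat n <-> n \<in> range hnat"
proof
  show "is_nat n ==> n \<in> range hnat"
  proof (induction n rule: elts_induct)
    case (1 n)
    show ?case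
    proof (cases "n = hempty")
      case True
      then show ?thesis using hnat.simps(1) by (metis rangeI)
    next
      case False
      with 1(2) obtain k where k: "k \<in> elts n" "n = hsucc k" by (auto simp: is_nat_def)
      have "is_nat k" using 1(2) k(2) by (auto simp: is_nat_def)
      with 1(1) k(1) have "k \<in> range hnat" by blast
      then show ?thesis using k(2) hnat.simps(2) by (metis image_iff rangeI)
    qed
  qed
  have K: "hnat m = hempty \<or> (\<exists>k\<in>elts (hnat m). hnat m = hsucc k)" for m
    by (cases m) auto
  show "is_nat n" if "n \<in> range hnat"
    unfolding is_nat_def
  proof
    fix m assume "m \<in> elts (hsucc n)"
    with that obtain j where "m = hnat j" by (auto simp: elts_hnat simp del: hnat.simps)
    then show "m = hempty \<or> (\<exists>k\<in>elts m. m = hsucc k)" using K by blast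
  qed
qed

lemma models_ZFC_tm:
  assumes "transitive_class M" "models_ZFC M" shows "tm M"
proof
  show ne: "M \<noteq> {}" using assms(2) by (auto simp: models_ZFC_def infinity_axiom_in_def)
  show tr: "x \<in> M ==> elts x \<subseteq> M" for x using assms(1) by (auto simp: transitive_class_def)
  show "x \<in> M ==> y \<in> M ==> \<exists>z\<in>M. x \<in> elts z \<and> y \<in> elts z" for x y
    using assms(2) by (auto simp: models_ZFC_def pairing_axiom_in_def)
  show "\<exists>u\<in>M. \<forall>y\<in>elts x. elts y \<subseteq> elts u" if x: "x \<in> M" for x
  proof -
    have "union_axiom_in M" using assms(2) by (simp add: models_ZFC_def)
    then obtain u where "u \<in> M" "\<forall>y\<in>M. \<forall>z\<in>M. z \<in> elts y \<and> y \<in> elts x --> z \<in> elts u"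
      using x unfolding union_axiom_in_def by blast
    then show ?thesis using tr x by (intro bexI[of _ u]) (auto, blast)
  qed
  show "\<exists>y\<in>M. \<forall>z\<in>M. elts z \<subseteq> elts x --> z \<in> elts y" if x: "x \<in> M" for x
  proof -
    have "power_set_axiom_in M" using assms(2) by (simp add: models_ZFC_def)
    then obtain y where "y \<in> M" "\<forall>z\<in>M. (\<forall>w\<in>M. w \<in> elts z --> w \<in> elts x) --> z \<in> elts y"
      using x unfolding power_set_axiom_in_def by blast
    then show ?thesis by blast
  qed
  show "hset {x \<in> elts a. P x} \<in> M" if a: "a \<in> M" and P: "dfn M (\<lambda>s. P (s 0))" for a P
  proof -
    obtain c where c: "c \<in> M" using ne by blast
    obtain \<phi> b where b: "range b \<subseteq> M" "\<And>s. range s \<subseteq> M ==> P (s 0) <-> sat M (interleave s b) \<phi>"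
      using P unfolding dfn_def by metis
    define t where "t = interleave (\<lambda>_. c) b"
    have "separation_schema_in M" using assms(2) by (simp add: models_ZFC_def)
    moreover have "\<forall>i. t i \<in> M" using b(1) c by (auto simp: t_def interleave_def)
    ultimately obtain d where d: "d \<in> M" "\<forall>x\<in>M. x \<in> elts d <-> x \<in> elts a \<and> sat M (t(0 := x)) \<phi>"
      unfolding separation_schema_in_def using a by blast
    have "sat M (t(0 := x)) \<phi> <-> P x" if "x \<in> M" for x
      using b(2)[of "(\<lambda>_. c)(0 := x)"] that c by (auto simp: t_def interleave_upd)
    then have "elts d = {x \<in> elts a. P x}" using d tr a by blast
    then show ?thesis using d(1) by (metis hset_elts)
  qed
qed

lemma models_ZFC_zfc:
  assumes "transitive_class M" "models_ZFC M" shows "zfc M"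
proof -
  interpret tm M by (rule models_ZFC_tm[OF assms])
  obtain c0 where c0: "c0 \<in> M" using nonempty by blast
  show ?thesis
  proof
    have "infinity_axiom_in M" using assms(2) by (simp add: models_ZFC_def)
    then obtain I e where I: "I \<in> M" "e \<in> M" "e \<in> elts I" "\<not> (\<exists>z\<in>M. z \<in> elts e)"
      "\<forall>y\<in>M. y \<in> elts I --> (\<exists>t\<in>M. t \<in> elts I \<and> (\<forall>w\<in>M. w \<in> elts t <-> w \<in> elts y \<or> w = y))"
      unfolding infinity_axiom_in_def by blast
    have "hnat n \<in> elts I" for n
    proof (induction n)
      case 0
      have "elts e = {}" using I(2,4) transD by blast
      then show ?case using I(3) by simp
    next
      case (Suc n)
      have M: "hnat n \<in> M" using Suc I(1) transD by blast
      then obtain t where t: "t \<in> M" "t \<in> elts I" "\<forall>w\<in>M. w \<in> elts t <-> w \<in> elts (hnat n) \<or> w = hnat n"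
        using I(5) Suc by blast
      have "t = hsucc (hnat n)" by (rule hc_eqI) (use t M transD in auto)
      then show ?case using t(2) by simp
    qed
    moreover have "hset {n \<in> elts I. is_nat n} \<in> M"
      unfolding is_nat_def by (rule sep[OF I(1)]) (intro dfi, simp)
    moreover have "homega = hset (range hnat)" by (simp add: homega_def)
    moreover have "{n \<in> elts I. is_nat n} = range hnat" using calculation(1) is_nat_iff by auto
    ultimately show "homega \<in> M" by simp
  next
    fix a Q assume a: "a \<in> M" and Q: "dfn M (\<lambda>s. Q (s 0) (s 1))"
      and ex: "\<And>x. x \<in> elts a ==> \<exists>!y. y \<in> M \<and> Q x y"
    obtain \<phi> b where b: "range b \<subseteq> M" "\<And>s. range s \<subseteq> M ==> Q (s 0) (s 1) <-> sat M (interleave s b) \<phi>"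
      using Q unfolding dfn_def by metis
    \<comment> \<open>In the axiom the argument and the value are variables 0 and 1; in the
      interleaved assignment they sit at 0 and 2. The renaming keeps 0, sends 2 to 1 and every other
      n to n + 2, where \<open>t\<close> holds the right entry.\<close>
    define r :: "nat => nat" where "r n = (if n = 0 then 0 else if n = 2 then 1 else n + 2)" for n
    define t where "t n = interleave (\<lambda>_. c0) b (n - 2)" for n
    have sat: "sat M (t(0 := x, 1 := y)) (fm_rename \<phi> r) <-> Q x y" if "x \<in> M" "y \<in> M" for x y
    proof -
      have "(t(0 := x, 1 := y)) (r n) = interleave (case_nat x (case_nat y (\<lambda>_. c0))) b n" for n
      proof -
        consider "n = 0" | "n = 2" | "odd n" | m where "n = 2 * (Suc (Suc m))"
          by (metis evenE not0_implies_Suc mult_0_right mult_Suc_right One_nat_def nat_mult_1_right)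
        then show ?thesis
          by cases (auto simp: r_def t_def interleave_def)
      qed
      then have "sat M (t(0 := x, 1 := y)) (fm_rename \<phi> r) <->
          sat M (interleave (case_nat x (case_nat y (\<lambda>_. c0))) b) \<phi>"
        by (simp add: sat_rename)
      also have "\<dots> <-> Q x y"
        using b(2)[of "case_nat x (case_nat y (\<lambda>_. c0))"] that c0 by (simp add: range_case_nat2)
      finally show ?thesis .
    qed
    have "replacement_schema_in M" using assms(2) by (simp add: models_ZFC_def)
    moreover have "\<forall>i. t i \<in> M" using b(1) c0 by (auto simp: t_def interleave_def)
    moreover have "\<forall>x\<in>M. x \<in> elts a --> (\<exists>!y. y \<in> M \<and> sat M (t(0 := x, 1 := y)) (fm_rename \<phi> r))"
      using ex sat by metis
    ultimately obtain d where "d \<in> M" "\<forall>x\<in>M. x \<in> elts a --> (\<exists>y\<in>M. y \<in> elts d \<and> sat M (t(0 := x, 1 := y)) (fm_rename \<phi> r))"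
      unfolding replacement_schema_in_def using a by blast
    then show "\<exists>b\<in>M. \<forall>x\<in>elts a. \<exists>y\<in>elts b. Q x y"
      using sat transD[OF _ a] by metis
  next
    fix F assume F: "F \<in> M" "\<And>x. x \<in> elts F ==> elts x \<noteq> {}"
      "\<And>x y. x \<in> elts F ==> y \<in> elts F ==> x \<noteq> y ==> elts x \<inter> elts y = {}"
    have "choice_axiom_in M" using assms(2) by (simp add: models_ZFC_def)
    moreover have "\<forall>x\<in>M. x \<in> elts F --> (\<exists>z\<in>M. z \<in> elts x)" using F(2) transD by blast
    moreover have "\<forall>x\<in>M. \<forall>y\<in>M. x \<in> elts F \<and> y \<in> elts F \<and> x \<noteq> y --> \<not> (\<exists>z\<in>M. z \<in> elts x \<and> z \<in> elts y)"
      using F(3) by blast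
    ultimately obtain c where c: "c \<in> M" "\<forall>x\<in>M. x \<in> elts F --> (\<exists>!z. z \<in> M \<and> z \<in> elts x \<and> z \<in> elts c)"
      unfolding choice_axiom_in_def using F(1) by blast
    then have "\<forall>x\<in>elts F. \<exists>!z. z \<in> elts x \<and> z \<in> elts c"
      using transD F(1) by (metis (no_types, lifting))
    then show "\<exists>c\<in>M. \<forall>x\<in>elts F. \<exists>!z. z \<in> elts x \<and> z \<in> elts c" using c(1) by blast
  qed
qed

section \<open>Recursion in a model of ZFC\<close>

definition htrans :: "hc => bool" where "htrans x <-> (\<forall>y\<in>elts x. elts y \<subseteq> elts x)"

lemma (in tm) dfn_htrans [dfi]: "dff M f ==> dfn M (\<lambda>s. htrans (f s))"
proof (rule dfn_comp1[where Q = htrans])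
  show "dfn M (\<lambda>s. htrans (s 0))" unfolding htrans_def by (intro dfi)
qed

context zfc
begin

text \<open>Replacement yields a set that covers the values, and separation cuts it down to the
  image.\<close>

lemma dff_image [dfi]:
  assumes g: "dff M g" and f: "dff M (\<lambda>s. f (\<lambda>i. s (Suc i)) (s 0))"
  shows "dff M (\<lambda>s. hset (f s ` elts (g s)))"
proof (rule dff_ext)
  fix s :: "nat => hc" assume s: "range s \<subseteq> M"
  have gs: "g s \<in> M" using dff_closed[OF g s] .
  have fM: "f s x \<in> M" if "x \<in> M" for x
    using dff_closed[OF f, of "case_nat x s"] range_case_nat[OF s that] by simp
  have "dff M (\<lambda>s. f (\<lambda>i. s (Suc (Suc i))) (s 0))"
    using dff_shift[OF f, of "case_nat 0 (\<lambda>i. Suc (Suc i))"] by simp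
  then have "dfn M (\<lambda>s. s 1 = f (\<lambda>i. s (Suc (Suc i))) (s 0))" by (intro eq var)
  from dfn_inst2[of "\<lambda>s y x. y = f s x", OF this s]
  have D: "dfn M (\<lambda>e. e 1 = f s (e 0))" .
  obtain b where b: "b \<in> M" "\<forall>x\<in>elts (g s). \<exists>y\<in>elts b. y = f s x"
    using repl[OF gs D] fM transD[OF _ gs] by auto
  have "dff M (\<lambda>e. f s (e 0))"
  proof (rule dffI)
    show "dfn M (\<lambda>e. e 0 = f s (e (Suc 0)))" using dfn_shift[OF D, of "\<lambda>i. 1 - i"] by simp
  qed (use fM in \<open>simp add: env_closed\<close>)
  then have "dfn M (\<lambda>e. \<exists>x\<in>elts (g s). e 0 = f s x)"
    using gs dfn_shift[OF D, of "\<lambda>i. i"] by (intro bex elem) (auto simp: numeral_eq_Suc)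
  then have "hset {y \<in> elts b. \<exists>x\<in>elts (g s). y = f s x} \<in> M" by (rule sep[OF b(1)])
  moreover have "{y \<in> elts b. \<exists>x\<in>elts (g s). y = f s x} = f s ` elts (g s)" using b(2) by auto
  ultimately show "hset (f s ` elts (g s)) \<in> M" by simp
next
  have "dff M (\<lambda>s. f (\<lambda>i. s (Suc (Suc i))) (s 0))"
    using dff_shift[OF f, of "case_nat 0 (\<lambda>i. Suc (Suc i))"] by simp
  then have "dff M (\<lambda>s. f (\<lambda>i. s (Suc (Suc i))) (s 0))" .
  note f2 = dff_shift[OF this, of "case_nat 0 (\<lambda>i. Suc i)"]
  have "dfn M (\<lambda>s. \<exists>x\<in>elts (g (\<lambda>i. s (Suc i))). s 0 = f (\<lambda>i. s (Suc i)) x)"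
    by (intro bex eq var dff_shift[OF g] dff_shift[OF f, of "case_nat 0 (\<lambda>i. Suc (Suc i))", simplified])
  then show "dfn M (\<lambda>s. s 0 \<in> elts (hset (f (\<lambda>i. s (Suc i)) ` elts (g (\<lambda>i. s (Suc i))))))"
    by (simp add: image_iff)
qed

definition minimal_trans :: "hc => hc => bool" where
  "minimal_trans x T <-> htrans T \<and> x \<in> elts T \<and> (\<forall>T'\<in>M. htrans T' \<and> x \<in> elts T' --> elts T \<subseteq> elts T')"

text \<open>Replacement asks for unique values, which is why transitive closures are characterized
  by minimality. The closures of the elements are collected, and their union together with x is cut
  down to what lies in every transitive set containing x.\<close>

lemma minimal_trans_ex: "x \<in> M ==> \<exists>T\<in>M. minimal_trans x T"
proof (induction x rule: elts_induct)
  case (1 x)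
  have uq: "\<exists>!T. T \<in> M \<and> minimal_trans y T" if y: "y \<in> elts x" for y
  proof -
    have "y \<in> M" using y 1(2) transD by blast
    then obtain T where "T \<in> M" "minimal_trans y T" using 1(1)[OF y] by blast
    moreover have "T' = T" if "T' \<in> M" "minimal_trans y T'" for T'
      using that calculation unfolding minimal_trans_def by (metis hc_extensionality subset_antisym)
    ultimately show ?thesis by blast
  qed
  have D: "dfn M (\<lambda>s. minimal_trans (s 0) (s 1))"
    unfolding minimal_trans_def by (intro dfi)
  obtain b where b: "b \<in> M" "\<forall>y\<in>elts x. \<exists>T\<in>elts b. minimal_trans y T"
    using repl[OF 1(2) D uq] by blast
  define c where "c = hset {T \<in> elts b. \<exists>y\<in>elts x. minimal_trans y T}"
  have c: "c \<in> M" unfolding c_def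
    by (rule sep[OF b(1)], rule bex[OF elem[OF 1(2)]])
      (use dfn_shift[OF D, of "\<lambda>i. i"] in simp)
  define U where "U = hun (hUn c) (hset {x})"
  have UM: "U \<in> M" using c 1(2) by (simp add: U_def)
  have eU: "elts U = insert x (\<Union> (elts ` {T \<in> elts b. \<exists>y\<in>elts x. minimal_trans y T}))"
    by (auto simp: U_def c_def)
  have xU: "elts x \<subseteq> elts U"
  proof
    fix y assume y: "y \<in> elts x"
    then obtain T where "T \<in> elts b" "minimal_trans y T" using b(2) by blast
    then have "y \<in> elts T" "T \<in> {T \<in> elts b. \<exists>y\<in>elts x. minimal_trans y T}"
      using y by (auto simp: minimal_trans_def)
    then show "y \<in> elts U" unfolding eU by blast
  qed
  have UT: "htrans U"
    unfolding htrans_def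
  proof
    fix v assume "v \<in> elts U"
    then consider "v = x" | T where "T \<in> {T \<in> elts b. \<exists>y\<in>elts x. minimal_trans y T}" "v \<in> elts T"
      unfolding eU by blast
    then show "elts v \<subseteq> elts U"
    proof cases
      case (2 T)
      then have "elts v \<subseteq> elts T" by (auto simp: minimal_trans_def htrans_def)
      then show ?thesis using 2(1) unfolding eU by blast
    qed (use xU in simp)
  qed
  define T where "T = hset {z \<in> elts U. \<forall>T'\<in>M. htrans T' \<and> x \<in> elts T' --> z \<in> elts T'}"
  have "T \<in> M" unfolding T_def by (rule sep[OF UM]) (intro dfi 1(2))
  moreover have "x \<in> elts U" by (simp add: eU)
  then have "minimal_trans x T"
    using UT UM unfolding minimal_trans_def T_def htrans_def by simp blast
  ultimately show ?case by blast
qed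

lemma trans_ex: "x \<in> M ==> \<exists>T\<in>M. htrans T \<and> x \<in> elts T"
  using minimal_trans_ex unfolding minimal_trans_def by blast

text \<open>An approximation to the recursion on a transitive set \<open>T\<close>. The earlier
  values are separated from the double union of \<open>f\<close>, which contains the second
  components of all pairs in \<open>f\<close>.\<close>

definition attempt :: "(hc => hc => hc) => hc => hc => hc => bool" where
  "attempt H a T f <-> htrans T \<and> (\<forall>u\<in>elts T. (\<exists>y\<in>M. hpair u y \<in> elts f) \<and>
    (\<forall>y\<in>M. hpair u y \<in> elts f --> y = H a (hset {z \<in> elts (hUn (hUn f)). \<exists>v\<in>elts u. hpair v z \<in> elts f})))"

text \<open>The function exists outside the model already; at issue are closure of \<open>M\<close>
  and definability of the graph. The graph is \<open>ch\<close>, the existence of an attempt: by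
  induction every attempt computes the true value, and the attempts at the elements of x are glued
  by replacement.\<close>

lemma recursion:
  assumes H: "dff M (\<lambda>s. H (s 0) (s 1))"
    and F: "\<And>a x. F a x = H a (hset (F a ` elts x))"
  shows "dff M (\<lambda>s. F (s 0) (s 1))"
proof -
  define ch where "ch a x y <-> (\<exists>T\<in>M. \<exists>f\<in>M. attempt H a T f \<and> x \<in> elts T \<and> hpair x y \<in> elts f)" for a x y
  have inU: "z \<in> elts (hUn (hUn f))" if "hpair v z \<in> elts f" for v z f
  proof -
    have "hset {v, z} \<in> elts (hpair v z)" "z \<in> elts (hset {v, z})" by simp_all
    then show ?thesis using that unfolding elts_hUn by blast
  qed
  have val: "y = F a u" if at: "attempt H a T f" and f: "f \<in> M" and u: "u \<in> elts T" "hpair u y \<in> elts f" for a T f u y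
    using u
  proof (induction u arbitrary: y rule: elts_induct)
    case (1 u)
    have yM: "y \<in> M" using 1(3) transD[OF _ f] by (metis hpair_closed)
    have T: "v \<in> elts T" if "v \<in> elts u" for v
      using at 1(2) that unfolding attempt_def htrans_def by blast
    have "{z \<in> elts (hUn (hUn f)). \<exists>v\<in>elts u. hpair v z \<in> elts f} = F a ` elts u"
    proof (intro equalityI subsetI)
      fix z assume "z \<in> F a ` elts u"
      then obtain v where v: "v \<in> elts u" "z = F a v" by blast
      obtain z' where "hpair v z' \<in> elts f" using at T[OF v(1)] unfolding attempt_def by blast
      then show "z \<in> {z \<in> elts (hUn (hUn f)). \<exists>v\<in>elts u. hpair v z \<in> elts f}"
        using 1(1)[OF v(1) T[OF v(1)]] v inU by blast
    qed (use 1(1) T in blast)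
    moreover have "y = H a (hset {z \<in> elts (hUn (hUn f)). \<exists>v\<in>elts u. hpair v z \<in> elts f})"
      using at 1(2,3) yM unfolding attempt_def by blast
    ultimately show ?case using F[of a u] by (simp only:)
  qed
  have Dat: "dfn M (\<lambda>s. attempt H (s 0) (s 1) (s 2))"
    unfolding attempt_def by (intro dfi dff_comp2[where h = H, OF H])
  have Dch: "dfn M (\<lambda>s. ch (s 0) (s 1) (s 2))"
    unfolding ch_def by (intro dfi dfn_comp3[where Q = "attempt H", OF Dat])
  have ex: "ch a x (F a x) \<and> F a x \<in> M" if a: "a \<in> M" and "x \<in> M" for a x
    using that(2)
  proof (induction x rule: elts_induct)
    case (1 x)
    obtain T0 where T0: "T0 \<in> M" "htrans T0" "x \<in> elts T0" using trans_ex[OF 1(2)] by blast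
    \<comment> \<open>The part of \<open>T0\<close> that attempts already cover. It is transitive
      and contains the elements of x, so adding one pair to its graph gives an attempt at x.\<close>
    define T' where "T' = hset {u \<in> elts T0. \<exists>y\<in>M. ch a u y}"
    have T'M: "T' \<in> M" unfolding T'_def
      by (rule sep[OF T0(1)]) (intro dfi a dfn_comp3[where Q = ch, OF Dch])
    have chF: "y = F a u" if "ch a u y" for u y using that val unfolding ch_def by blast
    have eT': "elts T' = {u \<in> elts T0. \<exists>y\<in>M. ch a u y}" by (simp add: T'_def)
    have "\<exists>!y. y \<in> M \<and> ch a u y" if "u \<in> elts T'" for u
      using that chF unfolding eT' by blast
    moreover have "dfn M (\<lambda>s. ch a (s 0) (s 1))" by (intro dfi a dfn_comp3[where Q = ch, OF Dch])
    ultimately obtain b where b: "b \<in> M" "\<forall>u\<in>elts T'. \<exists>y\<in>elts b. ch a u y"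
      using repl[OF T'M, of "ch a"] by blast
    define f0 where "f0 = hset {z \<in> elts (hprd T' b). \<exists>u\<in>M. \<exists>y\<in>M. z = hpair u y \<and> ch a u y}"
    have f0M: "f0 \<in> M" unfolding f0_def
      by (rule sep, simp add: T'M b) (intro dfi a dfn_comp3[where Q = ch, OF Dch])
    have f0: "hpair u y \<in> elts f0 <-> u \<in> elts T' \<and> y = F a u" for u y
    proof
      assume u: "u \<in> elts T' \<and> y = F a u"
      then obtain y' where y': "y' \<in> elts b" "ch a u y'" using b(2) by blast
      then have "y' = y" using chF u by blast
      moreover have "u \<in> M" "y' \<in> M" using u y' transD[OF _ b(1)] transD[OF _ T'M] by blast+
      ultimately show "hpair u y \<in> elts f0" unfolding f0_def using u y' by auto
    qed (use chF in \<open>unfold f0_def, auto\<close>)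
    have xT': "elts x \<subseteq> elts T'"
      using 1 T0 transD[OF _ 1(2)] unfolding eT' htrans_def by blast
    have trT': "htrans T'"
      unfolding htrans_def
    proof (intro ballI subsetI)
      fix u v assume u: "u \<in> elts T'" "v \<in> elts u"
      then obtain y T f where y: "y \<in> M" "T \<in> M" "f \<in> M" "attempt H a T f" "u \<in> elts T"
        unfolding eT' ch_def by blast
      then have v: "v \<in> elts T" using u unfolding attempt_def htrans_def by blast
      then obtain z where "z \<in> M" "hpair v z \<in> elts f" using y unfolding attempt_def by blast
      then have "ch a v z" using y v unfolding ch_def by blast
      moreover have "v \<in> elts T0" using u T0(2) unfolding eT' htrans_def by blast
      ultimately show "v \<in> elts T'" using \<open>z \<in> M\<close> unfolding eT' by blast
    qed
    have YM: "hset (F a ` elts x) \<in> M"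
    proof -
      have "hset {z \<in> elts b. \<exists>v\<in>elts x. ch a v z} \<in> M"
        by (rule sep[OF b(1)]) (intro dfi a 1(2) dfn_comp3[where Q = ch, OF Dch])
      moreover have "{z \<in> elts b. \<exists>v\<in>elts x. ch a v z} = F a ` elts x"
      proof (intro equalityI subsetI)
        fix z assume "z \<in> F a ` elts x"
        then obtain v where v: "v \<in> elts x" "z = F a v" by blast
        then have "ch a v z" using 1(1)[OF v(1)] transD[OF _ 1(2)] by blast
        moreover have "z \<in> elts b" using b(2) xT' v chF by blast
        ultimately show "z \<in> {z \<in> elts b. \<exists>v\<in>elts x. ch a v z}" using v by blast
      qed (use chF in blast)
      ultimately show ?thesis by simp
    qed
    have FM: "F a x \<in> M" using dff_apply2[OF H a YM] F[of a x] by simp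
    define f where "f = hun f0 (hset {hpair x (F a x)})"
    have fM: "f \<in> M" using f0M FM 1(2) by (simp add: f_def)
    have f: "hpair u y \<in> elts f <-> (u \<in> elts T' \<or> u = x) \<and> y = F a u" for u y
      using f0 by (auto simp: f_def)
    have FT: "F a u \<in> M" if "u \<in> elts T' \<or> u = x" for u
      using that FM chF unfolding eT' by blast
    have "attempt H a (hun T' (hset {x})) f"
      unfolding attempt_def
    proof (intro conjI ballI impI)
      show "htrans (hun T' (hset {x}))" using trT' xT' unfolding htrans_def by auto
    next
      fix u assume "u \<in> elts (hun T' (hset {x}))"
      then show "\<exists>y\<in>M. hpair u y \<in> elts f" using FT f by auto
    next
      fix u y assume u: "u \<in> elts (hun T' (hset {x}))" "hpair u y \<in> elts f"
      have "elts u \<subseteq> elts T'" using u(1) xT' trT' unfolding htrans_def by auto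
      then have "{z \<in> elts (hUn (hUn f)). \<exists>v\<in>elts u. hpair v z \<in> elts f} = F a ` elts u"
        using inU[of _ _ f] unfolding f by blast
      moreover have "y = F a u" using u(2) f by blast
      ultimately show "y = H a (hset {z \<in> elts (hUn (hUn f)). \<exists>v\<in>elts u. hpair v z \<in> elts f})"
        using F[of a u] by (simp only:)
    qed
    moreover have "hun T' (hset {x}) \<in> M" using T'M 1(2) by simp
    moreover have "hpair x (F a x) \<in> elts f" using f by simp
    ultimately have "ch a x (F a x)" unfolding ch_def using fM by (intro bexI[of _ "hun T' (hset {x})"] bexI[of _ f]) auto
    then show ?case using FM by blast
  qed
  show ?thesis
  proof (rule dffI)
    show "F (s 0) (s 1) \<in> M" if "range s \<subseteq> M" for s :: "nat => hc"
      using ex[of "s 0" "s 1"] env_closed[OF that] by blast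
    have "dfn M (\<lambda>s. ch (s 1) (s 2) (s 0))" by (intro dfn_comp3[where Q = ch, OF Dch] dfi)
    moreover have "ch (s 1) (s 2) (s 0) <-> s 0 = F (s (Suc 0)) (s (Suc 1))" if "range s \<subseteq> M" for s :: "nat => hc"
    proof -
      have "ch (s 1) (s 2) (F (s 1) (s 2))" using ex[of "s 1" "s 2"] env_closed[OF that] by blast
      moreover have "y = F (s 1) (s 2)" if "ch (s 1) (s 2) y" for y using that val unfolding ch_def by blast
      ultimately have "ch (s 1) (s 2) y <-> y = F (s 1) (s 2)" for y by metis
      then show ?thesis by (simp add: numeral_2_eq_2)
    qed
    ultimately show "dfn M (\<lambda>s. s 0 = F (s (Suc 0)) (s (Suc 1)))"
      by (subst dfn_cong[of M _ "\<lambda>s. ch (s 1) (s 2) (s 0)"]) auto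
  qed
qed

end

context zfc
begin

lemma dff_hcheck [dfi]: "dff M f ==> dff M g ==> dff M (\<lambda>s. hcheck (f s) (g s))"
proof (rule dff_comp2[where h = hcheck])
  show "dff M (\<lambda>s. hcheck (s 0) (s 1))"
  proof (rule recursion)
    show "dff M (\<lambda>s. hset ((\<lambda>y. hpair y (s 0)) ` elts (s 1)))" by (intro dfi)
    show "hcheck a x = hset ((\<lambda>y. hpair y a) ` elts (hset (hcheck a ` elts x)))" for a x
      by (subst hcheck.simps) (simp add: image_image)
  qed
qed

lemma dff_hadd [dfi]: "dff M f ==> dff M g ==> dff M (\<lambda>s. hadd (f s) (g s))"
proof (rule dff_comp2[where h = hadd])
  show "dff M (\<lambda>s. hadd (s 0) (s 1))"
  proof (rule recursion)
    show "dff M (\<lambda>s. hun (s 0) (s 1))" by (intro dfi)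
    show "hadd a x = hun a (hset (hadd a ` elts x))" for a x
      by (rule hadd.simps)
  qed
qed

lemma dff_hmul [dfi]: "dff M f ==> dff M g ==> dff M (\<lambda>s. hmul (f s) (g s))"
proof (rule dff_comp2[where h = hmul])
  show "dff M (\<lambda>s. hmul (s 0) (s 1))"
  proof (rule recursion)
    show "dff M (\<lambda>s. hUn (hset ((\<lambda>y. hadd y (s 0)) ` elts (s 1))))" by (intro dfi)
    show "hmul a x = hUn (hset ((\<lambda>y. hadd y a) ` elts (hset (hmul a ` elts x))))" for a x
      by (subst hmul.simps) (simp add: image_image)
  qed
qed

lemma dff_hpow2 [dfi]: "dff M f ==> dff M (\<lambda>s. hpow2 hempty (f s))"
proof (rule dff_comp2[where h = hpow2])
  show "dff M (\<lambda>s. hpow2 (s 0) (s 1))"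
  proof (rule recursion)
    show "dff M (\<lambda>s. hun (hsucc hempty) (hUn (hset ((\<lambda>y. hadd y y) ` elts (s 1)))))"
      by (intro dfi hempty_closed)
    show "hpow2 a x = hun (hsucc hempty) (hUn (hset ((\<lambda>y. hadd y y) ` elts (hset (hpow2 a ` elts x)))))" for a x
      by (subst hpow2.simps) (simp add: image_image)
  qed
qed (intro dfi hempty_closed)

end

lemma hadd_hnat [simp]: "hadd (hnat m) (hnat n) = hnat (m + n)"
proof (induction n rule: less_induct)
  case (less n)
  have "hadd (hnat m) ` elts (hnat n) = (\<lambda>i. hnat (m + i)) ` {..<n}"
    unfolding elts_hnat image_image by (rule image_cong) (use less in auto)
  moreover have "hnat ` {..<m} \<union> (\<lambda>i. hnat (m + i)) ` {..<n} = hnat ` {..<m + n}"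
  proof -
    have "{..<m + n} = {..<m} \<union> (\<lambda>i. m + i) ` {..<n}"
    proof (intro equalityI subsetI)
      fix x assume "x \<in> {..<m + n}"
      then show "x \<in> {..<m} \<union> (\<lambda>i. m + i) ` {..<n}"
        by (cases "x < m") (auto intro!: image_eqI[of _ _ "x - m"])
    qed auto
    then show ?thesis by (simp add: image_Un image_image)
  qed
  moreover have "elts (hadd (hnat m) (hnat n)) = elts (hnat m) \<union> hadd (hnat m) ` elts (hnat n)"
    by (subst hadd.simps) simp
  ultimately have "elts (hadd (hnat m) (hnat n)) = elts (hnat (m + n))"
    by (simp only: elts_hnat)
  then show ?case by (rule hc_eqI)
qed

lemma hmul_hnat [simp]: "hmul (hnat m) (hnat n) = hnat (m * n)"
proof (induction n rule: less_induct)
  case (less n)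
  have "elts (hmul (hnat m) (hnat n)) = (\<Union>i<n. elts (hadd (hmul (hnat m) (hnat i)) (hnat m)))"
    by (subst hmul.simps) (simp add: elts_hnat image_image del: hnat.simps)
  also have "\<dots> = (\<Union>i<n. hnat ` {..<m * i + m})"
    using less by (simp add: elts_hnat del: hnat.simps)
  also have "\<dots> = hnat ` (\<Union>i<n. {..<m * i + m})" by blast
  also have "(\<Union>i<n. {..<m * i + m}) = {..<m * n}"
  proof (cases n)
    case (Suc k)
    have "m * i + m \<le> m * n" if "i < n" for i
      using mult_le_mono2[of "Suc i" n m] that by simp
    moreover have "m * k + m = m * n" by (simp add: Suc)
    ultimately show ?thesis using Suc by (auto intro: less_le_trans)
  qed simp
  finally show ?case by (intro hc_eqI) (simp only: elts_hnat)
qed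

lemma hpow2_hnat [simp]: "hpow2 hempty (hnat n) = hnat (2 ^ n)"
proof (induction n rule: less_induct)
  case (less n)
  have "elts (hpow2 hempty (hnat n)) =
      insert hempty (\<Union>i<n. elts (hadd (hpow2 hempty (hnat i)) (hpow2 hempty (hnat i))))"
    by (subst hpow2.simps) (simp add: elts_hnat image_image del: hnat.simps)
  also have "\<dots> = insert (hnat 0) (\<Union>i<n. hnat ` {..<2 * 2 ^ i})"
    using less by (simp add: elts_hnat mult_2 del: hnat.simps) simp
  also have "\<dots> = hnat ` (insert 0 (\<Union>i<n. {..<2 * 2 ^ i}))" by blast
  also have "insert 0 (\<Union>i<n. {..<2 * 2 ^ i}) = {..<(2::nat) ^ n}"
  proof (cases n)
    case (Suc k)
    have "2 * 2 ^ i \<le> (2::nat) ^ n" if "i < n" for i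
      using power_increasing[of "Suc i" n "2::nat"] that by simp
    then have "(\<Union>i<n. {..<2 * 2 ^ i}) \<subseteq> {..<(2::nat) ^ n}" by force
    moreover have "{..<(2::nat) ^ n} \<subseteq> (\<Union>i<n. {..<2 * 2 ^ i})" using Suc by force
    ultimately show ?thesis by auto
  qed auto
  finally show ?case by (intro hc_eqI) (simp only: elts_hnat)
qed

section \<open>Functions, finite sets and countable sets in a model\<close>

text \<open>Recursion in which a value depends only on the set of earlier values; it supplies the
  chain of ordinals in \<open>reflection\<close>.\<close>

function hrec :: "(hc => hc) => hc => hc" where
  "hrec H x = H (hset ((\<lambda>y. hrec H y) ` elts x))"
  by pat_completeness simp
termination
  by (relation "inv_image {(x, y). x \<in> elts y} snd") (simp_all add: wf_elts)

declare hrec.simps [simp del]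

definition hgraph :: "hc set => (hc => hc) => hc" where
  "hgraph X g = hset ((\<lambda>x. hpair x (g x)) ` X)"

lemma happ_iff:
  assumes "hfun f X" "x \<in> X" shows "hpair x y \<in> elts f <-> f \<cdot> x = y"
proof -
  have u: "\<exists>!y. hpair x y \<in> elts f" using assms unfolding hfun_def by blast
  have "hpair x (f \<cdot> x) \<in> elts f" unfolding happ_def by (rule theI'[OF u])
  then show ?thesis using u by blast
qed

lemma hfunI:
  assumes "\<And>z. z \<in> elts f ==> \<exists>x\<in>X. z = hpair x (g x)" "\<And>x. x \<in> X ==> hpair x (g x) \<in> elts f"
  shows "hfun f X" "x \<in> X ==> f \<cdot> x = g x"
proof -
  have u: "\<exists>!y. hpair x y \<in> elts f" if "x \<in> X" for x
  proof (rule ex1I)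
    show "hpair x (g x) \<in> elts f" using assms(2) that .
    fix y assume "hpair x y \<in> elts f"
    then show "y = g x" using assms(1) by fastforce
  qed
  moreover have "\<exists>x\<in>X. \<exists>y. z = hpair x y" if "z \<in> elts f" for z using assms(1)[OF that] by blast
  ultimately show h: "hfun f X" unfolding hfun_def by blast
  show "x \<in> X ==> f \<cdot> x = g x" using happ_iff[OF h] assms(2) by blast
qed

lemma hgraph:
  assumes "countable X"
  shows "elts (hgraph X g) = {hpair x (g x) | x. x \<in> X}" "hfun (hgraph X g) X" "x \<in> X ==> hgraph X g \<cdot> x = g x"
proof -
  show e: "elts (hgraph X g) = {hpair x (g x) | x. x \<in> X}" using assms by (auto simp: hgraph_def)
  show "hfun (hgraph X g) X" "x \<in> X ==> hgraph X g \<cdot> x = g x"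
    by (rule hfunI[of "hgraph X g" X g]; use e in blast)+
qed

lemma hfun_cong_eq:
  assumes "hfun f X" "hfun g X" "\<And>x. x \<in> X ==> f \<cdot> x = g \<cdot> x" shows "f = g"
proof (rule hc_eqI, intro equalityI subsetI)
  fix z assume z: "z \<in> elts f"
  then obtain x y where "x \<in> X" "z = hpair x y" using assms(1) by (auto simp: hfun_def)
  then show "z \<in> elts g" using z happ_iff[OF assms(1)] happ_iff[OF assms(2)] assms(3) by auto
next
  fix z assume z: "z \<in> elts g"
  then obtain x y where "x \<in> X" "z = hpair x y" using assms(2) by (auto simp: hfun_def)
  then show "z \<in> elts f" using z happ_iff[OF assms(1)] happ_iff[OF assms(2)] assms(3) by auto
qed

text \<open>An injective relation instead of a function: a value may be chosen later as the least
  one, and the notion is given by bounded quantifiers.\<close>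

definition injrel :: "hc => hc set => hc set => bool" where
  "injrel f X Y <-> (\<forall>x\<in>X. \<exists>n\<in>Y. hpair x n \<in> elts f) \<and>
    (\<forall>x\<in>X. \<forall>y\<in>X. \<forall>n\<in>Y. hpair x n \<in> elts f \<and> hpair y n \<in> elts f --> x = y)"

definition hfin :: "hc => hc" where "hfin a = hset {x. elts x \<subseteq> elts a \<and> finite (elts x)}"

lemma elts_hfin [simp]: "elts (hfin a) = {x. elts x \<subseteq> elts a \<and> finite (elts x)}"
proof -
  have "countable {X. X \<subseteq> elts a \<and> finite X}"
    using countable_Collect_finite_subset[OF countable_elts[of a]] by (simp add: conj_commute)
  then have "countable (hset ` {X. X \<subseteq> elts a \<and> finite X})" by simp
  moreover have "{x. elts x \<subseteq> elts a \<and> finite (elts x)} \<subseteq> hset ` {X. X \<subseteq> elts a \<and> finite X}"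
    by (auto intro!: image_eqI[where x = "elts x" for x])
  ultimately have "countable {x. elts x \<subseteq> elts a \<and> finite (elts x)}" by (rule countable_subset[rotated])
  then show ?thesis by (simp add: hfin_def)
qed

locale tmo = tm + assumes omegaM [simp]: "homega \<in> M"

sublocale zfc \<subseteq> tmo by unfold_locales simp

context tm
begin

lemma finite_closed: "finite A ==> A \<subseteq> M ==> hset A \<in> M"
proof (induction rule: finite_induct)
  case empty then show ?case using hempty_closed by (simp add: hempty_def)
next
  case (insert x A)
  then have "hun (hset A) (hset {x}) \<in> M" by simp
  moreover have "hun (hset A) (hset {x}) = hset (insert x A)"
    using insert(1) by (intro hc_eqI) (simp add: countable_finite)
  ultimately show ?case by simp
qed

end

context tmo
begin

lemma hnat_closed [simp]: "hnat n \<in> M"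
  using transD[of "hnat n" homega] by simp

text \<open>Taking the least admissible number turns the relation into a function by separation
  alone, so the criterion is available in generic extensions too.\<close>

lemma countable_inI:
  assumes a: "a \<in> M" and D: "dfn M (\<lambda>s. Q (s 0) (s 1))"
    and tot: "\<And>x. x \<in> elts a ==> \<exists>n. Q x (hnat n)"
    and inj: "\<And>x y n. x \<in> elts a ==> y \<in> elts a ==> Q x (hnat n) ==> Q y (hnat n) ==> x = y"
  shows "countable_in M (elts a)"
proof -
  define g where "g x = (LEAST n. Q x (hnat n))" for x
  define f where "f = hset {z \<in> elts (hprd a homega). \<exists>x\<in>elts a. \<exists>n\<in>elts homega. z = hpair x n \<and> Q x n \<and>
    (\<forall>m\<in>elts n. \<not> Q x m)}"
  have fM: "f \<in> M" unfolding f_def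
    by (rule sep, simp add: a) (intro dfi a omegaM dfn_comp2[where Q = Q, OF D])
  have gQ: "Q x (hnat (g x))" if "x \<in> elts a" for x
    unfolding g_def using tot[OF that] by (rule LeastI_ex)
  have L: "Q x (hnat n) \<and> (\<forall>m\<in>elts (hnat n). \<not> Q x m) <-> n = g x" if "x \<in> elts a" for x n
  proof
    assume n: "Q x (hnat n) \<and> (\<forall>m\<in>elts (hnat n). \<not> Q x m)"
    have "\<not> g x < n" using n gQ[OF that] by auto
    moreover have "g x \<le> n" unfolding g_def using n by (intro Least_le) simp
    ultimately show "n = g x" by simp
  next
    assume n: "n = g x"
    have "\<not> Q x m" if m: "m \<in> elts (hnat n)" for m
    proof -
      obtain j where "m = hnat j" "j < n" using m unfolding elts_hnat by blast
      then show ?thesis using not_less_Least[of j "\<lambda>n. Q x (hnat n)"] n by (simp add: g_def)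
    qed
    then show "Q x (hnat n) \<and> (\<forall>m\<in>elts (hnat n). \<not> Q x m)"
      using gQ[OF that] n by blast
  qed
  have ef: "elts f = {hpair x (hnat (g x)) | x. x \<in> elts a}"
    unfolding f_def using L by (auto simp: elts_hset)
  have "hfun f (elts a)" and app: "\<And>x. x \<in> elts a ==> f \<cdot> x = hnat (g x)"
    by (rule hfunI[of f "elts a" "\<lambda>x. hnat (g x)"]; use ef in blast)+
  moreover have "inj_on (\<lambda>x. f \<cdot> x) (elts a)"
    using inj gQ app by (intro inj_onI) (metis hnat_inject)
  ultimately show ?thesis unfolding countable_in_def fun_in_def using fM by auto
qed

lemma countable_inE:
  assumes "countable_in M X"
  shows "\<exists>f g. f \<in> M \<and> (\<forall>x\<in>X. \<forall>y. hpair x y \<in> elts f <-> y = hnat (g x)) \<and> inj_on g X"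
proof -
  obtain f where f: "f \<in> M" "hfun f X" "\<forall>x\<in>X. f \<cdot> x \<in> range hnat" "inj_on (\<lambda>x. f \<cdot> x) X"
    using assms unfolding countable_in_def fun_in_def by auto
  define g where "g x = (SOME n. f \<cdot> x = hnat n)" for x
  have g: "f \<cdot> x = hnat (g x)" if "x \<in> X" for x
    unfolding g_def by (rule someI_ex) (use f(3) that in auto)
  have "hpair x y \<in> elts f <-> y = hnat (g x)" if "x \<in> X" for x y
    using happ_iff[OF f(2) that] g[OF that] by auto
  moreover have "inj_on g X" using f(4) g by (intro inj_onI) (metis inj_onD)
  ultimately show ?thesis using f(1) by blast
qed

lemma injrelI:
  assumes "\<And>x y. x \<in> X ==> hpair x y \<in> elts f <-> y = g x" "\<And>x. x \<in> X ==> g x \<in> Y" "inj_on g X"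
  shows "injrel f X Y"
  unfolding injrel_def
proof (intro conjI ballI impI)
  fix x assume "x \<in> X"
  then show "\<exists>n\<in>Y. hpair x n \<in> elts f" using assms(1)[of x "g x"] assms(2) by blast
next
  fix x y n assume "x \<in> X" "y \<in> X" "hpair x n \<in> elts f \<and> hpair y n \<in> elts f"
  then have "g x = g y" using assms(1)[of x n] assms(1)[of y n] by blast
  then show "x = y" using inj_onD[OF assms(3)] \<open>x \<in> X\<close> \<open>y \<in> X\<close> by blast
qed

lemma countable_in_iff:
  assumes "a \<in> M"
  shows "countable_in M (elts a) <-> (\<exists>f\<in>M. injrel f (elts a) (elts homega))"
proof
  assume c: "countable_in M (elts a)"
  obtain f g where f: "f \<in> M" "\<forall>x\<in>elts a. \<forall>y. hpair x y \<in> elts f <-> y = hnat (g x)" "inj_on g (elts a)"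
    using countable_inE[OF c] by blast
  have "inj_on (\<lambda>x. hnat (g x)) (elts a)" using f(3) by (simp add: inj_on_def)
  then have "injrel f (elts a) (elts homega)"
    by (intro injrelI[where g = "\<lambda>x. hnat (g x)"]) (use f(2) in blast, simp)
  then show "\<exists>f\<in>M. injrel f (elts a) (elts homega)" using f(1) by blast
next
  assume "\<exists>f\<in>M. injrel f (elts a) (elts homega)"
  then obtain f where f: "f \<in> M" "injrel f (elts a) (elts homega)" by blast
  show "countable_in M (elts a)"
  proof (rule countable_inI[OF assms, of "\<lambda>x n. hpair x n \<in> elts f"])
    show "dfn M (\<lambda>s. hpair (s 0) (s 1) \<in> elts f)" by (intro dfi f(1))
    show "\<exists>n. hpair x (hnat n) \<in> elts f" if "x \<in> elts a" for x
      using f(2) that unfolding injrel_def by auto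
    show "x = y" if "x \<in> elts a" "y \<in> elts a" "hpair x (hnat n) \<in> elts f" "hpair y (hnat n) \<in> elts f" for x y n
      using f(2) that unfolding injrel_def by auto
  qed
qed

lemma countable_in_rel:
  assumes a: "a \<in> M" and b: "countable_in M (elts b)" and D: "dfn M (\<lambda>s. Q (s 0) (s 1))"
    and tot: "\<And>x. x \<in> elts a ==> \<exists>z\<in>elts b. Q x z" and bM: "b \<in> M"
    and inj: "\<And>x y z. x \<in> elts a ==> y \<in> elts a ==> z \<in> elts b ==> Q x z ==> Q y z ==> x = y"
  shows "countable_in M (elts a)"
proof -
  obtain f g where f: "f \<in> M" "\<And>x y. x \<in> elts b ==> hpair x y \<in> elts f <-> y = hnat (g x)" "inj_on g (elts b)"
    using countable_inE[OF b] by blast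
  show ?thesis
  proof (rule countable_inI[OF a, of "\<lambda>x n. \<exists>z\<in>elts b. Q x z \<and> hpair z n \<in> elts f"])
    show "dfn M (\<lambda>s. \<exists>z\<in>elts b. Q (s 0) z \<and> hpair z (s 1) \<in> elts f)"
      by (intro dfi bM f(1) dfn_comp2[where Q = Q, OF D])
  next
    fix x assume "x \<in> elts a"
    then obtain z where "z \<in> elts b" "Q x z" using tot by blast
    then show "\<exists>n. \<exists>z\<in>elts b. Q x z \<and> hpair z (hnat n) \<in> elts f" using f(2) by blast
  next
    fix x y n assume xy: "x \<in> elts a" "y \<in> elts a" "\<exists>z\<in>elts b. Q x z \<and> hpair z (hnat n) \<in> elts f"
      "\<exists>z\<in>elts b. Q y z \<and> hpair z (hnat n) \<in> elts f"
    then obtain z w where z: "z \<in> elts b" "Q x z" "g z = n" "w \<in> elts b" "Q y w" "g w = n"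
      using f(2) by auto
    then have "z = w" using f(3) by (auto dest: inj_onD)
    then show "x = y" using inj xy z by blast
  qed
qed

lemma countable_in_subset:
  assumes "a \<in> M" "b \<in> M" "elts a \<subseteq> elts b" "countable_in M (elts b)"
  shows "countable_in M (elts a)"
  by (rule countable_in_rel[OF assms(1,4), of "\<lambda>x y. x = y"]) (use assms in \<open>auto intro!: dfi\<close>)

lemma finite_countable_in:
  assumes "a \<in> M" "finite (elts a)" shows "countable_in M (elts a)"
proof -
  obtain h n where h: "inj_on h (elts a)" "h ` elts a = {..<n::nat}"
    using assms(2) by (metis finite_imp_inj_to_nat_seg lessThan_def)
  define f where "f = hset ((\<lambda>x. hpair x (hnat (h x))) ` elts a)"
  have "f \<in> M" unfolding f_def
    by (rule finite_closed) (use assms transD in auto)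
  moreover have "injrel f (elts a) (elts homega)"
  proof (rule injrelI[where g = "\<lambda>x. hnat (h x)"])
    show "hpair x y \<in> elts f <-> y = hnat (h x)" if "x \<in> elts a" for x y
      using that unfolding f_def by auto
  qed (use h(1) in \<open>auto simp: inj_on_def\<close>)
  ultimately show ?thesis using countable_in_iff[OF assms(1)] by blast
qed

text \<open>Finiteness is absolute: a finite injection between elements of \<open>M\<close> is a
  finite set of elements of \<open>M\<close> and hence belongs to \<open>M\<close>. Inside the model
  one can therefore work with finiteness in the sense of the logic.\<close>

lemma finite_iff:
  assumes "a \<in> M"
  shows "finite (elts a) <-> (\<exists>n\<in>elts homega. \<exists>f\<in>M. injrel f (elts a) (elts n))"
proof
  assume fin: "finite (elts a)"
  then obtain h n where h: "inj_on h (elts a)" "h ` elts a = {..<n::nat}"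
    by (metis finite_imp_inj_to_nat_seg lessThan_def)
  define f where "f = hset ((\<lambda>x. hpair x (hnat (h x))) ` elts a)"
  have "f \<in> M" unfolding f_def
    by (rule finite_closed) (use assms transD fin in auto)
  moreover have "injrel f (elts a) (elts (hnat n))"
  proof (rule injrelI[where g = "\<lambda>x. hnat (h x)"])
    show "hpair x y \<in> elts f <-> y = hnat (h x)" if "x \<in> elts a" for x y
      using that unfolding f_def by auto
  qed (use h in \<open>auto simp: inj_on_def\<close>)
  ultimately show "\<exists>n\<in>elts homega. \<exists>f\<in>M. injrel f (elts a) (elts n)" by auto
next
  assume "\<exists>n\<in>elts homega. \<exists>f\<in>M. injrel f (elts a) (elts n)"
  then obtain n f where f: "injrel f (elts a) (elts (hnat n))" by auto
  define g where "g x = (SOME n'. n' \<in> elts (hnat n) \<and> hpair x n' \<in> elts f)" for x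
  have g: "g x \<in> elts (hnat n) \<and> hpair x (g x) \<in> elts f" if "x \<in> elts a" for x
    unfolding g_def by (rule someI_ex) (use f that in \<open>auto simp: injrel_def\<close>)
  have "inj_on g (elts a)" using g f unfolding injrel_def by (intro inj_onI) metis
  moreover have "g ` elts a \<subseteq> elts (hnat n)" using g by auto
  moreover have "finite (elts (hnat n))" by (rule finite_elts_hnat)
  ultimately show "finite (elts a)" by (metis finite_imageD finite_subset)
qed

lemma dfn_injrel [dfi]:
  assumes "dff M f" "dff M g" "dff M h" shows "dfn M (\<lambda>s. injrel (f s) (elts (g s)) (elts (h s)))"
proof (rule dfn_comp3[where Q = "\<lambda>f x y. injrel f (elts x) (elts y)"])
  show "dfn M (\<lambda>s. injrel (s 0) (elts (s 1)) (elts (s 2)))" unfolding injrel_def by (intro dfi)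
qed (rule assms)+

lemma dfn_finite [dfi]: "dff M f ==> dfn M (\<lambda>s. finite (elts (f s)))"
proof (rule dfn_comp1[where Q = "\<lambda>x. finite (elts x)"])
  have "dfn M (\<lambda>s. \<exists>n\<in>elts homega. \<exists>f\<in>M. injrel f (elts (s 0)) (elts n))" by (intro dfi omegaM)
  then show "dfn M (\<lambda>s. finite (elts (s 0)))"
    by (subst dfn_cong) (auto simp: finite_iff env_closed simp del: elts_homega)
qed

lemma dfn_countable_in [dfi]: "dff M f ==> dfn M (\<lambda>s. countable_in M (elts (f s)))"
proof (rule dfn_comp1[where Q = "\<lambda>x. countable_in M (elts x)"])
  have "dfn M (\<lambda>s. \<exists>f\<in>M. injrel f (elts (s 0)) (elts homega))" by (intro dfi omegaM)
  then show "dfn M (\<lambda>s. countable_in M (elts (s 0)))"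
    by (subst dfn_cong) (auto simp: countable_in_iff env_closed simp del: elts_homega)
qed

lemma finite_in_iff:
  assumes "X \<subseteq> M" shows "finite_in M X <-> finite X"
proof
  assume "finite_in M X"
  then obtain n f where "bij_betw (\<lambda>x. f \<cdot> x) (elts (hnat n)) X"
    unfolding finite_in_def equipollent_in_def by blast
  moreover have "finite (elts (hnat n))" by (rule finite_elts_hnat)
  ultimately show "finite X" using bij_betw_finite by blast
next
  assume "finite X"
  then obtain h n where h: "bij_betw h {..<n::nat} X"
    using ex_bij_betw_nat_finite[of X] by (auto simp: atLeast0LessThan)
  define g where "g x = h (inv_into UNIV hnat x)" for x
  have inj: "inj hnat" by (rule injI) simp
  have g: "g (hnat i) = h i" for i unfolding g_def by (simp add: inv_f_f[OF inj])
  have c: "countable (elts (hnat n))" by simp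
  have "bij_betw g (elts (hnat n)) X"
    using h g unfolding bij_betw_def elts_hnat by (auto simp: inj_on_def image_image simp del: hnat.simps)
  then have b: "bij_betw (\<lambda>x. hgraph (elts (hnat n)) g \<cdot> x) (elts (hnat n)) X"
    using bij_betw_cong[of "elts (hnat n)" "\<lambda>x. hgraph (elts (hnat n)) g \<cdot> x" g X] hgraph(3)[OF c] by blast
  have gX: "g x \<in> X" if "x \<in> elts (hnat n)" for x
    using \<open>bij_betw g (elts (hnat n)) X\<close> that bij_betwE by blast
  have "hgraph (elts (hnat n)) g \<in> M" unfolding hgraph_def
  proof (rule finite_closed)
    show "(\<lambda>x. hpair x (g x)) ` elts (hnat n) \<subseteq> M"
    proof (rule image_subsetI)
      fix x assume "x \<in> elts (hnat n)"
      then show "hpair x (g x) \<in> M" using gX[of x] assms transD[of x "hnat n"] by auto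
    qed
  qed (simp add: elts_hnat del: hnat.simps)
  then have "fun_in M (hgraph (elts (hnat n)) g) (elts (hnat n)) X"
    unfolding fun_in_def using hgraph(2,3)[OF c] gX by auto
  then show "finite_in M X" unfolding finite_in_def equipollent_in_def using b by blast
qed

lemma hfin_closed:
  assumes "a \<in> M" shows "hfin a \<in> M"
proof -
  have "hset {x. elts x \<subseteq> elts a \<and> finite (elts x)} \<in> M"
  proof (rule hset_sub_closed[OF pw(1)[OF assms]])
    fix x assume x: "elts x \<subseteq> elts a \<and> finite (elts x)"
    then have "hset (elts x) \<in> M" using assms transD by (intro finite_closed) auto
    then show "x \<in> elts (pw a)" using x by (simp add: pw(2)[OF assms])
  qed (intro dfi assms)
  then show ?thesis by (simp add: hfin_def)
qed

lemma dff_hfin [dfi]: "dff M f ==> dff M (\<lambda>s. hfin (f s))"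
proof (rule dff_comp1[where h = hfin])
  show "dff M (\<lambda>s. hfin (s 0))"
  proof (rule dff_ext)
    show "dfn M (\<lambda>s. s 0 \<in> elts (hfin (s (Suc 0))))" by simp (intro dfi)
  qed (simp add: hfin_closed env_closed)
qed

end

section \<open>Binary codes of finite sets of natural numbers\<close>

lemma bit_nat_iff: "odd (n div 2 ^ i) <-> (\<exists>a<2 ^ i. \<exists>b. n = 2 ^ Suc i * b + (2 ^ i + a))" for n i :: nat
proof
  assume "odd (n div 2 ^ i)"
  then obtain b where b: "n div 2 ^ i = 2 * b + 1" by (elim oddE)
  have "n = (n div 2 ^ i) * 2 ^ i + n mod 2 ^ i" by (rule div_mult_mod_eq[symmetric])
  also have "\<dots> = 2 ^ Suc i * b + (2 ^ i + n mod 2 ^ i)" by (simp only: b) (simp add: algebra_simps)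
  finally show "\<exists>a<2 ^ i. \<exists>b. n = 2 ^ Suc i * b + (2 ^ i + a)" by (metis mod_less_divisor zero_less_numeral zero_less_power)
next
  assume "\<exists>a<2 ^ i. \<exists>b. n = 2 ^ Suc i * b + (2 ^ i + a)"
  then obtain a b where a: "a < 2 ^ i" "n = 2 ^ Suc i * b + (2 ^ i + a)" by blast
  then have n: "n = a + (2 * b + 1) * 2 ^ i" by (simp add: algebra_simps)
  have "n div 2 ^ i = (2 * b + 1) + a div 2 ^ i" unfolding n by (rule div_mult_self1) simp
  then have "n div 2 ^ i = 2 * b + 1" using a(1) by simp
  then show "odd (n div 2 ^ i)" by simp
qed

text \<open>The binary digit number i of n is 1, expressed without division through a remainder
  \<open>a\<close> below 2^i and a quotient \<open>b\<close>.\<close>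

definition hbit :: "hc => hc => bool" where
  "hbit i n <-> (\<exists>a\<in>elts (hpow2 hempty i). \<exists>b\<in>elts homega. n = hadd (hmul (hpow2 hempty (hsucc i)) b) (hadd (hpow2 hempty i) a))"

lemma hbit_hnat: "hbit (hnat i) (hnat n) <-> i \<in> set_decode n"
proof -
  have p: "hpow2 hempty (hsucc (hnat i)) = hnat (2 ^ Suc i)"
    using hpow2_hnat[of "Suc i"] by simp
  show ?thesis
    unfolding hbit_def p hpow2_hnat set_decode_def mem_Collect_eq bit_nat_iff
    by (auto simp: elts_hnat simp del: hnat.simps power_Suc)
qed

context zfc
begin

lemma dfn_hbit [dfi]: "dff M f ==> dff M g ==> dfn M (\<lambda>s. hbit (f s) (g s))"
proof (rule dfn_comp2[where Q = hbit])
  show "dfn M (\<lambda>s. hbit (s 0) (s 1))" unfolding hbit_def by (intro dfi homega_closed)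
qed

text \<open>A finite subset is coded by the number whose binary digits mark the codes of its
  elements.\<close>

lemma countable_in_hfin:
  assumes a: "a \<in> M" "countable_in M (elts a)" shows "countable_in M (elts (hfin a))"
proof -
  obtain f g where f: "f \<in> M" "\<And>x y. x \<in> elts a ==> hpair x y \<in> elts f <-> y = hnat (g x)" "inj_on g (elts a)"
    using countable_inE[OF a(2)] by blast
  have f2: "(\<exists>y\<in>elts x. hpair y (hnat i) \<in> elts f) <-> i \<in> g ` elts x" if "x \<in> elts (hfin a)" for x i
  proof -
    have "hpair y (hnat i) \<in> elts f <-> i = g y" if "y \<in> elts x" for y
      using f(2)[of y "hnat i"] that \<open>x \<in> elts (hfin a)\<close> by auto
    then show ?thesis by blast
  qed
  show ?thesis
  proof (rule countable_inI[of _ "\<lambda>x n. \<forall>i\<in>elts homega. hbit i n <-> (\<exists>y\<in>elts x. hpair y i \<in> elts f)"])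
    show "dfn M (\<lambda>s. \<forall>i\<in>elts homega. hbit i (s 1) <-> (\<exists>y\<in>elts (s 0). hpair y i \<in> elts f))"
      by (intro dfi homega_closed f(1))
  next
    fix x assume x: "x \<in> elts (hfin a)"
    then have "finite (g ` elts x)" by simp
    then have "\<forall>i. hbit (hnat i) (hnat (set_encode (g ` elts x))) <-> i \<in> g ` elts x"
      by (simp add: hbit_hnat set_encode_inverse)
    then show "\<exists>n. \<forall>i\<in>elts homega. hbit i (hnat n) <-> (\<exists>y\<in>elts x. hpair y i \<in> elts f)"
      using f2[OF x] by auto
  next
    fix x y n assume x: "x \<in> elts (hfin a)" and y: "y \<in> elts (hfin a)"
      and "\<forall>i\<in>elts homega. hbit i (hnat n) <-> (\<exists>y\<in>elts x. hpair y i \<in> elts f)"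
      and "\<forall>i\<in>elts homega. hbit i (hnat n) <-> (\<exists>z\<in>elts y. hpair z i \<in> elts f)"
    then have "\<forall>i. i \<in> g ` elts x <-> i \<in> g ` elts y" using f2[OF x] f2[OF y] by auto
    then have "g ` elts x = g ` elts y" by blast
    moreover have "elts x \<subseteq> elts a" "elts y \<subseteq> elts a" using x y by auto
    ultimately have "elts x = elts y" using f(3) by (simp add: inj_on_image_eq_iff)
    then show "x = y" by (rule hc_eqI)
  qed (simp add: hfin_closed a)
qed

text \<open>Codes of elements of the first set become even, those of the remaining elements
  odd.\<close>

lemma countable_in_hun:
  assumes a: "a \<in> M" "countable_in M (elts a)" and b: "b \<in> M" "countable_in M (elts b)"
  shows "countable_in M (elts (hun a b))"
proof -
  obtain f g where f: "f \<in> M" "\<And>x y. x \<in> elts a ==> hpair x y \<in> elts f <-> y = hnat (g x)" "inj_on g (elts a)"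
    using countable_inE[OF a(2)] by blast
  obtain f' g' where f': "f' \<in> M" "\<And>x y. x \<in> elts b ==> hpair x y \<in> elts f' <-> y = hnat (g' x)" "inj_on g' (elts b)"
    using countable_inE[OF b(2)] by blast
  define Q where "Q x n <-> (\<exists>m\<in>elts homega. (x \<in> elts a \<and> hpair x m \<in> elts f \<and> n = hadd m m) \<or>
    (x \<in> elts b \<and> x \<notin> elts a \<and> hpair x m \<in> elts f' \<and> n = hsucc (hadd m m)))" for x n
  have h: "hsucc (hnat m) = hnat (Suc m)" for m by simp
  have Q: "Q x (hnat n) <-> n = (if x \<in> elts a then 2 * g x else Suc (2 * g' x))" if "x \<in> elts (hun a b)" for x n
    using that f(2) f'(2) unfolding Q_def h[symmetric] by (auto simp: h mult_2 simp del: hnat.simps)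
  show ?thesis
  proof (rule countable_inI[of _ Q])
    show "dfn M (\<lambda>s. Q (s 0) (s 1))" unfolding Q_def by (intro dfi homega_closed a(1) b(1) f(1) f'(1))
    fix x y n assume x: "x \<in> elts (hun a b)" "y \<in> elts (hun a b)" "Q x (hnat n)" "Q y (hnat n)"
    then have *: "(if x \<in> elts a then 2 * g x else Suc (2 * g' x)) = (if y \<in> elts a then 2 * g y else Suc (2 * g' y))"
      using Q by metis
    have "Suc (2 * m) \<noteq> 2 * k" for m k by presburger
    with * have "(x \<in> elts a \<and> y \<in> elts a \<and> g x = g y) \<or> (x \<notin> elts a \<and> y \<notin> elts a \<and> g' x = g' y)"
      by (auto split: if_splits) metis
    then show "x = y" using x(1,2) f(3) f'(3) by (auto dest: inj_onD)
  qed (use a(1) b(1) Q in auto)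
qed

text \<open>A Kuratowski pair is a finite set of finite subsets of the union.\<close>

lemma countable_in_hprd:
  assumes a: "a \<in> M" "countable_in M (elts a)" and b: "b \<in> M" "countable_in M (elts b)"
  shows "countable_in M (elts (hprd a b))"
proof (rule countable_in_subset)
  show "countable_in M (elts (hfin (hfin (hun a b))))"
    by (intro countable_in_hfin countable_in_hun hfin_closed hun_closed assms)
  show "elts (hprd a b) \<subseteq> elts (hfin (hfin (hun a b)))" by (auto simp: hprod_def)
qed (simp_all add: a b hfin_closed)

lemma countable_in_homega: "countable_in M (elts homega)"
  by (rule countable_inI[OF homega_closed, of "\<lambda>x y. x = y"]) (auto intro!: dfi)

end

section \<open>Ordinals and the first uncountable ordinal of a model\<close>

lemma hordinal_elem: "hordinal a ==> x \<in> elts a ==> hordinal x"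
  unfolding hordinal_def by blast

lemma hordinal_trans: "hordinal a ==> x \<in> elts a ==> y \<in> elts x ==> y \<in> elts a"
  unfolding hordinal_def by blast

text \<open>By a double induction on membership, two incomparable ordinals would be included in each
  other.\<close>

lemma hordinal_linear: "hordinal a ==> hordinal b ==> a \<in> elts b \<or> a = b \<or> b \<in> elts a"
proof (induction a arbitrary: b rule: elts_induct)
  case (1 a)
  note IHa = this
  show ?case using 1(3)
  proof (induction b rule: elts_induct)
    case (1 b)
    show ?case
    proof (rule ccontr)
      assume neg: "\<not> ?thesis"
      have "elts a \<subseteq> elts b"
      proof
        fix x assume x: "x \<in> elts a"
        then have "x \<in> elts b \<or> x = b \<or> b \<in> elts x"
          using IHa(1)[OF x] hordinal_elem[OF IHa(2) x] 1(2) by blast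
        then show "x \<in> elts b" using neg x hordinal_trans[OF IHa(2)] by blast
      qed
      moreover have "elts b \<subseteq> elts a"
      proof
        fix y assume y: "y \<in> elts b"
        then have "a \<in> elts y \<or> a = y \<or> y \<in> elts a"
          using 1(1)[OF y] hordinal_elem[OF 1(2) y] by blast
        then show "y \<in> elts a" using neg y hordinal_trans[OF 1(2)] by blast
      qed
      ultimately have "a = b" by (intro hc_eqI) simp
      then show False using neg by blast
    qed
  qed
qed

lemma hordinal_hUn: "(\<And>x. x \<in> elts B ==> hordinal x) ==> hordinal (hUn B)"
  unfolding hordinal_def by simp blast

lemma hordinal_hsucc: "hordinal a ==> hordinal (hsucc a)"
  unfolding hordinal_def by simp blast

lemma hordinal_hnat: "hordinal (hnat n)"
proof (induction n)
  case 0 show ?case by (simp add: hordinal_def)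
next
  case (Suc n) then show ?case using hordinal_hsucc by simp
qed

lemma hordinal_homega: "hordinal homega"
  unfolding hordinal_def
proof (intro conjI ballI)
  show "elts x \<subseteq> elts homega" if x: "x \<in> elts homega" for x
  proof -
    obtain n where "x = hnat n" using x by auto
    then show ?thesis by (simp add: elts_hnat image_subset_iff del: hnat.simps)
  qed
  show "elts y \<subseteq> elts x" if x: "x \<in> elts homega" and y: "y \<in> elts x" for x y
  proof -
    obtain n where "x = hnat n" using x by auto
    then show ?thesis using hordinal_hnat[of n] y unfolding hordinal_def by blast
  qed
qed

lemma (in tm) dfn_hordinal [dfi]: "dff M f ==> dfn M (\<lambda>s. hordinal (f s))"
proof (rule dfn_comp1[where Q = hordinal])
  show "dfn M (\<lambda>s. hordinal (s 0))" unfolding hordinal_def by (intro dfi)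
qed

text \<open>\<open>f\<close> numbers the elements of the ordinal \<open>a\<close>, and
  \<open>E\<close> is the image of its order. The order is taken reflexive so that the field of
  \<open>E\<close> is exactly the set of numbers in use.\<close>

definition order_code :: "hc => hc => hc => bool" where
  "order_code E a f <-> injrel f (elts a) (elts homega) \<and>
    (\<forall>x\<in>elts a. \<forall>m\<in>elts homega. \<forall>n\<in>elts homega. hpair x m \<in> elts f \<and> hpair x n \<in> elts f --> m = n) \<and>
    (\<forall>m\<in>elts homega. \<forall>n\<in>elts homega. hpair m n \<in> elts E <->
      (\<exists>x\<in>elts a. \<exists>y\<in>elts a. hpair x m \<in> elts f \<and> hpair y n \<in> elts f \<and> (x = y \<or> x \<in> elts y)))"

text \<open>Uniqueness of the transitive collapse: by induction on membership, elements of the two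
  ordinals that carry the same number are equal.\<close>

lemma order_code_sub:
  assumes "order_code E a f" "order_code E b g" "hordinal a" "hordinal b" "x \<in> elts a"
  shows "x \<in> elts b \<and> (\<forall>n\<in>elts homega. hpair x n \<in> elts f --> hpair x n \<in> elts g)"
proof -
  have partner: "\<exists>y\<in>elts b. hpair y n \<in> elts g"
    if "order_code E a f" "order_code E b g" "n \<in> elts homega" "hpair x n \<in> elts f" "x \<in> elts a" for a b f g x n
  proof -
    have "hpair n n \<in> elts E" using that unfolding order_code_def by blast
    then show ?thesis using that unfolding order_code_def by blast
  qed
  have img: "\<exists>n\<in>elts homega. hpair x n \<in> elts f" if "order_code E a f" "x \<in> elts a" for a f x
    using that unfolding order_code_def injrel_def by blast
  have inj: "x = y" if "order_code E a f" "x \<in> elts a" "y \<in> elts a" "n \<in> elts homega"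
    "hpair x n \<in> elts f" "hpair y n \<in> elts f" for a f x y n
    using that unfolding order_code_def injrel_def by blast
  have fn: "m = n" if "order_code E a f" "x \<in> elts a" "n \<in> elts homega" "m \<in> elts homega"
    "hpair x n \<in> elts f" "hpair x m \<in> elts f" for a f x m n
    using that unfolding order_code_def by blast
  have less: "x \<in> elts y" if "order_code E a f" "order_code E b g" "x \<in> elts a" "y \<in> elts a" "x' \<in> elts b" "y' \<in> elts b"
    "m \<in> elts homega" "n \<in> elts homega" "hpair x m \<in> elts f" "hpair y n \<in> elts f" "hpair x' m \<in> elts g" "hpair y' n \<in> elts g"
    "x' \<in> elts y'" for a b f g x y x' y' m n
  proof -
    note h = that
    have "hpair m n \<in> elts E" using h unfolding order_code_def by blast
    then have "\<exists>u\<in>elts a. \<exists>v\<in>elts a. hpair u m \<in> elts f \<and> hpair v n \<in> elts f \<and> (u = v \<or> u \<in> elts v)"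
      using h(1,7,8) unfolding order_code_def by blast
    then obtain u v where uv: "u \<in> elts a" "v \<in> elts a" "hpair u m \<in> elts f" "hpair v n \<in> elts f" "u = v \<or> u \<in> elts v"
      by blast
    have "u = x" by (rule inj[OF h(1) uv(1) h(3) h(7) uv(3) h(9)])
    moreover have "v = y" by (rule inj[OF h(1) uv(2) h(4) h(8) uv(4) h(10)])
    moreover have "x \<noteq> y"
    proof
      assume "x = y"
      then have "m = n" using fn that by blast
      then have "x' = y'" using inj that by blast
      then show False using that by auto
    qed
    ultimately show ?thesis using uv(5) by blast
  qed
  have same: "y = x" if "x \<in> elts a" "y \<in> elts b" "n \<in> elts homega" "hpair x n \<in> elts f" "hpair y n \<in> elts g" for x y n
    using that
  proof (induction x arbitrary: y n rule: elts_induct)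
    case (1 x)
    show ?case
    proof (rule hc_eqI, intro equalityI subsetI)
      fix z assume z: "z \<in> elts y"
      then have zb: "z \<in> elts b" using 1(3) assms(4) hordinal_trans by blast
      obtain m where m: "m \<in> elts homega" "hpair z m \<in> elts g" using img[OF assms(2) zb] by blast
      obtain w where w: "w \<in> elts a" "hpair w m \<in> elts f" using partner[OF assms(2,1) m zb] by blast
      have "w \<in> elts x" using less[OF assms(1,2) w(1) 1(2) zb 1(3) m(1) 1(4) w(2) 1(5) m(2) 1(6) z] .
      moreover have "z = w" using 1(1)[OF calculation w(1) zb m(1) w(2) m(2)] .
      ultimately show "z \<in> elts x" by simp
    next
      fix z assume z: "z \<in> elts x"
      then have za: "z \<in> elts a" using 1(2) assms(3) hordinal_trans by blast
      obtain m where m: "m \<in> elts homega" "hpair z m \<in> elts f" using img[OF assms(1) za] by blast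
      obtain w where w: "w \<in> elts b" "hpair w m \<in> elts g" using partner[OF assms(1,2) m za] by blast
      have "w = z" using 1(1)[OF z za w(1) m(1) m(2) w(2)] .
      moreover have "w \<in> elts y" using less[OF assms(2,1) w(1) 1(3) za 1(2) m(1) 1(4) w(2) 1(6) m(2) 1(5) z] .
      ultimately show "z \<in> elts y" by simp
    qed
  qed
  obtain n where n: "n \<in> elts homega" "hpair x n \<in> elts f" using img[OF assms(1,5)] by blast
  obtain y where y: "y \<in> elts b" "hpair y n \<in> elts g" using partner[OF assms(1,2) n assms(5)] by blast
  have xy: "y = x" by (rule same[OF assms(5) y(1) n y(2)])
  show ?thesis using y xy fn[OF assms(1,5)] n by blast
qed

context zfc
begin

text \<open>Hartogs' construction: replacement collects the ordinals coded by subsets of omega x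
  omega, and \<open>\<omega>\<^sub>1\<close> consists of the countable ones. If it were countable it
  would be an element of itself.\<close>

lemma omega1_ex: "\<exists>k. omega1_in M k"
proof -
  define W where "W = hset {E \<in> elts (pw (hprd homega homega)). \<exists>a\<in>M. \<exists>f\<in>M. hordinal a \<and> order_code E a f}"
  have W1: "pw (hprd homega homega) \<in> M" by (simp add: pw(1))
  have Doc: "dfn M (\<lambda>s. order_code (s 0) (s 1) (s 2))" unfolding order_code_def by (intro dfi homega_closed)
  have WM: "W \<in> M" unfolding W_def by (rule sep[OF W1]) (intro dfi dfn_comp3[where Q = order_code, OF Doc])
  have uq: "\<exists>!a. a \<in> M \<and> hordinal a \<and> (\<exists>f\<in>M. order_code E a f)" if E: "E \<in> elts W" for E
  proof -
    obtain a f where a: "a \<in> M" "f \<in> M" "hordinal a" "order_code E a f" using E by (auto simp: W_def)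
    have "b = a" if b: "hordinal b" "order_code E b g" for b g
    proof (rule hc_eqI, intro equalityI subsetI)
      show "x \<in> elts a" if x: "x \<in> elts b" for x using order_code_sub[OF b(2) a(4) b(1) a(3) x] by blast
      show "x \<in> elts b" if x: "x \<in> elts a" for x using order_code_sub[OF a(4) b(2) a(3) b(1) x] by blast
    qed
    then show ?thesis using a by blast
  qed
  have "dfn M (\<lambda>s. hordinal (s 1) \<and> (\<exists>f\<in>M. order_code (s 0) (s 1) f))"
    by (intro dfi dfn_comp3[where Q = order_code, OF Doc])
  then obtain b where b: "b \<in> M" "\<forall>E\<in>elts W. \<exists>a\<in>elts b. hordinal a \<and> (\<exists>f\<in>M. order_code E a f)"
    using repl[OF WM, of "\<lambda>E a. hordinal a \<and> (\<exists>f\<in>M. order_code E a f)"] uq by blast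
  define k where "k = hset {a \<in> elts b. hordinal a \<and> countable_in M (elts a)}"
  have kM: "k \<in> M" unfolding k_def by (rule sep[OF b(1)]) (intro dfi)
  have k: "a \<in> elts k <-> a \<in> M \<and> hordinal a \<and> countable_in M (elts a)" for a
  proof
    assume "a \<in> elts k" then show "a \<in> M \<and> hordinal a \<and> countable_in M (elts a)"
      using transD[OF _ kM] by (auto simp: k_def)
  next
    assume a: "a \<in> M \<and> hordinal a \<and> countable_in M (elts a)"
    then obtain f g where f: "f \<in> M" "\<forall>x\<in>elts a. \<forall>y. hpair x y \<in> elts f <-> y = hnat (g x)" "inj_on g (elts a)"
      using countable_inE[of "elts a"] by blast
    define E where "E = hset {z \<in> elts (hprd homega homega). \<exists>m\<in>elts homega. \<exists>n\<in>elts homega. z = hpair m n \<and>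
      (\<exists>x\<in>elts a. \<exists>y\<in>elts a. hpair x m \<in> elts f \<and> hpair y n \<in> elts f \<and> (x = y \<or> x \<in> elts y))}"
    have "a \<in> M" using a by blast
    then have EM: "E \<in> M" unfolding E_def by (intro sep dfi f(1) homega_closed hprd_closed)
    have "E \<in> elts (pw (hprd homega homega))" using EM by (simp add: pw(2) E_def)
    moreover have "order_code E a f"
      unfolding order_code_def
    proof (intro conjI)
      show "injrel f (elts a) (elts homega)"
        using f(2,3) by (intro injrelI[where g = "\<lambda>x. hnat (g x)"]) (auto simp: inj_on_def)
      show "\<forall>x\<in>elts a. \<forall>m\<in>elts homega. \<forall>n\<in>elts homega. hpair x m \<in> elts f \<and> hpair x n \<in> elts f --> m = n"
      proof (intro ballI impI)
        fix x m n assume "x \<in> elts a" "hpair x m \<in> elts f \<and> hpair x n \<in> elts f"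
        then have "m = hnat (g x)" "n = hnat (g x)" using f(2) by blast+
        then show "m = n" by simp
      qed
      show "\<forall>m\<in>elts homega. \<forall>n\<in>elts homega. hpair m n \<in> elts E <->
        (\<exists>x\<in>elts a. \<exists>y\<in>elts a. hpair x m \<in> elts f \<and> hpair y n \<in> elts f \<and> (x = y \<or> x \<in> elts y))"
        by (simp add: E_def)
    qed
    ultimately have EW: "E \<in> elts W" using a f(1) unfolding W_def by auto
    then obtain a' f' where a': "a' \<in> elts b" "hordinal a'" "order_code E a' f'" using b(2) by blast
    have "a' = a"
    proof (rule hc_eqI, intro equalityI subsetI)
      show "x \<in> elts a" if x: "x \<in> elts a'" for x
        using order_code_sub[OF a'(3) \<open>order_code E a f\<close> a'(2) _ x] a by blast
      show "x \<in> elts a'" if x: "x \<in> elts a" for x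
        using order_code_sub[OF \<open>order_code E a f\<close> a'(3) _ a'(2) x] a by blast
    qed
    then show "a \<in> elts k" using a' a by (simp add: k_def)
  qed
  have tr: "x \<in> elts k" if "a \<in> elts k" "x \<in> elts a" for a x
  proof -
    have a: "a \<in> M" "hordinal a" "countable_in M (elts a)" using k that(1) by blast+
    have "x \<in> M" using a(1) that(2) transD by blast
    moreover have "elts x \<subseteq> elts a" using a(2) that(2) unfolding hordinal_def by blast
    ultimately show ?thesis
      using k countable_in_subset[OF _ a(1) _ a(3)] hordinal_elem[OF a(2) that(2)] by blast
  qed
  have ok: "hordinal k"
    unfolding hordinal_def
  proof (intro conjI ballI subsetI)
    show "y \<in> elts k" if "x \<in> elts k" "y \<in> elts x" for x y using tr that .
    show "z \<in> elts x" if "x \<in> elts k" "y \<in> elts x" "z \<in> elts y" for x y z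
      using k that hordinal_trans by blast
  qed
  have "\<not> countable_in M (elts k)" using k ok kM by (metis elts_irrefl)
  then show ?thesis unfolding omega1_in_def using k kM ok by blast
qed

end

section \<open>The first uncountable ordinal and reflection below it\<close>

locale omega1_model = zfc +
  fixes w1 assumes w1: "omega1_in M w1"
begin

lemma w1M [simp]: "w1 \<in> M" and w1_ord: "hordinal w1" and w1_unc: "\<not> countable_in M (elts w1)"
  and w1_cnt: "a \<in> elts w1 ==> countable_in M (elts a)"
  using w1 unfolding omega1_in_def by blast+

lemma w1D: "a \<in> elts w1 ==> a \<in> M" using transD[OF _ w1M] .

lemma w1_hordinal: "a \<in> elts w1 ==> hordinal a" using hordinal_elem[OF w1_ord] .

lemma w1I: "hordinal a ==> a \<in> M ==> countable_in M (elts a) ==> a \<in> elts w1"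
proof -
  assume a: "hordinal a" "a \<in> M" "countable_in M (elts a)"
  consider "a \<in> elts w1" | "a = w1" | "w1 \<in> elts a" using hordinal_linear[OF a(1) w1_ord] by blast
  then show ?thesis
  proof cases
    case 3
    then have "elts w1 \<subseteq> elts a" using a(1) unfolding hordinal_def by blast
    then show ?thesis using countable_in_subset[OF w1M a(2) _ a(3)] w1_unc by blast
  qed (use a w1_unc in auto)
qed

lemma w1_hsucc: "a \<in> elts w1 ==> hsucc a \<in> elts w1"
proof (rule w1I)
  assume a: "a \<in> elts w1"
  have e: "hsucc a = hun a (hset {a})" by (rule hc_eqI) auto
  show "countable_in M (elts (hsucc a))"
    unfolding e by (rule countable_in_hun) (use a w1D w1_cnt finite_countable_in[of "hset {a}"] in auto)
qed (use w1D w1_hordinal hordinal_hsucc in auto)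

lemma homega_w1: "homega \<in> elts w1"
  by (rule w1I[OF hordinal_homega homega_closed countable_in_homega])

lemma hempty_w1: "hempty \<in> elts w1"
  using hordinal_trans[OF w1_ord homega_w1, of "hnat 0"] by (metis elts_homega hnat.simps(1) rangeI)

text \<open>The axiom of choice selects an enumeration of every member of \<open>B\<close> at once.
  An element of the union is then coded by the number of a member containing it together with its
  own number there.\<close>

lemma w1_regular:
  assumes B: "B \<in> M" "elts B \<subseteq> elts w1" "countable_in M (elts B)"
  shows "hUn B \<in> elts w1"
proof -
  define I where "I b = hset {g \<in> elts (pw (hprd b homega)). injrel g (elts b) (elts homega)}" for b
  have dI: "dff M (\<lambda>s. I (f s))" if "dff M f" for f
    by (rule dff_comp1[where h = I, OF _ that]) (unfold I_def, intro dfi homega_closed)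
  have eI: "elts (I b) = {g \<in> elts (pw (hprd b homega)). injrel g (elts b) (elts homega)}" for b
    unfolding I_def by (rule elts_hset) simp
  have BM: "b \<in> M" if "b \<in> elts B" for b using that B(1) transD by blast
  have I_ne: "elts (I b) \<noteq> {}" if b: "b \<in> elts B" for b
  proof -
    have "countable_in M (elts b)" using b B(2) w1_cnt by blast
    then obtain f where f: "f \<in> M" "injrel f (elts b) (elts homega)" using countable_in_iff[OF BM[OF b]] by blast
    define g where "g = hset {z \<in> elts (hprd b homega). z \<in> elts f}"
    have "g \<in> M" unfolding g_def by (intro sep dfi f(1) hprd_closed BM b homega_closed)
    moreover have "injrel g (elts b) (elts homega)" using f(2) unfolding injrel_def g_def by simp
    moreover have "elts g \<subseteq> elts (hprd b homega)" by (auto simp: g_def)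
    ultimately have "g \<in> elts (I b)" unfolding eI using BM[OF b] by (simp add: pw(2))
    then show ?thesis by blast
  qed
  \<comment> \<open>The factor \<open>{b}\<close> makes these sets disjoint, as the axiom of choice
    requires.\<close>
  define F where "F = hset ((\<lambda>b. hprd (hset {b}) (I b)) ` elts B)"
  have FM: "F \<in> M" unfolding F_def by (rule dff_const_closed) (intro dfi dI B(1))
  have eF: "elts F = (\<lambda>b. hprd (hset {b}) (I b)) ` elts B" by (simp add: F_def)
  have "\<exists>c\<in>M. \<forall>x\<in>elts F. \<exists>!z. z \<in> elts x \<and> z \<in> elts c"
  proof (rule ac[OF FM])
    show "elts x \<noteq> {}" if x: "x \<in> elts F" for x
    proof -
      obtain b where b: "b \<in> elts B" "x = hprd (hset {b}) (I b)" using x eF by auto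
      then obtain g where "g \<in> elts (I b)" using I_ne by blast
      then have "hpair b g \<in> elts x" using b by simp
      then show ?thesis by blast
    qed
    show "elts x \<inter> elts y = {}" if "x \<in> elts F" "y \<in> elts F" "x \<noteq> y" for x y
      using that unfolding eF by (auto simp: hprod_def)
  qed
  then obtain c where c: "c \<in> M" "\<forall>x\<in>elts F. \<exists>!z. z \<in> elts x \<and> z \<in> elts c" by blast
  have "\<forall>b\<in>elts B. \<exists>g. g \<in> elts (I b) \<and> (\<forall>g'\<in>elts (I b). hpair b g' \<in> elts c <-> g' = g)"
  proof
    fix b assume b: "b \<in> elts B"
    then have "\<exists>!z. z \<in> elts (hprd (hset {b}) (I b)) \<and> z \<in> elts c" using c(2) eF by blast
    then obtain z where z: "z \<in> elts (hprd (hset {b}) (I b))" "z \<in> elts c"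
      "\<And>z'. z' \<in> elts (hprd (hset {b}) (I b)) ==> z' \<in> elts c ==> z' = z" by blast
    obtain g where g: "g \<in> elts (I b)" "z = hpair b g" using z(1) by (auto simp: hprod_def)
    have "hpair b g' \<in> elts c <-> g' = g" if g': "g' \<in> elts (I b)" for g'
      using z(2) z(3)[of "hpair b g'"] g g' by auto
    then show "\<exists>g. g \<in> elts (I b) \<and> (\<forall>g'\<in>elts (I b). hpair b g' \<in> elts c <-> g' = g)" using g(1) by blast
  qed
  then obtain ch where ch: "\<And>b. b \<in> elts B ==> ch b \<in> elts (I b)"
    "\<And>b g. b \<in> elts B ==> g \<in> elts (I b) ==> hpair b g \<in> elts c <-> g = ch b" by metis
  obtain e h where e: "e \<in> M" "\<forall>x\<in>elts B. \<forall>y. hpair x y \<in> elts e <-> y = hnat (h x)" "inj_on h (elts B)"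
    using countable_inE[OF B(3)] by blast
  \<comment> \<open>An element that lies in several members of \<open>B\<close> gets several codes;
    a total injective relation is enough.\<close>
  define Q where "Q x z <-> (\<exists>b\<in>elts B. \<exists>g\<in>elts (I b). \<exists>m\<in>elts homega. \<exists>n\<in>elts homega.
    x \<in> elts b \<and> hpair b g \<in> elts c \<and> hpair x m \<in> elts g \<and> hpair b n \<in> elts e \<and> z = hpair n m)" for x z
  have UM: "hUn B \<in> M" using B(1) by simp
  have cnt: "countable_in M (elts (hUn B))"
  proof (rule countable_in_rel[OF UM, of "hprd homega homega" Q])
    show "countable_in M (elts (hprd homega homega))" by (intro countable_in_hprd countable_in_homega homega_closed)
    show "dfn M (\<lambda>s. Q (s 0) (s 1))" unfolding Q_def by (intro dfi dI B(1) c(1) e(1) homega_closed)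
    show "\<exists>z\<in>elts (hprd homega homega). Q x z" if x: "x \<in> elts (hUn B)" for x
    proof -
      obtain b where b: "b \<in> elts B" "x \<in> elts b" using x by auto
      have "injrel (ch b) (elts b) (elts homega)" using ch(1)[OF b(1)] unfolding eI by blast
      then obtain m where m: "m \<in> elts homega" "hpair x m \<in> elts (ch b)" using b(2) unfolding injrel_def by blast
      have hb: "hnat (h b) \<in> elts homega" by simp
      have "Q x (hpair (hnat (h b)) m)" unfolding Q_def
      proof (rule bexI[OF _ b(1)], rule bexI[OF _ ch(1)[OF b(1)]], rule bexI[OF _ m(1)], rule bexI[OF _ hb], intro conjI)
        show "hpair b (ch b) \<in> elts c" using ch(2)[OF b(1) ch(1)[OF b(1)]] by simp
        show "hpair b (hnat (h b)) \<in> elts e" using e(2) b(1) by blast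
      qed (use b m in auto)
      moreover have "hpair (hnat (h b)) m \<in> elts (hprd homega homega)" using m(1) by simp
      ultimately show ?thesis by blast
    qed
    show "hprd homega homega \<in> M" by simp
    show "x = y" if "x \<in> elts (hUn B)" "y \<in> elts (hUn B)" "z \<in> elts (hprd homega homega)"
      and Qx: "Q x z" and Qy: "Q y z" for x y z
    proof -
      obtain b g m n where b: "b \<in> elts B" "g \<in> elts (I b)" "m \<in> elts homega" "n \<in> elts homega"
        "x \<in> elts b" "hpair b g \<in> elts c" "hpair x m \<in> elts g" "hpair b n \<in> elts e" "z = hpair n m"
        using Qx unfolding Q_def by blast
      obtain b' g' m' n' where b': "b' \<in> elts B" "g' \<in> elts (I b')" "m' \<in> elts homega" "n' \<in> elts homega"
        "y \<in> elts b'" "hpair b' g' \<in> elts c" "hpair y m' \<in> elts g'" "hpair b' n' \<in> elts e" "z = hpair n' m'"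
        using Qy unfolding Q_def by blast
      have nm: "n = n'" "m = m'" using b(9) b'(9) by auto
      have "n = hnat (h b)" "n' = hnat (h b')" using e(2) b(1,8) b'(1,8) by blast+
      then have "h b = h b'" using nm by simp
      then have bb: "b = b'" using inj_onD[OF e(3)] b(1) b'(1) by blast
      then have gg: "g = g'" using ch(2)[OF b(1,2)] ch(2)[OF b'(1,2)] b(6) b'(6) by simp
      have "injrel g (elts b) (elts homega)" using b(2) unfolding eI by blast
      then show "x = y" unfolding injrel_def using b(3,5,7) b'(5,7) nm bb gg by blast
    qed
  qed
  have "hordinal (hUn B)" by (rule hordinal_hUn) (use B(2) w1_hordinal in blast)
  then show ?thesis using w1I[OF _ UM cnt] by blast
qed

definition fs :: "hc => hc" where "fs a = hfin (hprd a homega)"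

lemma dff_fs [dfi]: "dff M f ==> dff M (\<lambda>s. fs (f s))"
  unfolding fs_def by (intro dfi homega_closed)

lemma fs_closed: "a \<in> M ==> fs a \<in> M"
  unfolding fs_def by (simp add: hfin_closed)

lemma fs_mono: "elts a \<subseteq> elts b ==> elts (fs a) \<subseteq> elts (fs b)"
  unfolding fs_def elts_hfin elts_hprd hprod_def by blast

lemma fs_countable: "a \<in> elts w1 ==> countable_in M (elts (fs a))"
  unfolding fs_def by (intro countable_in_hfin hprd_closed countable_in_hprd w1D w1_cnt homega_closed countable_in_homega)

lemma w1_least:
  assumes "x \<in> elts w1" "P x" shows "\<exists>x\<in>elts w1. P x \<and> (\<forall>y\<in>elts x. \<not> P y)"
  using assms
proof (induction x rule: elts_induct)
  case (1 x)
  then show ?case using hordinal_trans[OF w1_ord 1(2)] by blast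
qed

text \<open>Every definable requirement that conditions of countable support be met by conditions of
  bounded support holds below some countable limit ordinal.\<close>

lemma reflection:
  assumes D: "dfn M (\<lambda>s. E (s 0) (s 1) (s 2))" and Z: "Z \<in> M" "countable_in M (elts Z)" and \<beta>0: "\<beta>0 \<in> elts w1"
  shows "\<exists>\<delta>\<in>elts w1. \<beta>0 \<in> elts \<delta> \<and> (\<forall>\<alpha>\<in>elts \<delta>. hsucc \<alpha> \<in> elts \<delta>) \<and>
    (\<forall>r\<in>elts (fs \<delta>). \<forall>z\<in>elts Z. (\<exists>p\<in>elts (fs w1). E r z p) --> (\<exists>p\<in>elts (fs \<delta>). E r z p))"
proof -
  \<comment> \<open>Least bounds are unique, so countably many pairs (r, z) give only countably many
    of them.\<close>
  define lb where "lb r z \<beta> <-> (\<exists>p\<in>elts (fs \<beta>). E r z p) \<and> (\<forall>\<gamma>\<in>elts \<beta>. \<not> (\<exists>p\<in>elts (fs \<gamma>). E r z p))" for r z \<beta>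
  define B where "B \<alpha> = hset {\<beta> \<in> elts w1. \<exists>r\<in>elts (fs \<alpha>). \<exists>z\<in>elts Z. lb r z \<beta>}" for \<alpha>
  \<comment> \<open>\<open>hsucc \<alpha>\<close> puts each ordinal of the chain below the next one,
    which makes the limit \<delta> a limit ordinal; \<open>hsucc \<beta>0\<close> puts
    \<open>\<beta>0\<close> below \<delta>.\<close>
  define h where "h \<alpha> = hUn (hun (B \<alpha>) (hset {hsucc \<alpha>, hsucc \<beta>0}))" for \<alpha>
  have Dlb: "dfn M (\<lambda>s. lb (s 0) (s 1) (s 2))"
    unfolding lb_def by (intro dfi dfn_comp3[where Q = E, OF D])
  have \<beta>0M: "\<beta>0 \<in> M" using \<beta>0 w1D by blast
  have dB: "dff M (\<lambda>s. B (f s))" if "dff M f" for f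
    by (rule dff_comp1[where h = B, OF _ that])
      (unfold B_def, intro dfi w1M Z(1) dfn_comp3[where Q = lb, OF Dlb])
  have dh: "dff M (\<lambda>s. h (f s))" if "dff M f" for f
    by (rule dff_comp1[where h = h, OF _ that]) (unfold h_def, intro dfi dB \<beta>0M)
  have lb_unique: "\<beta> = \<gamma>" if "lb r z \<beta>" "lb r z \<gamma>" "\<beta> \<in> elts w1" "\<gamma> \<in> elts w1" for r z \<beta> \<gamma>
    using that hordinal_linear[OF w1_hordinal[OF that(3)] w1_hordinal[OF that(4)]] unfolding lb_def by blast
  have BM: "B \<alpha> \<in> M" if "\<alpha> \<in> M" for \<alpha>
    by (rule dff_const_closed) (intro dB dfi that)
  have Bcnt: "countable_in M (elts (B \<alpha>))" if \<alpha>: "\<alpha> \<in> elts w1" for \<alpha>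
  proof (rule countable_in_rel[of _ "hprd (fs \<alpha>) Z" "\<lambda>\<beta> w. \<exists>r\<in>elts (fs \<alpha>). \<exists>z\<in>elts Z. w = hpair r z \<and> lb r z \<beta>"])
    have \<alpha>M: "\<alpha> \<in> M" using \<alpha> w1D by blast
    show "B \<alpha> \<in> M" using BM[OF \<alpha>M] .
    show "countable_in M (elts (hprd (fs \<alpha>) Z))"
      by (intro countable_in_hprd fs_closed fs_countable \<alpha> \<alpha>M Z)
    show "dfn M (\<lambda>s. \<exists>r\<in>elts (fs \<alpha>). \<exists>z\<in>elts Z. s 1 = hpair r z \<and> lb r z (s 0))"
      by (intro dfi \<alpha>M Z(1) dfn_comp3[where Q = lb, OF Dlb])
    show "hprd (fs \<alpha>) Z \<in> M" by (simp add: fs_closed \<alpha>M Z)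
    show "\<exists>w\<in>elts (hprd (fs \<alpha>) Z). \<exists>r\<in>elts (fs \<alpha>). \<exists>z\<in>elts Z. w = hpair r z \<and> lb r z \<beta>"
      if \<beta>: "\<beta> \<in> elts (B \<alpha>)" for \<beta>
    proof -
      obtain r z where rz: "r \<in> elts (fs \<alpha>)" "z \<in> elts Z" "lb r z \<beta>" using \<beta> by (auto simp: B_def)
      then have "hpair r z \<in> elts (hprd (fs \<alpha>) Z)" by simp
      moreover have "\<exists>r'\<in>elts (fs \<alpha>). \<exists>z'\<in>elts Z. hpair r z = hpair r' z' \<and> lb r' z' \<beta>" using rz by blast
      ultimately show ?thesis by (rule rev_bexI)
    qed
    show "x = y" if x: "x \<in> elts (B \<alpha>)" and y: "y \<in> elts (B \<alpha>)"
      and wx: "\<exists>r\<in>elts (fs \<alpha>). \<exists>z\<in>elts Z. w = hpair r z \<and> lb r z x"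
      and wy: "\<exists>r\<in>elts (fs \<alpha>). \<exists>z\<in>elts Z. w = hpair r z \<and> lb r z y" for x y w
    proof -
      obtain r z where "lb r z x" "lb r z y" using wx wy by auto
      then show ?thesis using lb_unique x y by (simp add: B_def)
    qed
  qed
  have hw1: "h \<alpha> \<in> elts w1" if \<alpha>: "\<alpha> \<in> elts w1" for \<alpha>
    unfolding h_def
  proof (rule w1_regular)
    have \<alpha>M: "\<alpha> \<in> M" using \<alpha> w1D by blast
    have fM: "hset {hsucc \<alpha>, hsucc \<beta>0} \<in> M" using \<alpha>M \<beta>0M by (intro pair_closed) simp_all
    then show "hun (B \<alpha>) (hset {hsucc \<alpha>, hsucc \<beta>0}) \<in> M" using BM[OF \<alpha>M] by simp
    show "elts (hun (B \<alpha>) (hset {hsucc \<alpha>, hsucc \<beta>0})) \<subseteq> elts w1"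
      using w1_hsucc \<alpha> \<beta>0 by (auto simp: B_def)
    show "countable_in M (elts (hun (B \<alpha>) (hset {hsucc \<alpha>, hsucc \<beta>0})))"
      by (intro countable_in_hun BM[OF \<alpha>M] Bcnt[OF \<alpha>] fM finite_countable_in) simp
  qed
  \<comment> \<open>F n is the union of all h (F i) with i < n, so the chain and its limit
    \<open>F homega\<close> come from a single recursion.\<close>
  define F where "F x = hrec (\<lambda>Y. hUn (hset (h ` elts Y))) x" for x
  have F: "F x = hUn (hset (h ` F ` elts x))" for x
    unfolding F_def by (subst hrec.simps) (simp add: image_image)
  have dF: "dff M (\<lambda>s. F (f s))" if "dff M f" for f
  proof (rule dff_comp1[where h = F, OF _ that])
    have "dff M (\<lambda>s. (\<lambda>a. F) (s 0) (s 1))"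
    proof (rule recursion[where H = "\<lambda>a Y. hUn (hset (h ` elts Y))"])
      show "dff M (\<lambda>s. hUn (hset (h ` elts (s 1))))" by (intro dfi dh)
      show "F x = hUn (hset (h ` elts (hset (F ` elts x))))" for x by (subst F) simp
    qed
    from dff_shift[OF this, of "\<lambda>i. 0"] show "dff M (\<lambda>s. F (s 0))" by simp
  qed
  define G where "G n = F (hnat n)" for n
  have eG: "elts (G n) = (\<Union>i<n. elts (h (G i)))" for n
    unfolding G_def by (subst F) (simp add: elts_hnat image_image del: hnat.simps)
  have Gw1: "G n \<in> elts w1" for n
  proof (induction n rule: less_induct)
    case (less n)
    have "finite (h ` F ` elts (hnat n))" by (simp add: elts_hnat del: hnat.simps)
    have sub: "h ` F ` elts (hnat n) \<subseteq> elts w1"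
      using less hw1 by (auto simp: elts_hnat G_def simp del: hnat.simps)
    have "h ` F ` elts (hnat n) \<subseteq> M" using sub w1D by blast
    then have M: "hset (h ` F ` elts (hnat n)) \<in> M"
      by (rule finite_closed[rotated]) (simp add: elts_hnat del: hnat.simps)
    have "countable_in M (elts (hset (h ` F ` elts (hnat n))))"
      by (rule finite_countable_in[OF M]) (simp add: elts_hnat del: hnat.simps)
    then show "G n \<in> elts w1" unfolding G_def using w1_regular[OF M] sub by (subst F) simp
  qed
  define \<delta> where "\<delta> = F homega"
  have e\<delta>: "elts \<delta> = (\<Union>n. elts (h (G n)))"
    unfolding \<delta>_def by (subst F) (simp add: G_def)
  have \<delta>w1: "\<delta> \<in> elts w1"
  proof -
    have M: "hset (h ` F ` elts homega) \<in> M"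
    proof -
      have "hset ((\<lambda>x. h (F x)) ` elts homega) \<in> M"
        by (rule dff_const_closed) (intro dfi dh dF homega_closed)
      then show ?thesis by (simp add: image_image)
    qed
    have "countable_in M (elts (hset (h ` F ` elts homega)))"
    proof (rule countable_in_rel[OF M countable_in_homega, of "\<lambda>y n. y = h (F n)"])
      show "dfn M (\<lambda>s. s 0 = h (F (s 1)))" by (intro dfi dh dF)
    qed auto
    moreover have "elts (hset (h ` F ` elts homega)) \<subseteq> elts w1"
      using hw1 Gw1 by (auto simp: G_def)
    ultimately show ?thesis unfolding \<delta>_def using w1_regular[OF M] by (subst F) simp
  qed
  have mono: "elts (G m) \<subseteq> elts (G n)" if "m \<le> n" for m n unfolding eG using that by (intro UN_mono) auto
  have hG: "elts (h (G n)) \<subseteq> elts (G (Suc n))" for n unfolding eG[of "Suc n"] by auto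
  have Gd: "elts (G n) \<subseteq> elts \<delta>" for n unfolding e\<delta> eG by auto
  have Gin: "G n \<in> elts (G (Suc n))" for n
  proof -
    have "G n \<in> elts (h (G n))" by (simp add: h_def)
    then show ?thesis using hG by blast
  qed
  have \<delta>G: "\<exists>n. \<alpha> \<in> elts (G n)" if "\<alpha> \<in> elts \<delta>" for \<alpha> using that hG unfolding e\<delta> by blast
  show ?thesis
  proof (intro bexI[OF _ \<delta>w1] conjI ballI impI)
    have "\<beta>0 \<in> elts (h (G 0))" by (simp add: h_def)
    then show "\<beta>0 \<in> elts \<delta>" unfolding e\<delta> by blast
  next
    fix \<alpha> assume "\<alpha> \<in> elts \<delta>"
    then obtain n where n: "\<alpha> \<in> elts (G n)" using \<delta>G by blast
    have o: "hordinal (G n)" "hordinal \<alpha>" using w1_hordinal[OF Gw1[of n]] hordinal_elem n by blast+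
    consider "hsucc \<alpha> \<in> elts (G n)" | "hsucc \<alpha> = G n" | "G n \<in> elts (hsucc \<alpha>)"
      using hordinal_linear[OF hordinal_hsucc[OF o(2)] o(1)] by blast
    then show "hsucc \<alpha> \<in> elts \<delta>"
    proof cases
      case 3
      then show ?thesis using n elts_asym[of \<alpha> "G n"] by auto
    qed (use Gd[of n] Gin[of n] Gd[of "Suc n"] in auto)
  next
    \<comment> \<open>Being finite, \<open>r\<close> is supported in some \<open>G n\<close>; the
      least bound of a witness for (r, z) was absorbed when passing from \<open>G n\<close> to
      \<open>h (G n)\<close>.\<close>
    fix r z assume r: "r \<in> elts (fs \<delta>)" and z: "z \<in> elts Z" and ex: "\<exists>p\<in>elts (fs w1). E r z p"
    have "finite (elts r)" "elts r \<subseteq> hprod (elts \<delta>) (elts homega)" using r by (auto simp: fs_def)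
    then have "\<exists>n. elts r \<subseteq> hprod (elts (G n)) (elts homega)"
    proof (induction "elts r" arbitrary: r rule: finite_induct)
      case empty then show ?case by (metis empty_subsetI)
    next
      case (insert x A)
      have Ae: "elts (hset A) = A" using insert(1) by (simp add: countable_finite)
      have "A \<subseteq> hprod (elts \<delta>) (elts homega)" using insert(4,5) by blast
      then obtain n where n: "A \<subseteq> hprod (elts (G n)) (elts homega)" using insert(3)[of "hset A"] Ae by auto
      have "x \<in> hprod (elts \<delta>) (elts homega)" using insert(4,5) by blast
      then obtain \<alpha> m where x: "x = hpair \<alpha> m" "\<alpha> \<in> elts \<delta>" "m \<in> elts homega" unfolding hprod_def by blast
      obtain n' where n': "\<alpha> \<in> elts (G n')" using \<delta>G x(2) by blast
      have "elts (G n) \<subseteq> elts (G (max n n'))" "elts (G n') \<subseteq> elts (G (max n n'))" using mono by simp_all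
      then have "insert x A \<subseteq> hprod (elts (G (max n n'))) (elts homega)"
        using n n' x unfolding hprod_def by blast
      then show ?case using insert(4) by metis
    qed
    then obtain n where n: "elts r \<subseteq> hprod (elts (G n)) (elts homega)" by blast
    then have rG: "r \<in> elts (fs (G n))" using r by (simp add: fs_def)
    obtain p where p: "p \<in> elts (fs w1)" "E r z p" using ex by blast
    have "finite (elts p)" "elts p \<subseteq> hprod (elts w1) (elts homega)" using p(1) by (auto simp: fs_def)
    then have "\<exists>\<beta>\<in>elts w1. elts p \<subseteq> hprod (elts \<beta>) (elts homega)"
    proof -
      define C where "C = hset {\<alpha>. \<exists>m. hpair \<alpha> m \<in> elts p}"
      have sub: "{\<alpha>. \<exists>m. hpair \<alpha> m \<in> elts p} \<subseteq> elts w1"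
        using \<open>elts p \<subseteq> hprod (elts w1) (elts homega)\<close> by auto
      have "{\<alpha>. \<exists>m. hpair \<alpha> m \<in> elts p} \<subseteq> (\<lambda>z. THE \<alpha>. \<exists>m. z = hpair \<alpha> m) ` elts p"
        by (auto intro!: rev_image_eqI)
      then have fin: "finite {\<alpha>. \<exists>m. hpair \<alpha> m \<in> elts p}"
        using \<open>finite (elts p)\<close> finite_subset by blast
      have eC: "elts C = {\<alpha>. \<exists>m. hpair \<alpha> m \<in> elts p}" unfolding C_def using fin by (simp add: countable_finite)
      have fS: "finite (hsucc ` elts C)" using fin eC by simp
      have sS: "hsucc ` elts C \<subseteq> elts w1" using sub eC w1_hsucc by blast
      have SM: "hset (hsucc ` elts C) \<in> M" by (rule finite_closed[OF fS]) (use sS w1D in blast)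
      have eS: "elts (hset (hsucc ` elts C)) = hsucc ` elts C" using fS by (simp add: countable_finite)
      have "hUn (hset (hsucc ` elts C)) \<in> elts w1"
        by (rule w1_regular[OF SM]) (use eS sS fS finite_countable_in[OF SM] in auto)
      moreover have "elts p \<subseteq> hprod (elts (hUn (hset (hsucc ` elts C)))) (elts homega)"
      proof
        fix x assume x: "x \<in> elts p"
        then obtain \<alpha> m where am: "x = hpair \<alpha> m" "m \<in> elts homega"
          using \<open>elts p \<subseteq> hprod (elts w1) (elts homega)\<close> unfolding hprod_def by blast
        then have "\<alpha> \<in> elts C" using x eC by auto
        then have "\<alpha> \<in> elts (hUn (hset (hsucc ` elts C)))" unfolding elts_hUn eS by auto
        then show "x \<in> hprod (elts (hUn (hset (hsucc ` elts C)))) (elts homega)" using am by (simp del: elts_hUn)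
      qed
      ultimately show ?thesis by blast
    qed
    then obtain \<beta> where \<beta>: "\<beta> \<in> elts w1" "\<exists>p\<in>elts (fs \<beta>). E r z p"
      using p \<open>finite (elts p)\<close> by (auto simp: fs_def)
    obtain \<gamma> where \<gamma>: "\<gamma> \<in> elts w1" "\<exists>p\<in>elts (fs \<gamma>). E r z p" "\<forall>y\<in>elts \<gamma>. \<not> (\<exists>p\<in>elts (fs y). E r z p)"
      using w1_least[of \<beta> "\<lambda>\<beta>. \<exists>p\<in>elts (fs \<beta>). E r z p"] \<beta> by blast
    then have "lb r z \<gamma>" unfolding lb_def by blast
    then have "\<gamma> \<in> elts (B (G n))" using \<gamma>(1) rG z by (auto simp: B_def)
    then have "elts \<gamma> \<subseteq> elts (h (G n))" by (auto simp: h_def)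
    then have "elts \<gamma> \<subseteq> elts \<delta>" unfolding e\<delta> by blast
    then show "\<exists>p\<in>elts (fs \<delta>). E r z p" using \<gamma>(2) fs_mono by blast
  qed
qed

end

section \<open>The forcing theorem\<close>

text \<open>The least fixed point is formed as the intersection of all sets of the model that are
  closed under the operator. It serves to define over \<open>M\<close> predicates that are inductive
  outside.\<close>

lemma (in tm) knaster_tarski:
  assumes B: "B \<in> M" and D: "dfn M (\<lambda>s. \<Phi> (s 0) (s 1))"
    and mono: "\<And>z e e'. e \<in> M ==> e' \<in> M ==> elts e \<subseteq> elts e' ==> \<Phi> z e ==> \<Phi> z e'"
  defines "L \<equiv> hset {z \<in> elts B. \<forall>e\<in>M. (\<forall>y\<in>elts B. \<Phi> y e --> y \<in> elts e) --> z \<in> elts e}"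
  shows "z \<in> elts B ==> z \<in> elts L <-> \<Phi> z L"
proof -
  have LM: "L \<in> M" unfolding L_def by (rule sep[OF B]) (intro dfi B dfn_comp2[where Q = \<Phi>, OF D])
  have eL: "elts L = {z \<in> elts B. \<forall>e\<in>M. (\<forall>y\<in>elts B. \<Phi> y e --> y \<in> elts e) --> z \<in> elts e}"
    unfolding L_def by (rule elts_hset) simp
  have pre: "y \<in> elts L" if y: "y \<in> elts B" "\<Phi> y L" for y
    unfolding eL
  proof (intro CollectI conjI ballI impI)
    fix e assume e: "e \<in> M" "\<forall>y\<in>elts B. \<Phi> y e --> y \<in> elts e"
    then have "elts L \<subseteq> elts e" unfolding eL by blast
    then show "y \<in> elts e" using mono[OF LM e(1) _ y(2)] e(2) y(1) by blast
  qed (rule y)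
  define L' where "L' = hset {y \<in> elts B. \<Phi> y L}"
  have L'M: "L' \<in> M" unfolding L'_def by (rule sep[OF B]) (intro dfi LM dfn_comp2[where Q = \<Phi>, OF D])
  have eL': "elts L' = {y \<in> elts B. \<Phi> y L}" unfolding L'_def by (rule elts_hset) simp
  have L'L: "elts L' \<subseteq> elts L" unfolding eL' using pre by blast
  have "y \<in> elts L'" if "y \<in> elts B" "\<Phi> y L'" for y
    unfolding eL' using mono[OF L'M LM L'L] that by blast
  then have "elts L \<subseteq> elts L'" unfolding eL using L'M by blast
  then show "z \<in> elts B ==> z \<in> elts L <-> \<Phi> z L" using pre unfolding eL' by blast
qed

text \<open>A name enters another one through a Kuratowski pair, three membership steps deep; hence
  the induction along the transitive closure of membership.\<close>

lemma name_induct: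
  assumes "\<And>t. (\<And>s p. hpair s p \<in> elts t ==> Q s) ==> Q t" shows "Q t"
proof (induction t rule: wf_induct[OF wf_trancl[OF wf_elts]])
  case (1 t)
  show ?case
  proof (rule assms)
    fix s p assume "hpair s p \<in> elts t"
    moreover have "s \<in> elts (hset {s})" "hset {s} \<in> elts (hpair s p)" by simp_all
    ultimately have "(s, t) \<in> {(x, y). x \<in> elts y}\<^sup>+"
      by (meson CollectI case_prodI trancl.intros)
    then show "Q s" using 1 by blast
  qed
qed

lemma htrans_name: "htrans T ==> t \<in> elts T ==> hpair s p \<in> elts t ==> s \<in> elts T"
proof -
  assume T: "htrans T" "t \<in> elts T" "hpair s p \<in> elts t"
  then have "hpair s p \<in> elts T" unfolding htrans_def by blast
  then have "hset {s} \<in> elts T" using T(1) unfolding htrans_def by auto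
  then show "s \<in> elts T" using T(1) unfolding htrans_def by fastforce
qed

lemma elts_val: "elts (val G t) = {val G s | s. \<exists>p\<in>G. hpair s p \<in> elts t}"
proof -
  have "{s. \<exists>p\<in>G. hpair s p \<in> elts t} \<subseteq> (\<lambda>z. THE s. \<exists>p. z = hpair s p) ` elts t"
    by (auto intro!: rev_image_eqI)
  then have "countable {s. \<exists>p\<in>G. hpair s p \<in> elts t}"
    by (rule countable_subset) simp
  then show ?thesis by (subst val.simps) auto
qed

locale forcing = zfc +
  fixes P le one
  assumes PM [simp]: "P \<in> M" and leM [simp]: "le \<in> M" and poset: "forcing_poset P le one"
begin

abbreviation below (infix "\<unlhd>" 50) where "p \<unlhd> q \<equiv> hpair p q \<in> elts le"

lemma oneP [simp]: "one \<in> elts P" and leD: "p \<unlhd> q ==> p \<in> elts P" "p \<unlhd> q ==> q \<in> elts P"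
  and refl: "p \<in> elts P ==> p \<unlhd> p" and le_one: "p \<in> elts P ==> p \<unlhd> one"
proof -
  have l: "elts le \<subseteq> hprod (elts P) (elts P)" using poset by (simp add: forcing_poset_def)
  show "p \<unlhd> q ==> p \<in> elts P" "p \<unlhd> q ==> q \<in> elts P" using l by auto
qed (use poset in \<open>simp_all add: forcing_poset_def\<close>)

lemma letrans: "p \<unlhd> q ==> q \<unlhd> r ==> p \<unlhd> r"
  using poset leD unfolding forcing_poset_def by blast

lemma oneM [simp]: "one \<in> M" using transD[OF oneP PM] .

lemma PD: "p \<in> elts P ==> p \<in> M" using transD[OF _ PM] .

text \<open>One step in forcing s = t: below p, each potential member of either name is densely
  identified with a member of the other. The relation \<open>R\<close> between members is left open
  so that the inductive predicate and its set version share the clause.\<close>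

definition eq_clause where
  "eq_clause R p s t <->
    (\<forall>u\<in>M. \<forall>r\<in>elts P. hpair u r \<in> elts s --> (\<forall>q\<in>elts P. q \<unlhd> p \<and> q \<unlhd> r -->
      (\<exists>q'\<in>elts P. q' \<unlhd> q \<and> (\<exists>v\<in>M. \<exists>r'\<in>elts P. hpair v r' \<in> elts t \<and> q' \<unlhd> r' \<and> R q' u v)))) \<and>
    (\<forall>v\<in>M. \<forall>r\<in>elts P. hpair v r \<in> elts t --> (\<forall>q\<in>elts P. q \<unlhd> p \<and> q \<unlhd> r -->
      (\<exists>q'\<in>elts P. q' \<unlhd> q \<and> (\<exists>u\<in>M. \<exists>r'\<in>elts P. hpair u r' \<in> elts s \<and> q' \<unlhd> r' \<and> R q' u v))))"

lemma eq_clause_mono [mono]: "R \<le> R' ==> eq_clause R p s t --> eq_clause R' p s t"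
  unfolding eq_clause_def le_fun_def le_bool_def by blast

inductive feq :: "hc => hc => hc => bool" where
  "p \<in> elts P ==> eq_clause feq p s t ==> feq p s t"

lemma feq_iff: "feq p s t <-> p \<in> elts P \<and> eq_clause feq p s t"
  by (subst feq.simps) blast

lemma feqP: "feq p s t ==> p \<in> elts P" using feq_iff by blast

lemma eq_clause_cong:
  assumes "\<And>q u v r r'. hpair u r \<in> elts s ==> hpair v r' \<in> elts t ==> q \<in> elts P ==> R q u v <-> R' q u v"
  shows "eq_clause R p s t <-> eq_clause R' p s t"
proof -
  have "eq_clause R p s t" if imp: "\<And>q u v r r'. hpair u r \<in> elts s ==> hpair v r' \<in> elts t ==> q \<in> elts P ==> R' q u v ==> R q u v"
    and c: "eq_clause R' p s t" for R R'
    unfolding eq_clause_def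
  proof (intro conjI ballI impI)
    fix u r q assume h: "u \<in> M" "r \<in> elts P" "hpair u r \<in> elts s" "q \<in> elts P" "q \<unlhd> p \<and> q \<unlhd> r"
    then obtain q' v r' where "q' \<in> elts P" "q' \<unlhd> q" "v \<in> M" "r' \<in> elts P" "hpair v r' \<in> elts t" "q' \<unlhd> r'" "R' q' u v"
      using c unfolding eq_clause_def by blast
    then show "\<exists>q'\<in>elts P. q' \<unlhd> q \<and> (\<exists>v\<in>M. \<exists>r'\<in>elts P. hpair v r' \<in> elts t \<and> q' \<unlhd> r' \<and> R q' u v)"
      using imp h(3) by blast
  next
    fix v r q assume h: "v \<in> M" "r \<in> elts P" "hpair v r \<in> elts t" "q \<in> elts P" "q \<unlhd> p \<and> q \<unlhd> r"
    then obtain q' u r' where "q' \<in> elts P" "q' \<unlhd> q" "u \<in> M" "r' \<in> elts P" "hpair u r' \<in> elts s" "q' \<unlhd> r'" "R' q' u v"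
      using c unfolding eq_clause_def by blast
    then show "\<exists>q'\<in>elts P. q' \<unlhd> q \<and> (\<exists>u\<in>M. \<exists>r'\<in>elts P. hpair u r' \<in> elts s \<and> q' \<unlhd> r' \<and> R q' u v)"
      using imp h(3) by blast
  qed
  then show ?thesis using assms by metis
qed

definition eq_op :: "hc => hc => bool" where
  "eq_op z e <-> (\<exists>p\<in>elts P. \<exists>s\<in>M. \<exists>t\<in>M. z = hpair p (hpair s t) \<and>
    eq_clause (\<lambda>q u v. hpair q (hpair u v) \<in> elts e) p s t)"

lemma dfn_eq_op: "dfn M (\<lambda>s. eq_op (s 0) (s 1))"
  unfolding eq_op_def eq_clause_def by (intro dfi PM leM)

text \<open>On a transitive set the clause refers only to smaller names of the same set, so its
  fixed point there is unique, and the one formed in \<open>M\<close> agrees with the inductive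
  predicate.\<close>

lemma feq_local_def:
  assumes T: "T \<in> M" "htrans T" "s \<in> elts T" "t \<in> elts T" "p \<in> elts P"
  shows "feq p s t <-> (\<forall>e\<in>M. (\<forall>y\<in>elts (hprd P (hprd T T)). eq_op y e --> y \<in> elts e) --> hpair p (hpair s t) \<in> elts e)"
proof -
  define B where "B = hprd P (hprd T T)"
  define L where "L = hset {z \<in> elts B. \<forall>e\<in>M. (\<forall>y\<in>elts B. eq_op y e --> y \<in> elts e) --> z \<in> elts e}"
  have BM: "B \<in> M" by (simp add: B_def T)
  have L: "z \<in> elts L <-> eq_op z L" if "z \<in> elts B" for z
    unfolding L_def
  proof (rule knaster_tarski[OF BM dfn_eq_op _ that])
    fix z e e' assume e: "elts e \<subseteq> elts e'" "eq_op z e"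
    have "(\<lambda>q u v. hpair q (hpair u v) \<in> elts e) \<le> (\<lambda>q u v. hpair q (hpair u v) \<in> elts e')"
      using e(1) by (auto simp: le_fun_def)
    from eq_clause_mono[OF this] show "eq_op z e'" using e(2) unfolding eq_op_def by blast
  qed
  have "hpair p (hpair s t) \<in> elts L <-> feq p s t" if "s \<in> elts T" "t \<in> elts T" "p \<in> elts P" for p s t
    using that
  proof (induction s arbitrary: p t rule: name_induct)
    case (1 s)
    have M: "s \<in> M" "t \<in> M" using 1 T(1) transD by blast+
    have zB: "hpair p (hpair s t) \<in> elts B" using 1 by (simp add: B_def)
    have "hpair p (hpair s t) \<in> elts L <-> eq_clause (\<lambda>q u v. hpair q (hpair u v) \<in> elts L) p s t"
      unfolding L[OF zB] eq_op_def using M 1(4) by auto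
    also have "\<dots> <-> eq_clause feq p s t"
      by (rule eq_clause_cong) (use 1 htrans_name[OF T(2)] in blast)
    finally show ?case using feq_iff 1(4) by blast
  qed
  then have "feq p s t <-> hpair p (hpair s t) \<in> elts L" using T by blast
  moreover have "hpair p (hpair s t) \<in> elts B" using T by (simp add: B_def)
  moreover have "elts L = {z \<in> elts B. \<forall>e\<in>M. (\<forall>y\<in>elts B. eq_op y e --> y \<in> elts e) --> z \<in> elts e}"
    unfolding L_def by (rule elts_hset) simp
  ultimately show ?thesis unfolding B_def by blast
qed

lemma dfn_feq [dfi]:
  assumes "dff M f" "dff M g" "dff M h" shows "dfn M (\<lambda>s. feq (f s) (g s) (h s))"
proof (rule dfn_comp3[where Q = feq])
  have "dfn M (\<lambda>s. s 0 \<in> elts P \<and> (\<exists>T\<in>M. htrans T \<and> s 1 \<in> elts T \<and> s 2 \<in> elts T \<and>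
    (\<forall>e\<in>M. (\<forall>y\<in>elts (hprd P (hprd T T)). eq_op y e --> y \<in> elts e) --> hpair (s 0) (hpair (s 1) (s 2)) \<in> elts e)))"
    by (intro dfi PM dfn_comp2[where Q = eq_op, OF dfn_eq_op])
  moreover have "feq (s 0) (s 1) (s 2) <-> s 0 \<in> elts P \<and> (\<exists>T\<in>M. htrans T \<and> s 1 \<in> elts T \<and> s 2 \<in> elts T \<and>
    (\<forall>e\<in>M. (\<forall>y\<in>elts (hprd P (hprd T T)). eq_op y e --> y \<in> elts e) --> hpair (s 0) (hpair (s 1) (s 2)) \<in> elts e))"
    (is "?A <-> ?B") if s: "range s \<subseteq> M" for s :: "nat => hc"
  proof
    assume A: ?A
    have "hset {s 1, s 2} \<in> M" using s by (intro pair_closed) auto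
    then obtain T where T: "T \<in> M" "htrans T" "hset {s 1, s 2} \<in> elts T" using trans_ex by blast
    then have T2: "s 1 \<in> elts T" "s 2 \<in> elts T" unfolding htrans_def by fastforce+
    have p: "s 0 \<in> elts P" using feqP A by blast
    show ?B using feq_local_def[OF T(1,2) T2 p] A T(1,2) T2 p by blast
  next
    assume ?B
    then show ?A using feq_local_def by blast
  qed
  ultimately show "dfn M (\<lambda>s. feq (s 0) (s 1) (s 2))" by (subst dfn_cong) auto
qed (rule assms)+

lemma feq_mono: "feq p s t ==> q \<unlhd> p ==> feq q s t"
  unfolding feq_iff[of p] feq_iff[of q] eq_clause_def using letrans leD by blast

text \<open>Membership reduces to equality with a listed member \<open>v\<close>, densely below p;
  \<open>q'\<close> below \<open>r\<close> guarantees that \<open>v\<close> is in fact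
  present.\<close>

definition fmem where
  "fmem p s t <-> p \<in> elts P \<and> (\<forall>q\<in>elts P. q \<unlhd> p --> (\<exists>q'\<in>elts P. q' \<unlhd> q \<and>
    (\<exists>v\<in>M. \<exists>r\<in>elts P. hpair v r \<in> elts t \<and> q' \<unlhd> r \<and> feq q' s v)))"

lemma fmem_mono: "fmem p s t ==> q \<unlhd> p ==> fmem q s t"
  unfolding fmem_def using letrans leD by blast

lemma dfn_fmem [dfi]:
  assumes "dff M f" "dff M g" "dff M h" shows "dfn M (\<lambda>s. fmem (f s) (g s) (h s))"
proof (rule dfn_comp3[where Q = fmem])
  show "dfn M (\<lambda>s. fmem (s 0) (s 1) (s 2))" unfolding fmem_def by (intro dfi PM leM)
qed (rule assms)+

definition name_op :: "hc => hc => bool" where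
  "name_op z e <-> (\<forall>w\<in>elts z. \<exists>s\<in>elts e. \<exists>p\<in>elts P. w = hpair s p)"

lemma dfn_name_op: "dfn M (\<lambda>s. name_op (s 0) (s 1))"
  unfolding name_op_def by (intro dfi PM)

lemma pname_iff: "pname P' t <-> (\<forall>z\<in>elts t. \<exists>s p. z = hpair s p \<and> p \<in> elts P' \<and> pname P' s)"
  by (subst pname.simps) blast

text \<open>As for \<open>feq\<close>, the clause descends to smaller names within the transitive
  set, so it has only one fixed point there.\<close>

lemma pname_local_def:
  assumes T: "T \<in> M" "htrans T" "t \<in> elts T"
  shows "pname P t <-> (\<forall>e\<in>M. (\<forall>y\<in>elts T. name_op y e --> y \<in> elts e) --> t \<in> elts e)"
proof -
  define L where "L = hset {z \<in> elts T. \<forall>e\<in>M. (\<forall>y\<in>elts T. name_op y e --> y \<in> elts e) --> z \<in> elts e}"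
  have L: "z \<in> elts L <-> name_op z L" if "z \<in> elts T" for z
    unfolding L_def
  proof (rule knaster_tarski[OF T(1) dfn_name_op _ that])
    fix z e e' assume "elts e \<subseteq> elts e'" "name_op z e"
    then show "name_op z e'" unfolding name_op_def by blast
  qed
  have eL: "elts L = {z \<in> elts T. \<forall>e\<in>M. (\<forall>y\<in>elts T. name_op y e --> y \<in> elts e) --> z \<in> elts e}"
    unfolding L_def by (rule elts_hset) simp
  have "t \<in> elts L <-> pname P t" if "t \<in> elts T" for t
    using that
  proof (induction t rule: name_induct)
    case (1 t)
    show ?case
    proof
      assume "t \<in> elts L"
      then have op: "name_op t L" using L 1(2) by blast
      show "pname P t" unfolding pname_iff[of P t]
      proof
        fix z assume z: "z \<in> elts t"
        then obtain s p where sp: "s \<in> elts L" "p \<in> elts P" "z = hpair s p" using op unfolding name_op_def by blast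
        then have "s \<in> elts T" unfolding eL by blast
        then have "pname P s" using 1(1)[of s p] z sp by blast
        then show "\<exists>s p. z = hpair s p \<and> p \<in> elts P \<and> pname P s" using sp by blast
      qed
    next
      assume n: "pname P t"
      have "name_op t L" unfolding name_op_def
      proof
        fix w assume w: "w \<in> elts t"
        then obtain s p where sp: "w = hpair s p" "p \<in> elts P" "pname P s" using n pname_iff[of P t] by blast
        then have "s \<in> elts T" using htrans_name[OF T(2) 1(2)] w by blast
        then have "s \<in> elts L" using 1(1)[of s p] w sp by blast
        then show "\<exists>s\<in>elts L. \<exists>p\<in>elts P. w = hpair s p" using sp by blast
      qed
      then show "t \<in> elts L" using L 1(2) by blast
    qed
  qed
  then show ?thesis using T(3) unfolding eL by blast
qed

lemma dfn_pname [dfi]: "dff M f ==> dfn M (\<lambda>s. pname P (f s))"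
proof (rule dfn_comp1[where Q = "pname P"])
  have "dfn M (\<lambda>s. \<exists>T\<in>M. htrans T \<and> s 0 \<in> elts T \<and>
      (\<forall>e\<in>M. (\<forall>y\<in>elts T. name_op y e --> y \<in> elts e) --> s 0 \<in> elts e))"
    by (intro dfi dfn_comp2[where Q = name_op, OF dfn_name_op])
  moreover have "pname P (s 0) <-> (\<exists>T\<in>M. htrans T \<and> s 0 \<in> elts T \<and>
      (\<forall>e\<in>M. (\<forall>y\<in>elts T. name_op y e --> y \<in> elts e) --> s 0 \<in> elts e))" if "range s \<subseteq> M" for s :: "nat => hc"
    using trans_ex[of "s 0"] pname_local_def[of _ "s 0"] env_closed[OF that, of 0] by blast
  ultimately show "dfn M (\<lambda>s. pname P (s 0))" by (subst dfn_cong) auto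
qed

section \<open>The forcing relation for formulas\<close>

primrec frc :: "fm => hc => (nat => hc) => bool" where
  "frc (Mem i j) p s <-> fmem p (s i) (s j)"
| "frc (Eq i j) p s <-> feq p (s i) (s j)"
| "frc (Neg \<phi>) p s <-> p \<in> elts P \<and> (\<forall>q\<in>elts P. q \<unlhd> p --> \<not> frc \<phi> q s)"
| "frc (Conj \<phi> \<psi>) p s <-> frc \<phi> p s \<and> frc \<psi> p s"
| "frc (Exi i \<phi>) p s <-> p \<in> elts P \<and> (\<forall>q\<in>elts P. q \<unlhd> p -->
    (\<exists>r\<in>elts P. r \<unlhd> q \<and> (\<exists>x\<in>M. pname P x \<and> frc \<phi> r (s(i := x)))))"

lemma frc_mono: "frc \<phi> p s ==> q \<unlhd> p ==> frc \<phi> q s"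
proof (induction \<phi> arbitrary: p q s)
  case (Mem i j) then show ?case unfolding frc.simps by (rule fmem_mono)
next
  case (Eq i j) then show ?case unfolding frc.simps by (rule feq_mono)
next
  case (Conj \<phi> \<psi>) then show ?case unfolding frc.simps by blast
next
  case (Neg \<phi>) then show ?case using letrans leD unfolding frc.simps by blast
next
  case (Exi i \<phi>) then show ?case using letrans leD unfolding frc.simps by blast
qed

text \<open>The recursion on formulas runs outside the model, so each formula receives a definition
  of its own.\<close>

lemma dfn_frc: "dfn M (\<lambda>e. frc \<phi> (e 0) (\<lambda>i. e (Suc i)))"
proof (induction \<phi>)
  case (Neg \<phi>)
  have "dfn M (\<lambda>e. frc \<phi> (e 0) (\<lambda>i. e (Suc (Suc i))))"
    using dfn_shift[OF Neg, of "case_nat 0 (\<lambda>i. Suc (Suc i))"] by simp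
  then show ?case by (simp only: frc.simps) (intro dfi PM leM)
next
  case (Exi i \<phi>)
  define r where "r = case_nat (1::nat) (\<lambda>j. if j = i then 0 else Suc (Suc (Suc (Suc j))))"
  have "dfn M (\<lambda>e. frc \<phi> (e (Suc 0)) ((\<lambda>j. e (Suc (Suc (Suc (Suc j)))))(i := e 0)))"
    using dfn_shift[OF Exi, of r] by (simp add: r_def fun_upd_def if_distrib[of e for e])
  then show ?case by (simp only: frc.simps) (intro dfi PM leM)
qed (simp_all only: frc.simps, (intro dfi; assumption)+)

end

section \<open>Truth in generic extensions\<close>

locale generic_ext_of = forcing +
  fixes G assumes gen: "generic M P le G"
begin

lemma GP: "p \<in> G ==> p \<in> elts P" and G_up: "p \<in> G ==> p \<unlhd> q ==> q \<in> G"
  and G_dir: "p \<in> G ==> q \<in> G ==> \<exists>r\<in>G. r \<unlhd> p \<and> r \<unlhd> q"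
proof -
  show "p \<in> G ==> p \<in> elts P" using gen unfolding generic_def by blast
  show "p \<in> G ==> p \<unlhd> q ==> q \<in> G" using gen leD(2)[of p q] unfolding generic_def by blast
  show "p \<in> G ==> q \<in> G ==> \<exists>r\<in>G. r \<unlhd> p \<and> r \<unlhd> q" using gen unfolding generic_def by blast
qed

lemma oneG [simp]: "one \<in> G"
proof -
  obtain p where "p \<in> G" using gen unfolding generic_def by blast
  then show ?thesis using G_up le_one GP by blast
qed

text \<open>Adding the conditions incompatible with p makes the target set dense everywhere; the
  filter cannot meet the added part, since all its elements are compatible with p.\<close>

lemma generic_dense_below:
  assumes D: "dfn M (\<lambda>s. D (s 0))" and p: "p \<in> G"
    and dense: "\<And>q. q \<in> elts P ==> q \<unlhd> p ==> \<exists>r\<in>elts P. r \<unlhd> q \<and> D r"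
  shows "\<exists>r\<in>G. r \<unlhd> p \<and> D r"
proof -
  define X where "X = hset {r \<in> elts P. (r \<unlhd> p \<and> D r) \<or> \<not> (\<exists>q\<in>elts P. q \<unlhd> r \<and> q \<unlhd> p)}"
  have eX: "elts X = {r \<in> elts P. (r \<unlhd> p \<and> D r) \<or> \<not> (\<exists>q\<in>elts P. q \<unlhd> r \<and> q \<unlhd> p)}" by (simp add: X_def)
  have pM: "p \<in> M" using PD GP p by blast
  have "X \<in> M" unfolding X_def
    by (rule sep[OF PM]) (intro dfi PM leM pM dfn_comp1[where Q = D, OF D])
  moreover have "elts X \<subseteq> elts P" using eX by blast
  moreover have "\<forall>q\<in>elts P. \<exists>d\<in>elts X. d \<unlhd> q"
  proof
    fix q assume q: "q \<in> elts P"
    show "\<exists>d\<in>elts X. d \<unlhd> q"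
    proof (cases "\<exists>q'\<in>elts P. q' \<unlhd> q \<and> q' \<unlhd> p")
      case True
      then obtain q' where q': "q' \<in> elts P" "q' \<unlhd> q" "q' \<unlhd> p" by blast
      then obtain r where r: "r \<in> elts P" "r \<unlhd> q'" "D r" using dense by blast
      then show ?thesis unfolding eX using letrans q' by blast
    next
      case False
      then show ?thesis unfolding eX using q refl by blast
    qed
  qed
  ultimately have "G \<inter> elts X \<noteq> {}" using gen unfolding generic_def by blast
  then obtain r where r: "r \<in> G" "r \<in> elts X" by blast
  obtain q where "q \<in> G" "q \<unlhd> r" "q \<unlhd> p" using G_dir[OF r(1) p] by blast
  then show ?thesis using r GP unfolding eX by blast
qed

lemma generic_dense:
  assumes D: "dfn M (\<lambda>s. D (s 0))" and dense: "\<And>q. q \<in> elts P ==> \<exists>r\<in>elts P. r \<unlhd> q \<and> D r"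
  shows "\<exists>r\<in>G. D r"
  using generic_dense_below[OF D oneG] dense by blast

lemma truth_eq: "s \<in> M ==> t \<in> M ==> val G s = val G t <-> (\<exists>p\<in>G. feq p s t)"
proof (induction s arbitrary: t rule: name_induct)
  case (1 s)
  note sM = 1(2) and tM = 1(3)
  have IH: "val G u = val G v <-> (\<exists>p\<in>G. feq p u v)" if "hpair u r \<in> elts s" "v \<in> M" for u r v
  proof -
    have "hpair u r \<in> M" using that(1) sM transD by blast
    then show ?thesis using 1(1)[OF that(1) _ that(2)] by simp
  qed
  have comp: "u \<in> M \<and> r \<in> M" if "hpair u r \<in> elts w" "w \<in> M" for u r w
    using transD[OF that] by simp
  show ?case
  proof
    assume "\<exists>p\<in>G. feq p s t"
    then obtain p where p: "p \<in> G" "feq p s t" by blast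
    then have cl: "eq_clause feq p s t" using feq_iff by blast
    show "val G s = val G t"
    proof (rule hc_eqI, intro equalityI subsetI)
      fix x assume "x \<in> elts (val G s)"
      then obtain u r where u: "x = val G u" "r \<in> G" "hpair u r \<in> elts s" unfolding elts_val by blast
      obtain p0 where p0: "p0 \<in> G" "p0 \<unlhd> p" "p0 \<unlhd> r" using G_dir p(1) u(2) by blast
      have uM: "u \<in> M" using comp[OF u(3) sM] by blast
      have "\<exists>q\<in>G. q \<unlhd> p0 \<and> (\<exists>v\<in>M. \<exists>r'\<in>elts P. hpair v r' \<in> elts t \<and> q \<unlhd> r' \<and> feq q u v)"
      proof (rule generic_dense_below[OF _ p0(1)])
        show "dfn M (\<lambda>s. \<exists>v\<in>M. \<exists>r'\<in>elts P. hpair v r' \<in> elts t \<and> s 0 \<unlhd> r' \<and> feq (s 0) u v)"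
          by (intro dfi PM leM tM uM)
        fix q assume "q \<in> elts P" "q \<unlhd> p0"
        then have "q \<unlhd> p \<and> q \<unlhd> r" using p0 letrans by blast
        then show "\<exists>q'\<in>elts P. q' \<unlhd> q \<and> (\<exists>v\<in>M. \<exists>r'\<in>elts P. hpair v r' \<in> elts t \<and> q' \<unlhd> r' \<and> feq q' u v)"
          using cl uM GP u(2,3) \<open>q \<in> elts P\<close> unfolding eq_clause_def by blast
      qed
      then obtain q v r' where q: "q \<in> G" "v \<in> M" "hpair v r' \<in> elts t" "q \<unlhd> r'" "feq q u v" by blast
      then have "val G u = val G v" "r' \<in> G" using IH[OF u(3)] G_up by blast+
      then show "x \<in> elts (val G t)" unfolding elts_val using q(3) u(1) by blast
    next
      fix x assume "x \<in> elts (val G t)"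
      then obtain v r where v: "x = val G v" "r \<in> G" "hpair v r \<in> elts t" unfolding elts_val by blast
      obtain p0 where p0: "p0 \<in> G" "p0 \<unlhd> p" "p0 \<unlhd> r" using G_dir p(1) v(2) by blast
      have vM: "v \<in> M" using comp[OF v(3) tM] by blast
      have "\<exists>q\<in>G. q \<unlhd> p0 \<and> (\<exists>u\<in>M. \<exists>r'\<in>elts P. hpair u r' \<in> elts s \<and> q \<unlhd> r' \<and> feq q u v)"
      proof (rule generic_dense_below[OF _ p0(1)])
        show "dfn M (\<lambda>e. \<exists>u\<in>M. \<exists>r'\<in>elts P. hpair u r' \<in> elts s \<and> e 0 \<unlhd> r' \<and> feq (e 0) u v)"
          by (intro dfi PM leM sM vM)
        fix q assume "q \<in> elts P" "q \<unlhd> p0"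
        then have "q \<unlhd> p \<and> q \<unlhd> r" using p0 letrans by blast
        then show "\<exists>q'\<in>elts P. q' \<unlhd> q \<and> (\<exists>u\<in>M. \<exists>r'\<in>elts P. hpair u r' \<in> elts s \<and> q' \<unlhd> r' \<and> feq q' u v)"
          using cl vM GP v(2,3) \<open>q \<in> elts P\<close> unfolding eq_clause_def by blast
      qed
      then obtain q u r' where q: "q \<in> G" "u \<in> M" "hpair u r' \<in> elts s" "q \<unlhd> r'" "feq q u v" by blast
      then have "val G u = val G v" "r' \<in> G" using IH[OF q(3) vM] G_up by blast+
      then have "x = val G u" using v(1) by simp
      then show "x \<in> elts (val G s)" unfolding elts_val using q(3) \<open>r' \<in> G\<close> by blast
    qed
  next
    assume eq: "val G s = val G t"
    \<comment> \<open>\<open>A\<close> and \<open>B\<close> say that p witnesses the failure of one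
      half of the clause: some member of one name is identified with no member of the other below p.
      If no extension of p does this, then p forces equality.\<close>
    define A where "A p <-> (\<exists>u\<in>M. \<exists>r\<in>elts P. hpair u r \<in> elts s \<and> p \<unlhd> r \<and>
      (\<forall>q\<in>elts P. q \<unlhd> p --> \<not> (\<exists>v\<in>M. \<exists>r'\<in>elts P. hpair v r' \<in> elts t \<and> q \<unlhd> r' \<and> feq q u v)))" for p
    define B where "B p <-> (\<exists>v\<in>M. \<exists>r\<in>elts P. hpair v r \<in> elts t \<and> p \<unlhd> r \<and>
      (\<forall>q\<in>elts P. q \<unlhd> p --> \<not> (\<exists>u\<in>M. \<exists>r'\<in>elts P. hpair u r' \<in> elts s \<and> q \<unlhd> r' \<and> feq q u v)))" for p
    have "\<exists>p\<in>G. feq p s t \<or> A p \<or> B p"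
    proof (rule generic_dense)
      show "dfn M (\<lambda>e. feq (e 0) s t \<or> A (e 0) \<or> B (e 0))"
        unfolding A_def B_def by (intro dfi PM leM sM tM)
      fix p assume p: "p \<in> elts P"
      show "\<exists>r\<in>elts P. r \<unlhd> p \<and> (feq r s t \<or> A r \<or> B r)"
      proof (rule ccontr)
        assume no: "\<not> (\<exists>r\<in>elts P. r \<unlhd> p \<and> (feq r s t \<or> A r \<or> B r))"
        have "eq_clause feq p s t" unfolding eq_clause_def
        proof (intro conjI ballI impI)
          fix u r q assume h: "u \<in> M" "r \<in> elts P" "hpair u r \<in> elts s" "q \<in> elts P" "q \<unlhd> p \<and> q \<unlhd> r"
          have "\<not> A q" using no h by blast
          then show "\<exists>q'\<in>elts P. q' \<unlhd> q \<and> (\<exists>v\<in>M. \<exists>r'\<in>elts P. hpair v r' \<in> elts t \<and> q' \<unlhd> r' \<and> feq q' u v)"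
            unfolding A_def using h by blast
        next
          fix v r q assume h: "v \<in> M" "r \<in> elts P" "hpair v r \<in> elts t" "q \<in> elts P" "q \<unlhd> p \<and> q \<unlhd> r"
          have "\<not> B q" using no h by blast
          then show "\<exists>q'\<in>elts P. q' \<unlhd> q \<and> (\<exists>u\<in>M. \<exists>r'\<in>elts P. hpair u r' \<in> elts s \<and> q' \<unlhd> r' \<and> feq q' u v)"
            unfolding B_def using h by blast
        qed
        then have "feq p s t" using feq_iff p by blast
        then show False using no p refl by blast
      qed
    qed
    then obtain p where p: "p \<in> G" "feq p s t \<or> A p \<or> B p" by blast
    have "\<not> A p"
    proof
      assume "A p"
      then obtain u r where u: "u \<in> M" "hpair u r \<in> elts s" "p \<unlhd> r"
        "\<forall>q\<in>elts P. q \<unlhd> p --> \<not> (\<exists>v\<in>M. \<exists>r'\<in>elts P. hpair v r' \<in> elts t \<and> q \<unlhd> r' \<and> feq q u v)"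
        unfolding A_def by blast
      have "val G u \<in> elts (val G s)" unfolding elts_val using u G_up[OF p(1)] by blast
      then have "val G u \<in> elts (val G t)" using eq by simp
      then obtain v r' where v: "val G u = val G v" "r' \<in> G" "hpair v r' \<in> elts t" unfolding elts_val by blast
      have vM: "v \<in> M" using comp[OF v(3) tM] by blast
      obtain p1 where p1: "p1 \<in> G" "feq p1 u v" using IH[OF u(2) vM] v(1) by blast
      obtain p2 where p2: "p2 \<in> G" "p2 \<unlhd> p1" "p2 \<unlhd> r'" using G_dir p1(1) v(2) by blast
      obtain p3 where p3: "p3 \<in> G" "p3 \<unlhd> p2" "p3 \<unlhd> p" using G_dir p2(1) p(1) by blast
      have "feq p3 u v" using feq_mono p1(2) p2(2) p3(2) by blast
      then show False using u(4) p3 GP vM v(2,3) p2(3) letrans by blast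
    qed
    moreover have "\<not> B p"
    proof
      assume "B p"
      then obtain v r where v: "v \<in> M" "hpair v r \<in> elts t" "p \<unlhd> r"
        "\<forall>q\<in>elts P. q \<unlhd> p --> \<not> (\<exists>u\<in>M. \<exists>r'\<in>elts P. hpair u r' \<in> elts s \<and> q \<unlhd> r' \<and> feq q u v)"
        unfolding B_def by blast
      have "val G v \<in> elts (val G t)" unfolding elts_val using v G_up[OF p(1)] by blast
      then have "val G v \<in> elts (val G s)" using eq by simp
      then obtain u r' where u: "val G v = val G u" "r' \<in> G" "hpair u r' \<in> elts s" unfolding elts_val by blast
      have uM: "u \<in> M" using comp[OF u(3) sM] by blast
      obtain p1 where p1: "p1 \<in> G" "feq p1 u v" using IH[OF u(3) v(1)] u(1) by auto
      obtain p2 where p2: "p2 \<in> G" "p2 \<unlhd> p1" "p2 \<unlhd> r'" using G_dir p1(1) u(2) by blast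
      obtain p3 where p3: "p3 \<in> G" "p3 \<unlhd> p2" "p3 \<unlhd> p" using G_dir p2(1) p(1) by blast
      have "feq p3 u v" using feq_mono p1(2) p2(2) p3(2) by blast
      then show False using v(4) p3 GP uM u(2,3) p2(3) letrans by blast
    qed
    ultimately show "\<exists>p\<in>G. feq p s t" using p by blast
  qed
qed

lemma truth_mem:
  assumes "s \<in> M" "t \<in> M" shows "val G s \<in> elts (val G t) <-> (\<exists>p\<in>G. fmem p s t)"
proof
  assume "val G s \<in> elts (val G t)"
  then obtain v r where v: "val G s = val G v" "r \<in> G" "hpair v r \<in> elts t" unfolding elts_val by blast
  have vM: "v \<in> M" using transD[OF v(3) assms(2)] by simp
  obtain p where p: "p \<in> G" "feq p s v" using truth_eq[OF assms(1) vM] v(1) by blast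
  obtain q where q: "q \<in> G" "q \<unlhd> p" "q \<unlhd> r" using G_dir p(1) v(2) by blast
  have "fmem q s t" unfolding fmem_def
  proof (intro conjI ballI impI)
    fix q' assume q': "q' \<in> elts P" "q' \<unlhd> q"
    then have "q' \<unlhd> r" "feq q' s v" using q letrans feq_mono p(2) by blast+
    then show "\<exists>q''\<in>elts P. q'' \<unlhd> q' \<and> (\<exists>v\<in>M. \<exists>r\<in>elts P. hpair v r \<in> elts t \<and> q'' \<unlhd> r \<and> feq q'' s v)"
      using q' refl vM v GP by blast
  qed (use q GP in blast)
  then show "\<exists>p\<in>G. fmem p s t" using q by blast
next
  assume "\<exists>p\<in>G. fmem p s t"
  then obtain p where p: "p \<in> G" "fmem p s t" by blast
  have "\<exists>q\<in>G. q \<unlhd> p \<and> (\<exists>v\<in>M. \<exists>r\<in>elts P. hpair v r \<in> elts t \<and> q \<unlhd> r \<and> feq q s v)"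
    by (rule generic_dense_below[OF _ p(1)], intro dfi PM leM assms) (use p(2) in \<open>unfold fmem_def, blast\<close>)
  then obtain q v r where q: "q \<in> G" "v \<in> M" "hpair v r \<in> elts t" "q \<unlhd> r" "feq q s v" by blast
  then have "val G s = val G v" "r \<in> G" using truth_eq[OF assms(1)] G_up by blast+
  then show "val G s \<in> elts (val G t)" unfolding elts_val using q(3) by blast
qed

abbreviation N where "N \<equiv> generic_ext M P G"

lemma dfn_frc_const:
  assumes "range s \<subseteq> M" shows "dfn M (\<lambda>e. frc \<phi> (e 0) s)"
proof -
  have "dfn M (\<lambda>e. (\<lambda>t. frc \<phi> (t 0) (\<lambda>i. t (Suc i))) (\<lambda>i. (if i = 0 then (\<lambda>e. e 0) else (\<lambda>e. s (i - 1))) e))"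
    by (rule dfn_subst[OF dfn_frc]) (use assms in auto)
  then show ?thesis by simp
qed

text \<open>Induction on the formula. For a negation, the conditions deciding the formula are dense;
  for an existential statement, genericity below a forcing condition yields a name for a
  witness.\<close>

lemma truth:
  "(\<And>i. s i \<in> M \<and> pname P (s i)) ==> sat N (\<lambda>i. val G (s i)) \<phi> <-> (\<exists>p\<in>G. frc \<phi> p s)"
proof (induction \<phi> arbitrary: s)
  case (Mem i j) then show ?case using truth_mem by simp
next
  case (Eq i j) then show ?case using truth_eq by simp
next
  case (Neg \<phi>)
  have sM: "range s \<subseteq> M" using Neg.prems by auto
  have "\<exists>p\<in>G. frc \<phi> p s \<or> frc (Neg \<phi>) p s"
  proof (rule generic_dense)
    show "dfn M (\<lambda>e. frc \<phi> (e 0) s \<or> frc (Neg \<phi>) (e 0) s)" by (intro dfi dfn_frc_const sM)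
    fix q assume "q \<in> elts P"
    then show "\<exists>r\<in>elts P. r \<unlhd> q \<and> (frc \<phi> r s \<or> frc (Neg \<phi>) r s)" using refl by auto
  qed
  moreover have "\<not> ((\<exists>p\<in>G. frc \<phi> p s) \<and> (\<exists>p\<in>G. frc (Neg \<phi>) p s))"
  proof
    assume "(\<exists>p\<in>G. frc \<phi> p s) \<and> (\<exists>p\<in>G. frc (Neg \<phi>) p s)"
    then obtain p q where pq: "p \<in> G" "frc \<phi> p s" "q \<in> G" "frc (Neg \<phi>) q s" by blast
    obtain r where r: "r \<in> G" "r \<unlhd> p" "r \<unlhd> q" using G_dir pq(1,3) by blast
    then have "frc \<phi> r s" using frc_mono pq by blast
    then show False using pq(4) r GP by auto
  qed
  ultimately have "(\<exists>p\<in>G. frc (Neg \<phi>) p s) <-> \<not> (\<exists>p\<in>G. frc \<phi> p s)" by blast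
  then show ?case using Neg.IH[OF Neg.prems] by simp
next
  case (Conj \<phi> \<psi>)
  have "(\<exists>p\<in>G. frc \<phi> p s \<and> frc \<psi> p s)" if pq: "p \<in> G" "frc \<phi> p s" "q \<in> G" "frc \<psi> q s" for p q
    using G_dir[OF pq(1,3)] frc_mono pq by blast
  then show ?case using Conj.IH(1)[OF Conj.prems] Conj.IH(2)[OF Conj.prems] by auto
next
  case (Exi i \<phi>)
  have sM: "range s \<subseteq> M" using Exi.prems by auto
  have upd: "(\<lambda>j. val G (s j))(i := val G x) = (\<lambda>j. val G ((s(i := x)) j))" for x by auto
  have IH: "sat N ((\<lambda>j. val G (s j))(i := val G x)) \<phi> <-> (\<exists>p\<in>G. frc \<phi> p (s(i := x)))"
    if "x \<in> M" "pname P x" for x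
    unfolding upd by (rule Exi.IH) (use that Exi.prems in auto)
  show ?case
  proof
    assume "sat N (\<lambda>j. val G (s j)) (Exi i \<phi>)"
    then obtain x where x: "x \<in> M" "pname P x" "sat N ((\<lambda>j. val G (s j))(i := val G x)) \<phi>"
      by (auto simp: generic_ext_def)
    then obtain p where p: "p \<in> G" "frc \<phi> p (s(i := x))" using IH by blast
    have "frc (Exi i \<phi>) p s"
      unfolding frc.simps
    proof (intro conjI ballI impI)
      fix q assume q: "q \<in> elts P" "q \<unlhd> p"
      then have "frc \<phi> q (s(i := x))" using frc_mono p(2) by blast
      then show "\<exists>r\<in>elts P. r \<unlhd> q \<and> (\<exists>x\<in>M. pname P x \<and> frc \<phi> r (s(i := x)))"
        using q refl x by blast
    qed (use GP p in blast)
    then show "\<exists>p\<in>G. frc (Exi i \<phi>) p s" using p by blast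
  next
    assume "\<exists>p\<in>G. frc (Exi i \<phi>) p s"
    then obtain p where p: "p \<in> G" "frc (Exi i \<phi>) p s" by blast
    have D: "dfn M (\<lambda>e. \<exists>x\<in>M. pname P x \<and> frc \<phi> (e 0) (s(i := x)))"
    proof (intro dfi)
      have "dfn M (\<lambda>e. (\<lambda>t. frc \<phi> (t 0) (\<lambda>j. t (Suc j)))
          (\<lambda>j. (case j of 0 => (\<lambda>e. e (Suc 0)) | Suc k => if k = i then (\<lambda>e. e 0) else (\<lambda>e. s k)) e))"
        by (rule dfn_subst[OF dfn_frc]) (use sM in \<open>auto split: nat.splits\<close>)
      moreover have "(\<lambda>k. (if k = i then (\<lambda>e. e 0) else (\<lambda>e. s k)) e) = s(i := e 0)" for e :: "nat => hc"
        by (auto simp: fun_eq_iff)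
      ultimately show "dfn M (\<lambda>e. frc \<phi> (e (Suc 0)) (s(i := e 0)))"
        by simp
    qed
    have "\<exists>r\<in>G. r \<unlhd> p \<and> (\<exists>x\<in>M. pname P x \<and> frc \<phi> r (s(i := x)))"
      by (rule generic_dense_below[OF D p(1)]) (use p(2) in \<open>unfold frc.simps, blast\<close>)
    then obtain r x where "r \<in> G" "x \<in> M" "pname P x" "frc \<phi> r (s(i := x))" by blast
    then have "sat N ((\<lambda>j. val G (s j))(i := val G x)) \<phi>" "val G x \<in> N"
      using IH by (auto simp: generic_ext_def)
    then show "sat N (\<lambda>j. val G (s j)) (Exi i \<phi>)" by auto
  qed
qed

end

section \<open>The generic extension as a model\<close>

lemma in_hUn2: "hpair u p \<in> elts t ==> u \<in> elts (hUn (hUn t))"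
proof -
  assume t: "hpair u p \<in> elts t"
  have "hset {u} \<in> elts (hpair u p)" "u \<in> elts (hset {u})" by simp_all
  then show ?thesis using t unfolding elts_hUn by blast
qed

lemma elts_hcheck: "elts (hcheck o1 x) = (\<lambda>y. hpair (hcheck o1 y) o1) ` elts x"
  by (subst hcheck.simps) simp

lemma pname_hcheck: "o1 \<in> elts P ==> pname P (hcheck o1 x)"
proof (induction x rule: elts_induct)
  case (1 x)
  show ?case by (rule pname.intros) (use 1 in \<open>auto simp: elts_hcheck\<close>)
qed

lemma val_hcheck:
  assumes "o1 \<in> G" shows "val G (hcheck o1 x) = x"
proof (induction x rule: elts_induct)
  case (1 x)
  have "elts (val G (hcheck o1 x)) = (\<lambda>y. val G (hcheck o1 y)) ` elts x"
    unfolding elts_val elts_hcheck using assms by auto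
  also have "\<dots> = elts x" using 1 by simp
  finally show ?case by (rule hc_eqI)
qed

lemma (in tm) dff_if [dfi]:
  assumes P: "dfn M P" and f: "dff M f" and g: "dff M g" shows "dff M (\<lambda>s. if P s then f s else g s)"
proof (rule dff_ext)
  show "(if P s then f s else g s) \<in> M" if "range s \<subseteq> M" for s
    using dff_closed[OF f that] dff_closed[OF g that] by simp
  have "dfn M (\<lambda>s. (P (\<lambda>i. s (Suc i)) \<and> s 0 \<in> elts (f (\<lambda>i. s (Suc i)))) \<or>
      (\<not> P (\<lambda>i. s (Suc i)) \<and> s 0 \<in> elts (g (\<lambda>i. s (Suc i)))))"
    by (intro dfn_disj dfn_conj dfn_not mem var dff_shift[OF f] dff_shift[OF g] dfn_shift[OF P])
  moreover have "(P (\<lambda>i. s (Suc i)) \<and> s 0 \<in> elts (f (\<lambda>i. s (Suc i)))) \<or>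
      (\<not> P (\<lambda>i. s (Suc i)) \<and> s 0 \<in> elts (g (\<lambda>i. s (Suc i)))) <->
      s 0 \<in> elts (if P (\<lambda>i. s (Suc i)) then f (\<lambda>i. s (Suc i)) else g (\<lambda>i. s (Suc i)))" for s
    by simp
  ultimately show "dfn M (\<lambda>s. s 0 \<in> elts (if P (\<lambda>i. s (Suc i)) then f (\<lambda>i. s (Suc i)) else g (\<lambda>i. s (Suc i))))"
    by simp
qed

context generic_ext_of
begin

lemma N_I: "t \<in> M ==> pname P t ==> val G t \<in> N"
  unfolding generic_ext_def by blast

lemma N_E: "x \<in> N ==> \<exists>t\<in>M. pname P t \<and> x = val G t"
  unfolding generic_ext_def by blast

lemma name_dom: "t \<in> M ==> pname P t ==> hpair u p \<in> elts t ==> u \<in> M \<and> pname P u \<and> p \<in> elts P"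
  using transD[of "hpair u p" t] pname_iff[of P t] by (metis hpair_closed hpair_inject)

text \<open>The name consists of the pairs (u, p) with \<open>C u p\<close>. Separation, pairing,
  union and power set in the extension all obtain their names from here.\<close>

lemma make_name:
  assumes D: "D \<in> M" "\<And>u. u \<in> elts D ==> pname P u" and C: "dfn M (\<lambda>s. C (s 0) (s 1))"
  shows "\<exists>w\<in>M. pname P w \<and> elts (val G w) = {val G u | u. u \<in> elts D \<and> (\<exists>p\<in>G. C u p)}"
proof -
  define w where "w = hset {z \<in> elts (hprd D P). \<exists>u\<in>elts D. \<exists>p\<in>elts P. z = hpair u p \<and> C u p}"
  have wM: "w \<in> M" unfolding w_def
    by (rule sep, simp add: D) (intro dfi D PM dfn_comp2[where Q = C, OF C])
  have ew: "elts w = {z \<in> elts (hprd D P). \<exists>u\<in>elts D. \<exists>p\<in>elts P. z = hpair u p \<and> C u p}"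
    unfolding w_def by (rule elts_hset) simp
  have w: "hpair u p \<in> elts w <-> u \<in> elts D \<and> p \<in> elts P \<and> C u p" for u p
    unfolding ew by auto
  have "pname P w"
  proof (rule pname.intros, rule ballI)
    fix z assume "z \<in> elts w"
    then obtain u p where "u \<in> elts D" "p \<in> elts P" "z = hpair u p" unfolding ew by blast
    then show "\<exists>s p. z = hpair s p \<and> p \<in> elts P \<and> pname P s" using D(2) by blast
  qed
  moreover have "elts (val G w) = {val G u | u. u \<in> elts D \<and> (\<exists>p\<in>G. C u p)}"
    unfolding elts_val w using GP by blast
  ultimately show ?thesis using wM by blast
qed

text \<open>The names that occur in \<open>t\<close>; since pairs are Kuratowski pairs, these are
  found two unions down.\<close>

definition dm :: "hc => hc" where "dm t = hset {u \<in> elts (hUn (hUn t)). pname P u}"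

lemma elts_dm: "elts (dm t) = {u \<in> elts (hUn (hUn t)). pname P u}"
  by (rule elts_sep[OF dm_def])

lemma dm_closed: "t \<in> M ==> dm t \<in> M"
  unfolding dm_def by (rule sep) (simp, intro dfi)

lemma in_dm: "t \<in> M ==> pname P t ==> hpair u p \<in> elts t ==> u \<in> elts (dm t)"
  unfolding elts_dm using name_dom in_hUn2 by blast

text \<open>The subset is named by the pairs (u, p) such that p forces u to belong to the given set
  and to satisfy the formula; correctness is the truth theorem.\<close>

lemma N_sep:
  assumes a: "a \<in> N" and Q: "dfn N (\<lambda>s. Q (s 0))" shows "hset {x \<in> elts a. Q x} \<in> N"
proof -
  obtain t where t: "t \<in> M" "pname P t" "a = val G t" using N_E[OF a] by blast
  obtain \<phi> b where b: "range b \<subseteq> N" "\<And>s. range s \<subseteq> N ==> Q (s 0) <-> sat N (interleave s b) \<phi>"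
    using Q unfolding dfn_def by metis
  have "\<forall>i. \<exists>c. c \<in> M \<and> pname P c \<and> b i = val G c" using b(1) N_E by blast
  then obtain c where c: "\<And>i. c i \<in> M" "\<And>i. pname P (c i)" "\<And>i. b i = val G (c i)" by metis
  define \<sigma> where "\<sigma> u = interleave (\<lambda>_. u) c" for u :: hc
  have s: "Q (val G u) <-> (\<exists>p\<in>G. frc \<phi> p (\<sigma> u))" if u: "u \<in> M" "pname P u" for u
  proof -
    have "range (\<lambda>_::nat. val G u) \<subseteq> N" using N_I u by auto
    from b(2)[OF this] have "Q (val G u) <-> sat N (interleave (\<lambda>_. val G u) b) \<phi>" .
    also have "interleave (\<lambda>_. val G u) b = (\<lambda>i. val G (\<sigma> u i))"
      by (simp add: \<sigma>_def interleave_def c(3) fun_eq_iff)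
    also have "sat N (\<lambda>i. val G (\<sigma> u i)) \<phi> <-> (\<exists>p\<in>G. frc \<phi> p (\<sigma> u))"
      by (rule truth) (use u c in \<open>simp add: \<sigma>_def interleave_def\<close>)
    finally show ?thesis .
  qed
  have "dfn M (\<lambda>e. (\<lambda>t. frc \<phi> (t 0) (\<lambda>i. t (Suc i)))
      (\<lambda>j. (case j of 0 => (\<lambda>e. e 1) | Suc k => if even k then (\<lambda>e. e 0) else (\<lambda>e. c (k div 2))) e))"
    by (rule dfn_subst[OF dfn_frc]) (use c in \<open>auto split: nat.splits\<close>)
  moreover have "(\<lambda>k. (if even k then (\<lambda>e. e 0) else (\<lambda>e. c (k div 2))) e) = \<sigma> (e 0)" for e :: "nat => hc"
    by (auto simp: fun_eq_iff \<sigma>_def interleave_def)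
  ultimately have D: "dfn M (\<lambda>e. frc \<phi> (e 1) (\<sigma> (e 0)))" by simp
  have D2: "dfn M (\<lambda>s. fmem (s 1) (s 0) t \<and> frc \<phi> (s 1) (\<sigma> (s 0)))"
    by (intro dfn_conj D dfi t)
  obtain w where w: "w \<in> M" "pname P w"
    "elts (val G w) = {val G u | u. u \<in> elts (dm t) \<and> (\<exists>p\<in>G. fmem p u t \<and> frc \<phi> p (\<sigma> u))}"
    using make_name[OF dm_closed[OF t(1)] _ D2] elts_dm by blast
  have "elts (val G w) = {x \<in> elts a. Q x}"
  proof (intro equalityI subsetI)
    fix x assume "x \<in> elts (val G w)"
    then obtain u p where u: "x = val G u" "u \<in> elts (dm t)" "p \<in> G" "fmem p u t" "frc \<phi> p (\<sigma> u)"
      unfolding w(3) by blast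
    have um: "u \<in> M" "pname P u" using u(2) transD[OF _ dm_closed[OF t(1)]] elts_dm by blast+
    have "x \<in> elts a" using truth_mem[OF um(1) t(1)] u t(3) by blast
    moreover have "Q x" using s[OF um] u by blast
    ultimately show "x \<in> {x \<in> elts a. Q x}" by blast
  next
    fix x assume x: "x \<in> {x \<in> elts a. Q x}"
    then obtain u p where u: "x = val G u" "p \<in> G" "hpair u p \<in> elts t" unfolding t(3) elts_val by blast
    have um: "u \<in> M" "pname P u" using name_dom[OF t(1,2) u(3)] by blast+
    obtain p1 where p1: "p1 \<in> G" "fmem p1 u t" using truth_mem[OF um(1) t(1)] x u(1) t(3) by blast
    obtain p2 where p2: "p2 \<in> G" "frc \<phi> p2 (\<sigma> u)" using s[OF um] x u(1) by blast
    obtain p3 where p3: "p3 \<in> G" "p3 \<unlhd> p1" "p3 \<unlhd> p2" using G_dir p1(1) p2(1) by blast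
    have "fmem p3 u t" "frc \<phi> p3 (\<sigma> u)" using fmem_mono[OF p1(2) p3(2)] frc_mono[OF p2(2) p3(3)] by blast+
    moreover have "u \<in> elts (dm t)" using in_dm[OF t(1,2) u(3)] .
    ultimately show "x \<in> elts (val G w)" unfolding w(3) using u(1) p3(1) by blast
  qed
  then have "val G w = hset {x \<in> elts a. Q x}" by (intro hc_eqI) simp
  then show ?thesis using N_I w by metis
qed

lemma N_trans: "x \<in> N ==> elts x \<subseteq> N"
proof
  fix y assume x: "x \<in> N" and y: "y \<in> elts x"
  obtain t where t: "t \<in> M" "pname P t" "x = val G t" using N_E[OF x] by blast
  then obtain u p where "y = val G u" "hpair u p \<in> elts t" using y unfolding t(3) elts_val by blast
  then show "y \<in> N" using name_dom[OF t(1,2)] N_I by blast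
qed

lemma check_M: "x \<in> M ==> hcheck one x \<in> M"
  by (rule dff_const_closed) (intro dfi oneM)

lemma M_sub_N: "x \<in> M ==> x \<in> N"
  using N_I[OF check_M pname_hcheck[OF oneP], of x] val_hcheck[OF oneG] by simp

lemma tm_N: "tm N"
proof
  show "N \<noteq> {}" using M_sub_N hempty_closed by blast
  show "x \<in> N ==> elts x \<subseteq> N" for x using N_trans .
  show "\<exists>z\<in>N. x \<in> elts z \<and> y \<in> elts z" if xy: "x \<in> N" "y \<in> N" for x y
  proof -
    obtain s where s: "s \<in> M" "pname P s" "x = val G s" using N_E[OF xy(1)] by blast
    obtain t where t: "t \<in> M" "pname P t" "y = val G t" using N_E[OF xy(2)] by blast
    have D: "dfn M (\<lambda>s. True)" by (intro dfi)
    have "hset {s, t} \<in> M" using s t by (intro pair_closed)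
    then obtain w where w: "w \<in> M" "pname P w" "elts (val G w) = {val G u | u. u \<in> elts (hset {s, t}) \<and> (\<exists>p\<in>G. True)}"
      using make_name[of "hset {s, t}" "\<lambda>_ _. True"] D s t by auto
    have "val G w \<in> N" using N_I w by blast
    moreover have "x \<in> elts (val G w)" "y \<in> elts (val G w)" unfolding w(3) using s(3) t(3) oneG by fastforce+
    ultimately have "val G w \<in> N" "x \<in> elts (val G w)" "y \<in> elts (val G w)" .
    then show ?thesis by blast
  qed
  show "\<exists>u\<in>N. \<forall>y\<in>elts x. elts y \<subseteq> elts u" if x: "x \<in> N" for x
  proof -
    obtain t where t: "t \<in> M" "pname P t" "x = val G t" using N_E[OF x] by blast
    \<comment> \<open>Two unions reach the names u occurring in \<open>t\<close>, a third one their
      pairs (v, q), and the two unions inside \<open>dm\<close> the names v.\<close>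
    define D where "D = dm (hUn (hUn (hUn t)))"
    have DM: "D \<in> M" unfolding D_def by (rule dm_closed) (simp add: t)
    have True: "dfn M (\<lambda>s. True)" by (intro dfi)
    obtain w where w: "w \<in> M" "pname P w" "elts (val G w) = {val G u | u. u \<in> elts D \<and> (\<exists>p\<in>G. True)}"
      using make_name[OF DM, of "\<lambda>_ _. True"] True unfolding D_def elts_dm by blast
    have "elts y \<subseteq> elts (val G w)" if y: "y \<in> elts x" for y
    proof
      fix z assume z: "z \<in> elts y"
      obtain u p where u: "y = val G u" "hpair u p \<in> elts t" using y unfolding t(3) elts_val by blast
      obtain v q where v: "z = val G v" "hpair v q \<in> elts u" using z unfolding u(1) elts_val by blast
      have um: "u \<in> M" "pname P u" using name_dom[OF t(1,2) u(2)] by blast+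
      have "u \<in> elts (hUn (hUn t))" using in_hUn2[OF u(2)] .
      then have "hpair v q \<in> elts (hUn (hUn (hUn t)))" using v(2) by (subst elts_hUn) blast
      moreover have "hset {v} \<in> elts (hpair v q)" by simp
      ultimately have "hset {v} \<in> elts (hUn (hUn (hUn (hUn t))))" by (subst elts_hUn) blast
      moreover have "v \<in> elts (hset {v})" by simp
      ultimately have "v \<in> elts (hUn (hUn (hUn (hUn (hUn t)))))" by (subst elts_hUn) blast
      then have "v \<in> elts D" unfolding D_def elts_dm using name_dom[OF um v(2)] by blast
      then show "z \<in> elts (val G w)" unfolding w(3) using v(1) oneG by blast
    qed
    then show ?thesis using N_I w by blast
  qed
  show "\<exists>y\<in>N. \<forall>z\<in>N. elts z \<subseteq> elts x --> z \<in> elts y" if x: "x \<in> N" for x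
  proof -
    obtain t where t: "t \<in> M" "pname P t" "x = val G t" using N_E[OF x] by blast
    define B where "B = hprd (dm t) P"
    have BM: "B \<in> M" unfolding B_def by (simp add: dm_closed t)
    have True: "dfn M (\<lambda>s. True)" by (intro dfi)
    have "pname P w" if "w \<in> elts (pw B)" for w
    proof (rule pname.intros, rule ballI)
      fix z assume "z \<in> elts w"
      then have "z \<in> elts B" using that pw(2)[OF BM] by blast
      then show "\<exists>s p. z = hpair s p \<and> p \<in> elts P \<and> pname P s" unfolding B_def elts_hprd hprod_def elts_dm by blast
    qed
    then obtain y where y: "y \<in> M" "pname P y" "elts (val G y) = {val G u | u. u \<in> elts (pw B) \<and> (\<exists>p\<in>G. True)}"
      using make_name[OF pw(1)[OF BM], of "\<lambda>_ _. True"] True by blast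
    have "z \<in> elts (val G y)" if z: "z \<in> N" "elts z \<subseteq> elts x" for z
    proof -
      obtain \<zeta> where \<zeta>: "\<zeta> \<in> M" "pname P \<zeta>" "z = val G \<zeta>" using N_E[OF z(1)] by blast
      \<comment> \<open>An arbitrary name of a subset is replaced by a name with the same value that
        uses only names occurring in \<open>t\<close>; such names form a set of the ground
        model.\<close>
      define w where "w = hset {v \<in> elts B. \<exists>u\<in>elts (dm t). \<exists>p\<in>elts P. v = hpair u p \<and> fmem p u \<zeta>}"
      have wM: "w \<in> M" unfolding w_def by (rule sep[OF BM]) (intro dfi dm_closed t PM \<zeta>)
      have ew: "elts w = {v \<in> elts B. \<exists>u\<in>elts (dm t). \<exists>p\<in>elts P. v = hpair u p \<and> fmem p u \<zeta>}"
        unfolding w_def by (rule elts_hset) simp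
      have "w \<in> elts (pw B)" unfolding pw(2)[OF BM] using wM ew by blast
      moreover have "val G w = z"
      proof (rule hc_eqI, intro equalityI subsetI)
        fix a assume "a \<in> elts (val G w)"
        then obtain u p where u: "a = val G u" "p \<in> G" "hpair u p \<in> elts w" unfolding elts_val by blast
        then have f: "fmem p u \<zeta>" "u \<in> elts (dm t)" unfolding ew by auto
        then have "u \<in> M" using transD[OF _ dm_closed[OF t(1)]] by blast
        then show "a \<in> elts z" using truth_mem[OF _ \<zeta>(1)] u f \<zeta>(3) by blast
      next
        fix a assume a: "a \<in> elts z"
        then have "a \<in> elts x" using z by blast
        then obtain u p where u: "a = val G u" "hpair u p \<in> elts t" unfolding t(3) elts_val by blast
        have um: "u \<in> M" "u \<in> elts (dm t)" using name_dom[OF t(1,2) u(2)] in_dm[OF t(1,2) u(2)] by blast+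
        obtain q where q: "q \<in> G" "fmem q u \<zeta>" using truth_mem[OF um(1) \<zeta>(1)] a u(1) \<zeta>(3) by blast
        then have "hpair u q \<in> elts w" unfolding ew B_def using um GP by auto
        then show "a \<in> elts (val G w)" unfolding elts_val using u(1) q(1) by blast
      qed
      ultimately show ?thesis unfolding y(3) using oneG by blast
    qed
    then show ?thesis using N_I y by blast
  qed
  show "a \<in> N ==> dfn N (\<lambda>s. Q (s 0)) ==> hset {x \<in> elts a. Q x} \<in> N" for a Q using N_sep .
qed

lemma tmo_N: "tmo N"
  by (intro tmo.intro tm_N tmo_axioms.intro M_sub_N omegaM)

lemma G_in_N: "hset G \<in> N"
proof -
  define w where "w = hset ((\<lambda>p. hpair (hcheck one p) p) ` elts P)"
  have wM: "w \<in> M" unfolding w_def by (rule dff_const_closed) (intro dfi PM oneM)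
  have "pname P w" by (rule pname.intros) (auto simp: w_def pname_hcheck)
  moreover have "elts (val G w) = G"
  proof (intro equalityI subsetI)
    fix p assume "p \<in> G"
    then have "hpair (hcheck one p) p \<in> elts w" using GP by (simp add: w_def)
    then show "p \<in> elts (val G w)" unfolding elts_val using \<open>p \<in> G\<close> val_hcheck[OF oneG, of p] by force
  qed (auto simp: elts_val w_def val_hcheck[OF oneG])
  ultimately show ?thesis using N_I[OF wM] by (metis hset_elts)
qed

text \<open>A subset of a ground model set is described by a relation between elements and
  conditions that is closed under strengthening the condition. In the later combinatorics this
  relation stands in for names and the forcing relation.\<close>

lemma nice_name:
  assumes X: "X \<in> N" and Z: "Z \<in> M" "elts X \<subseteq> elts Z"
  shows "\<exists>\<tau>\<in>M. (\<forall>z\<in>elts Z. z \<in> elts X <-> (\<exists>p\<in>G. hpair z p \<in> elts \<tau>)) \<and>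
    (\<forall>z p q. hpair z p \<in> elts \<tau> \<and> q \<unlhd> p --> hpair z q \<in> elts \<tau>)"
proof -
  obtain \<zeta> where \<zeta>: "\<zeta> \<in> M" "pname P \<zeta>" "X = val G \<zeta>" using N_E[OF X] by blast
  define \<tau> where "\<tau> = hset {w \<in> elts (hprd Z P). \<exists>z\<in>elts Z. \<exists>p\<in>elts P. w = hpair z p \<and> fmem p (hcheck one z) \<zeta>}"
  have \<tau>M: "\<tau> \<in> M" unfolding \<tau>_def by (rule sep, simp add: Z) (intro dfi Z PM oneM \<zeta>)
  have e\<tau>: "elts \<tau> = {w \<in> elts (hprd Z P). \<exists>z\<in>elts Z. \<exists>p\<in>elts P. w = hpair z p \<and> fmem p (hcheck one z) \<zeta>}"
    unfolding \<tau>_def by (rule elts_hset) simp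
  have \<tau>: "hpair z p \<in> elts \<tau> <-> z \<in> elts Z \<and> p \<in> elts P \<and> fmem p (hcheck one z) \<zeta>" for z p
    unfolding e\<tau> by auto
  have "z \<in> elts X <-> (\<exists>p\<in>G. hpair z p \<in> elts \<tau>)" if z: "z \<in> elts Z" for z
  proof -
    have "z \<in> elts X <-> (\<exists>p\<in>G. fmem p (hcheck one z) \<zeta>)"
      using truth_mem[OF check_M \<zeta>(1), of z] transD[OF z Z(1)] val_hcheck[OF oneG] \<zeta>(3) by simp
    then show ?thesis unfolding \<tau> using z GP by blast
  qed
  moreover have "hpair z q \<in> elts \<tau>" if "hpair z p \<in> elts \<tau>" "q \<unlhd> p" for z p q
    using that fmem_mono leD unfolding \<tau> by blast
  ultimately show ?thesis using \<tau>M by blast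
qed

end

section \<open>The poset of finite approximations\<close>

definition in_dom :: "hc => hc => bool" where "in_dom \<alpha> p <-> (\<exists>m. hpair \<alpha> m \<in> elts p)"

text \<open>A condition is a finite subset of \<open>\<omega>\<^sub>1 \<times> \<omega>\<close>; the pair \<open>(\<alpha>, m)\<close> promises that \<open>m\<close> belongs to
  the \<open>\<alpha>\<close>-th generic set. The sets mentioned by a condition acquire no new common elements.\<close>

definition ext :: "hc => hc => bool" where
  "ext q p <-> elts p \<subseteq> elts q \<and> (\<forall>\<alpha> \<beta> m. \<alpha> \<noteq> \<beta> \<and> in_dom \<alpha> p \<and> in_dom \<beta> p \<and>
    hpair \<alpha> m \<in> elts q \<and> hpair \<beta> m \<in> elts q --> hpair \<alpha> m \<in> elts p \<and> hpair \<beta> m \<in> elts p)"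

lemma ext_refl: "ext p p" unfolding ext_def by blast

lemma ext_trans: "ext r q ==> ext q p ==> ext r p"
  unfolding ext_def in_dom_def by (meson subsetD subset_trans)

lemma ext_sub: "ext q p ==> elts p \<subseteq> elts q" unfolding ext_def by blast

lemma ext_hempty: "ext p hempty" unfolding ext_def in_dom_def by simp

lemma elts_hrestrict: "elts (hrestrict f a) = {z \<in> elts f. \<exists>x\<in>elts a. \<exists>y. z = hpair x y}"
  by (rule elts_sep[OF hrestrict_def])

lemma hrestrict_mem [simp]: "hpair x y \<in> elts (hrestrict f a) <-> hpair x y \<in> elts f \<and> x \<in> elts a"
  unfolding elts_hrestrict by auto

text \<open>The restriction keeps every row with index in \<open>d\<close> whole, so what it freezes
  cannot be violated by the condition itself.\<close>

lemma ext_hrestrict: "ext p (hrestrict p d)"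
  unfolding ext_def in_dom_def using elts_hrestrict by auto

context zfc
begin

lemma dfn_in_dom [dfi]: "dff M f ==> dff M g ==> dfn M (\<lambda>s. in_dom (f s) (g s))"
proof (rule dfn_comp2[where Q = in_dom])
  have "dfn M (\<lambda>s. \<exists>m\<in>M. hpair (s 0) m \<in> elts (s 1))" by (intro dfi)
  moreover have "in_dom (s 0) (s 1) <-> (\<exists>m\<in>M. hpair (s 0) m \<in> elts (s 1))" if "range s \<subseteq> M" for s :: "nat => hc"
    unfolding in_dom_def using transD[OF _ env_closed[OF that, of 1]] by (metis hpair_closed)
  ultimately show "dfn M (\<lambda>s. in_dom (s 0) (s 1))" by (subst dfn_cong) auto
qed

lemma dfn_ext [dfi]: "dff M f ==> dff M g ==> dfn M (\<lambda>s. ext (f s) (g s))"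
proof (rule dfn_comp2[where Q = ext])
  have "dfn M (\<lambda>s. elts (s 1) \<subseteq> elts (s 0) \<and> (\<forall>\<alpha>\<in>M. \<forall>\<beta>\<in>M. \<forall>m\<in>M. \<alpha> \<noteq> \<beta> \<and> in_dom \<alpha> (s 1) \<and> in_dom \<beta> (s 1) \<and>
    hpair \<alpha> m \<in> elts (s 0) \<and> hpair \<beta> m \<in> elts (s 0) --> hpair \<alpha> m \<in> elts (s 1) \<and> hpair \<beta> m \<in> elts (s 1)))"
    by (intro dfi)
  moreover have "ext (s 0) (s 1) <-> elts (s 1) \<subseteq> elts (s 0) \<and> (\<forall>\<alpha>\<in>M. \<forall>\<beta>\<in>M. \<forall>m\<in>M. \<alpha> \<noteq> \<beta> \<and> in_dom \<alpha> (s 1) \<and> in_dom \<beta> (s 1) \<and>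
    hpair \<alpha> m \<in> elts (s 0) \<and> hpair \<beta> m \<in> elts (s 0) --> hpair \<alpha> m \<in> elts (s 1) \<and> hpair \<beta> m \<in> elts (s 1))"
    (is "?A <-> ?B") if "range s \<subseteq> M" for s :: "nat => hc"
  proof
    have M: "\<alpha> \<in> M \<and> m \<in> M" if "hpair \<alpha> m \<in> elts (s 0)" for \<alpha> m
      using transD[OF that env_closed[OF \<open>range s \<subseteq> M\<close>, of 0]] by simp
    assume B: ?B
    show ?A unfolding ext_def using B M by blast
  qed (unfold ext_def, blast)
  ultimately show "dfn M (\<lambda>s. ext (s 0) (s 1))" by (subst dfn_cong) auto
qed

end

context omega1_model
begin

lemma fs_iff: "p \<in> elts (fs d) <-> finite (elts p) \<and> (\<forall>z\<in>elts p. \<exists>\<alpha>\<in>elts d. \<exists>m. z = hpair \<alpha> (hnat m))"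
  unfolding fs_def elts_hfin elts_hprd hprod_def elts_homega by auto

lemma fs_mem: "p \<in> elts (fs d) ==> hpair \<alpha> m \<in> elts p ==> \<alpha> \<in> elts d \<and> (\<exists>n. m = hnat n)"
  unfolding fs_iff by fastforce

lemma hempty_fs [simp]: "hempty \<in> elts (fs d)"
  unfolding fs_iff by simp

lemma fs_hun: "p \<in> elts (fs d) ==> q \<in> elts (fs d) ==> hun p q \<in> elts (fs d)"
  unfolding fs_iff by auto

lemma fs_hrestrict: "p \<in> elts (fs d) ==> hrestrict p e \<in> elts (fs e)"
  unfolding fs_iff elts_hrestrict by auto

lemma finite_dom: "p \<in> elts (fs d) ==> finite {\<alpha>. in_dom \<alpha> p}" and finite_vals: "p \<in> elts (fs d) ==> finite {m. \<exists>\<alpha>. hpair \<alpha> m \<in> elts p}"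
proof -
  assume p: "p \<in> elts (fs d)"
  have "{\<alpha>. in_dom \<alpha> p} \<subseteq> (\<lambda>z. THE \<alpha>. \<exists>m. z = hpair \<alpha> m) ` elts p"
    by (auto simp: in_dom_def intro!: rev_image_eqI)
  then show "finite {\<alpha>. in_dom \<alpha> p}" using p finite_subset unfolding fs_iff by blast
next
  assume p: "p \<in> elts (fs d)"
  have "{m. \<exists>\<alpha>. hpair \<alpha> m \<in> elts p} \<subseteq> (\<lambda>z. THE m. \<exists>\<alpha>. z = hpair \<alpha> m) ` elts p"
    by (auto intro!: rev_image_eqI)
  then show "finite {m. \<exists>\<alpha>. hpair \<alpha> m \<in> elts p}" using p finite_subset unfolding fs_iff by blast
qed

lemma fs_insert: "p \<in> elts (fs d) ==> \<alpha> \<in> elts d ==> hun p (hset {hpair \<alpha> (hnat m)}) \<in> elts (fs d)"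
  by (rule fs_hun) (auto simp: fs_iff)

lemma ext_hrestrict_fs: "ext r p ==> p \<in> elts (fs d) ==> ext (hrestrict r d) p"
  unfolding ext_def using fs_mem[of p d] by (auto simp: elts_hrestrict fs_iff)

text \<open>\<gamma> is a controlling row below \<open>d\<close>. If an extension q of the
  restriction puts a number of p into another row \<alpha> mentioned by p, then in q both \<gamma>
  and \<alpha> contain it, and freezing implies that it was in row \<alpha> of p already.\<close>

definition full :: "hc => hc => bool" where
  "full p d <-> (\<exists>\<gamma>\<in>elts d. in_dom \<gamma> p \<and> (\<forall>\<alpha> m. hpair \<alpha> m \<in> elts p --> hpair \<gamma> m \<in> elts p))"

text \<open>An index in \<open>d\<close> that p does not mention is bound by no promise, so its row
  can be filled with all numbers of p.\<close>

lemma full_ext: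
  assumes p: "p \<in> elts (fs e)" and d: "infinite (elts d)" "elts d \<subseteq> elts e"
  shows "\<exists>p'\<in>elts (fs e). ext p' p \<and> full p' d"
proof -
  have "infinite (elts d - {\<alpha>. in_dom \<alpha> p})" using d(1) finite_dom[OF p] by simp
  then obtain \<gamma> where \<gamma>: "\<gamma> \<in> elts d" "\<not> in_dom \<gamma> p" by (metis (no_types, lifting) DiffE finite.emptyI ex_in_conv mem_Collect_eq)
  \<comment> \<open>0 is included so that the new row is nonempty even if p is empty.\<close>
  define S where "S = insert (hnat 0) {m. \<exists>\<alpha>. hpair \<alpha> m \<in> elts p}"
  have S: "finite S" using finite_vals[OF p] by (simp add: S_def)
  have Sn: "\<exists>n. m = hnat n" if "m \<in> S" for m using that fs_mem[OF p] unfolding S_def by blast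
  define p' where "p' = hun p (hset ((\<lambda>m. hpair \<gamma> m) ` S))"
  have c: "countable S" using S by (rule countable_finite)
  have p': "hpair \<alpha> m \<in> elts p' <-> hpair \<alpha> m \<in> elts p \<or> (\<alpha> = \<gamma> \<and> m \<in> S)" for \<alpha> m
    using c by (auto simp: p'_def)
  have "hset ((\<lambda>m. hpair \<gamma> m) ` S) \<in> elts (fs e)"
    unfolding fs_iff using c S Sn \<gamma>(1) d(2) by auto
  then have "p' \<in> elts (fs e)" unfolding p'_def using p by (intro fs_hun)
  moreover have "ext p' p" unfolding ext_def
  proof (intro conjI allI impI)
    show "elts p \<subseteq> elts p'" by (simp add: p'_def)
  qed (use p' \<gamma>(2) in blast)+
  moreover have "full p' d" unfolding full_def in_dom_def
  proof (rule bexI[OF _ \<gamma>(1)], intro conjI allI impI)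
    show "\<exists>m. hpair \<gamma> m \<in> elts p'" using p' S_def by blast
    show "hpair \<gamma> m \<in> elts p'" if "hpair \<alpha> m \<in> elts p'" for \<alpha> m
      using that unfolding p' S_def by blast
  qed
  ultimately show ?thesis by blast
qed

text \<open>The restriction of a full condition to \<open>\<delta>\<close> is a reduction: everything below it with support
  in \<open>\<delta>\<close> is compatible with the whole condition.\<close>

lemma amalgamate:
  assumes p: "full p d" and q: "q \<in> elts (fs d)" "ext q (hrestrict p d)"
  shows "ext (hun q p) p" "ext (hun q p) q"
proof -
  have qd: "\<alpha> \<in> elts d" if "hpair \<alpha> m \<in> elts q" for \<alpha> m using fs_mem[OF q(1) that] by blast
  have pq: "hpair \<alpha> m \<in> elts q" if "hpair \<alpha> m \<in> elts p" "\<alpha> \<in> elts d" for \<alpha> m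
    using ext_sub[OF q(2)] that by auto
  have amal: "hpair \<alpha> m \<in> elts p \<and> hpair \<beta> m \<in> elts p"
    if "\<alpha> \<noteq> \<beta>" "in_dom \<alpha> p" "in_dom \<beta> p" "hpair \<alpha> m \<in> elts q" "hpair \<beta> m \<in> elts q" for \<alpha> \<beta> m
  proof -
    have "in_dom \<alpha> (hrestrict p d)" "in_dom \<beta> (hrestrict p d)" using that qd unfolding in_dom_def by auto
    then show ?thesis using q(2) that unfolding ext_def by (meson hrestrict_mem)
  qed
  obtain \<gamma> where \<gamma>: "\<gamma> \<in> elts d" "in_dom \<gamma> p" "\<And>\<alpha> m. hpair \<alpha> m \<in> elts p ==> hpair \<gamma> m \<in> elts p"
    using p unfolding full_def by blast
  \<comment> \<open>The critical case: m is in row \<alpha> of q and in row \<beta> of p. The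
    controlling row carries m over to q, where freezing applies to \<alpha> and \<gamma>.\<close>
  have mixed: "hpair \<alpha> m \<in> elts p" if "in_dom \<alpha> p" "hpair \<alpha> m \<in> elts q" "hpair \<beta> m \<in> elts p" for \<alpha> \<beta> m
  proof (cases "\<alpha> = \<gamma>")
    case True then show ?thesis using \<gamma>(3) that(3) by blast
  next
    case False
    have "hpair \<gamma> m \<in> elts q" using pq \<gamma> that(3) by blast
    then show ?thesis using amal[OF False that(1) \<gamma>(2) that(2)] by blast
  qed
  show "ext (hun q p) p" unfolding ext_def
  proof (intro conjI allI impI)
    fix \<alpha> \<beta> m assume h: "\<alpha> \<noteq> \<beta> \<and> in_dom \<alpha> p \<and> in_dom \<beta> p \<and> hpair \<alpha> m \<in> elts (hun q p) \<and> hpair \<beta> m \<in> elts (hun q p)"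
    show "hpair \<alpha> m \<in> elts p" using h amal[of \<alpha> \<beta> m] mixed[of \<alpha> m \<beta>] by auto
    show "hpair \<beta> m \<in> elts p" using h amal[of \<alpha> \<beta> m] mixed[of \<beta> m \<alpha>] by auto
  qed simp
  show "ext (hun q p) q" unfolding ext_def
  proof (intro conjI allI impI)
    fix \<alpha> \<beta> m assume h: "\<alpha> \<noteq> \<beta> \<and> in_dom \<alpha> q \<and> in_dom \<beta> q \<and> hpair \<alpha> m \<in> elts (hun q p) \<and> hpair \<beta> m \<in> elts (hun q p)"
    then have "\<alpha> \<in> elts d" "\<beta> \<in> elts d" using qd unfolding in_dom_def by blast+
    then show "hpair \<alpha> m \<in> elts q" "hpair \<beta> m \<in> elts q" using h pq by auto
  qed simp
qed

definition leq :: "hc => hc" where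
  "leq d = hset {z \<in> elts (hprd (fs d) (fs d)). \<exists>q\<in>elts (fs d). \<exists>p\<in>elts (fs d). z = hpair q p \<and> ext q p}"

lemma leq_iff: "hpair q p \<in> elts (leq d) <-> q \<in> elts (fs d) \<and> p \<in> elts (fs d) \<and> ext q p"
proof -
  have "elts (leq d) = {z \<in> elts (hprd (fs d) (fs d)). \<exists>q\<in>elts (fs d). \<exists>p\<in>elts (fs d). z = hpair q p \<and> ext q p}"
    by (rule elts_sep[OF leq_def])
  then show ?thesis by auto
qed

lemma leq_sub: "elts (leq d) \<subseteq> hprod (elts (fs d)) (elts (fs d))"
  unfolding leq_def by (subst elts_hset) auto

lemma leq_closed: "d \<in> M ==> leq d \<in> M"
  unfolding leq_def by (rule sep) (simp add: fs_closed, intro dfi)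

lemma poset_fs: "forcing_poset (fs d) (leq d) hempty"
  unfolding forcing_poset_def leq_iff using leq_sub ext_refl ext_trans ext_hempty by (auto; blast)

lemma forcing_fs: "d \<in> M ==> forcing M (fs d) (leq d) hempty"
  by unfold_locales (simp_all add: fs_closed leq_closed poset_fs)

lemma infinite_limit: "hempty \<in> elts \<delta> ==> (\<And>\<alpha>. \<alpha> \<in> elts \<delta> ==> hsucc \<alpha> \<in> elts \<delta>) ==> infinite (elts \<delta>)"
proof -
  assume h: "hempty \<in> elts \<delta>" "\<And>\<alpha>. \<alpha> \<in> elts \<delta> ==> hsucc \<alpha> \<in> elts \<delta>"
  have "hnat n \<in> elts \<delta>" for n by (induction n) (use h in auto)
  then have "range hnat \<subseteq> elts \<delta>" by blast
  moreover have "infinite (range hnat)" by (rule range_inj_infinite) (simp add: inj_def)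
  ultimately show ?thesis using finite_subset by blast
qed

lemma reflection_infinite:
  assumes "dfn M (\<lambda>s. E (s 0) (s 1) (s 2))" "Z \<in> M" "countable_in M (elts Z)"
  shows "\<exists>\<delta>\<in>elts w1. infinite (elts \<delta>) \<and>
    (\<forall>r\<in>elts (fs \<delta>). \<forall>z\<in>elts Z. (\<exists>p\<in>elts (fs w1). E r z p) --> (\<exists>p\<in>elts (fs \<delta>). E r z p))"
  using reflection[OF assms hempty_w1] infinite_limit by blast

lemma w1_sub: "\<delta> \<in> elts w1 ==> elts \<delta> \<subseteq> elts w1"
  using w1_ord unfolding hordinal_def by blast

text \<open>Each member p of the antichain has a full extension. The restriction of that extension
  to \<delta> is compatible with p, hence by reflection with some member supported in \<delta>;
  amalgamation makes this member compatible with p, hence equal to p. The chain condition follows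
  because only countably many conditions are supported in \<delta>.\<close>

lemma antichain_bounded:
  assumes A: "A \<in> M" "elts A \<subseteq> elts (fs w1)"
    and anti: "\<And>p q r. p \<in> elts A ==> q \<in> elts A ==> r \<in> elts (fs w1) ==> ext r p ==> ext r q ==> p = q"
  shows "\<exists>\<delta>\<in>elts w1. elts A \<subseteq> elts (fs \<delta>)"
proof -
  have FM: "fs w1 \<in> M" by (simp add: fs_closed)
  define E where "E r z p <-> p \<in> elts A \<and> (\<exists>s\<in>elts (fs w1). ext s p \<and> ext s r)" for r z p :: hc
  have D: "dfn M (\<lambda>s. E (s 0) (s 1) (s 2))" unfolding E_def by (intro dfi A(1) w1M)
  have Z: "hset {hempty} \<in> M" by simp
  obtain \<delta> where \<delta>: "\<delta> \<in> elts w1" "infinite (elts \<delta>)"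
    "\<forall>r\<in>elts (fs \<delta>). \<forall>z\<in>elts (hset {hempty}). (\<exists>p\<in>elts (fs w1). E r z p) --> (\<exists>p\<in>elts (fs \<delta>). E r z p)"
    using reflection_infinite[OF D Z finite_countable_in[OF Z]] by auto
  have "p \<in> elts (fs \<delta>)" if p: "p \<in> elts A" for p
  proof -
    obtain p' where p': "p' \<in> elts (fs w1)" "ext p' p" "full p' \<delta>"
      using full_ext[of p w1 \<delta>] p A(2) \<delta>(2) w1_sub[OF \<delta>(1)] by blast
    define r where "r = hrestrict p' \<delta>"
    have r: "r \<in> elts (fs \<delta>)" unfolding r_def by (rule fs_hrestrict[OF p'(1)])
    have "E r hempty p" unfolding E_def r_def using p p' ext_hrestrict by blast
    moreover have "hempty \<in> elts (hset {hempty})" by simp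
    moreover have "p \<in> elts (fs w1)" using p A(2) by blast
    ultimately obtain a where a: "a \<in> elts (fs \<delta>)" "E r hempty a" using \<delta>(3) r by blast
    then obtain s where s: "s \<in> elts (fs w1)" "ext s a" "ext s r" unfolding E_def by blast
    define q where "q = hrestrict s \<delta>"
    have q: "q \<in> elts (fs \<delta>)" "ext q a" "ext q r"
      unfolding q_def using fs_hrestrict[OF s(1)] ext_hrestrict_fs s a(1) r by blast+
    have "ext (hun q p') p'" "ext (hun q p') q" using amalgamate[OF p'(3) q(1)] q(3) unfolding r_def by blast+
    moreover have "hun q p' \<in> elts (fs w1)" using q(1) fs_mono[OF w1_sub[OF \<delta>(1)]] p'(1) by (intro fs_hun) blast
    ultimately have "p = a" using anti[OF p _ , of a "hun q p'"] a(2) p'(2) q(2) ext_trans unfolding E_def by blast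
    then show ?thesis using a(1) by simp
  qed
  then show ?thesis using \<delta>(1) by blast
qed

end

section \<open>The iteration\<close>

lemma hcheck_hempty [simp]: "hcheck o1 hempty = hempty"
  by (rule hc_eqI) (simp add: elts_hcheck)

lemma hcheck_inject: "hcheck o1 x = hcheck o1 y ==> x = y"
  using val_hcheck[of o1 "{o1}"] by (metis singletonI)

lemma hfun_hrestrict:
  assumes "hfun f X" "elts a \<subseteq> X"
  shows "hfun (hrestrict f a) (elts a)" "x \<in> elts a ==> hrestrict f a \<cdot> x = f \<cdot> x"
proof -
  show "hfun (hrestrict f a) (elts a)"
    by (rule hfunI(1)[where g = "\<lambda>x. f \<cdot> x"])
      (use assms happ_iff[OF assms(1)] in \<open>auto simp: elts_hrestrict\<close>)
  show "x \<in> elts a ==> hrestrict f a \<cdot> x = f \<cdot> x"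
    by (rule hfunI(2)[where g = "\<lambda>x. f \<cdot> x"])
      (use assms happ_iff[OF assms(1)] in \<open>auto simp: elts_hrestrict\<close>)
qed

lemma generic_one: "generic M P le G ==> forcing_poset P le one ==> one \<in> G"
proof -
  assume G: "generic M P le G" and P: "forcing_poset P le one"
  obtain p where p: "p \<in> G" "p \<in> elts P" using G unfolding generic_def by blast
  then have "hpair p one \<in> elts le" "one \<in> elts P" using P unfolding forcing_poset_def by blast+
  then show "one \<in> G" using G p(1) unfolding generic_def by blast
qed

context omega1_model
begin

abbreviation "R \<equiv> fs w1"

text \<open>The coordinate 0 of a condition carries the canonical name of an element of \<open>R\<close>; all later
  iterands are trivial.\<close>

definition coord :: "hc => hc => hc" where
  "coord x \<beta> = (if \<beta> = hempty then hcheck hempty x else hempty)"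

text \<open>\<open>cn y x\<close> is the condition of length y that represents x. At length 0 all of
  these coincide; from length 1 on the representation is faithful.\<close>

definition cn :: "hc => hc => hc" where "cn y x = hset ((\<lambda>\<beta>. hpair \<beta> (coord x \<beta>)) ` elts y)"
definition Pc :: "hc => hc" where "Pc y = hset ((\<lambda>x. cn y x) ` elts R)"
definition lc :: "hc => hc" where
  "lc y = hset {z \<in> elts (hprd (Pc y) (Pc y)). \<exists>x\<in>elts R. \<exists>x'\<in>elts R. z = hpair (cn y x) (cn y x') \<and> ext x x'}"
definition oc :: "hc => hc" where "oc y = cn y hempty"
text \<open>Check names are formed with the top condition of their stage, so their values are the
  same for all filters that contain it. Forcing statements about them thereby reduce to statements
  about the sets themselves.\<close>

definition Qc :: "hc => hc" where "Qc y = hcheck (oc y) (if y = hempty then R else hset {hempty})"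
definition Qlc :: "hc => hc" where
  "Qlc y = hcheck (oc y) (if y = hempty then leq w1 else hset {hpair hempty hempty})"

lemma R_closed [simp]: "R \<in> M" by (simp add: fs_closed)
lemma leq_w1_closed [simp]: "leq w1 \<in> M" by (simp add: leq_closed)

lemma dff_cn [dfi]: "dff M f ==> dff M g ==> dff M (\<lambda>s. cn (f s) (g s))"
proof (rule dff_comp2[where h = cn])
  show "dff M (\<lambda>s. cn (s 0) (s 1))" unfolding cn_def coord_def by (intro dfi hempty_closed)
qed

lemma dff_Pc [dfi]: "dff M f ==> dff M (\<lambda>s. Pc (f s))"
proof (rule dff_comp1[where h = Pc])
  show "dff M (\<lambda>s. Pc (s 0))" unfolding Pc_def by (intro dff_image elem R_closed dff_cn var)
qed

lemma dff_lc [dfi]: "dff M f ==> dff M (\<lambda>s. lc (f s))"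
proof (rule dff_comp1[where h = lc])
  show "dff M (\<lambda>s. lc (s 0))" unfolding lc_def
    by (intro dff_sep dff_hprd dff_Pc var bex elem R_closed dfn_conj eq dff_hpair dff_cn dfn_ext)
qed

lemma dff_oc [dfi]: "dff M f ==> dff M (\<lambda>s. oc (f s))"
  unfolding oc_def by (intro dff_cn elem hempty_closed)

lemma dff_Qc [dfi]: "dff M f ==> dff M (\<lambda>s. Qc (f s))"
  unfolding Qc_def by (intro dff_hcheck dff_oc dff_if eq elem hempty_closed R_closed single_closed)

lemma dff_Qlc [dfi]: "dff M f ==> dff M (\<lambda>s. Qlc (f s))"
  unfolding Qlc_def
  by (intro dff_hcheck dff_oc dff_if eq elem hempty_closed leq_w1_closed single_closed) simp_all

lemma Pc_closed: "y \<in> M ==> Pc y \<in> M" and lc_closed: "y \<in> M ==> lc y \<in> M"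
  and Qc_closed: "y \<in> M ==> Qc y \<in> M" and Qlc_closed: "y \<in> M ==> Qlc y \<in> M"
  by (rule dff_const_closed, intro dff_Pc dff_lc dff_Qc dff_Qlc elem, assumption)+

lemma elts_cn: "elts (cn y x) = {hpair \<beta> (coord x \<beta>) | \<beta>. \<beta> \<in> elts y}"
  unfolding cn_def by auto

lemma cn: "hfun (cn y x) (elts y)" "\<beta> \<in> elts y ==> cn y x \<cdot> \<beta> = coord x \<beta>"
  by (rule hfunI[of "cn y x" "elts y" "coord x"]; auto simp: elts_cn)+

lemma cn_eqI: "hfun f (elts y) ==> (\<And>\<beta>. \<beta> \<in> elts y ==> f \<cdot> \<beta> = coord x \<beta>) ==> f = cn y x"
  by (rule hfun_cong_eq[OF _ cn(1)]) (auto simp: cn(2))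

lemma hrestrict_cn: "elts z \<subseteq> elts y ==> hrestrict (cn y x) z = cn z x"
  by (rule cn_eqI) (auto simp: hfun_hrestrict[OF cn(1)] cn(2) subset_eq)

lemma cn_inj: "hempty \<in> elts y ==> cn y x = cn y x' ==> x = x'"
  using cn(2)[of hempty y x] cn(2)[of hempty y x'] hcheck_inject by (auto simp: coord_def)

lemma cn_hempty [simp]: "cn hempty x = hempty"
  by (rule hc_eqI) (simp add: elts_cn)

lemma elts_Pc: "elts (Pc y) = cn y ` elts R"
  unfolding Pc_def by simp

lemma lc_iff': "hpair p q \<in> elts (lc y) <-> (\<exists>x\<in>elts R. \<exists>x'\<in>elts R. p = cn y x \<and> q = cn y x' \<and> ext x x')"
proof -
  have "elts (lc y) = {z \<in> elts (hprd (Pc y) (Pc y)). \<exists>x\<in>elts R. \<exists>x'\<in>elts R. z = hpair (cn y x) (cn y x') \<and> ext x x'}"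
    by (rule elts_sep[OF lc_def])
  then show ?thesis by (auto simp: elts_Pc)
qed

lemma lc_iff: "hempty \<in> elts y ==> x \<in> elts R ==> x' \<in> elts R ==> hpair (cn y x) (cn y x') \<in> elts (lc y) <-> ext x x'"
  unfolding lc_iff' using cn_inj by metis

lemma lc_hempty: "hpair hempty hempty \<in> elts (lc hempty)"
  unfolding lc_iff' using ext_refl hempty_fs by (metis cn_hempty)

lemma hordinal_cases: "hordinal y ==> y = hempty \<or> hempty \<in> elts y"
  using hordinal_linear[of y hempty] hordinal_hnat[of 0] by auto

lemma poset_Pc:
  assumes y: "hordinal y" shows "forcing_poset (Pc y) (lc y) (oc y)"
proof -
  have sub: "elts (lc y) \<subseteq> hprod (elts (Pc y)) (elts (Pc y))"
    unfolding lc_def by (subst elts_hset) auto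
  have tr: "hpair p r \<in> elts (lc y)" if pq: "hpair p q \<in> elts (lc y)" and qr: "hpair q r \<in> elts (lc y)" for p q r
    using hordinal_cases[OF y]
  proof
    assume "y = hempty"
    then show ?thesis using pq qr lc_hempty unfolding lc_iff' by auto
  next
    assume 0: "hempty \<in> elts y"
    obtain a b where a: "a \<in> elts R" "b \<in> elts R" "p = cn y a" "q = cn y b" "ext a b" using pq unfolding lc_iff' by blast
    obtain b' c where b: "b' \<in> elts R" "c \<in> elts R" "q = cn y b'" "r = cn y c" "ext b' c" using qr unfolding lc_iff' by blast
    have "b = b'" using cn_inj[OF 0] a b by blast
    then show ?thesis unfolding lc_iff' using a b ext_trans by blast
  qed
  show ?thesis unfolding forcing_poset_def
  proof (intro conjI ballI impI)
    show "oc y \<in> elts (Pc y)" unfolding oc_def elts_Pc by simp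
    show "hpair p p \<in> elts (lc y)" if "p \<in> elts (Pc y)" for p
      using that ext_refl unfolding elts_Pc lc_iff' by blast
    show "hpair p (oc y) \<in> elts (lc y)" if "p \<in> elts (Pc y)" for p
      using that ext_hempty hempty_fs unfolding elts_Pc lc_iff' oc_def by blast
  qed (use sub tr in blast)+
qed

lemma forces_I:
  assumes "hordinal y" "\<And>G. oc y \<in> G ==> \<Phi> (val G)" shows "forces M (Pc y) (lc y) p \<Phi>"
  unfolding forces_def using generic_one[OF _ poset_Pc[OF assms(1)]] assms(2) by blast

lemma elts_Pc_hempty: "elts (Pc hempty) = {hempty}"
proof -
  have "elts R \<noteq> {}" using hempty_fs[of w1] by blast
  then show ?thesis by (simp add: elts_Pc image_constant_conv)
qed

text \<open>The one-point poset has the generic filter consisting of the empty condition. Evaluating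
  there recovers the order of \<open>R\<close> from the forced statement at stage 0.\<close>

lemma forces_trivial:
  assumes "forces M (Pc hempty) (lc hempty) hempty \<Phi>" shows "\<Phi> (val {hempty})"
proof -
  note P = elts_Pc_hempty
  have "generic M (Pc hempty) (lc hempty) {hempty}"
    unfolding generic_def P using lc_hempty by auto
  then show ?thesis using assms unfolding forces_def by blast
qed

lemma val_Qc: "oc y \<in> G ==> val G (Qc y) = (if y = hempty then R else hset {hempty})"
  unfolding Qc_def by (rule val_hcheck)

lemma val_Qlc: "oc y \<in> G ==> val G (Qlc y) = (if y = hempty then leq w1 else hset {hpair hempty hempty})"
  unfolding Qlc_def by (rule val_hcheck)

lemma val_hempty [simp]: "val G hempty = hempty"
  by (rule hc_eqI) (simp add: elts_val)

lemma oc_app: "y \<in> elts x ==> oc x \<cdot> y = hempty"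
  unfolding oc_def by (simp add: cn(2) coord_def)

definition "itP = hgraph (elts (hsucc w1)) Pc"
definition "itle = hgraph (elts (hsucc w1)) lc"
definition "itone = hgraph (elts (hsucc w1)) oc"
definition "itQ = hgraph (elts w1) Qc"
definition "itQle = hgraph (elts w1) Qlc"
definition "itQone = hgraph (elts w1) (\<lambda>_. hempty)"

lemma it_app:
  "x \<in> elts (hsucc w1) ==> itP \<cdot> x = Pc x" "x \<in> elts (hsucc w1) ==> itle \<cdot> x = lc x"
  "x \<in> elts (hsucc w1) ==> itone \<cdot> x = oc x"
  "x \<in> elts w1 ==> itQ \<cdot> x = Qc x" "x \<in> elts w1 ==> itQle \<cdot> x = Qlc x" "x \<in> elts w1 ==> itQone \<cdot> x = hempty"
  unfolding itP_def itle_def itone_def itQ_def itQle_def itQone_def by (rule hgraph(3); simp)+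

lemma it_closed: "itP \<in> M" "itle \<in> M" "itone \<in> M" "itQ \<in> M" "itQle \<in> M" "itQone \<in> M"
  unfolding itP_def itle_def itone_def itQ_def itQle_def itQone_def hgraph_def
  by (rule dff_const_closed,
    intro dff_image elem dff_hpair var dff_Pc dff_lc dff_oc dff_Qc dff_Qlc w1M hempty_closed hsucc_closed)+

lemma it_hfun: "hfun itP (elts (hsucc w1))" "hfun itle (elts (hsucc w1))" "hfun itone (elts (hsucc w1))"
  "hfun itQ (elts w1)" "hfun itQle (elts w1)" "hfun itQone (elts w1)"
  unfolding itP_def itle_def itone_def itQ_def itQle_def itQone_def by (rule hgraph(2); simp)+

lemma Qc_dom: "(\<exists>r. hpair t r \<in> elts (Qc x)) <-> (\<exists>a\<in>elts R. t = coord a x)"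
proof (cases "x = hempty")
  case True
  then show ?thesis unfolding Qc_def elts_hcheck by (auto simp: coord_def oc_def)
next
  case False
  then show ?thesis unfolding Qc_def elts_hcheck by (auto simp: coord_def intro: exI[of _ hempty])
qed

text \<open>At x = 0 the new coordinate carries the element of \<open>R\<close>; at later x it has
  only one possible value, and the element of \<open>R\<close> is read off the restriction.\<close>

lemma succ_stage:
  assumes x: "x \<in> elts w1"
  shows "p \<in> elts (Pc (hsucc x)) <-> hfun p (elts (hsucc x)) \<and> hrestrict p x \<in> elts (Pc x) \<and>
    (\<exists>r. hpair (p \<cdot> x) r \<in> elts (Qc x)) \<and>
    forces M (Pc x) (lc x) (hrestrict p x) (\<lambda>v. v (p \<cdot> x) \<in> elts (v (Qc x)))"
proof
  have ox: "hordinal x" using w1_hordinal[OF x] .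
  assume "p \<in> elts (Pc (hsucc x))"
  then obtain a where a: "a \<in> elts R" "p = cn (hsucc x) a" unfolding elts_Pc by blast
  have px: "p \<cdot> x = coord a x" using a cn(2)[of x "hsucc x" a] by simp
  have "forces M (Pc x) (lc x) (hrestrict p x) (\<lambda>v. v (p \<cdot> x) \<in> elts (v (Qc x)))"
  proof (rule forces_I[OF ox])
    fix G assume G: "oc x \<in> G"
    show "val G (p \<cdot> x) \<in> elts (val G (Qc x))"
      unfolding val_Qc[OF G] px coord_def using a(1) G val_hcheck[of hempty G] by (auto simp: oc_def)
  qed
  moreover have "hrestrict p x = cn x a" unfolding a(2) by (rule hrestrict_cn) auto
  then have "hrestrict p x \<in> elts (Pc x)" unfolding elts_Pc using a(1) by blast
  moreover have "hfun p (elts (hsucc x))" unfolding a(2) by (rule cn(1))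
  moreover have "\<exists>r. hpair (p \<cdot> x) r \<in> elts (Qc x)" unfolding Qc_dom px using a(1) by blast
  ultimately show "hfun p (elts (hsucc x)) \<and> hrestrict p x \<in> elts (Pc x) \<and>
    (\<exists>r. hpair (p \<cdot> x) r \<in> elts (Qc x)) \<and>
    forces M (Pc x) (lc x) (hrestrict p x) (\<lambda>v. v (p \<cdot> x) \<in> elts (v (Qc x)))"
    by blast
next
  assume h: "hfun p (elts (hsucc x)) \<and> hrestrict p x \<in> elts (Pc x) \<and>
    (\<exists>r. hpair (p \<cdot> x) r \<in> elts (Qc x)) \<and>
    forces M (Pc x) (lc x) (hrestrict p x) (\<lambda>v. v (p \<cdot> x) \<in> elts (v (Qc x)))"
  then obtain a b where a: "a \<in> elts R" "hrestrict p x = cn x a" and b: "b \<in> elts R" "p \<cdot> x = coord b x"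
    unfolding elts_Pc Qc_dom by blast
  have pb: "p \<cdot> \<beta> = coord a \<beta>" if "\<beta> \<in> elts x" for \<beta>
  proof -
    have "hrestrict p x \<cdot> \<beta> = p \<cdot> \<beta>"
      by (rule hfun_hrestrict(2)[of p "elts (hsucc x)"]) (use h that in auto)
    then show ?thesis using cn(2)[OF that, of a] a(2) by simp
  qed
  have "hordinal x" using w1_hordinal[OF x] .
  then consider "x = hempty" | "hempty \<in> elts x" using hordinal_cases by blast
  then show "p \<in> elts (Pc (hsucc x))"
  proof cases
    case 1
    then have "p = cn (hsucc x) b" using h b by (intro cn_eqI) auto
    then show ?thesis unfolding elts_Pc using b by blast
  next
    case 2
    then have "x \<noteq> hempty" by auto
    then have "p = cn (hsucc x) a" using h b pb by (intro cn_eqI) (auto simp: coord_def)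
    then show ?thesis unfolding elts_Pc using a by blast
  qed
qed

lemma succ_stage_order:
  assumes x: "x \<in> elts w1" and p: "p \<in> elts (Pc (hsucc x))" and q: "q \<in> elts (Pc (hsucc x))"
  shows "hpair p q \<in> elts (lc (hsucc x)) <-> hpair (hrestrict p x) (hrestrict q x) \<in> elts (lc x) \<and>
    forces M (Pc x) (lc x) (hrestrict p x) (\<lambda>v. hpair (v (p \<cdot> x)) (v (q \<cdot> x)) \<in> elts (v (Qlc x)))"
proof -
  obtain a where a: "a \<in> elts R" "p = cn (hsucc x) a" using p unfolding elts_Pc by blast
  obtain b where b: "b \<in> elts R" "q = cn (hsucc x) b" using q unfolding elts_Pc by blast
  have ox: "hordinal x" using w1_hordinal[OF x] .
  have 0: "hempty \<in> elts (hsucc x)" using hordinal_cases[OF ox] by auto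
  have r: "hrestrict p x = cn x a" "hrestrict q x = cn x b" unfolding a b by (rule hrestrict_cn; auto)+
  have px: "p \<cdot> x = coord a x" "q \<cdot> x = coord b x" unfolding a b by (rule cn(2); simp)+
  have L: "hpair p q \<in> elts (lc (hsucc x)) <-> ext a b" unfolding a b using lc_iff[OF 0] a b by blast
  show ?thesis
  proof (cases "x = hempty")
    case True
    have "forces M (Pc x) (lc x) (hrestrict p x) (\<lambda>v. hpair (v (p \<cdot> x)) (v (q \<cdot> x)) \<in> elts (v (Qlc x))) <-> ext a b"
    proof
      assume "forces M (Pc x) (lc x) (hrestrict p x) (\<lambda>v. hpair (v (p \<cdot> x)) (v (q \<cdot> x)) \<in> elts (v (Qlc x)))"
      then have "hpair (val {hempty} (p \<cdot> x)) (val {hempty} (q \<cdot> x)) \<in> elts (val {hempty} (Qlc x))"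
        using forces_trivial[of "\<lambda>v. hpair (v (p \<cdot> x)) (v (q \<cdot> x)) \<in> elts (v (Qlc x))"] True r by simp
      then have "hpair a b \<in> elts (leq w1)"
        using val_Qlc[of x "{hempty}"] val_hcheck[of hempty "{hempty}"] px True by (simp add: oc_def coord_def)
      then show "ext a b" using leq_iff by blast
    next
      assume e: "ext a b"
      show "forces M (Pc x) (lc x) (hrestrict p x) (\<lambda>v. hpair (v (p \<cdot> x)) (v (q \<cdot> x)) \<in> elts (v (Qlc x)))"
      proof (rule forces_I[OF ox])
        fix G assume G: "oc x \<in> G"
        then have "hempty \<in> G" using True by (simp add: oc_def)
        then show "hpair (val G (p \<cdot> x)) (val G (q \<cdot> x)) \<in> elts (val G (Qlc x))"
          unfolding val_Qlc[OF G] px coord_def using True val_hcheck[of hempty G] e a b leq_iff by simp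
      qed
    qed
    then show ?thesis using L r True lc_hempty by simp
  next
    case False
    have "forces M (Pc x) (lc x) (hrestrict p x) (\<lambda>v. hpair (v (p \<cdot> x)) (v (q \<cdot> x)) \<in> elts (v (Qlc x)))"
    proof (rule forces_I[OF ox])
      fix G assume G: "oc x \<in> G"
      show "hpair (val G (p \<cdot> x)) (val G (q \<cdot> x)) \<in> elts (val G (Qlc x))"
        unfolding val_Qlc[OF G] px coord_def using False by simp
    qed
    moreover have "hempty \<in> elts x" using hordinal_cases[OF ox] False by blast
    ultimately show ?thesis using L r lc_iff a(1) b(1) by simp
  qed
qed

text \<open>All coordinates other than 0 are trivial, so a support has at most one element and
  coordinate 0 determines the whole sequence.\<close>

lemma limit_stage:
  assumes x: "x \<in> M" "hordinal x" and lim: "hlimit x"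
  shows "p \<in> elts (Pc x) <-> hfun p (elts x) \<and> (\<forall>y\<in>elts x. hrestrict p y \<in> elts (Pc y)) \<and>
    finite_in M {y \<in> elts x. p \<cdot> y \<noteq> hempty}"
proof
  have xs: "elts y \<subseteq> elts x" if "y \<in> elts x" for y using x(2) that unfolding hordinal_def by blast
  have xM: "elts x \<subseteq> M" using transD x by blast
  assume "p \<in> elts (Pc x)"
  then obtain a where a: "a \<in> elts R" "p = cn x a" unfolding elts_Pc by blast
  have "{y \<in> elts x. p \<cdot> y \<noteq> hempty} \<subseteq> {hempty}" 
  proof
    fix y assume y: "y \<in> {y \<in> elts x. p \<cdot> y \<noteq> hempty}"
    then have "coord a y \<noteq> hempty" using cn(2)[of y x a] a(2) by simp
    then show "y \<in> {hempty}" unfolding coord_def by (simp split: if_splits)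
  qed
  then have "finite {y \<in> elts x. p \<cdot> y \<noteq> hempty}" by (rule finite_subset) simp
  then have "finite_in M {y \<in> elts x. p \<cdot> y \<noteq> hempty}" using xM by (subst finite_in_iff) auto
  moreover have "\<forall>y\<in>elts x. hrestrict p y \<in> elts (Pc y)" unfolding a(2) elts_Pc using hrestrict_cn xs a(1) by auto
  ultimately show "hfun p (elts x) \<and> (\<forall>y\<in>elts x. hrestrict p y \<in> elts (Pc y)) \<and>
    finite_in M {y \<in> elts x. p \<cdot> y \<noteq> hempty}" using a(2) cn(1) by blast
next
  have xs: "elts y \<subseteq> elts x" if "y \<in> elts x" for y using x(2) that unfolding hordinal_def by blast
  have sx: "hsucc y \<in> elts x" if "y \<in> elts x" for y using lim that unfolding hlimit_def by blast
  have 0: "hempty \<in> elts x" using hordinal_cases[OF x(2)] lim unfolding hlimit_def by blast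
  assume h: "hfun p (elts x) \<and> (\<forall>y\<in>elts x. hrestrict p y \<in> elts (Pc y)) \<and> finite_in M {y \<in> elts x. p \<cdot> y \<noteq> hempty}"
  have c: "\<exists>b\<in>elts R. p \<cdot> \<beta> = coord b \<beta>" if b: "\<beta> \<in> elts x" for \<beta>
  proof -
    obtain c where c: "c \<in> elts R" "hrestrict p (hsucc \<beta>) = cn (hsucc \<beta>) c"
      using h sx[OF b] unfolding elts_Pc by blast
    have "p \<cdot> \<beta> = coord c \<beta>"
      using hfun_hrestrict(2)[of p "elts x" "hsucc \<beta>" \<beta>] h xs[OF sx[OF b]] cn(2)[of \<beta> "hsucc \<beta>" c] c(2) by auto
    then show ?thesis using c(1) by blast
  qed
  obtain a where a: "a \<in> elts R" "p \<cdot> hempty = coord a hempty" using c[OF 0] by blast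
  have "p \<cdot> \<beta> = coord a \<beta>" if "\<beta> \<in> elts x" for \<beta>
    using c[OF that] a(2) by (cases "\<beta> = hempty") (auto simp: coord_def)
  then have "p = cn x a" using h by (intro cn_eqI) auto
  then show "p \<in> elts (Pc x)" unfolding elts_Pc using a(1) by blast
qed

lemma limit_stage_order:
  assumes x: "hordinal x" and lim: "hlimit x" and p: "p \<in> elts (Pc x)" and q: "q \<in> elts (Pc x)"
  shows "hpair p q \<in> elts (lc x) <-> (\<forall>y\<in>elts x. hpair (hrestrict p y) (hrestrict q y) \<in> elts (lc y))"
proof -
  have xs: "elts y \<subseteq> elts x" if "y \<in> elts x" for y using x that unfolding hordinal_def by blast
  have 0: "hempty \<in> elts x" using hordinal_cases[OF x] lim unfolding hlimit_def by blast
  then have 1: "hsucc hempty \<in> elts x" using lim unfolding hlimit_def by blast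
  obtain a where a: "a \<in> elts R" "p = cn x a" using p unfolding elts_Pc by blast
  obtain b where b: "b \<in> elts R" "q = cn x b" using q unfolding elts_Pc by blast
  have r: "hrestrict p y = cn y a" "hrestrict q y = cn y b" if "y \<in> elts x" for y
    unfolding a b by (rule hrestrict_cn[OF xs[OF that]])+
  have L: "hpair p q \<in> elts (lc x) <-> ext a b" unfolding a b using lc_iff[OF 0] a b by blast
  show ?thesis
  proof
    assume "hpair p q \<in> elts (lc x)"
    then have "ext a b" using L by blast
    then show "\<forall>y\<in>elts x. hpair (hrestrict p y) (hrestrict q y) \<in> elts (lc y)"
      using r a b unfolding lc_iff' by blast
  next
    assume "\<forall>y\<in>elts x. hpair (hrestrict p y) (hrestrict q y) \<in> elts (lc y)"
    \<comment> \<open>Stage 1 already decides the order, because it contains the only nontrivial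
      coordinate.\<close>
    then have "hpair (cn (hsucc hempty) a) (cn (hsucc hempty) b) \<in> elts (lc (hsucc hempty))" using 1 r by metis
    then show "hpair p q \<in> elts (lc x)" using L lc_iff[of "hsucc hempty" a b] a b by simp
  qed
qed

lemma succ_w1: "x \<in> elts (hsucc w1) ==> x \<in> M \<and> hordinal x"
  using w1D w1_hordinal w1_ord by auto

lemma iteration: "fs_iteration_in M w1 itP itle itone itQ itQle itQone"
  unfolding fs_iteration_in_def
proof (intro conjI)
  show "w1 \<in> M" "hordinal w1" using w1_ord by simp_all
  show "\<forall>f\<in>{itP, itle, itone}. f \<in> M \<and> hfun f (elts (hsucc w1))" using it_closed it_hfun by blast
  show "\<forall>f\<in>{itQ, itQle, itQone}. f \<in> M \<and> hfun f (elts w1)" using it_closed it_hfun by blast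
  have sub: "elts x \<subseteq> elts w1" if "x \<in> elts (hsucc w1)" for x using that w1_sub by auto
  have up: "x \<in> elts (hsucc w1)" if "x \<in> elts w1" for x using that by simp
  have us: "hsucc x \<in> elts (hsucc w1)" if "x \<in> elts w1" for x using that w1_hsucc by simp
  have p0: "hempty \<in> elts (hsucc w1)" using hempty_w1 by simp
  show "\<forall>x\<in>elts (hsucc w1). forcing_poset (itP \<cdot> x) (itle \<cdot> x) (itone \<cdot> x) \<and>
      hfun (itone \<cdot> x) (elts x) \<and> (\<forall>y\<in>elts x. itone \<cdot> x \<cdot> y = itQone \<cdot> y)"
  proof (intro ballI conjI)
    fix x assume x: "x \<in> elts (hsucc w1)"
    show "forcing_poset (itP \<cdot> x) (itle \<cdot> x) (itone \<cdot> x)" unfolding it_app(1-3)[OF x] using poset_Pc succ_w1[OF x] by blast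
    show "hfun (itone \<cdot> x) (elts x)" unfolding it_app(3)[OF x] oc_def by (rule cn(1))
    show "itone \<cdot> x \<cdot> y = itQone \<cdot> y" if "y \<in> elts x" for y
      using it_app(3)[OF x] it_app(6)[of y] sub[OF x] that oc_app by auto
  qed
  show "\<forall>x\<in>elts w1. poset_name M (itP \<cdot> x) (itle \<cdot> x) (itone \<cdot> x) (itQ \<cdot> x) (itQle \<cdot> x) (itQone \<cdot> x)"
  proof
    fix x assume x: "x \<in> elts w1"
    have xM: "x \<in> M" "hordinal x" using succ_w1[OF up[OF x]] by blast+
    have o: "oc x \<in> elts (Pc x)" unfolding oc_def elts_Pc by simp
    have tr: "forcing_poset (hset {hempty}) (hset {hpair hempty hempty}) hempty"
      unfolding forcing_poset_def by simp
    have "forces M (Pc x) (lc x) (oc x) (\<lambda>v. forcing_poset (v (Qc x)) (v (Qlc x)) (v hempty))"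
      by (rule forces_I[OF xM(2)]) (simp add: val_Qc val_Qlc poset_fs tr)
    moreover have "\<exists>r. hpair hempty r \<in> elts (Qc x)"
      unfolding Qc_dom by (rule bexI[of _ hempty]) (auto simp: coord_def)
    moreover have "pname (Pc x) hempty" by (rule pname.intros) simp
    ultimately show "poset_name M (itP \<cdot> x) (itle \<cdot> x) (itone \<cdot> x) (itQ \<cdot> x) (itQle \<cdot> x) (itQone \<cdot> x)"
      unfolding it_app(1-3)[OF up[OF x]] it_app(4-6)[OF x] poset_name_def
      using Qc_closed[OF xM(1)] Qlc_closed[OF xM(1)] pname_hcheck[OF o] by (simp add: Qc_def Qlc_def)
  qed
  show "elts (itP \<cdot> hempty) = {hempty}"
    unfolding it_app(1)[OF p0] by (rule elts_Pc_hempty)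
  show "\<forall>x\<in>elts w1.
      (\<forall>p\<in>M. p \<in> elts (itP \<cdot> hsucc x) <->
        hfun p (elts (hsucc x)) \<and> hrestrict p x \<in> elts (itP \<cdot> x) \<and>
        (\<exists>r. hpair (p \<cdot> x) r \<in> elts (itQ \<cdot> x)) \<and>
        forces M (itP \<cdot> x) (itle \<cdot> x) (hrestrict p x) (\<lambda>v. v (p \<cdot> x) \<in> elts (v (itQ \<cdot> x)))) \<and>
      (\<forall>p\<in>elts (itP \<cdot> hsucc x). \<forall>q\<in>elts (itP \<cdot> hsucc x).
        hpair p q \<in> elts (itle \<cdot> hsucc x) <->
          hpair (hrestrict p x) (hrestrict q x) \<in> elts (itle \<cdot> x) \<and>
          forces M (itP \<cdot> x) (itle \<cdot> x) (hrestrict p x)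
            (\<lambda>v. hpair (v (p \<cdot> x)) (v (q \<cdot> x)) \<in> elts (v (itQle \<cdot> x))))"
  proof
    fix x assume x: "x \<in> elts w1"
    show "(\<forall>p\<in>M. p \<in> elts (itP \<cdot> hsucc x) <->
        hfun p (elts (hsucc x)) \<and> hrestrict p x \<in> elts (itP \<cdot> x) \<and>
        (\<exists>r. hpair (p \<cdot> x) r \<in> elts (itQ \<cdot> x)) \<and>
        forces M (itP \<cdot> x) (itle \<cdot> x) (hrestrict p x) (\<lambda>v. v (p \<cdot> x) \<in> elts (v (itQ \<cdot> x)))) \<and>
      (\<forall>p\<in>elts (itP \<cdot> hsucc x). \<forall>q\<in>elts (itP \<cdot> hsucc x).
        hpair p q \<in> elts (itle \<cdot> hsucc x) <->
          hpair (hrestrict p x) (hrestrict q x) \<in> elts (itle \<cdot> x) \<and>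
          forces M (itP \<cdot> x) (itle \<cdot> x) (hrestrict p x)
            (\<lambda>v. hpair (v (p \<cdot> x)) (v (q \<cdot> x)) \<in> elts (v (itQle \<cdot> x))))"
      unfolding it_app(1,2)[OF up[OF x]] it_app(1,2)[OF us[OF x]] it_app(4,5)[OF x]
      using succ_stage[OF x] succ_stage_order[OF x] by blast
  qed
  show "\<forall>x\<in>elts (hsucc w1). hlimit x -->
      (\<forall>p\<in>M. p \<in> elts (itP \<cdot> x) <->
        hfun p (elts x) \<and> (\<forall>y\<in>elts x. hrestrict p y \<in> elts (itP \<cdot> y)) \<and>
        finite_in M {y \<in> elts x. p \<cdot> y \<noteq> itQone \<cdot> y}) \<and>
      (\<forall>p\<in>elts (itP \<cdot> x). \<forall>q\<in>elts (itP \<cdot> x).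
        hpair p q \<in> elts (itle \<cdot> x) <->
          (\<forall>y\<in>elts x. hpair (hrestrict p y) (hrestrict q y) \<in> elts (itle \<cdot> y)))"
  proof (intro ballI impI)
    fix x assume x: "x \<in> elts (hsucc w1)" "hlimit x"
    have y: "itP \<cdot> y = Pc y" "itle \<cdot> y = lc y" "itQone \<cdot> y = hempty" if "y \<in> elts x" for y
      using it_app[of y] sub[OF x(1)] up that by blast+
    have e: "{y \<in> elts x. p \<cdot> y \<noteq> itQone \<cdot> y} = {y \<in> elts x. p \<cdot> y \<noteq> hempty}" for p using y(3) by auto
    show "(\<forall>p\<in>M. p \<in> elts (itP \<cdot> x) <->
        hfun p (elts x) \<and> (\<forall>y\<in>elts x. hrestrict p y \<in> elts (itP \<cdot> y)) \<and>
        finite_in M {y \<in> elts x. p \<cdot> y \<noteq> itQone \<cdot> y}) \<and>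
      (\<forall>p\<in>elts (itP \<cdot> x). \<forall>q\<in>elts (itP \<cdot> x).
        hpair p q \<in> elts (itle \<cdot> x) <->
          (\<forall>y\<in>elts x. hpair (hrestrict p y) (hrestrict q y) \<in> elts (itle \<cdot> y)))"
      unfolding it_app(1,2)[OF x(1)] e
      using limit_stage[OF _ _ x(2)] limit_stage_order[OF _ x(2)] succ_w1[OF x(1)] y(1,2) by simp
  qed
qed

text \<open>The antichain is pulled back along the order isomorphism from \<open>R\<close> to the
  last stage, and there it is bounded.\<close>

lemma iteration_ccc: "ccc_in M (itP \<cdot> w1) (itle \<cdot> w1)"
proof -
  have w: "w1 \<in> elts (hsucc w1)" by simp
  show ?thesis unfolding it_app(1,2)[OF w] ccc_in_def
  proof (intro ballI impI)
    fix A assume A: "A \<in> M" "elts A \<subseteq> elts (Pc w1) \<and> (\<forall>p\<in>elts A. \<forall>q\<in>elts A. p \<noteq> q -->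
        \<not> (\<exists>r\<in>elts (Pc w1). hpair r p \<in> elts (lc w1) \<and> hpair r q \<in> elts (lc w1)))"
    define B where "B = hset {x \<in> elts R. cn w1 x \<in> elts A}"
    have BM: "B \<in> M" unfolding B_def by (rule sep[OF R_closed]) (intro dfi w1M A(1))
    note eB = elts_sep[OF B_def]
    have "\<exists>\<delta>\<in>elts w1. elts B \<subseteq> elts (fs \<delta>)"
    proof (rule antichain_bounded[OF BM])
      fix p q r assume h: "p \<in> elts B" "q \<in> elts B" "r \<in> elts R" "ext r p" "ext r q"
      then have "hpair (cn w1 r) (cn w1 p) \<in> elts (lc w1)" "hpair (cn w1 r) (cn w1 q) \<in> elts (lc w1)" "cn w1 r \<in> elts (Pc w1)"
        unfolding lc_iff' elts_Pc eB by blast+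
      then have "cn w1 p = cn w1 q" using A(2) h(1,2) unfolding eB by blast
      then show "p = q" using cn_inj[OF hempty_w1] by blast
    qed (use eB in blast)
    then obtain \<delta> where \<delta>: "\<delta> \<in> elts w1" "elts B \<subseteq> elts (fs \<delta>)" by blast
    have \<delta>M: "fs \<delta> \<in> M" using fs_closed w1D \<delta>(1) by blast
    show "countable_in M (elts A)"
    proof (rule countable_in_rel[OF A(1) fs_countable[OF \<delta>(1)], of "\<lambda>a x. a = cn w1 x"])
      show "dfn M (\<lambda>s. s 0 = cn w1 (s 1))" by (intro dfi w1M)
      show "\<exists>z\<in>elts (fs \<delta>). x = cn w1 z" if "x \<in> elts A" for x
        using that A(2) \<delta>(2) unfolding eB elts_Pc by blast
    qed (use \<delta>M in auto)
  qed
qed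

end

section \<open>The generic almost disjoint family\<close>

lemma infinite_hnat: "infinite X <-> (\<forall>n. \<exists>m\<ge>n. hnat m \<in> X)" if "X \<subseteq> range hnat" for X
proof -
  have "X = hnat ` {m. hnat m \<in> X}" using that by auto
  moreover have "finite (hnat ` {m. hnat m \<in> X}) <-> finite {m. hnat m \<in> X}"
    by (rule finite_image_iff) (simp add: inj_on_def)
  ultimately have "infinite X <-> infinite {m. hnat m \<in> X}" by simp
  also have "\<dots> <-> (\<forall>n. \<exists>m\<ge>n. hnat m \<in> X)" unfolding infinite_nat_iff_unbounded_le by simp
  finally show ?thesis .
qed

locale hechler = omega1_model +
  fixes G assumes G: "generic M (itP \<cdot> w1) (itle \<cdot> w1) G"
begin

lemma G': "generic M (Pc w1) (lc w1) G"
  using G it_app(1,2)[of w1] by simp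

end

sublocale hechler \<subseteq> FP: generic_ext_of M "Pc w1" "lc w1" "oc w1" G
  by unfold_locales (simp_all add: Pc_closed lc_closed poset_Pc w1_ord G')

context hechler
begin

abbreviation "NG \<equiv> generic_ext M (Pc w1) G"

end

sublocale hechler \<subseteq> NN: tmo "generic_ext M (Pc w1) G"
  by (rule FP.tmo_N)

context hechler
begin

text \<open>The filter on \<open>R\<close> that corresponds to \<open>G\<close>. The combinatorics
  takes place in \<open>R\<close> from here on, while the extension remains the one defined from
  \<open>G\<close>.\<close>

definition H :: "hc set" where "H = {x \<in> elts R. cn w1 x \<in> G}"

lemma HR: "x \<in> H ==> x \<in> elts R" unfolding H_def by blast

lemma cn_le: "x \<in> elts R ==> y \<in> elts R ==> hpair (cn w1 x) (cn w1 y) \<in> elts (lc w1) <-> ext x y"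
  by (rule lc_iff[OF hempty_w1])

lemma generic_H: "generic M R (leq w1) H"
  unfolding generic_def
proof (intro conjI ballI impI)
  show "H \<subseteq> elts R" using HR by blast
  have "hempty \<in> H" unfolding H_def using FP.oneG hempty_fs unfolding oc_def by blast
  then show "H \<noteq> {}" by blast
  show "q \<in> H" if "p \<in> H" "q \<in> elts R" "hpair p q \<in> elts (leq w1)" for p q
  proof -
    have "ext p q" using that(3) leq_iff by blast
    then have "hpair (cn w1 p) (cn w1 q) \<in> elts (lc w1)" using cn_le that HR by blast
    then show ?thesis using FP.G_up that unfolding H_def by blast
  qed
  show "\<exists>r\<in>H. hpair r p \<in> elts (leq w1) \<and> hpair r q \<in> elts (leq w1)" if pq: "p \<in> H" "q \<in> H" for p q
  proof -
    obtain c where c: "c \<in> G" "hpair c (cn w1 p) \<in> elts (lc w1)" "hpair c (cn w1 q) \<in> elts (lc w1)"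
      using FP.G_dir pq unfolding H_def by blast
    then obtain r where r: "r \<in> elts R" "c = cn w1 r" using FP.GP unfolding elts_Pc by blast
    then have "ext r p" "ext r q" using c cn_le HR pq by blast+
    then show ?thesis using r c HR pq unfolding H_def leq_iff by blast
  qed
  show "H \<inter> elts D \<noteq> {}" if D: "D \<in> M" "elts D \<subseteq> elts R \<and> (\<forall>p\<in>elts R. \<exists>d\<in>elts D. hpair d p \<in> elts (leq w1))" for D
  proof -
    define D' where "D' = hset ((\<lambda>x. cn w1 x) ` elts D)"
    have D'M: "D' \<in> M" unfolding D'_def by (rule dff_const_closed) (intro dff_image elem D(1) dff_cn w1M var)
    have eD': "elts D' = cn w1 ` elts D" unfolding D'_def by simp
    have "elts D' \<subseteq> elts (Pc w1)" unfolding eD' elts_Pc using D by blast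
    moreover have "\<forall>p\<in>elts (Pc w1). \<exists>d\<in>elts D'. hpair d p \<in> elts (lc w1)"
    proof
      fix p assume "p \<in> elts (Pc w1)"
      then obtain x where x: "x \<in> elts R" "p = cn w1 x" unfolding elts_Pc by blast
      then obtain d where d: "d \<in> elts D" "hpair d x \<in> elts (leq w1)" using D(2) by blast
      then have "hpair (cn w1 d) p \<in> elts (lc w1)" using x cn_le leq_iff by blast
      then show "\<exists>d\<in>elts D'. hpair d p \<in> elts (lc w1)" unfolding eD' using d(1) by blast
    qed
    ultimately have "G \<inter> elts D' \<noteq> {}" using G' D'M unfolding generic_def by blast
    then show ?thesis unfolding eD' H_def using D(2) by blast
  qed
qed

end

sublocale hechler \<subseteq> FR: generic_ext_of M "fs w1" "leq w1" hempty H
  by unfold_locales (simp_all add: poset_fs generic_H)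

context hechler
begin

lemma H_up: "p \<in> H ==> q \<in> elts R ==> ext p q ==> q \<in> H"
  using FR.G_up leq_iff HR by blast

lemma H_dir:
  assumes "p \<in> H" "q \<in> H" shows "\<exists>r\<in>H. ext r p \<and> ext r q"
proof -
  obtain r where "r \<in> H" "hpair r p \<in> elts (leq w1)" "hpair r q \<in> elts (leq w1)"
    using FR.G_dir[OF assms] by blast
  then show ?thesis by (auto simp: leq_iff)
qed

lemma H_dense_below:
  assumes D: "dfn M (\<lambda>s. D (s 0))" and p: "p \<in> H"
    and dense: "\<And>q. q \<in> elts R ==> ext q p ==> \<exists>r\<in>elts R. ext r q \<and> D r"
  shows "\<exists>r\<in>H. ext r p \<and> D r"
proof -
  have "\<exists>r\<in>H. hpair r p \<in> elts (leq w1) \<and> D r"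
  proof (rule FR.generic_dense_below[OF D p])
    fix q assume q: "q \<in> elts R" "hpair q p \<in> elts (leq w1)"
    then have "ext q p" by (simp add: leq_iff)
    then obtain r where "r \<in> elts R" "ext r q" "D r" using dense q(1) by blast
    then show "\<exists>r\<in>elts R. hpair r q \<in> elts (leq w1) \<and> D r" using q(1) by (auto simp: leq_iff)
  qed
  then show ?thesis by (auto simp: leq_iff)
qed

lemma H_dense:
  assumes D: "dfn M (\<lambda>s. D (s 0))" and dense: "\<And>q. q \<in> elts R ==> \<exists>r\<in>elts R. ext r q \<and> D r"
  shows "\<exists>r\<in>H. D r"
  using H_dense_below[OF D FR.oneG] dense by blast

lemma H_cases:
  assumes D: "dfn M (\<lambda>s. D (s 0))"
  shows "(\<exists>r\<in>H. D r) \<or> (\<exists>p\<in>H. \<forall>r\<in>elts R. ext r p --> \<not> D r)"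
proof -
  have "\<exists>p\<in>H. D p \<or> (\<forall>r\<in>elts R. ext r p --> \<not> D r)"
  proof (rule H_dense)
    show "dfn M (\<lambda>s. D (s 0) \<or> (\<forall>r\<in>elts R. ext r (s 0) --> \<not> D r))"
      by (intro dfi R_closed dfn_comp1[where Q = D, OF D])
  qed (use ext_refl in blast)
  then show ?thesis by blast
qed

section \<open>Intermediate extensions by the sets with index below \<delta>\<close>

definition Hd :: "hc => hc set" where "Hd \<delta> = H \<inter> elts (fs \<delta>)"
abbreviation Nd :: "hc => hc set" where "Nd \<delta> \<equiv> generic_ext M (fs \<delta>) (Hd \<delta>)"

lemma hrestrict_Hd: "p \<in> H ==> \<delta> \<in> elts w1 ==> hrestrict p \<delta> \<in> Hd \<delta>"
  unfolding Hd_def using H_up[of p "hrestrict p \<delta>"] ext_hrestrict fs_hrestrict[OF HR] fs_mono[OF w1_sub] by blast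

text \<open>A dense set of conditions supported in \<delta> stays predense in \<open>R\<close>: a
  full extension of an arbitrary condition is restricted to \<delta>, the restriction is extended
  into the dense set, and the result is amalgamated with the full extension.\<close>

lemma generic_Hd:
  assumes \<delta>: "\<delta> \<in> elts w1" "infinite (elts \<delta>)" shows "generic M (fs \<delta>) (leq \<delta>) (Hd \<delta>)"
  unfolding generic_def
proof (intro conjI ballI impI)
  have sub: "elts (fs \<delta>) \<subseteq> elts R" using fs_mono[OF w1_sub[OF \<delta>(1)]] .
  show "Hd \<delta> \<subseteq> elts (fs \<delta>)" unfolding Hd_def by blast
  have "hempty \<in> Hd \<delta>" unfolding Hd_def using FR.oneG by simp
  then show "Hd \<delta> \<noteq> {}" by blast
  show "q \<in> Hd \<delta>" if "p \<in> Hd \<delta>" "q \<in> elts (fs \<delta>)" "hpair p q \<in> elts (leq \<delta>)" for p q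
    using that H_up sub unfolding Hd_def leq_iff by blast
  show "\<exists>r\<in>Hd \<delta>. hpair r p \<in> elts (leq \<delta>) \<and> hpair r q \<in> elts (leq \<delta>)" if pq: "p \<in> Hd \<delta>" "q \<in> Hd \<delta>" for p q
  proof -
    obtain r where r: "r \<in> H" "ext r p" "ext r q" using H_dir pq unfolding Hd_def by blast
    have "ext (hrestrict r \<delta>) p" "ext (hrestrict r \<delta>) q" using ext_hrestrict_fs r pq unfolding Hd_def by blast+
    then show ?thesis using hrestrict_Hd[OF r(1) \<delta>(1)] pq unfolding leq_iff Hd_def by blast
  qed
  show "Hd \<delta> \<inter> elts D \<noteq> {}" if D: "D \<in> M" "elts D \<subseteq> elts (fs \<delta>) \<and> (\<forall>p\<in>elts (fs \<delta>). \<exists>d\<in>elts D. hpair d p \<in> elts (leq \<delta>))" for D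
  proof -
    have "\<exists>r\<in>H. \<exists>d\<in>elts D. ext r d"
    proof (rule H_dense)
      show "dfn M (\<lambda>s. \<exists>d\<in>elts D. ext (s 0) d)" by (intro dfi D(1))
      fix p assume p: "p \<in> elts R"
      obtain p' where p': "p' \<in> elts R" "ext p' p" "full p' \<delta>" using full_ext[OF p \<delta>(2) w1_sub[OF \<delta>(1)]] by blast
      obtain d where d: "d \<in> elts D" "hpair d (hrestrict p' \<delta>) \<in> elts (leq \<delta>)"
        using D(2) fs_hrestrict[OF p'(1)] by blast
      then have d2: "d \<in> elts (fs \<delta>)" "ext d (hrestrict p' \<delta>)" unfolding leq_iff by blast+
      have "ext (hun d p') p" "ext (hun d p') d" using amalgamate[OF p'(3) d2] p'(2) ext_trans by blast+
      moreover have "hun d p' \<in> elts R" using d2(1) sub p'(1) by (intro fs_hun) blast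
      ultimately show "\<exists>r\<in>elts R. ext r p \<and> (\<exists>d\<in>elts D. ext r d)" using d(1) by blast
    qed
    then obtain r d where "r \<in> H" "d \<in> elts D" "ext r d" by blast
    then show ?thesis using H_up[of r d] D(2) sub unfolding Hd_def by blast
  qed
qed

lemma ext_of_Hd:
  assumes \<delta>: "\<delta> \<in> elts w1" "infinite (elts \<delta>)" shows "generic_ext_of M (fs \<delta>) (leq \<delta>) hempty (Hd \<delta>)"
proof -
  interpret F: forcing M "fs \<delta>" "leq \<delta>" hempty by (rule forcing_fs[OF w1D[OF \<delta>(1)]])
  show ?thesis by unfold_locales (rule generic_Hd[OF \<delta>])
qed

lemma nice_name_R:
  assumes X: "X \<in> NG" "Z \<in> M" "elts X \<subseteq> elts Z"
  shows "\<exists>\<tau>\<in>M. (\<forall>z\<in>elts Z. z \<in> elts X <-> (\<exists>p\<in>H. hpair z p \<in> elts \<tau>)) \<and>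
    (\<forall>z p q. hpair z p \<in> elts \<tau> \<and> q \<in> elts R \<and> ext q p --> hpair z q \<in> elts \<tau>)"
proof -
  obtain \<sigma> where \<sigma>: "\<sigma> \<in> M" "\<forall>z\<in>elts Z. z \<in> elts X <-> (\<exists>p\<in>G. hpair z p \<in> elts \<sigma>)"
    "\<forall>z p q. hpair z p \<in> elts \<sigma> \<and> hpair q p \<in> elts (lc w1) --> hpair z q \<in> elts \<sigma>"
    using FP.nice_name[OF X] by blast
  define \<tau> where "\<tau> = hset {w \<in> elts (hprd Z R). \<exists>z\<in>elts Z. \<exists>x\<in>elts R. w = hpair z x \<and> hpair z (cn w1 x) \<in> elts \<sigma>}"
  have \<tau>M: "\<tau> \<in> M" unfolding \<tau>_def by (rule sep, simp add: X(2)) (intro dfi X(2) w1M \<sigma>(1))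
  have e\<tau>: "elts \<tau> = {w \<in> elts (hprd Z R). \<exists>z\<in>elts Z. \<exists>x\<in>elts R. w = hpair z x \<and> hpair z (cn w1 x) \<in> elts \<sigma>}"
    by (rule elts_sep[OF \<tau>_def])
  have \<tau>: "hpair z x \<in> elts \<tau> <-> z \<in> elts Z \<and> x \<in> elts R \<and> hpair z (cn w1 x) \<in> elts \<sigma>" for z x
    unfolding e\<tau> by auto
  have "z \<in> elts X <-> (\<exists>p\<in>H. hpair z p \<in> elts \<tau>)" if z: "z \<in> elts Z" for z
  proof -
    have "z \<in> elts X <-> (\<exists>p\<in>G. hpair z p \<in> elts \<sigma>)" using \<sigma>(2) z by blast
    also have "\<dots> <-> (\<exists>x\<in>H. hpair z (cn w1 x) \<in> elts \<sigma>)"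
      using FP.GP unfolding H_def elts_Pc by blast
    finally show ?thesis unfolding \<tau> using z HR by blast
  qed
  moreover have "hpair z q \<in> elts \<tau>" if "hpair z p \<in> elts \<tau>" "q \<in> elts R" "ext q p" for z p q
    using that \<sigma>(3) cn_le unfolding \<tau> by blast
  ultimately show ?thesis using \<tau>M by blast
qed

lemma countable_H: "countable H" using HR countable_subset[of H "elts R"] by auto

lemma H_in_NG: "hset H \<in> NG"
proof -
  define cg where "cg = hset ((\<lambda>x. hpair x (cn w1 x)) ` elts R)"
  have "cg \<in> M" unfolding cg_def by (rule dff_const_closed) (intro dff_image elem R_closed dff_hpair var dff_cn w1M)
  then have cg: "cg \<in> NG" using FP.M_sub_N by blast
  have RN: "R \<in> NG" using FP.M_sub_N by simp
  have "hset {x \<in> elts R. \<exists>g\<in>elts (hset G). hpair x g \<in> elts cg} \<in> NG"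
    by (rule NN.sep[OF RN]) (intro NN.bex NN.mem NN.dff_rules FP.G_in_N cg)
  moreover have "countable G" using FP.GP countable_subset[of G "elts (Pc w1)"] by auto
  then have "{x \<in> elts R. \<exists>g\<in>elts (hset G). hpair x g \<in> elts cg} = H"
    unfolding H_def cg_def by auto
  ultimately show ?thesis by simp
qed

lemma ground_sub_NG: "x \<in> M ==> x \<in> NG" by (rule FP.M_sub_N)

text \<open>Only subsets of ground model sets are transferred; such a set is definable in the large
  extension from its description in the ground model and \<open>H\<close>.\<close>

lemma Nd_sub_NG:
  assumes \<delta>: "\<delta> \<in> elts w1" "infinite (elts \<delta>)" and X: "X \<in> Nd \<delta>" "Z \<in> M" "elts X \<subseteq> elts Z"
  shows "X \<in> NG"
proof -
  interpret F: generic_ext_of M "fs \<delta>" "leq \<delta>" hempty "Hd \<delta>" by (rule ext_of_Hd[OF \<delta>])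
  obtain \<tau> where \<tau>: "\<tau> \<in> M" "\<forall>z\<in>elts Z. z \<in> elts X <-> (\<exists>p\<in>Hd \<delta>. hpair z p \<in> elts \<tau>)"
    using F.nice_name[OF X] by blast
  have dM: "fs \<delta> \<in> M" using fs_closed w1D[OF \<delta>(1)] by blast
  have "hset {z \<in> elts Z. \<exists>p\<in>elts (hset H). p \<in> elts (fs \<delta>) \<and> hpair z p \<in> elts \<tau>} \<in> NG"
    by (rule NN.sep[OF ground_sub_NG[OF X(2)]])
      (intro NN.bex NN.mem dfn_conj NN.dff_hpair NN.elem NN.var H_in_NG ground_sub_NG \<tau>(1) dM)
  moreover have "{z \<in> elts Z. \<exists>p\<in>elts (hset H). p \<in> elts (fs \<delta>) \<and> hpair z p \<in> elts \<tau>} = elts X"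
    using \<tau>(2) X(3) countable_H unfolding Hd_def by auto
  ultimately show ?thesis by simp
qed

text \<open>Whether z belongs to X is a countable family of questions, each decided densely.
  Reflection provides \<delta> such that conditions supported in \<delta> have deciding extensions
  supported in \<delta>; then \<open>Hd \<delta>\<close> contains an answer to every
  question.\<close>

lemma countable_bounded:
  assumes X: "X \<in> NG" "elts X \<subseteq> elts Z" and Z: "Z \<in> M" "countable_in M (elts Z)"
  shows "\<exists>\<delta>\<in>elts w1. infinite (elts \<delta>) \<and> X \<in> Nd \<delta>"
proof -
  obtain \<tau> where \<tau>: "\<tau> \<in> M" "\<And>z. z \<in> elts Z ==> z \<in> elts X <-> (\<exists>p\<in>H. hpair z p \<in> elts \<tau>)"
    "\<And>z p q. hpair z p \<in> elts \<tau> ==> q \<in> elts R ==> ext q p ==> hpair z q \<in> elts \<tau>"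
    using nice_name_R[OF X(1) Z(1) X(2)] by blast
  define dec where "dec z p <-> hpair z p \<in> elts \<tau> \<or> (\<forall>q\<in>elts R. ext q p --> hpair z q \<notin> elts \<tau>)" for z p
  define E where "E r z p <-> ext p r \<and> dec z p" for r z p
  have Ddec: "dfn M (\<lambda>s. dec (s 0) (s 1))" unfolding dec_def by (intro dfi w1M \<tau>(1))
  have D: "dfn M (\<lambda>s. E (s 0) (s 1) (s 2))" unfolding E_def by (intro dfi dfn_comp2[where Q = dec, OF Ddec])
  obtain \<delta> where \<delta>: "\<delta> \<in> elts w1" "infinite (elts \<delta>)"
    "\<forall>r\<in>elts (fs \<delta>). \<forall>z\<in>elts Z. (\<exists>p\<in>elts R. E r z p) --> (\<exists>p\<in>elts (fs \<delta>). E r z p)"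
    using reflection_infinite[OF D Z] by blast
  have sub: "elts (fs \<delta>) \<subseteq> elts R" using fs_mono[OF w1_sub[OF \<delta>(1)]] .
  interpret F: generic_ext_of M "fs \<delta>" "leq \<delta>" hempty "Hd \<delta>" by (rule ext_of_Hd[OF \<delta>(1,2)])
  have ex: "\<exists>p\<in>elts R. E r z p" if "r \<in> elts R" for r z
    using that ext_refl unfolding E_def dec_def by blast
  have X_iff: "z \<in> elts X <-> (\<exists>p\<in>Hd \<delta>. hpair z p \<in> elts \<tau>)" if z: "z \<in> elts Z" for z
  proof
    assume "z \<in> elts X"
    then obtain x where x: "x \<in> H" "hpair z x \<in> elts \<tau>" using \<tau>(2)[OF z] by blast
    have zM: "z \<in> M" using transD[OF z Z(1)] .
    have "\<exists>p\<in>Hd \<delta>. dec z p"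
    proof (rule F.generic_dense)
      show "dfn M (\<lambda>s. dec z (s 0))" by (intro dfi zM dfn_comp2[where Q = dec, OF Ddec])
      fix r assume r: "r \<in> elts (fs \<delta>)"
      then obtain p where "p \<in> elts (fs \<delta>)" "E r z p" using \<delta>(3) ex sub z by blast
      then show "\<exists>p\<in>elts (fs \<delta>). hpair p r \<in> elts (leq \<delta>) \<and> dec z p" using r unfolding E_def leq_iff by blast
    qed
    then obtain p where p: "p \<in> Hd \<delta>" "dec z p" by blast
    obtain r where "r \<in> H" "ext r p" "ext r x" using H_dir[OF _ x(1)] p(1) unfolding Hd_def by blast
    then have "hpair z p \<in> elts \<tau>" using p(2) \<tau>(3)[OF x(2)] HR unfolding dec_def by blast
    then show "\<exists>p\<in>Hd \<delta>. hpair z p \<in> elts \<tau>" using p(1) by blast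
  qed (use \<tau>(2)[OF z] in \<open>unfold Hd_def, blast\<close>)
  interpret T: tm "Nd \<delta>" by (rule F.tm_N)
  have cHd: "countable (Hd \<delta>)" using countable_H countable_subset[of "Hd \<delta>" H] unfolding Hd_def by auto
  have "hset {z \<in> elts Z. \<exists>p\<in>elts (hset (Hd \<delta>)). hpair z p \<in> elts \<tau>} \<in> Nd \<delta>"
    by (rule T.sep[OF F.M_sub_N[OF Z(1)]])
      (intro T.bex T.mem T.dff_hpair T.elem T.var F.G_in_N F.M_sub_N \<tau>(1))
  moreover have "{z \<in> elts Z. \<exists>p\<in>elts (hset (Hd \<delta>)). hpair z p \<in> elts \<tau>} = elts X"
    using X_iff X(2) cHd by auto
  ultimately have "X \<in> Nd \<delta>" by simp
  then show ?thesis using \<delta> by blast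
qed

text \<open>A number that occurs in no row can be put into any row, since it creates no common
  element.\<close>

lemma add_new:
  assumes x: "x \<in> elts R" and \<alpha>: "\<alpha> \<in> elts w1" and m: "\<And>\<beta>. hpair \<beta> (hnat m) \<notin> elts x"
  shows "hun x (hset {hpair \<alpha> (hnat m)}) \<in> elts R" "ext (hun x (hset {hpair \<alpha> (hnat m)})) x"
  using fs_insert[OF x \<alpha>, of m] m unfolding ext_def by auto

lemma new_value: "x \<in> elts R ==> \<exists>m\<ge>n. \<forall>\<beta>. hpair \<beta> (hnat m) \<notin> elts x"
proof -
  assume x: "x \<in> elts R"
  have "finite {m. \<exists>\<beta>. hpair \<beta> (hnat m) \<in> elts x}"
  proof (rule finite_imageD[of hnat])
    show "finite (hnat ` {m. \<exists>\<beta>. hpair \<beta> (hnat m) \<in> elts x})"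
      by (rule finite_subset[OF _ finite_vals[OF x]]) auto
  qed (simp add: inj_on_def)
  then have "finite ({m. \<exists>\<beta>. hpair \<beta> (hnat m) \<in> elts x} \<union> {..<n})" by simp
  then obtain m where "m \<notin> {m. \<exists>\<beta>. hpair \<beta> (hnat m) \<in> elts x} \<union> {..<n}"
    using ex_new_if_finite[OF infinite_UNIV_nat] by blast
  then show ?thesis by (intro exI[of _ m]) auto
qed

text \<open>Suppose that \<open>f\<close> is injective and \<open>p0\<close> excludes collisions. A
  condition that mentions \<delta> and gives it the value n is reflected to one supported in
  \<delta>, which gives the value n to some \<beta> below \<delta>; amalgamating the two produces a
  collision.\<close>

lemma w1_preserved: "omega1_in NG w1"
proof -
  have "\<not> countable_in NG (elts w1)"
  proof
    assume "countable_in NG (elts w1)"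
    from NN.countable_inE[OF this] obtain f g where f: "f \<in> NG"
      "\<forall>x\<in>elts w1. \<forall>y. hpair x y \<in> elts f <-> y = hnat (g x)" "inj_on g (elts w1)" by blast
    define Z where "Z = hprd w1 homega"
    have ZM: "Z \<in> M" by (simp add: Z_def)
    define f' where "f' = hset {z \<in> elts Z. z \<in> elts f}"
    have f'N: "f' \<in> NG" unfolding f'_def
      by (rule NN.sep[OF ground_sub_NG[OF ZM]]) (intro NN.mem NN.var NN.elem f(1))
    have ef': "elts f' = {z \<in> elts Z. z \<in> elts f}" by (rule elts_sep[OF f'_def])
    obtain \<tau> where \<tau>: "\<tau> \<in> M" "\<And>z. z \<in> elts Z ==> z \<in> elts f' <-> (\<exists>p\<in>H. hpair z p \<in> elts \<tau>)"
      "\<And>z p q. hpair z p \<in> elts \<tau> ==> q \<in> elts R ==> ext q p ==> hpair z q \<in> elts \<tau>"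
      using nice_name_R[OF f'N ZM] ef' by blast
    have val: "n = hnat (g \<alpha>)" if "\<alpha> \<in> elts w1" "n \<in> elts homega" "p \<in> H" "hpair (hpair \<alpha> n) p \<in> elts \<tau>" for \<alpha> n p
    proof -
      have "hpair \<alpha> n \<in> elts Z" using that(1,2) by (simp add: Z_def)
      then have "hpair \<alpha> n \<in> elts f'" using \<tau>(2) that(3,4) by blast
      then show ?thesis using f(2) that(1) unfolding ef' by blast
    qed
    define D where "D r <-> (\<exists>\<alpha>\<in>elts w1. \<exists>\<beta>\<in>elts w1. \<exists>n\<in>elts homega. \<alpha> \<noteq> \<beta> \<and>
      hpair (hpair \<alpha> n) r \<in> elts \<tau> \<and> hpair (hpair \<beta> n) r \<in> elts \<tau>)" for r
    have DD: "dfn M (\<lambda>s. D (s 0))" unfolding D_def by (intro dfi w1M homega_closed \<tau>(1))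
    have "\<not> (\<exists>r\<in>H. D r)"
    proof
      assume "\<exists>r\<in>H. D r"
      then obtain r \<alpha> \<beta> n where r: "r \<in> H" "\<alpha> \<in> elts w1" "\<beta> \<in> elts w1" "n \<in> elts homega" "\<alpha> \<noteq> \<beta>"
        "hpair (hpair \<alpha> n) r \<in> elts \<tau>" "hpair (hpair \<beta> n) r \<in> elts \<tau>" unfolding D_def by blast
      have "n = hnat (g \<alpha>)" "n = hnat (g \<beta>)" using val r by blast+
      then have "g \<alpha> = g \<beta>" by simp
      then show False using inj_onD[OF f(3)] r by blast
    qed
    then obtain p0 where p0: "p0 \<in> H" "\<forall>r\<in>elts R. ext r p0 --> \<not> D r" using H_cases[OF DD] by blast
    \<comment> \<open>Since \<beta> must be mentioned by p, it lies below \<delta> as soon as p is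
      supported in \<delta>.\<close>
    define E where "E r n p <-> ext p r \<and> (\<exists>\<beta>\<in>elts w1. in_dom \<beta> p \<and> hpair (hpair \<beta> n) p \<in> elts \<tau>)" for r n p
    have DE: "dfn M (\<lambda>s. E (s 0) (s 1) (s 2))" unfolding E_def by (intro dfi w1M \<tau>(1))
    obtain \<delta> where \<delta>: "\<delta> \<in> elts w1" "infinite (elts \<delta>)"
      "\<forall>r\<in>elts (fs \<delta>). \<forall>z\<in>elts homega. (\<exists>p\<in>elts R. E r z p) --> (\<exists>p\<in>elts (fs \<delta>). E r z p)"
      using reflection_infinite[OF DE homega_closed countable_in_homega] by blast
    have sub: "elts (fs \<delta>) \<subseteq> elts R" using fs_mono[OF w1_sub[OF \<delta>(1)]] .
    define n where "n = hnat (g \<delta>)"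
    have "hpair \<delta> n \<in> elts f'" unfolding ef' Z_def n_def using f(2) \<delta>(1) by auto
    moreover have "hpair \<delta> n \<in> elts Z" unfolding Z_def n_def using \<delta>(1) by simp
    ultimately obtain p1 where p1: "p1 \<in> H" "hpair (hpair \<delta> n) p1 \<in> elts \<tau>" using \<tau>(2) by blast
    obtain p2 where p2: "p2 \<in> H" "ext p2 p1" "ext p2 p0" using H_dir p0(1) p1(1) by blast
    \<comment> \<open>A fresh number is put into row \<delta> so that the condition mentions
      \<delta>.\<close>
    obtain m where m: "\<And>\<beta>. hpair \<beta> (hnat m) \<notin> elts p2" using new_value[OF HR[OF p2(1)]] by blast
    define p3 where "p3 = hun p2 (hset {hpair \<delta> (hnat m)})"
    have p3: "p3 \<in> elts R" "ext p3 p2" unfolding p3_def using add_new[OF HR[OF p2(1)] \<delta>(1) m] by blast+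
    have d3: "hpair \<delta> (hnat m) \<in> elts p3" by (simp add: p3_def)
    obtain p4 where p4: "p4 \<in> elts R" "ext p4 p3" "full p4 \<delta>" using full_ext[OF p3(1) \<delta>(2) w1_sub[OF \<delta>(1)]] by blast
    have p4\<tau>: "hpair (hpair \<delta> n) p4 \<in> elts \<tau>" using \<tau>(3)[OF p1(2) p4(1)] p4(2) p3(2) p2(2) ext_trans by blast
    have p40: "ext p4 p0" using p4(2) p3(2) p2(3) ext_trans by blast
    have "in_dom \<delta> p4" using ext_sub[OF p4(2)] d3 unfolding in_dom_def by blast
    then have "E (hrestrict p4 \<delta>) n p4" unfolding E_def using ext_hrestrict p4\<tau> \<delta>(1) by blast
    moreover have "n \<in> elts homega" by (simp add: n_def)
    ultimately obtain q where q: "q \<in> elts (fs \<delta>)" "E (hrestrict p4 \<delta>) n q"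
      using \<delta>(3) fs_hrestrict[OF p4(1)] p4(1) by blast
    then obtain \<beta> where \<beta>: "ext q (hrestrict p4 \<delta>)" "\<beta> \<in> elts w1" "in_dom \<beta> q" "hpair (hpair \<beta> n) q \<in> elts \<tau>" unfolding E_def by blast
    have "\<beta> \<in> elts \<delta>" using \<beta>(3) fs_mem[OF q(1)] unfolding in_dom_def by blast
    then have "\<delta> \<noteq> \<beta>" by auto
    have r: "ext (hun q p4) p4" "ext (hun q p4) q" "hun q p4 \<in> elts R"
      using amalgamate[OF p4(3) q(1) \<beta>(1)] fs_hun q(1) sub p4(1) by blast+
    have "hpair (hpair \<delta> n) (hun q p4) \<in> elts \<tau>" "hpair (hpair \<beta> n) (hun q p4) \<in> elts \<tau>"
      using \<tau>(3)[OF p4\<tau> r(3) r(1)] \<tau>(3)[OF \<beta>(4) r(3) r(2)] by blast+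
    then have "D (hun q p4)" unfolding D_def using \<delta>(1) \<beta>(2) \<open>n \<in> elts homega\<close> \<open>\<delta> \<noteq> \<beta>\<close> by blast
    then show False using p0(2) r(3) ext_trans[OF r(1) p40] by blast
  qed
  moreover have "countable_in NG (elts a)" if a: "a \<in> elts w1" for a
  proof -
    obtain f where "fun_in M f (elts a) (elts homega)" "inj_on (\<lambda>x. f \<cdot> x) (elts a)"
      using w1_cnt[OF a] unfolding countable_in_def by blast
    then show ?thesis unfolding countable_in_def fun_in_def using ground_sub_NG by blast
  qed
  ultimately show ?thesis unfolding omega1_in_def using ground_sub_NG[OF w1M] w1_ord by blast
qed

section \<open>The generic sets\<close>

definition U :: hc where "U = hUn (hset H)"
definition a :: "hc => hc" where "a \<alpha> = hset {m \<in> elts homega. hpair \<alpha> m \<in> elts U}"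

lemma elts_U: "elts U = \<Union> (elts ` H)"
  unfolding U_def using countable_H by simp

lemma U_NG: "U \<in> NG" unfolding U_def using H_in_NG by simp

lemma elts_a: "elts (a \<alpha>) = {m \<in> elts homega. hpair \<alpha> m \<in> elts U}"
  by (rule elts_sep[OF a_def])

lemma a_iff: "m \<in> elts (a \<alpha>) <-> (\<exists>x\<in>H. hpair \<alpha> m \<in> elts x)"
proof -
  have "m \<in> elts homega" if "x \<in> H" "hpair \<alpha> m \<in> elts x" for x
    using fs_mem[OF HR[OF that(1)] that(2)] by auto
  then show ?thesis unfolding elts_a elts_U by blast
qed

lemma a_NG: "\<alpha> \<in> NG ==> a \<alpha> \<in> NG"
  unfolding a_def by (rule NN.sep[OF NN.omegaM]) (intro NN.mem NN.dff_rules U_NG)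

lemma a_infinite:
  assumes \<alpha>: "\<alpha> \<in> elts w1" shows "infinite (elts (a \<alpha>))"
proof -
  have "\<exists>m\<ge>n. hnat m \<in> elts (a \<alpha>)" for n
  proof -
    have "\<exists>x\<in>H. \<exists>m\<in>elts homega. m \<notin> elts (hnat n) \<and> hpair \<alpha> m \<in> elts x"
    proof (rule H_dense)
      show "dfn M (\<lambda>s. \<exists>m\<in>elts homega. m \<notin> elts (hnat n) \<and> hpair \<alpha> m \<in> elts (s 0))"
        by (intro dfi homega_closed hnat_closed w1D[OF \<alpha>])
      fix x assume x: "x \<in> elts R"
      obtain m where m: "m \<ge> n" "\<And>\<beta>. hpair \<beta> (hnat m) \<notin> elts x" using new_value[OF x] by blast
      have "hnat m \<in> elts homega" "hnat m \<notin> elts (hnat n)" "hpair \<alpha> (hnat m) \<in> elts (hun x (hset {hpair \<alpha> (hnat m)}))"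
        using m(1) by simp_all
      then show "\<exists>r\<in>elts R. ext r x \<and> (\<exists>m\<in>elts homega. m \<notin> elts (hnat n) \<and> hpair \<alpha> m \<in> elts r)"
        using add_new[OF x \<alpha> m(2)] by blast
    qed
    then obtain x m where x: "x \<in> H" "m \<in> elts homega" "m \<notin> elts (hnat n)" "hpair \<alpha> m \<in> elts x" by blast
    then obtain k where "m = hnat k" by auto
    then show ?thesis using x a_iff by (intro exI[of _ k]) auto
  qed
  moreover have "elts (a \<alpha>) \<subseteq> range hnat" unfolding elts_a by auto
  ultimately show ?thesis using infinite_hnat by blast
qed

text \<open>A condition of the filter that mentions both indices freezes the intersection, which
  then consists of numbers occurring in that condition.\<close>

lemma a_disjoint:
  assumes \<alpha>\<beta>: "\<alpha> \<in> elts w1" "\<beta> \<in> elts w1" "\<alpha> \<noteq> \<beta>" shows "finite (elts (a \<alpha>) \<inter> elts (a \<beta>))"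
proof -
  have dom: "\<exists>x\<in>H. ext x p \<and> in_dom \<alpha> x" if p: "p \<in> H" and \<alpha>: "\<alpha> \<in> elts w1" for p \<alpha>
  proof (rule H_dense_below[OF _ p])
    show "dfn M (\<lambda>s. in_dom \<alpha> (s 0))" by (intro dfi w1D[OF \<alpha>])
    fix x assume x: "x \<in> elts R"
    obtain m where m: "\<And>\<beta>. hpair \<beta> (hnat m) \<notin> elts x" using new_value[OF x] by blast
    show "\<exists>r\<in>elts R. ext r x \<and> in_dom \<alpha> r"
      using add_new[OF x \<alpha> m] unfolding in_dom_def by (intro bexI[of _ "hun x (hset {hpair \<alpha> (hnat m)})"]) auto
  qed
  obtain x where x: "x \<in> H" "in_dom \<alpha> x" using dom[OF FR.oneG \<alpha>\<beta>(1)] by blast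
  obtain y where y: "y \<in> H" "ext y x" "in_dom \<beta> y" using dom[OF x(1) \<alpha>\<beta>(2)] by blast
  have \<alpha>y: "in_dom \<alpha> y" using x(2) ext_sub[OF y(2)] unfolding in_dom_def by blast
  have "elts (a \<alpha>) \<inter> elts (a \<beta>) \<subseteq> {m. \<exists>\<gamma>. hpair \<gamma> m \<in> elts y}"
  proof
    fix m assume "m \<in> elts (a \<alpha>) \<inter> elts (a \<beta>)"
    then obtain u v where u: "u \<in> H" "hpair \<alpha> m \<in> elts u" "v \<in> H" "hpair \<beta> m \<in> elts v" using a_iff by blast
    obtain w where w: "w \<in> H" "ext w u" "ext w v" using H_dir u by blast
    obtain z where z: "z \<in> H" "ext z w" "ext z y" using H_dir w(1) y(1) by blast
    have "hpair \<alpha> m \<in> elts z" "hpair \<beta> m \<in> elts z" using u w z ext_sub by blast+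
    then have "hpair \<alpha> m \<in> elts y" using z(3) \<alpha>\<beta>(3) \<alpha>y y(3) unfolding ext_def by blast
    then show "m \<in> {m. \<exists>\<gamma>. hpair \<gamma> m \<in> elts y}" by blast
  qed
  then show ?thesis using finite_vals[OF HR[OF y(1)]] finite_subset by blast
qed

lemma dfn_full: "\<delta> \<in> M ==> dfn M (\<lambda>s. full (s 0) \<delta>)"
proof -
  assume \<delta>: "\<delta> \<in> M"
  have "dfn M (\<lambda>s. \<exists>\<gamma>\<in>elts \<delta>. in_dom \<gamma> (s 0) \<and> (\<forall>\<alpha>\<in>M. \<forall>m\<in>M. hpair \<alpha> m \<in> elts (s 0) --> hpair \<gamma> m \<in> elts (s 0)))"
    by (intro dfi \<delta>)
  moreover have "full p \<delta> <-> (\<exists>\<gamma>\<in>elts \<delta>. in_dom \<gamma> p \<and> (\<forall>\<alpha>\<in>M. \<forall>m\<in>M. hpair \<alpha> m \<in> elts p --> hpair \<gamma> m \<in> elts p))"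
    if "p \<in> M" for p
  proof -
    have "\<alpha> \<in> M \<and> m \<in> M" if "hpair \<alpha> m \<in> elts p" for \<alpha> m using transD[OF that \<open>p \<in> M\<close>] by simp
    then show ?thesis unfolding full_def by blast
  qed
  ultimately show ?thesis
    by (subst dfn_cong[of M _ "\<lambda>s. \<exists>\<gamma>\<in>elts \<delta>. in_dom \<gamma> (s 0) \<and> (\<forall>\<alpha>\<in>M. \<forall>m\<in>M. hpair \<alpha> m \<in> elts (s 0) --> hpair \<gamma> m \<in> elts (s 0))"])
      (simp_all add: env_closed)
qed

text \<open>The sets with index at least \<open>\<delta>\<close> are generic over the extension by the sets with index below
  \<open>\<delta>\<close>; \<open>W2\<close> and \<open>W3\<close> make \<open>w\<close> compatible with any given condition of the generic filter.\<close>

lemma generic_pattern: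
  assumes \<delta>: "\<delta> \<in> elts w1" "infinite (elts \<delta>)" and W: "W \<in> Nd \<delta>" "elts W \<subseteq> elts R"
    and W1: "\<And>w \<alpha> m. w \<in> elts W ==> hpair \<alpha> m \<in> elts w ==> \<alpha> \<notin> elts \<delta>"
    and W2: "\<And>w \<alpha> \<beta> m. w \<in> elts W ==> hpair \<alpha> m \<in> elts w ==> hpair \<beta> m \<in> elts w ==> \<alpha> = \<beta>"
    and W3: "\<And>F K. finite F ==> F \<subseteq> elts \<delta> ==> finite K ==>
      \<exists>w\<in>elts W. \<forall>\<alpha> m. hpair \<alpha> m \<in> elts w --> m \<notin> K \<and> (\<forall>\<beta>\<in>F. m \<notin> elts (a \<beta>))"
  shows "\<exists>w\<in>elts W. elts w \<subseteq> elts U"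
proof -
  interpret F: generic_ext_of M "fs \<delta>" "leq \<delta>" hempty "Hd \<delta>" by (rule ext_of_Hd[OF \<delta>])
  have sub: "elts (fs \<delta>) \<subseteq> elts R" using fs_mono[OF w1_sub[OF \<delta>(1)]] .
  have dM: "\<delta> \<in> M" "fs \<delta> \<in> M" using fs_closed w1D[OF \<delta>(1)] by blast+
  obtain \<tau> where \<tau>: "\<tau> \<in> M" "\<And>z. z \<in> elts R ==> z \<in> elts W <-> (\<exists>p\<in>Hd \<delta>. hpair z p \<in> elts \<tau>)"
    using F.nice_name[OF W(1) R_closed W(2)] by blast
  \<comment> \<open>\<open>s\<close> guarantees that w belongs to \<open>W\<close>, and r realizes w
    in addition to extending s.\<close>
  define D where "D r <-> (\<exists>w\<in>elts R. \<exists>s\<in>elts (fs \<delta>). hpair w s \<in> elts \<tau> \<and> ext r s \<and> elts w \<subseteq> elts r)" for r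
  have DD: "dfn M (\<lambda>s. D (s 0))" unfolding D_def by (intro dfi R_closed dM w1M \<tau>(1))
  have "\<exists>r\<in>H. D r"
  proof (rule ccontr)
    assume "\<not> (\<exists>r\<in>H. D r)"
    then obtain p where p: "p \<in> H" "\<forall>r\<in>elts R. ext r p --> \<not> D r" using H_cases[OF DD] by blast
    have "\<exists>r\<in>H. ext r p \<and> full r \<delta>"
      by (rule H_dense_below[OF dfn_full[OF dM(1)] p(1)]) (use full_ext[OF _ \<delta>(2) w1_sub[OF \<delta>(1)]] in blast)
    then obtain p1 where p1: "p1 \<in> H" "ext p1 p" "full p1 \<delta>" by blast
    note p1R = HR[OF p1(1)]
    \<comment> \<open>\<open>F\<close> and \<open>K\<close> collect what w has to avoid: the earlier
      sets whose rows are frozen by \<open>p1\<close>, and the numbers that \<open>p1\<close> uses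
      already.\<close>
    define F where "F = {\<beta> \<in> elts \<delta>. in_dom \<beta> p1}"
    define K where "K = {m. \<exists>\<alpha>. hpair \<alpha> m \<in> elts p1}"
    have fF: "finite F" and Fs: "F \<subseteq> elts \<delta>" using finite_dom[OF p1R] unfolding F_def by auto
    have fK: "finite K" using finite_vals[OF p1R] unfolding K_def .
    obtain w where w: "w \<in> elts W" "\<forall>\<alpha> m. hpair \<alpha> m \<in> elts w --> m \<notin> K \<and> (\<forall>\<beta>\<in>F. m \<notin> elts (a \<beta>))"
      using W3[OF fF Fs fK] by (elim bexE)
    have wR: "w \<in> elts R" using w(1) W(2) by blast
    obtain s where s: "s \<in> Hd \<delta>" "hpair w s \<in> elts \<tau>" using \<tau>(2)[OF wR] w(1) by blast
    obtain q where q: "q \<in> Hd \<delta>" "hpair q s \<in> elts (leq \<delta>)" "hpair q (hrestrict p1 \<delta>) \<in> elts (leq \<delta>)"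
      using F.G_dir[OF s(1) hrestrict_Hd[OF p1(1) \<delta>(1)]] by blast
    have qq: "q \<in> elts (fs \<delta>)" "q \<in> H" "ext q s" "ext q (hrestrict p1 \<delta>)" using q unfolding leq_iff Hd_def by blast+
    note am = amalgamate[OF p1(3) qq(1,4)]
    define r where "r = hun (hun q p1) w"
    have rR: "r \<in> elts R" unfolding r_def using qq(1) sub p1R wR by (intro fs_hun) blast+
    \<comment> \<open>No number of w occurs in a row that \<open>p1\<close> mentions: for numbers of
      \<open>p1\<close> this is the choice of \<open>K\<close>; for numbers brought in by q, which
      is in the filter, it is the choice of \<open>F\<close>.\<close>
    have wq: "\<not> (hpair \<beta> m \<in> elts (hun q p1) \<and> in_dom \<beta> p1)" if "hpair \<alpha> m \<in> elts w" for \<alpha> \<beta> m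
    proof
      assume h: "hpair \<beta> m \<in> elts (hun q p1) \<and> in_dom \<beta> p1"
      have "hpair \<beta> m \<notin> elts p1" using w(2) that unfolding K_def by blast
      then have "hpair \<beta> m \<in> elts q" using h by simp
      then have "\<beta> \<in> F" "m \<in> elts (a \<beta>)" using fs_mem[OF qq(1)] h qq(2) a_iff unfolding F_def by blast+
      then show False using w(2) that by blast
    qed
    have "ext r p1" unfolding ext_def
    proof (intro conjI allI impI)
      fix \<alpha> \<beta> m assume h: "\<alpha> \<noteq> \<beta> \<and> in_dom \<alpha> p1 \<and> in_dom \<beta> p1 \<and> hpair \<alpha> m \<in> elts r \<and> hpair \<beta> m \<in> elts r"
      have "hpair \<alpha> m \<in> elts (hun q p1)" "hpair \<beta> m \<in> elts (hun q p1)"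
        using h wq[of \<alpha> m \<beta>] wq[of \<beta> m \<alpha>] W2[OF w(1), of \<alpha> m \<beta>] unfolding r_def elts_hun[of _ w] by blast+
      then show "hpair \<alpha> m \<in> elts p1" "hpair \<beta> m \<in> elts p1" using am(1) h unfolding ext_def by blast+
    qed (auto simp: r_def)
    moreover have "ext r q" unfolding ext_def
    proof (intro conjI allI impI)
      fix \<alpha> \<beta> m assume h: "\<alpha> \<noteq> \<beta> \<and> in_dom \<alpha> q \<and> in_dom \<beta> q \<and> hpair \<alpha> m \<in> elts r \<and> hpair \<beta> m \<in> elts r"
      then have "\<alpha> \<in> elts \<delta>" "\<beta> \<in> elts \<delta>" using fs_mem[OF qq(1)] unfolding in_dom_def by blast+
      then have "hpair \<alpha> m \<in> elts (hun q p1)" "hpair \<beta> m \<in> elts (hun q p1)"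
        using h W1[OF w(1)] unfolding r_def elts_hun[of _ w] by blast+
      then show "hpair \<alpha> m \<in> elts q" "hpair \<beta> m \<in> elts q" using am(2) h unfolding ext_def by blast+
    qed (auto simp: r_def)
    then have "ext r s" using qq(3) ext_trans by blast
    then have "D r" unfolding D_def using wR s by (intro bexI[of _ w] bexI[of _ s]) (auto simp: r_def Hd_def)
    ultimately show False using p(2) rR ext_trans p1(2) by blast
  qed
  then obtain r w s where r: "r \<in> H" "w \<in> elts R" "s \<in> elts (fs \<delta>)" "hpair w s \<in> elts \<tau>" "ext r s" "elts w \<subseteq> elts r"
    unfolding D_def by blast
  have "s \<in> Hd \<delta>" unfolding Hd_def using H_up[OF r(1)] r(3,5) sub by blast
  then have "w \<in> elts W" using \<tau>(2) r by blast
  moreover have "elts w \<subseteq> elts U" unfolding elts_U using r by blast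
  ultimately show ?thesis by blast
qed

definition A :: hc where "A = hset (a ` elts w1)"

lemma elts_A: "elts A = a ` elts w1" unfolding A_def by simp

lemma a_NG': "\<alpha> \<in> elts w1 ==> a \<alpha> \<in> NG" using a_NG ground_sub_NG w1D by blast

lemma a_sub: "elts (a \<alpha>) \<subseteq> elts homega" unfolding elts_a by blast

text \<open>A bounded description of the map from indices to generic sets, by which the family is
  separated from the power set of omega in the extension.\<close>

lemma a_eq_iff: "y = a \<alpha> <-> elts y \<subseteq> elts homega \<and> (\<forall>m\<in>elts homega. m \<in> elts y <-> hpair \<alpha> m \<in> elts U)"
  using elts_a hc_extensionality[of y "a \<alpha>"] by blast

lemma A_NG: "A \<in> NG"
proof -
  have w: "w1 \<in> NG" using ground_sub_NG by simp
  have "hset {y \<in> elts (NN.pw homega). \<exists>\<alpha>\<in>elts w1. elts y \<subseteq> elts homega \<and> (\<forall>m\<in>elts homega. m \<in> elts y <-> hpair \<alpha> m \<in> elts U)} \<in> NG"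
    by (rule NN.sep[OF NN.pw(1)[OF NN.omegaM]])
      (intro NN.dfn_rules NN.dff_rules w NN.omegaM U_NG)
  moreover have "{y \<in> elts (NN.pw homega). \<exists>\<alpha>\<in>elts w1. elts y \<subseteq> elts homega \<and> (\<forall>m\<in>elts homega. m \<in> elts y <-> hpair \<alpha> m \<in> elts U)} = a ` elts w1"
    unfolding a_eq_iff[symmetric] NN.pw(2)[OF NN.omegaM] using a_NG' a_sub by blast
  ultimately show ?thesis unfolding A_def by simp
qed

lemma a_inj: "inj_on a (elts w1)"
  using a_disjoint a_infinite by (metis inf.idem inj_onI)

lemma A_almost_disjoint: "almost_disjoint_in NG A"
proof -
  have sub: "elts A \<subseteq> NG" using NN.trans[OF A_NG] .
  have subN: "X \<subseteq> NG" if "X \<subseteq> elts homega" for X using that NN.trans[OF NN.omegaM] by blast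
  have "infinite (elts w1)"
    using w1_unc finite_countable_in[OF w1M] by blast
  then have "infinite (elts A)" unfolding elts_A using finite_imageD a_inj by blast
  then have "\<not> finite_in NG (elts A)" using NN.finite_in_iff[OF sub] by blast
  moreover have "\<not> finite_in NG (elts (a \<alpha>))" if "\<alpha> \<in> elts w1" for \<alpha>
    using NN.finite_in_iff[OF subN[OF a_sub]] a_infinite[OF that] by blast
  moreover have "finite_in NG (elts x \<inter> elts y)" if xy: "x \<in> elts A" "y \<in> elts A" "x \<noteq> y" for x y
  proof -
    obtain \<alpha> \<beta> where "\<alpha> \<in> elts w1" "\<beta> \<in> elts w1" "x = a \<alpha>" "y = a \<beta>" using xy elts_A by auto
    then have "finite (elts x \<inter> elts y)" "elts x \<inter> elts y \<subseteq> elts homega" using a_disjoint xy(3) a_sub by blast+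
    then show ?thesis using NN.finite_in_iff[OF subN] by blast
  qed
  ultimately show ?thesis unfolding almost_disjoint_in_def using A_NG a_sub unfolding elts_A by blast
qed

lemma A_equipollent: "equipollent_in NG (elts A) (elts w1)"
proof -
  define f where "f = hset {z \<in> elts (hprd A w1). \<exists>y\<in>elts A. \<exists>\<alpha>\<in>elts w1. z = hpair y \<alpha> \<and>
    elts y \<subseteq> elts homega \<and> (\<forall>m\<in>elts homega. m \<in> elts y <-> hpair \<alpha> m \<in> elts U)}"
  have w: "w1 \<in> NG" using ground_sub_NG by simp
  have fN: "f \<in> NG" unfolding f_def
    by (rule NN.sep[OF NN.hprd_closed[OF A_NG w]])
      (intro NN.dfn_rules NN.dff_rules w NN.omegaM U_NG A_NG)
  have ef: "elts f = {z \<in> elts (hprd A w1). \<exists>y\<in>elts A. \<exists>\<alpha>\<in>elts w1. z = hpair y \<alpha> \<and> y = a \<alpha>}"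
    unfolding f_def a_eq_iff by (rule elts_hset) (rule countable_elts_Collect)
  define g where "g = inv_into (elts w1) a"
  have g: "g y \<in> elts w1" "a (g y) = y" if "y \<in> elts A" for y
    using that unfolding g_def elts_A by (auto intro: inv_into_into f_inv_into_f)
  have ga: "g (a \<alpha>) = \<alpha>" if "\<alpha> \<in> elts w1" for \<alpha> unfolding g_def using inv_into_f_f[OF a_inj that] .
  have f: "hfun f (elts A)" "\<And>y. y \<in> elts A ==> f \<cdot> y = g y"
  proof -
    have 1: "\<exists>x\<in>elts A. z = hpair x (g x)" if "z \<in> elts f" for z using that ga unfolding ef by auto
    have 2: "hpair x (g x) \<in> elts f" if "x \<in> elts A" for x unfolding ef using g[OF that] that by simp
    show "hfun f (elts A)" "\<And>y. y \<in> elts A ==> f \<cdot> y = g y" using hfunI[OF 1 2] by blast+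
  qed
  have "bij_betw g (elts A) (elts w1)"
    unfolding elts_A g_def by (rule bij_betw_inv_into) (simp add: bij_betw_def a_inj)
  then have "bij_betw (\<lambda>y. f \<cdot> y) (elts A) (elts w1)" using f(2) by (subst bij_betw_cong[of _ _ g]) auto
  moreover have "fun_in NG f (elts A) (elts w1)"
    unfolding fun_in_def
  proof (intro conjI ballI fN f(1))
    fix y assume y: "y \<in> elts A"
    show "f \<cdot> y \<in> elts w1" unfolding f(2)[OF y] by (rule g(1)[OF y])
  qed
  ultimately show ?thesis unfolding equipollent_in_def by (intro exI[of _ f] conjI)
qed

lemma Nd_D:
  assumes "\<delta> \<in> elts w1" "infinite (elts \<delta>)"
  shows "tmo (Nd \<delta>)" "M \<subseteq> Nd \<delta>" "hset (Hd \<delta>) \<in> Nd \<delta>"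
proof -
  interpret F: generic_ext_of M "fs \<delta>" "leq \<delta>" hempty "Hd \<delta>" by (rule ext_of_Hd[OF assms])
  show "tmo (Nd \<delta>)" "M \<subseteq> Nd \<delta>" "hset (Hd \<delta>) \<in> Nd \<delta>" using F.tmo_N F.M_sub_N F.G_in_N by blast+
qed

text \<open>X lies in the intermediate model for some \<delta>. If X is infinite and almost disjoint
  from all sets with smaller index, then the one-point patterns (\<delta>, m) with m in X beyond a
  given n can avoid finitely many of these sets, so \<open>a \<delta>\<close> meets X beyond every
  n.\<close>

lemma maximal:
  assumes X: "X \<in> NG" "elts X \<subseteq> elts homega" and fin: "\<And>\<alpha>. \<alpha> \<in> elts w1 ==> finite (elts X \<inter> elts (a \<alpha>))"
  shows "finite (elts X)"
proof (rule ccontr)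
  assume inf: "infinite (elts X)"
  obtain \<delta> where \<delta>: "\<delta> \<in> elts w1" "infinite (elts \<delta>)" "X \<in> Nd \<delta>"
    using countable_bounded[OF X homega_closed countable_in_homega] by blast
  interpret T: tmo "Nd \<delta>" by (rule Nd_D(1)[OF \<delta>(1,2)])
  have MN: "x \<in> Nd \<delta>" if "x \<in> M" for x using Nd_D(2)[OF \<delta>(1,2)] that by blast
  have "\<exists>m\<ge>n. hnat m \<in> elts X \<inter> elts (a \<delta>)" for n
  proof -
    define W where "W = hset {w \<in> elts R. \<exists>m\<in>elts X. m \<notin> elts (hnat n) \<and> w = hset {hpair \<delta> m}}"
    have WN: "W \<in> Nd \<delta>" unfolding W_def
      by (rule T.sep[OF MN[OF R_closed]])
        (intro T.bex dfn_conj dfn_not T.mem T.eq T.dff_single T.dff_hpair T.elem T.var \<delta>(3) MN hnat_closed w1D \<delta>(1))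
    note eW = elts_sep[OF W_def]
    have "\<exists>w\<in>elts W. elts w \<subseteq> elts U"
    proof (rule generic_pattern[OF \<delta>(1,2) WN])
      show "elts W \<subseteq> elts R" unfolding eW by blast
      show "\<alpha> \<notin> elts \<delta>" if "w \<in> elts W" "hpair \<alpha> m \<in> elts w" for w \<alpha> m using that unfolding eW by auto
      show "\<alpha> = \<beta>" if "w \<in> elts W" "hpair \<alpha> m \<in> elts w" "hpair \<beta> m \<in> elts w" for w \<alpha> \<beta> m using that unfolding eW by auto
      show "\<exists>w\<in>elts W. \<forall>\<alpha> m. hpair \<alpha> m \<in> elts w --> m \<notin> K \<and> (\<forall>\<beta>\<in>F. m \<notin> elts (a \<beta>))"
        if F: "finite F" "F \<subseteq> elts \<delta>" "finite K" for F K
      proof -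
        have "finite (\<Union>\<beta>\<in>F. elts X \<inter> elts (a \<beta>))"
          by (rule finite_UN_I[OF F(1)]) (use F(2) fin w1_sub[OF \<delta>(1)] in blast)
        moreover have "finite (elts (hnat n))" by (rule finite_elts_hnat)
        ultimately have "finite (K \<union> elts (hnat n) \<union> (\<Union>\<beta>\<in>F. elts X \<inter> elts (a \<beta>)))"
          using F(3) by (intro finite_UnI)
        then have "infinite (elts X - (K \<union> elts (hnat n) \<union> (\<Union>\<beta>\<in>F. elts X \<inter> elts (a \<beta>))))" using inf by (rule Diff_infinite_finite)
        then have "elts X - (K \<union> elts (hnat n) \<union> (\<Union>\<beta>\<in>F. elts X \<inter> elts (a \<beta>))) \<noteq> {}" by (rule infinite_imp_nonempty)
        then obtain m where "m \<in> elts X - (K \<union> elts (hnat n) \<union> (\<Union>\<beta>\<in>F. elts X \<inter> elts (a \<beta>)))" by blast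
        then have m: "m \<in> elts X" "m \<notin> K" "m \<notin> elts (hnat n)" "\<forall>\<beta>\<in>F. m \<notin> elts (a \<beta>)" by blast+
        then obtain k where k: "m = hnat k" using X(2) by auto
        have "hset {hpair \<delta> m} \<in> elts R" using \<delta>(1) k unfolding fs_iff by auto
        then have "hset {hpair \<delta> m} \<in> elts W" unfolding eW using m by blast
        then show ?thesis using m by (intro bexI[of _ "hset {hpair \<delta> m}"]) auto
      qed
    qed
    then obtain m where m: "m \<in> elts X" "m \<notin> elts (hnat n)" "hpair \<delta> m \<in> elts U" unfolding eW by auto
    then obtain k where k: "m = hnat k" using X(2) by auto
    then show ?thesis using m unfolding elts_a by (intro exI[of _ k]) auto
  qed
  then have "infinite (elts X \<inter> elts (a \<delta>))" using infinite_hnat[of "elts X \<inter> elts (a \<delta>)"] X(2) by auto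
  then show False using fin[OF \<delta>(1)] by blast
qed

lemma A_MAD: "MAD_in NG A"
  unfolding MAD_in_def
proof (intro conjI ballI impI)
  show "almost_disjoint_in NG A" by (rule A_almost_disjoint)
  fix B assume B: "B \<in> NG" "almost_disjoint_in NG B \<and> elts A \<subseteq> elts B"
  have "b \<in> elts A" if b: "b \<in> elts B" for b
  proof (rule ccontr)
    assume nb: "b \<notin> elts A"
    have bN: "b \<in> NG" and bo: "elts b \<subseteq> elts homega" using b B NN.transD unfolding almost_disjoint_in_def by blast+
    have subN: "X \<subseteq> NG" if "X \<subseteq> elts homega" for X using that NN.trans[OF NN.omegaM] by blast
    have "finite (elts b)"
    proof (rule maximal[OF bN bo])
      fix \<alpha> assume "\<alpha> \<in> elts w1"
      then have "a \<alpha> \<in> elts A" unfolding elts_A by blast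
      then have "a \<alpha> \<in> elts B" "b \<noteq> a \<alpha>" using B(2) nb by blast+
      then have "finite_in NG (elts b \<inter> elts (a \<alpha>))" using B(2) b unfolding almost_disjoint_in_def by blast
      then show "finite (elts b \<inter> elts (a \<alpha>))" using NN.finite_in_iff[OF subN[of "elts b \<inter> elts (a \<alpha>)"]] bo by blast
    qed
    then show False using B(2) b NN.finite_in_iff[OF subN[OF bo]] unfolding almost_disjoint_in_def by blast
  qed
  then show "B = A" using B(2) by (intro hc_eqI) blast
qed

end

section \<open>The real line of a model\<close>

text \<open>A code of the rational (a - b) / (n + 1); each rational has many codes.\<close>

definition rcode :: "nat => nat => nat => hc" where
  "rcode a b n = hpair (hnat a) (hpair (hnat b) (hnat (Suc n)))"

definition rv :: "hc => real" where
  "rv q = (THE r. \<exists>a b n. q = rcode a b n \<and> r = (real a - real b) / real (Suc n))"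

lemma rcode_inject [simp]: "rcode a b n = rcode a' b' n' <-> a = a' \<and> b = b' \<and> n = n'"
  unfolding rcode_def by (simp del: hnat.simps)

lemma rv_rcode [simp]: "rv (rcode a b n) = (real a - real b) / real (Suc n)"
  unfolding rv_def by (rule the_equality) auto

definition QQ :: hc where "QQ = hset {rcode a b n | a b n. True}"

lemma elts_QQ: "elts QQ = {rcode a b n | a b n. True}"
proof -
  have "{rcode a b n | a b n. True} \<subseteq> (\<lambda>z. rcode (fst z) (fst (snd z)) (snd (snd z))) ` UNIV"
  proof
    fix q assume "q \<in> {rcode a b n | a b n. True}"
    then obtain a b n where "q = rcode a b n" by blast
    then show "q \<in> (\<lambda>z. rcode (fst z) (fst (snd z)) (snd (snd z))) ` UNIV" by (intro image_eqI[of _ _ "(a, b, n)"]) simp_all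
  qed
  then have "countable {rcode a b n | a b n. True}" by (rule countable_subset) (rule countable_image[OF countableI_type])
  then show ?thesis unfolding QQ_def by simp
qed

lemma rv_dense: assumes "x < y" shows "\<exists>q\<in>elts QQ. x < rv q \<and> rv q < y"
proof -
  obtain r where r: "r \<in> \<rat>" "x < r" "r < y" using Rats_dense_in_real[OF assms] by blast
  obtain p k :: int where pk: "k > 0" "r = of_int p / of_int k" using r(1) by (elim Rats_cases') auto
  define q where "q = rcode (nat p) (nat (- p)) (nat k - 1)"
  have "real (Suc (nat k - 1)) = of_int k" using pk(1) by simp
  moreover have "real (nat p) - real (nat (- p)) = of_int p" by (cases "p \<ge> 0") auto
  ultimately have "rv q = r" unfolding q_def rv_rcode pk(2) by simp
  moreover have "q \<in> elts QQ" unfolding elts_QQ q_def by blast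
  ultimately show ?thesis using r by blast
qed

text \<open>Rational arithmetic enters the model only through these strict inequalities. With the
  third entry 0, coded by \<open>rcode 0 0 0\<close>, this relation is the order of the
  rationals.\<close>

definition RADD :: hc where
  "RADD = hset {hpair q (hpair q1 q2) | q q1 q2. q \<in> elts QQ \<and> q1 \<in> elts QQ \<and> q2 \<in> elts QQ \<and> rv q < rv q1 + rv q2}"
definition RMUL :: hc where
  "RMUL = hset {hpair q (hpair q1 q2) | q q1 q2. q \<in> elts QQ \<and> q1 \<in> elts QQ \<and> q2 \<in> elts QQ \<and> rv q < rv q1 * rv q2}"

lemma countable_triples: "countable {hpair q (hpair q1 q2) | q q1 q2. q \<in> elts QQ \<and> q1 \<in> elts QQ \<and> q2 \<in> elts QQ \<and> P q q1 q2}"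
proof (rule countable_subset)
  show "{hpair q (hpair q1 q2) | q q1 q2. q \<in> elts QQ \<and> q1 \<in> elts QQ \<and> q2 \<in> elts QQ \<and> P q q1 q2} \<subseteq> elts (hprd QQ (hprd QQ QQ))" by auto
  show "countable (elts (hprd QQ (hprd QQ QQ)))" by simp
qed

lemma elts_RADD: "hpair q (hpair q1 q2) \<in> elts RADD <-> q \<in> elts QQ \<and> q1 \<in> elts QQ \<and> q2 \<in> elts QQ \<and> rv q < rv q1 + rv q2"
  unfolding RADD_def using countable_triples by simp

lemma elts_RMUL: "hpair q (hpair q1 q2) \<in> elts RMUL <-> q \<in> elts QQ \<and> q1 \<in> elts QQ \<and> q2 \<in> elts QQ \<and> rv q < rv q1 * rv q2"
  unfolding RMUL_def using countable_triples by simp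

text \<open>Clearing denominators and moving negative terms to the other side leaves an inequality
  between natural numbers, which ordinal arithmetic can express.\<close>

lemma RADD_nat: "rv (rcode a b n) < rv (rcode a1 b1 n1) + rv (rcode a2 b2 n2) <->
  (a * Suc n1) * Suc n2 + (b1 * Suc n) * Suc n2 + (b2 * Suc n) * Suc n1 < (b * Suc n1) * Suc n2 + (a1 * Suc n) * Suc n2 + (a2 * Suc n) * Suc n1"
proof -
  define u v w where "u = real (Suc n)" and "v = real (Suc n1)" and "w = real (Suc n2)"
  have pos: "u > 0" "v > 0" "w > 0" by (simp_all add: u_def v_def w_def)
  have uvw: "u * v * w > 0" using pos by simp
  have "rv (rcode a b n) < rv (rcode a1 b1 n1) + rv (rcode a2 b2 n2) <->
    (real a - real b) / u < (real a1 - real b1) / v + (real a2 - real b2) / w" by (simp add: u_def v_def w_def)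
  also have "\<dots> <-> ((real a - real b) / u) * (u * v * w) < ((real a1 - real b1) / v + (real a2 - real b2) / w) * (u * v * w)"
    by (rule mult_less_cancel_right_pos[OF uvw, symmetric])
  also have "((real a - real b) / u) * (u * v * w) = (real a - real b) * v * w" using pos by simp
  also have "((real a1 - real b1) / v + (real a2 - real b2) / w) * (u * v * w) = (real a1 - real b1) * u * w + (real a2 - real b2) * u * v"
    using pos by (simp add: distrib_right)
  also have "(real a - real b) * v * w < (real a1 - real b1) * u * w + (real a2 - real b2) * u * v <->
    (real a * v) * w + (real b1 * u) * w + (real b2 * u) * v < (real b * v) * w + (real a1 * u) * w + (real a2 * u) * v"
    by (simp add: algebra_simps)
  also have "\<dots> <-> real ((a * Suc n1) * Suc n2 + (b1 * Suc n) * Suc n2 + (b2 * Suc n) * Suc n1) <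
      real ((b * Suc n1) * Suc n2 + (a1 * Suc n) * Suc n2 + (a2 * Suc n) * Suc n1)"
    unfolding u_def v_def w_def of_nat_add of_nat_mult ..
  finally show ?thesis unfolding of_nat_less_iff .
qed

lemma RMUL_nat: "rv (rcode a b n) < rv (rcode a1 b1 n1) * rv (rcode a2 b2 n2) <->
  (a * Suc n1) * Suc n2 + (a1 * b2) * Suc n + (b1 * a2) * Suc n < (b * Suc n1) * Suc n2 + (a1 * a2) * Suc n + (b1 * b2) * Suc n"
proof -
  define u v w where "u = real (Suc n)" and "v = real (Suc n1)" and "w = real (Suc n2)"
  have pos: "u > 0" "v > 0" "w > 0" by (simp_all add: u_def v_def w_def)
  have uvw: "u * v * w > 0" using pos by simp
  have "rv (rcode a b n) < rv (rcode a1 b1 n1) * rv (rcode a2 b2 n2) <->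
    (real a - real b) / u < ((real a1 - real b1) / v) * ((real a2 - real b2) / w)" by (simp add: u_def v_def w_def)
  also have "\<dots> <-> ((real a - real b) / u) * (u * v * w) < (((real a1 - real b1) / v) * ((real a2 - real b2) / w)) * (u * v * w)"
    by (rule mult_less_cancel_right_pos[OF uvw, symmetric])
  also have "((real a - real b) / u) * (u * v * w) = (real a - real b) * v * w" using pos by simp
  also have "(((real a1 - real b1) / v) * ((real a2 - real b2) / w)) * (u * v * w) = (real a1 - real b1) * (real a2 - real b2) * u"
    using pos by simp
  also have "(real a - real b) * v * w < (real a1 - real b1) * (real a2 - real b2) * u <->
    (real a * v) * w + (real a1 * real b2) * u + (real b1 * real a2) * u < (real b * v) * w + (real a1 * real a2) * u + (real b1 * real b2) * u"
    by (simp add: algebra_simps)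
  also have "\<dots> <-> real ((a * Suc n1) * Suc n2 + (a1 * b2) * Suc n + (b1 * a2) * Suc n) <
      real ((b * Suc n1) * Suc n2 + (a1 * a2) * Suc n + (b1 * b2) * Suc n)"
    unfolding u_def v_def w_def of_nat_add of_nat_mult ..
  finally show ?thesis unfolding of_nat_less_iff .
qed

context zfc
begin

definition trip :: "hc => hc => hc => hc" where "trip a b n = hpair a (hpair b (hsucc n))"

lemma trip_hnat: "trip (hnat a) (hnat b) (hnat n) = rcode a b n"
  by (simp add: trip_def rcode_def)

lemma QQ_closed: "QQ \<in> M"
proof -
  have "hset {z \<in> elts (hprd homega (hprd homega homega)).
      \<exists>a\<in>elts homega. \<exists>b\<in>elts homega. \<exists>n\<in>elts homega. z = hpair a (hpair b (hsucc n))} \<in> M"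
    by (rule sep) (simp, intro dfi homega_closed)
  moreover have "{z \<in> elts (hprd homega (hprd homega homega)).
      \<exists>a\<in>elts homega. \<exists>b\<in>elts homega. \<exists>n\<in>elts homega. z = hpair a (hpair b (hsucc n))} = {rcode a b n | a b n. True}"
  proof (intro equalityI subsetI)
    fix z assume "z \<in> {z \<in> elts (hprd homega (hprd homega homega)).
      \<exists>a\<in>elts homega. \<exists>b\<in>elts homega. \<exists>n\<in>elts homega. z = hpair a (hpair b (hsucc n))}"
    then obtain a b n where "z = hpair (hnat a) (hpair (hnat b) (hsucc (hnat n)))" by auto
    then have "z = rcode a b n" by (simp add: rcode_def)
    then show "z \<in> {rcode a b n | a b n. True}" by blast
  next
    fix z assume "z \<in> {rcode a b n | a b n. True}"
    then obtain a b n where z: "z = hpair (hnat a) (hpair (hnat b) (hsucc (hnat n)))" by (auto simp: rcode_def)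
    have "hsucc (hnat n) \<in> elts homega" using rangeI[of hnat "Suc n"] by simp
    then show "z \<in> {z \<in> elts (hprd homega (hprd homega homega)).
      \<exists>a\<in>elts homega. \<exists>b\<in>elts homega. \<exists>n\<in>elts homega. z = hpair a (hpair b (hsucc n))}" using z by auto
  qed
  ultimately show ?thesis unfolding QQ_def by simp
qed

text \<open>Quantifiers over codes become quantifiers over nine natural numbers, so a relation
  between rationals that is given by arithmetic of naturals is a set of the model.\<close>

lemma triple_rel_closed:
  assumes C: "dfn M (\<lambda>s. C (s 0) (s 1) (s 2) (s 3) (s 4) (s 5) (s 6) (s 7) (s 8))"
    and P: "\<And>a b n a1 b1 n1 a2 b2 n2. P (rcode a b n) (rcode a1 b1 n1) (rcode a2 b2 n2) <->
      C (hnat a) (hnat b) (hnat n) (hnat a1) (hnat b1) (hnat n1) (hnat a2) (hnat b2) (hnat n2)"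
  shows "hset {hpair q (hpair q1 q2) | q q1 q2. q \<in> elts QQ \<and> q1 \<in> elts QQ \<and> q2 \<in> elts QQ \<and> P q q1 q2} \<in> M"
    (is "hset ?R \<in> M")
proof -
  define Z where "Z z <-> (\<exists>a\<in>elts homega. \<exists>b\<in>elts homega. \<exists>n\<in>elts homega. \<exists>a1\<in>elts homega. \<exists>b1\<in>elts homega. \<exists>n1\<in>elts homega.
    \<exists>a2\<in>elts homega. \<exists>b2\<in>elts homega. \<exists>n2\<in>elts homega. z = hpair (trip a b n) (hpair (trip a1 b1 n1) (trip a2 b2 n2)) \<and>
    C a b n a1 b1 n1 a2 b2 n2)" for z
  have C': "dfn M (\<lambda>s. C (s (Suc (Suc (Suc (Suc (Suc (Suc (Suc (Suc 0)))))))))  (s (Suc (Suc (Suc (Suc (Suc (Suc (Suc 0))))))))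
    (s (Suc (Suc (Suc (Suc (Suc (Suc 0))))))) (s (Suc (Suc (Suc (Suc (Suc 0)))))) (s (Suc (Suc (Suc (Suc 0))))) (s (Suc (Suc (Suc 0)))) (s (Suc (Suc 0))) (s (Suc 0)) (s 0))"
    using dfn_shift[OF C, of "\<lambda>i. 8 - i"] by (simp add: eval_nat_numeral)
  have D: "dfn M (\<lambda>s. Z (s 0))" unfolding Z_def trip_def
    by (intro bex elem homega_closed dfn_conj eq dff_hpair dff_hsucc var C')
  have "hset {z \<in> elts (hprd QQ (hprd QQ QQ)). Z z} \<in> M"
    by (rule sep[OF _ D]) (simp add: QQ_closed)
  moreover have "{z \<in> elts (hprd QQ (hprd QQ QQ)). Z z} = ?R"
  proof (intro equalityI subsetI)
    fix z assume "z \<in> {z \<in> elts (hprd QQ (hprd QQ QQ)). Z z}"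
    then have zQ: "z \<in> elts (hprd QQ (hprd QQ QQ))" and "Z z" by blast+
    then obtain a b n a1 b1 n1 a2 b2 n2 where
      z: "z = hpair (trip (hnat a) (hnat b) (hnat n)) (hpair (trip (hnat a1) (hnat b1) (hnat n1)) (trip (hnat a2) (hnat b2) (hnat n2)))"
      "C (hnat a) (hnat b) (hnat n) (hnat a1) (hnat b1) (hnat n1) (hnat a2) (hnat b2) (hnat n2)"
      unfolding Z_def by auto
    then have "P (rcode a b n) (rcode a1 b1 n1) (rcode a2 b2 n2)" using P by blast
    then show "z \<in> ?R" using zQ z(1) unfolding trip_hnat by auto
  next
    fix z assume "z \<in> ?R"
    then obtain q q1 q2 where q: "z = hpair q (hpair q1 q2)" "q \<in> elts QQ" "q1 \<in> elts QQ" "q2 \<in> elts QQ" "P q q1 q2" by blast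
    obtain a b n a1 b1 n1 a2 b2 n2 where e: "q = rcode a b n" "q1 = rcode a1 b1 n1" "q2 = rcode a2 b2 n2" using q(2-4) unfolding elts_QQ by blast
    have "C (hnat a) (hnat b) (hnat n) (hnat a1) (hnat b1) (hnat n1) (hnat a2) (hnat b2) (hnat n2)"
      using P q(5) unfolding e by blast
    moreover have "z = hpair (trip (hnat a) (hnat b) (hnat n)) (hpair (trip (hnat a1) (hnat b1) (hnat n1)) (trip (hnat a2) (hnat b2) (hnat n2)))"
      unfolding trip_hnat q(1) e ..
    moreover have w: "hnat k \<in> elts homega" for k by simp
    ultimately have "Z z" unfolding Z_def using w by blast
    then show "z \<in> {z \<in> elts (hprd QQ (hprd QQ QQ)). Z z}" using q by simp
  qed
  ultimately show ?thesis by simp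
qed

lemma RADD_closed: "RADD \<in> M"
  unfolding RADD_def
proof (rule triple_rel_closed)
  \<comment> \<open>\<open>F\<close> is the left side of the inequality; the right side arises by
    exchanging a and b in all three codes.\<close>
  define F where "F a b n a1 b1 n1 a2 b2 n2 = hadd (hadd (hmul (hmul a (hsucc n1)) (hsucc n2)) (hmul (hmul b1 (hsucc n)) (hsucc n2)))
    (hmul (hmul b2 (hsucc n)) (hsucc n1))" for a b n a1 b1 n1 a2 b2 n2 :: hc
  have S: "hsucc (hnat k) = hnat (Suc k)" for k by simp
  show "dfn M (\<lambda>s. F (s 0) (s 1) (s 2) (s 3) (s 4) (s 5) (s 6) (s 7) (s 8) \<in> elts (F (s 1) (s 0) (s 2) (s 4) (s 3) (s 5) (s 7) (s 6) (s 8)))"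
    unfolding F_def by (intro dfi)
  show "rv (rcode a b n) < rv (rcode a1 b1 n1) + rv (rcode a2 b2 n2) <->
      F (hnat a) (hnat b) (hnat n) (hnat a1) (hnat b1) (hnat n1) (hnat a2) (hnat b2) (hnat n2) \<in>
      elts (F (hnat b) (hnat a) (hnat n) (hnat b1) (hnat a1) (hnat n1) (hnat b2) (hnat a2) (hnat n2))" for a b n a1 b1 n1 a2 b2 n2
    unfolding RADD_nat F_def S hmul_hnat hadd_hnat hnat_mem ..
qed

lemma RMUL_closed: "RMUL \<in> M"
  unfolding RMUL_def
proof (rule triple_rel_closed)
  \<comment> \<open>Here the right side arises by exchanging a and b in the first and the third code
    only.\<close>
  define F where "F a b n a1 b1 n1 a2 b2 n2 = hadd (hadd (hmul (hmul a (hsucc n1)) (hsucc n2)) (hmul (hmul a1 b2) (hsucc n)))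
    (hmul (hmul b1 a2) (hsucc n))" for a b n a1 b1 n1 a2 b2 n2 :: hc
  have S: "hsucc (hnat k) = hnat (Suc k)" for k by simp
  show "dfn M (\<lambda>s. F (s 0) (s 1) (s 2) (s 3) (s 4) (s 5) (s 6) (s 7) (s 8) \<in> elts (F (s 1) (s 0) (s 2) (s 3) (s 4) (s 5) (s 7) (s 6) (s 8)))"
    unfolding F_def by (intro dfi)
  show "rv (rcode a b n) < rv (rcode a1 b1 n1) * rv (rcode a2 b2 n2) <->
      F (hnat a) (hnat b) (hnat n) (hnat a1) (hnat b1) (hnat n1) (hnat a2) (hnat b2) (hnat n2) \<in>
      elts (F (hnat b) (hnat a) (hnat n) (hnat a1) (hnat b1) (hnat n1) (hnat b2) (hnat a2) (hnat n2))" for a b n a1 b1 n1 a2 b2 n2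
    unfolding RMUL_nat F_def S hmul_hnat hadd_hnat hnat_mem ..
qed

end

text \<open>The rationals with their arithmetic are obtained by recursion in the ground model and
  handed on to the generic extension through these assumptions.\<close>

locale real_model = tmo +
  assumes QQM [simp]: "QQ \<in> M" and RADDM [simp]: "RADD \<in> M" and RMULM [simp]: "RMUL \<in> M"

definition dcut :: "real => hc" where "dcut r = hset {q \<in> elts QQ. rv q < r}"

lemma elts_cut: "elts (dcut r) = {q \<in> elts QQ. rv q < r}"
  by (rule elts_sep[OF dcut_def])

lemma cut_subset: "elts (dcut r) \<subseteq> elts (dcut s) <-> r \<le> s"
proof
  assume s: "elts (dcut r) \<subseteq> elts (dcut s)"
  show "r \<le> s"
  proof (rule ccontr)
    assume "\<not> r \<le> s"
    then obtain q where "q \<in> elts QQ" "s < rv q" "rv q < r" using rv_dense[of s r] by auto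
    then show False using s unfolding elts_cut by auto
  qed
qed (auto simp: elts_cut)

lemma cut_inject [simp]: "dcut r = dcut s <-> r = s"
  using cut_subset[of r s] cut_subset[of s r] by auto

text \<open>A nonempty proper initial segment of the rationals without a largest element, phrased
  with \<open>RADD\<close> alone so as to be definable over the model.\<close>

definition is_cut :: "hc => bool" where
  "is_cut X <-> elts X \<subseteq> elts QQ \<and> X \<noteq> hempty \<and> X \<noteq> QQ \<and>
    (\<forall>q\<in>elts X. \<forall>q'\<in>elts QQ. hpair q' (hpair q (rcode 0 0 0)) \<in> elts RADD --> q' \<in> elts X) \<and>
    (\<forall>q\<in>elts X. \<exists>q'\<in>elts X. hpair q (hpair q' (rcode 0 0 0)) \<in> elts RADD)"

lemma rcode_QQ [simp]: "rcode a b n \<in> elts QQ" unfolding elts_QQ by blast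

lemma RLT: "hpair q (hpair q' (rcode 0 0 0)) \<in> elts RADD <-> q \<in> elts QQ \<and> q' \<in> elts QQ \<and> rv q < rv q'"
  unfolding elts_RADD by simp

text \<open>By completeness of the reals outside the model, the cut belongs to the supremum of the
  rationals in it.\<close>

lemma is_cut_iff: "is_cut X <-> (\<exists>r. X = dcut r)"
proof
  assume X: "is_cut X"
  then have sub: "elts X \<subseteq> elts QQ" unfolding is_cut_def by blast
  have down: "q' \<in> elts X" if "q \<in> elts X" "q' \<in> elts QQ" "rv q' < rv q" for q q'
    using X that sub unfolding is_cut_def RLT by blast
  have up: "\<exists>q'\<in>elts X. rv q < rv q'" if "q \<in> elts X" for q
    using X that unfolding is_cut_def RLT by blast
  obtain q0 where q0: "q0 \<in> elts X" using X unfolding is_cut_def using elts_eq_empty by blast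
  obtain q1 where q1: "q1 \<in> elts QQ" "q1 \<notin> elts X" using X sub unfolding is_cut_def by (metis hc_eqI subsetI subset_antisym)
  have bd: "rv q \<le> rv q1" if "q \<in> elts X" for q using down[OF that q1(1)] q1(2) by fastforce
  define r where "r = Sup (rv ` elts X)"
  have bdd: "bdd_above (rv ` elts X)" using bd by (intro bdd_aboveI[of _ "rv q1"]) auto
  have "X = dcut r"
  proof (rule hc_eqI, intro equalityI subsetI)
    fix q assume q: "q \<in> elts X"
    obtain q' where "q' \<in> elts X" "rv q < rv q'" using up[OF q] by blast
    then have "rv q < r" unfolding r_def using cSup_upper[OF _ bdd, of "rv q'"] by fastforce
    then show "q \<in> elts (dcut r)" unfolding elts_cut using q sub by blast
  next
    fix q assume "q \<in> elts (dcut r)"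
    then have "q \<in> elts QQ" "rv q < r" unfolding elts_cut by blast+
    moreover have "rv ` elts X \<noteq> {}" using q0 by blast
    ultimately obtain q' where "q' \<in> elts X" "rv q < rv q'"
      unfolding r_def using less_cSup_iff[OF _ bdd] by auto
    then show "q \<in> elts X" using down \<open>q \<in> elts QQ\<close> by blast
  qed
  then show "\<exists>r. X = dcut r" by blast
next
  assume "\<exists>r. X = dcut r"
  then obtain r where X: "X = dcut r" by blast
  obtain q0 where q0: "q0 \<in> elts QQ" "rv q0 < r" using rv_dense[of "r - 1" r] by auto
  obtain q1 where q1: "q1 \<in> elts QQ" "r < rv q1" using rv_dense[of r "r + 1"] by auto
  have "X \<noteq> hempty" using q0 X elts_cut[of r] by auto
  moreover have "X \<noteq> QQ"
  proof -
    have "q1 \<notin> elts X" unfolding X elts_cut using q1(2) by simp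
    then show ?thesis using q1(1) by blast
  qed
  moreover have "\<exists>q'\<in>elts X. hpair q (hpair q' (rcode 0 0 0)) \<in> elts RADD" if "q \<in> elts X" for q
  proof -
    have "q \<in> elts QQ" "rv q < r" using that X elts_cut by auto
    then show ?thesis using rv_dense[of "rv q" r] unfolding X elts_cut RLT by auto
  qed
  ultimately show "is_cut X" unfolding is_cut_def X RLT by (auto simp: elts_cut)
qed

lemma add_cut: "q < r + s <-> (\<exists>q1\<in>elts (dcut r). \<exists>q2\<in>elts (dcut s). q < rv q1 + rv q2)"
proof
  assume q: "q < r + s"
  define e where "e = (r + s - q) / 2"
  have e: "e > 0" using q by (simp add: e_def)
  obtain q1 where q1: "q1 \<in> elts QQ" "r - e < rv q1" "rv q1 < r" using rv_dense[of "r - e" r] e by auto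
  obtain q2 where q2: "q2 \<in> elts QQ" "s - e < rv q2" "rv q2 < s" using rv_dense[of "s - e" s] e by auto
  have "q = (r - e) + (s - e)" by (simp add: e_def field_simps)
  then have "q < rv q1 + rv q2" using q1 q2 by linarith
  then show "\<exists>q1\<in>elts (dcut r). \<exists>q2\<in>elts (dcut s). q < rv q1 + rv q2" using q1 q2 unfolding elts_cut by blast
qed (force simp: elts_cut)

text \<open>A bilinear function on a rectangle attains its minimum at a corner; fixing one factor at
  a time covers all signs.\<close>

lemma bilinear_min:
  fixes x y :: real
  assumes "a \<le> x" "x \<le> b" "c \<le> y" "y \<le> d" "q < a * c" "q < a * d" "q < b * c" "q < b * d"
  shows "q < x * y"
proof -
  have mid: "q < u * z" if "c \<le> z" "z \<le> d" "q < u * c" "q < u * d" for u z :: real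
  proof (cases "u \<ge> 0")
    case True then have "u * c \<le> u * z" using that by (intro mult_left_mono) auto
    then show ?thesis using that by linarith
  next
    case False then have "u * d \<le> u * z" using that by (intro mult_left_mono_neg) auto
    then show ?thesis using that by linarith
  qed
  have "q < a * y" "q < b * y" using mid assms by blast+
  show ?thesis
  proof (cases "y \<ge> 0")
    case True then have "a * y \<le> x * y" using assms by (intro mult_right_mono) auto
    then show ?thesis using \<open>q < a * y\<close> by linarith
  next
    case False then have "b * y \<le> x * y" using assms by (intro mult_right_mono_neg) auto
    then show ?thesis using \<open>q < b * y\<close> by linarith
  qed
qed

text \<open>q lies below all four corner products of a rational rectangle around the two reals. This
  treats all signs alike, in contrast to the usual case distinction for products of cuts.\<close>

definition mul_below :: "hc => hc => hc => bool" where
  "mul_below q X Y <-> (\<exists>q1\<in>elts X. \<exists>q1'\<in>elts QQ. q1' \<notin> elts X \<and> (\<exists>q2\<in>elts Y. \<exists>q2'\<in>elts QQ. q2' \<notin> elts Y \<and>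
    hpair q (hpair q1 q2) \<in> elts RMUL \<and> hpair q (hpair q1 q2') \<in> elts RMUL \<and>
    hpair q (hpair q1' q2) \<in> elts RMUL \<and> hpair q (hpair q1' q2') \<in> elts RMUL))"

lemma mul_cut:
  assumes q: "q \<in> elts QQ" shows "rv q < r * s <-> mul_below q (dcut r) (dcut s)"
proof
  assume qr: "rv q < r * s"
  \<comment> \<open>The bound 1 gives |y| <= |s| + 1 when r s - x y is estimated; the other bound
    keeps the total error below r s - q.\<close>
  define e where "e = min 1 ((r * s - rv q) / (\<bar>r\<bar> + \<bar>s\<bar> + 1))"
  have e: "e > 0" unfolding e_def using qr by (simp add: add_nonneg_pos)
  have e2: "e * (\<bar>r\<bar> + \<bar>s\<bar> + 1) \<le> r * s - rv q"
  proof -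
    have "e \<le> (r * s - rv q) / (\<bar>r\<bar> + \<bar>s\<bar> + 1)" unfolding e_def by simp
    then show ?thesis by (simp add: pos_le_divide_eq add_nonneg_pos)
  qed
  have near: "rv q < x * y" if "\<bar>x - r\<bar> < e" "\<bar>y - s\<bar> < e" for x y
  proof -
    have y: "\<bar>y\<bar> \<le> \<bar>s\<bar> + 1" using that(2) unfolding e_def by linarith
    have "r * s - x * y = (r - x) * y + r * (s - y)" by (simp add: algebra_simps)
    also have "\<dots> \<le> \<bar>r - x\<bar> * \<bar>y\<bar> + \<bar>r\<bar> * \<bar>s - y\<bar>" by (metis abs_ge_self abs_mult add_mono)
    also have "\<bar>r - x\<bar> * \<bar>y\<bar> \<le> \<bar>r - x\<bar> * (\<bar>s\<bar> + 1)" using y by (intro mult_left_mono) auto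
    also have "\<bar>r - x\<bar> * (\<bar>s\<bar> + 1) < e * (\<bar>s\<bar> + 1)" using that(1) by (intro mult_strict_right_mono) auto
    also have "\<bar>r\<bar> * \<bar>s - y\<bar> \<le> \<bar>r\<bar> * e" using that(2) by (intro mult_left_mono) auto
    finally have "r * s - x * y < e * (\<bar>s\<bar> + 1) + \<bar>r\<bar> * e" by simp
    also have "\<dots> = e * (\<bar>r\<bar> + \<bar>s\<bar> + 1)" by (simp add: algebra_simps)
    finally show ?thesis using e2 by linarith
  qed
  obtain q1 where q1: "q1 \<in> elts QQ" "r - e < rv q1" "rv q1 < r" using rv_dense[of "r - e" r] e by auto
  obtain q2 where q2: "q2 \<in> elts QQ" "s - e < rv q2" "rv q2 < s" using rv_dense[of "s - e" s] e by auto
  obtain q1' where q1': "q1' \<in> elts QQ" "r < rv q1'" "rv q1' < r + e" using rv_dense[of r "r + e"] e by auto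
  obtain q2' where q2': "q2' \<in> elts QQ" "s < rv q2'" "rv q2' < s + e" using rv_dense[of s "s + e"] e by auto
  have ab: "\<bar>rv q1 - r\<bar> < e" "\<bar>rv q1' - r\<bar> < e" "\<bar>rv q2 - s\<bar> < e" "\<bar>rv q2' - s\<bar> < e" using q1 q2 q1' q2' by linarith+
  have "q1 \<in> elts (dcut r)" "q1' \<notin> elts (dcut r)" "q2 \<in> elts (dcut s)" "q2' \<notin> elts (dcut s)" using q1 q2 q1' q2' unfolding elts_cut by auto
  then show "mul_below q (dcut r) (dcut s)"
    unfolding mul_below_def elts_RMUL using near ab q q1(1) q2(1) q1'(1) q2'(1) by blast
next
  assume "mul_below q (dcut r) (dcut s)"
  then obtain q1 q1' q2 q2' where h: "q1 \<in> elts (dcut r)" "q1' \<in> elts QQ" "q1' \<notin> elts (dcut r)" "q2 \<in> elts (dcut s)" "q2' \<in> elts QQ"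
    "q2' \<notin> elts (dcut s)" "rv q < rv q1 * rv q2" "rv q < rv q1 * rv q2'" "rv q < rv q1' * rv q2" "rv q < rv q1' * rv q2'"
    unfolding mul_below_def elts_RMUL by blast
  then have "rv q1 \<le> r" "r \<le> rv q1'" "rv q2 \<le> s" "s \<le> rv q2'" unfolding elts_cut by auto
  then show "rv q < r * s" using bilinear_min h by blast
qed

context real_model
begin

text \<open>The reals whose cut belongs to \<open>M\<close> form a field, so that the field axioms of the model are inherited
  from the type of real numbers.\<close>

definition K :: "real set" where "K = {r. dcut r \<in> M}"

lemma cut_closed_iff: "dcut r \<in> M <-> r \<in> K" unfolding K_def by simp

lemma QQD: "q \<in> elts QQ ==> q \<in> M" using transD[OF _ QQM] .

lemma KI:
  assumes "dfn M (\<lambda>s. P (s 0))" "\<And>q. q \<in> elts QQ ==> P q <-> rv q < r" shows "r \<in> K"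
proof -
  have "hset {q \<in> elts QQ. P q} \<in> M" by (rule sep[OF QQM assms(1)])
  moreover have "{q \<in> elts QQ. P q} = {q \<in> elts QQ. rv q < r}" using assms(2) by blast
  ultimately show ?thesis unfolding K_def dcut_def by simp
qed

lemma dfn_mul_below: "dfn M (\<lambda>s. mul_below (s 0) (s 1) (s 2))"
  unfolding mul_below_def
  by (intro bex dfn_conj dfn_not mem dff_hpair var elem QQM RMULM)

lemma K_rv: "q \<in> elts QQ ==> rv q \<in> K"
proof (rule KI[of "\<lambda>q'. hpair q' (hpair q (rcode 0 0 0)) \<in> elts RADD"])
  assume q: "q \<in> elts QQ"
  show "dfn M (\<lambda>s. hpair (s 0) (hpair q (rcode 0 0 0)) \<in> elts RADD)"
    by (intro mem dff_hpair var elem RADDM QQD q rcode_QQ)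
qed (simp add: RLT)

lemma K_of_nat: "real n \<in> K" and K_minus_nat: "- real n \<in> K"
  using K_rv[of "rcode n 0 0"] K_rv[of "rcode 0 n 0"] by simp_all

lemma K_0: "0 \<in> K" and K_1: "1 \<in> K" using K_of_nat[of 0] K_of_nat[of 1] by simp_all

lemma K_add: "r \<in> K ==> s \<in> K ==> r + s \<in> K"
proof (rule KI[of "\<lambda>q. \<exists>q1\<in>elts (dcut r). \<exists>q2\<in>elts (dcut s). hpair q (hpair q1 q2) \<in> elts RADD"])
  assume "r \<in> K" "s \<in> K"
  then have M: "dcut r \<in> M" "dcut s \<in> M" using cut_closed_iff by blast+
  show "dfn M (\<lambda>e. \<exists>q1\<in>elts (dcut r). \<exists>q2\<in>elts (dcut s). hpair (e 0) (hpair q1 q2) \<in> elts RADD)"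
    by (intro bex mem dff_hpair var elem RADDM M)
  show "(\<exists>q1\<in>elts (dcut r). \<exists>q2\<in>elts (dcut s). hpair q (hpair q1 q2) \<in> elts RADD) <-> rv q < r + s" if "q \<in> elts QQ" for q
    using that add_cut[of "rv q" r s] unfolding elts_RADD by (simp add: elts_cut)
qed

lemma K_mul: "r \<in> K ==> s \<in> K ==> r * s \<in> K"
proof (rule KI[of "\<lambda>q. mul_below q (dcut r) (dcut s)"])
  assume "r \<in> K" "s \<in> K"
  then have M: "dcut r \<in> M" "dcut s \<in> M" using cut_closed_iff by blast+
  show "dfn M (\<lambda>e. mul_below (e 0) (dcut r) (dcut s))"
    by (rule dfn_comp3[where Q = mul_below, OF dfn_mul_below]) (intro var elem M)+
qed (simp add: mul_cut)

lemma K_uminus: "r \<in> K ==> - r \<in> K"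
  using K_mul[OF K_minus_nat[of 1]] by force

text \<open>q < 1/r holds exactly if p q' <= 1 for some p > q and some q' >= r, a condition on the
  cut that avoids division.\<close>

lemma K_inverse_pos:
  assumes r: "r \<in> K" "r > 0" shows "inverse r \<in> K"
proof (rule KI[of "\<lambda>q. \<exists>q'\<in>elts QQ. q' \<notin> elts (dcut r) \<and> (\<exists>p\<in>elts QQ. hpair q (hpair p (rcode 0 0 0)) \<in> elts RADD \<and>
    hpair (rcode 1 0 0) (hpair p q') \<notin> elts RMUL)"])
  have M: "dcut r \<in> M" using r cut_closed_iff by blast
  show "dfn M (\<lambda>e. \<exists>q'\<in>elts QQ. q' \<notin> elts (dcut r) \<and> (\<exists>p\<in>elts QQ. hpair (e 0) (hpair p (rcode 0 0 0)) \<in> elts RADD \<and>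
    hpair (rcode 1 0 0) (hpair p q') \<notin> elts RMUL))"
    by (intro bex dfn_conj dfn_not mem dff_hpair var elem RADDM RMULM QQM M QQD rcode_QQ)
  fix q assume q: "q \<in> elts QQ"
  show "(\<exists>q'\<in>elts QQ. q' \<notin> elts (dcut r) \<and> (\<exists>p\<in>elts QQ. hpair q (hpair p (rcode 0 0 0)) \<in> elts RADD \<and>
    hpair (rcode 1 0 0) (hpair p q') \<notin> elts RMUL)) <-> rv q < inverse r" (is "?L <-> _")
  proof
    assume ?L
    then obtain q' p where h: "q' \<in> elts QQ" "r \<le> rv q'" "p \<in> elts QQ" "rv q < rv p" "\<not> 1 < rv p * rv q'"
      unfolding RLT elts_RMUL elts_cut by auto
    have "rv p \<le> inverse r"
    proof (cases "rv p \<le> 0")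
      case True then show ?thesis using r(2) by (meson inverse_nonnegative_iff_nonnegative less_eq_real_def order_trans)
    next
      case False
      then have "rv p * r \<le> rv p * rv q'" using h(2) by (intro mult_left_mono) auto
      then have "rv p * r \<le> 1" using h(5) by linarith
      then show ?thesis using r(2) by (simp add: field_simps)
    qed
    then show "rv q < inverse r" using h(4) by linarith
  next
    assume ql: "rv q < inverse r"
    obtain p where p: "p \<in> elts QQ" "max (rv q) 0 < rv p" "rv p < inverse r"
      using rv_dense[of "max (rv q) 0" "inverse r"] ql r(2) by auto
    have "r < inverse (rv p)" using p r(2) by (simp add: field_simps)
    then obtain q' where q': "q' \<in> elts QQ" "r < rv q'" "rv q' < inverse (rv p)" using rv_dense by blast
    have "rv p > 0" using p by simp
    then have "rv p * rv q' < 1" using q'(3) by (simp add: field_simps)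
    then show ?L using p q q' unfolding RLT elts_RMUL elts_cut by (intro bexI[of _ q'] conjI bexI[of _ p]) auto
  qed
qed

lemma K_inverse: "r \<in> K ==> r \<noteq> 0 ==> inverse r \<in> K"
proof (cases "r > 0")
  case False
  assume "r \<in> K" "r \<noteq> 0"
  then have "inverse (- r) \<in> K" using False K_uminus by (intro K_inverse_pos) auto
  then show ?thesis using K_uminus by fastforce
qed (rule K_inverse_pos)

definition RS :: hc where "RS = hset {X \<in> elts (pw QQ). is_cut X}"

lemma dfn_is_cut: "dfn M (\<lambda>s. is_cut (s 0))"
  unfolding is_cut_def
  by (intro dfn_conj subset dfn_not eq ball bex dfn_imp mem dff_hpair var elem QQM RADDM QQD rcode_QQ hempty_closed)

lemma RS_closed: "RS \<in> M" unfolding RS_def by (rule sep[OF pw(1)[OF QQM] dfn_is_cut])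

lemma elts_RS: "elts RS = dcut ` K"
proof -
  note elts_sep[OF RS_def]
  then show ?thesis unfolding pw(2)[OF QQM] is_cut_iff K_def by (auto simp: elts_cut)
qed

definition addf :: hc where
  "addf = hset {z \<in> elts (hprd (hprd RS RS) RS). \<exists>X\<in>elts RS. \<exists>Y\<in>elts RS. \<exists>Z\<in>elts RS. z = hpair (hpair X Y) Z \<and>
    (\<forall>q\<in>elts QQ. q \<in> elts Z <-> (\<exists>q1\<in>elts X. \<exists>q2\<in>elts Y. hpair q (hpair q1 q2) \<in> elts RADD))}"
definition mulf :: hc where
  "mulf = hset {z \<in> elts (hprd (hprd RS RS) RS). \<exists>X\<in>elts RS. \<exists>Y\<in>elts RS. \<exists>Z\<in>elts RS. z = hpair (hpair X Y) Z \<and>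
    (\<forall>q\<in>elts QQ. q \<in> elts Z <-> mul_below q X Y)}"
definition ltf :: hc where
  "ltf = hset {z \<in> elts (hprd RS RS). \<exists>X\<in>elts RS. \<exists>Y\<in>elts RS. z = hpair X Y \<and> elts X \<subseteq> elts Y \<and> X \<noteq> Y}"

lemma op_closed: "addf \<in> M" "mulf \<in> M" "ltf \<in> M"
proof -
  have B: "hprd (hprd RS RS) RS \<in> M" "hprd RS RS \<in> M" using RS_closed by simp_all
  show "addf \<in> M" unfolding addf_def
    by (rule sep[OF B(1)]) (intro bex ball dfn_conj dfn_iff eq mem dff_hpair var elem RS_closed QQM RADDM)
  show "mulf \<in> M" unfolding mulf_def
    by (rule sep[OF B(1)])
      (intro bex ball dfn_conj dfn_iff eq mem dff_hpair var elem RS_closed QQM dfn_comp3[where Q = mul_below, OF dfn_mul_below])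
  show "ltf \<in> M" unfolding ltf_def
    by (rule sep[OF B(2)]) (intro bex dfn_conj dfn_not subset eq dff_hpair var elem RS_closed)
qed

text \<open>The common part of addition and multiplication: a relation between cuts that describes
  an operation on \<open>K\<close> is a function of the model.\<close>

lemma op_graph:
  assumes f: "f = hset {z \<in> elts (hprd (hprd RS RS) RS). \<exists>X\<in>elts RS. \<exists>Y\<in>elts RS. \<exists>Z\<in>elts RS. z = hpair (hpair X Y) Z \<and> Q X Y Z}"
    and fM: "f \<in> M" and c: "\<And>r s. r \<in> K ==> s \<in> K ==> op r s \<in> K"
    and Q: "\<And>r s t. r \<in> K ==> s \<in> K ==> t \<in> K ==> Q (dcut r) (dcut s) (dcut t) <-> t = op r s"
  shows "fun_in M f (hprod (elts RS) (elts RS)) (elts RS)" "r \<in> K ==> s \<in> K ==> f \<cdot> hpair (dcut r) (dcut s) = dcut (op r s)"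
proof -
  note ef = elts_sep[OF f]
  have m: "hpair (hpair (dcut r) (dcut s)) z \<in> elts f <-> z = dcut (op r s)" if rs: "r \<in> K" "s \<in> K" for r s z
  proof
    assume "hpair (hpair (dcut r) (dcut s)) z \<in> elts f"
    then have "z \<in> elts RS" "Q (dcut r) (dcut s) z" unfolding ef by auto
    then obtain t where "t \<in> K" "z = dcut t" unfolding elts_RS by blast
    then show "z = dcut (op r s)" using Q rs \<open>Q (dcut r) (dcut s) z\<close> by blast
  next
    assume z: "z = dcut (op r s)"
    have "Q (dcut r) (dcut s) z" unfolding z using Q[OF rs c[OF rs]] by blast
    moreover have "dcut r \<in> elts RS" "dcut s \<in> elts RS" "z \<in> elts RS" unfolding elts_RS z using rs c by blast+
    ultimately show "hpair (hpair (dcut r) (dcut s)) z \<in> elts f" unfolding ef by auto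
  qed
  have h: "hfun f (hprod (elts RS) (elts RS))"
    unfolding hfun_def
  proof (intro conjI ballI)
    fix z assume "z \<in> elts f"
    then show "\<exists>x\<in>hprod (elts RS) (elts RS). \<exists>y. z = hpair x y" unfolding ef by auto
  next
    fix x assume "x \<in> hprod (elts RS) (elts RS)"
    then obtain r s where "r \<in> K" "s \<in> K" "x = hpair (dcut r) (dcut s)" unfolding hprod_def elts_RS by blast
    then show "\<exists>!y. hpair x y \<in> elts f" using m by auto
  qed
  have app: "f \<cdot> hpair (dcut r) (dcut s) = dcut (op r s)" if "r \<in> K" "s \<in> K" for r s
  proof -
    have "hpair (dcut r) (dcut s) \<in> hprod (elts RS) (elts RS)" unfolding elts_RS using that by auto
    then show ?thesis using happ_iff[OF h] m[OF that] by blast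
  qed
  then show "r \<in> K ==> s \<in> K ==> f \<cdot> hpair (dcut r) (dcut s) = dcut (op r s)" .
  show "fun_in M f (hprod (elts RS) (elts RS)) (elts RS)" unfolding fun_in_def
  proof (intro conjI ballI fM h)
    fix x assume "x \<in> hprod (elts RS) (elts RS)"
    then obtain r s where "r \<in> K" "s \<in> K" "x = hpair (dcut r) (dcut s)" unfolding hprod_def elts_RS by blast
    then show "f \<cdot> x \<in> elts RS" using app c unfolding elts_RS by blast
  qed
qed

lemma cut_ext: "(\<forall>q\<in>elts QQ. q \<in> elts (dcut t) <-> rv q < u) <-> t = u"
proof
  assume h: "\<forall>q\<in>elts QQ. q \<in> elts (dcut t) <-> rv q < u"
  have "dcut t = dcut u" by (rule hc_eqI) (use h elts_cut in blast)
  then show "t = u" by simp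
qed (auto simp: elts_cut)

lemma add_in: "fun_in M addf (hprod (elts RS) (elts RS)) (elts RS)"
  "r \<in> K ==> s \<in> K ==> addf \<cdot> hpair (dcut r) (dcut s) = dcut (r + s)"
proof -
  have "(\<forall>q\<in>elts QQ. q \<in> elts (dcut t) <-> (\<exists>q1\<in>elts (dcut r). \<exists>q2\<in>elts (dcut s). hpair q (hpair q1 q2) \<in> elts RADD)) <-> t = r + s" for r s t
  proof -
    have "(\<exists>q1\<in>elts (dcut r). \<exists>q2\<in>elts (dcut s). hpair q (hpair q1 q2) \<in> elts RADD) <-> rv q < r + s" if "q \<in> elts QQ" for q
      using that add_cut[of "rv q" r s] unfolding elts_RADD by (simp add: elts_cut)
    then have "(\<forall>q\<in>elts QQ. q \<in> elts (dcut t) <-> (\<exists>q1\<in>elts (dcut r). \<exists>q2\<in>elts (dcut s). hpair q (hpair q1 q2) \<in> elts RADD)) <->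
      (\<forall>q\<in>elts QQ. q \<in> elts (dcut t) <-> rv q < r + s)" by (intro ball_cong refl) simp
    then show ?thesis unfolding cut_ext .
  qed
  note g = op_graph[OF addf_def op_closed(1) K_add this]
  show "fun_in M addf (hprod (elts RS) (elts RS)) (elts RS)"
    "r \<in> K ==> s \<in> K ==> addf \<cdot> hpair (dcut r) (dcut s) = dcut (r + s)" by (rule g; assumption)+
qed

lemma mul_in: "fun_in M mulf (hprod (elts RS) (elts RS)) (elts RS)"
  "r \<in> K ==> s \<in> K ==> mulf \<cdot> hpair (dcut r) (dcut s) = dcut (r * s)"
proof -
  have "(\<forall>q\<in>elts QQ. q \<in> elts (dcut t) <-> mul_below q (dcut r) (dcut s)) <-> t = r * s" for r s t
  proof -
    have "(\<forall>q\<in>elts QQ. q \<in> elts (dcut t) <-> mul_below q (dcut r) (dcut s)) <->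
      (\<forall>q\<in>elts QQ. q \<in> elts (dcut t) <-> rv q < r * s)" by (intro ball_cong) (auto simp: mul_cut)
    then show ?thesis unfolding cut_ext .
  qed
  note g = op_graph[OF mulf_def op_closed(2) K_mul this]
  show "fun_in M mulf (hprod (elts RS) (elts RS)) (elts RS)"
    "r \<in> K ==> s \<in> K ==> mulf \<cdot> hpair (dcut r) (dcut s) = dcut (r * s)" by (rule g; assumption)+
qed

lemma ltf_iff: "hpair X Y \<in> elts ltf <-> (\<exists>r\<in>K. \<exists>s\<in>K. X = dcut r \<and> Y = dcut s \<and> r < s)"
proof -
  note elts_sep[OF ltf_def]
  then have "hpair X Y \<in> elts ltf <-> X \<in> elts RS \<and> Y \<in> elts RS \<and> elts X \<subseteq> elts Y \<and> X \<noteq> Y" by auto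
  also have "\<dots> <-> (\<exists>r\<in>K. \<exists>s\<in>K. X = dcut r \<and> Y = dcut s \<and> r < s)"
  proof
    assume "X \<in> elts RS \<and> Y \<in> elts RS \<and> elts X \<subseteq> elts Y \<and> X \<noteq> Y"
    then obtain r s where rs: "r \<in> K" "s \<in> K" "X = dcut r" "Y = dcut s" "elts (dcut r) \<subseteq> elts (dcut s)" "dcut r \<noteq> dcut s"
      unfolding elts_RS by blast
    then have "r < s" using cut_subset by force
    then show "\<exists>r\<in>K. \<exists>s\<in>K. X = dcut r \<and> Y = dcut s \<and> r < s" using rs by blast
  next
    assume "\<exists>r\<in>K. \<exists>s\<in>K. X = dcut r \<and> Y = dcut s \<and> r < s"
    then obtain r s where rs: "r \<in> K" "s \<in> K" "X = dcut r" "Y = dcut s" "r < s" by blast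
    have "elts (dcut r) \<subseteq> elts (dcut s)" unfolding cut_subset using rs(5) by simp
    moreover have "dcut r \<noteq> dcut s" using rs(5) by simp
    ultimately show "X \<in> elts RS \<and> Y \<in> elts RS \<and> elts X \<subseteq> elts Y \<and> X \<noteq> Y" unfolding elts_RS using rs by blast
  qed
  finally show ?thesis .
qed

lemma lt_cut: "r \<in> K ==> s \<in> K ==> hpair (dcut r) (dcut s) \<in> elts ltf <-> r < s"
  unfolding ltf_iff by auto

text \<open>The union of a set of cuts is the cut of their supremum; as the union belongs to the
  model, so does that cut.\<close>

lemma sup_cut:
  assumes S: "S \<in> M" "elts S \<subseteq> elts RS" "elts S \<noteq> {}" and b: "\<exists>b\<in>elts RS. \<forall>s\<in>elts S. hpair b s \<notin> elts ltf"
  shows "\<exists>l\<in>elts RS. (\<forall>s\<in>elts S. hpair l s \<notin> elts ltf) \<and>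
    (\<forall>b\<in>elts RS. (\<forall>s\<in>elts S. hpair b s \<notin> elts ltf) --> hpair b l \<notin> elts ltf)"
proof -
  define T where "T = {r \<in> K. dcut r \<in> elts S}"
  have ST: "elts S = dcut ` T" using S(2) unfolding T_def elts_RS by auto
  have TK: "T \<subseteq> K" unfolding T_def by blast
  obtain b0 where b0: "b0 \<in> K" "\<And>t. t \<in> T ==> \<not> b0 < t"
  proof -
    obtain c where c: "c \<in> elts RS" "\<forall>s\<in>elts S. hpair c s \<notin> elts ltf" using b by blast
    obtain b0 where b0: "b0 \<in> K" "c = dcut b0" using c(1) unfolding elts_RS by blast
    have "\<not> b0 < t" if h: "t \<in> T" for t
    proof -
      have "hpair (dcut b0) (dcut t) \<notin> elts ltf" using c(2) b0(2) h ST by blast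
      then show ?thesis using lt_cut b0(1) TK h by blast
    qed
    then show thesis using b0(1) by (rule_tac that[of b0])
  qed
  have Tne: "T \<noteq> {}" using S(3) ST by blast
  have bdd: "bdd_above T" using b0(2) by (intro bdd_aboveI[of _ b0]) (meson linorder_not_less)
  have "hUn S = dcut (Sup T)"
  proof (rule hc_eqI)
    have "elts (hUn S) = (\<Union>t\<in>T. elts (dcut t))" unfolding elts_hUn ST by simp
    also have "\<dots> = elts (dcut (Sup T))" unfolding elts_cut using less_cSup_iff[OF Tne bdd] by blast
    finally show "elts (hUn S) = elts (dcut (Sup T))" .
  qed
  then have SK: "Sup T \<in> K" using S(1) hUn_closed cut_closed_iff by metis
  show ?thesis
  proof (intro bexI[of _ "dcut (Sup T)"] conjI ballI impI)
    show "dcut (Sup T) \<in> elts RS" unfolding elts_RS using SK by blast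
    show "hpair (dcut (Sup T)) s \<notin> elts ltf" if "s \<in> elts S" for s
    proof -
      obtain t where t: "t \<in> T" "s = dcut t" using \<open>s \<in> elts S\<close> ST by blast
      then have "t \<le> Sup T" using cSup_upper[OF _ bdd] by blast
      moreover have "t \<in> K" using t TK by blast
      ultimately show ?thesis unfolding t(2) using lt_cut[OF SK] by auto
    qed
    show "hpair b (dcut (Sup T)) \<notin> elts ltf" if bR: "b \<in> elts RS" and ub: "\<forall>s\<in>elts S. hpair b s \<notin> elts ltf" for b
    proof -
      obtain c where c: "c \<in> K" "b = dcut c" using bR unfolding elts_RS by blast
      have "t \<le> c" if "t \<in> T" for t
      proof -
        have "hpair (dcut c) (dcut t) \<notin> elts ltf" using ub that c ST by blast
        then show ?thesis using lt_cut[OF c(1)] TK that by (meson linorder_not_less subsetD)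
      qed
      then have "Sup T \<le> c" using Tne by (intro cSup_least)
      then show ?thesis unfolding c(2) using lt_cut[OF c(1) SK] by auto
    qed
  qed
qed

lemma complete_field: "complete_ordered_field_in M RS addf mulf (dcut 0) (dcut 1) ltf"
proof -
  have ltsub: "elts ltf \<subseteq> hprod (elts RS) (elts RS)" unfolding ltf_def by (subst elts_hset) auto
  note s = add_in(2) mul_in(2) K_add K_mul lt_cut K_0 K_1
  show ?thesis
    unfolding complete_ordered_field_in_def Let_def
  proof (intro conjI RS_closed add_in(1) mul_in(1) op_closed(3) ltsub)
    show "dcut 0 \<in> elts RS" "dcut 1 \<in> elts RS" unfolding elts_RS using K_0 K_1 by blast+
    show "dcut 0 \<noteq> dcut 1" by simp
    show "\<forall>x\<in>elts RS. \<forall>y\<in>elts RS. \<forall>z\<in>elts RS.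
          addf \<cdot> hpair (addf \<cdot> hpair x y) z = addf \<cdot> hpair x (addf \<cdot> hpair y z) \<and> addf \<cdot> hpair x y = addf \<cdot> hpair y x \<and>
          mulf \<cdot> hpair (mulf \<cdot> hpair x y) z = mulf \<cdot> hpair x (mulf \<cdot> hpair y z) \<and> mulf \<cdot> hpair x y = mulf \<cdot> hpair y x \<and>
          mulf \<cdot> hpair x (addf \<cdot> hpair y z) = addf \<cdot> hpair (mulf \<cdot> hpair x y) (mulf \<cdot> hpair x z)"
      unfolding elts_RS by (simp add: s algebra_simps)
    show "\<forall>x\<in>elts RS. addf \<cdot> hpair x (dcut 0) = x \<and> mulf \<cdot> hpair x (dcut 1) = x" unfolding elts_RS by (simp add: s)
    show "\<forall>x\<in>elts RS. \<exists>y\<in>elts RS. addf \<cdot> hpair x y = dcut 0"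
    proof
      fix x assume "x \<in> elts RS"
      then obtain r where r: "r \<in> K" "x = dcut r" unfolding elts_RS by blast
      then show "\<exists>y\<in>elts RS. addf \<cdot> hpair x y = dcut 0" unfolding elts_RS using K_uminus[OF r(1)] by (intro bexI[of _ "dcut (- r)"]) (auto simp: s)
    qed
    show "\<forall>x\<in>elts RS. x \<noteq> dcut 0 --> (\<exists>y\<in>elts RS. mulf \<cdot> hpair x y = dcut 1)"
    proof (intro ballI impI)
      fix x assume "x \<in> elts RS" "x \<noteq> dcut 0"
      then obtain r where r: "r \<in> K" "x = dcut r" "r \<noteq> 0" unfolding elts_RS by auto
      then show "\<exists>y\<in>elts RS. mulf \<cdot> hpair x y = dcut 1" unfolding elts_RS using K_inverse[OF r(1,3)] by (intro bexI[of _ "dcut (inverse r)"]) (auto simp: s)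
    qed
    show "\<forall>x\<in>elts RS. hpair x x \<notin> elts ltf" unfolding elts_RS by (simp add: s)
    show "\<forall>x\<in>elts RS. \<forall>y\<in>elts RS. \<forall>z\<in>elts RS. hpair x y \<in> elts ltf \<and> hpair y z \<in> elts ltf --> hpair x z \<in> elts ltf"
      unfolding elts_RS by (auto simp: s)
    show "\<forall>x\<in>elts RS. \<forall>y\<in>elts RS. hpair x y \<in> elts ltf \<or> x = y \<or> hpair y x \<in> elts ltf"
      unfolding elts_RS by (auto simp: s)
    show "\<forall>x\<in>elts RS. \<forall>y\<in>elts RS. \<forall>z\<in>elts RS. hpair x y \<in> elts ltf --> hpair (addf \<cdot> hpair x z) (addf \<cdot> hpair y z) \<in> elts ltf"
      unfolding elts_RS by (auto simp: s)
    show "\<forall>x\<in>elts RS. \<forall>y\<in>elts RS. hpair (dcut 0) x \<in> elts ltf \<and> hpair (dcut 0) y \<in> elts ltf --> hpair (dcut 0) (mulf \<cdot> hpair x y) \<in> elts ltf"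
      unfolding elts_RS by (auto simp: s)
    show "\<forall>S\<in>M. elts S \<subseteq> elts RS \<and> elts S \<noteq> {} \<and> (\<exists>b\<in>elts RS. \<forall>s\<in>elts S. hpair b s \<notin> elts ltf) -->
          (\<exists>l\<in>elts RS. (\<forall>s\<in>elts S. hpair l s \<notin> elts ltf) \<and>
            (\<forall>b\<in>elts RS. (\<forall>s\<in>elts S. hpair b s \<notin> elts ltf) --> hpair b l \<notin> elts ltf))"
      using sup_cut by blast
  qed
qed

end

section \<open>Selecting a convergent subsequence\<close>

lemma countable_in_mono: "countable_in M X ==> M \<subseteq> N ==> countable_in N X"
  unfolding countable_in_def fun_in_def by blast

context tmo
begin

lemma dfn_finite_sep:
  assumes "dff M f" "dfn M (\<lambda>s. P (\<lambda>i. s (Suc i)) (s 0))"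
  shows "dfn M (\<lambda>s. finite {x \<in> elts (f s). P s x})"
proof -
  have "dfn M (\<lambda>s. finite (elts (hset {x \<in> elts (f s). P s x})))" by (rule dfn_finite[OF dff_sep[OF assms]])
  then show ?thesis by simp
qed

text \<open>Infinite sets B 0, B 1, ... are obtained by deciding one question at a time, and
  \<open>J'\<close> takes for each j the least element of B j that is at least j. The sequence is
  defined over the model without recursion: B j is determined by the finite set of those questions
  below j that were answered positively.\<close>

lemma decide_omega:
  assumes Q: "dfn M (\<lambda>s. Q (s 0) (s 1))" and J: "J \<in> M" "elts J \<subseteq> elts homega" "infinite (elts J)"
  shows "\<exists>J'\<in>M. elts J' \<subseteq> elts J \<and> infinite (elts J') \<and>
    (\<forall>i\<in>elts homega. finite {n \<in> elts J'. Q i n} \<or> finite {n \<in> elts J'. \<not> Q i n})"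
proof -
  define B where "B = rec_nat (elts J) (\<lambda>j X. if infinite {n \<in> X. Q (hnat j) n} then {n \<in> X. Q (hnat j) n} else {n \<in> X. \<not> Q (hnat j) n})"
  define b where "b l <-> infinite {n \<in> B l. Q (hnat l) n}" for l
  have B0: "B 0 = elts J" and BS: "B (Suc j) = {n \<in> B j. Q (hnat j) n <-> b j}" for j
    unfolding b_def by (auto simp: B_def)
  have Binf: "infinite (B j)" for j
  proof (induction j)
    case 0 then show ?case using B0 J(3) by simp
  next
    case (Suc j)
    show ?case
    proof (cases "b j")
      case True then show ?thesis unfolding BS using b_def[of j] by simp
    next
      case False
      then have "finite {n \<in> B j. Q (hnat j) n}" using b_def[of j] by simp
      moreover have "B j \<subseteq> {n \<in> B j. Q (hnat j) n} \<union> B (Suc j)" unfolding BS using False by auto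
      ultimately show ?thesis using Suc finite_subset by blast
    qed
  qed
  have Bj: "B j = {n \<in> elts J. \<forall>l<j. Q (hnat l) n <-> b l}" for j
    by (induction j) (auto simp: B0 BS less_Suc_eq)
  have Bmono: "B j \<subseteq> B i" if "i \<le> j" for i j unfolding Bj using that by auto
  \<comment> \<open>\<open>u\<close> records the correct answers below j, each one computed from the
    earlier ones in \<open>u\<close>; this determines \<open>u\<close> below j.\<close>
  define good where "good u j <-> (\<forall>l\<in>elts j. l \<in> elts u <->
    infinite {n \<in> elts J. (\<forall>l'\<in>elts l. l' \<in> elts u <-> Q l' n) \<and> Q l n})" for u j
  have step: "(infinite {n \<in> elts J. (\<forall>l'\<in>elts (hnat l). l' \<in> elts u <-> Q l' n) \<and> Q (hnat l) n}) <-> b l"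
    if h: "\<forall>l'<l. hnat l' \<in> elts u <-> b l'" for u l
  proof -
    have "{n \<in> elts J. (\<forall>l'\<in>elts (hnat l). l' \<in> elts u <-> Q l' n) \<and> Q (hnat l) n} = {n \<in> B l. Q (hnat l) n}"
      unfolding Bj elts_hnat using h by auto
    then show ?thesis unfolding b_def by simp
  qed
  have good: "good u (hnat j) <-> (\<forall>l<j. hnat l \<in> elts u <-> b l)" for u j
  proof
    assume g: "good u (hnat j)"
    have "l < j --> (hnat l \<in> elts u <-> b l)" for l
    proof (induction l rule: less_induct)
      case (less l)
      show ?case
      proof
        assume l: "l < j"
        then have "\<forall>l'<l. hnat l' \<in> elts u <-> b l'" using less by simp
        note st = step[OF this]
        have "hnat l \<in> elts (hnat j)" using l by simp
        then show "hnat l \<in> elts u <-> b l" using g st unfolding good_def by blast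
      qed
    qed
    then show "\<forall>l<j. hnat l \<in> elts u <-> b l" by blast
  next
    assume h: "\<forall>l<j. hnat l \<in> elts u <-> b l"
    show "good u (hnat j)" unfolding good_def
    proof
      fix l assume "l \<in> elts (hnat j)"
      then obtain k where k: "l = hnat k" "k < j" unfolding elts_hnat by blast
      then have "\<forall>l'<k. hnat l' \<in> elts u <-> b l'" using h by simp
      note st = step[OF this]
      show "l \<in> elts u <-> infinite {n \<in> elts J. (\<forall>l'\<in>elts l. l' \<in> elts u <-> Q l' n) \<and> Q l n}"
        unfolding k(1) st using h k(2) by blast
    qed
  qed
  define BB where "BB j n <-> n \<in> elts J \<and> (\<exists>u\<in>elts (hfin homega). good u j \<and> (\<forall>l\<in>elts j. l \<in> elts u <-> Q l n))" for j n
  have BB: "BB (hnat j) n <-> n \<in> B j" for j n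
  proof
    assume "BB (hnat j) n"
    then obtain u where u: "n \<in> elts J" "good u (hnat j)" "\<forall>l\<in>elts (hnat j). l \<in> elts u <-> Q l n" unfolding BB_def by blast
    have "Q (hnat l) n <-> b l" if h: "l < j" for l
    proof -
      have "hnat l \<in> elts (hnat j)" using h by simp
      then show ?thesis using u(2,3) h unfolding good by blast
    qed
    then show "n \<in> B j" unfolding Bj using u(1) by blast
  next
    assume n: "n \<in> B j"
    define u where "u = hset (hnat ` {l. l < j \<and> b l})"
    have eu: "elts u = hnat ` {l. l < j \<and> b l}" unfolding u_def by (simp add: countable_finite)
    have ub: "hnat l \<in> elts u <-> b l" if "l < j" for l unfolding eu using that by auto
    have "u \<in> elts (hfin homega)" by (auto simp: eu)
    moreover have "good u (hnat j)" unfolding good using ub by blast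
    moreover have "\<forall>l\<in>elts (hnat j). l \<in> elts u <-> Q l n" unfolding elts_hnat using ub n unfolding Bj by auto
    ultimately show "BB (hnat j) n" unfolding BB_def using n Bj by blast
  qed
  \<comment> \<open>For some j, n is the least element of B j at or above j.\<close>
  define P where "P n <-> (\<exists>j\<in>elts homega. n \<notin> elts j \<and> BB j n \<and> (\<forall>m\<in>elts n. m \<notin> elts j --> \<not> BB j m))" for n
  have P: "P (hnat n) <-> (\<exists>j\<le>n. hnat n \<in> B j \<and> (\<forall>m<n. j \<le> m --> hnat m \<notin> B j))" for n
    unfolding P_def elts_homega elts_hnat[of n] by (auto simp: BB not_less)
  define J' where "J' = hset {n \<in> elts J. P n}"
  note eJ = elts_sep[OF J'_def]
  have dgood: "dfn M (\<lambda>s. good (s 0) (s 1))" unfolding good_def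
    by (intro ball dfn_iff mem elem dfn_not dfn_finite_sep dfn_conj var J(1) dfn_comp2[where Q = Q, OF Q])
  have dBB: "dfn M (\<lambda>s. BB (s 0) (s 1))" unfolding BB_def
    by (intro dfn_conj bex ball mem elem dfn_iff var J(1) hfin_closed omegaM dfn_comp2[where Q = Q, OF Q] dfn_comp2[where Q = good, OF dgood])
  have dP: "dfn M (\<lambda>s. P (s 0))" unfolding P_def
    by (intro bex ball dfn_conj dfn_not dfn_imp mem var elem omegaM dfn_comp2[where Q = BB, OF dBB])
  have JM: "J' \<in> M" unfolding J'_def by (rule sep[OF J(1) dP])
  have Bh: "B j \<subseteq> range hnat" for j using J(2) unfolding Bj by auto
  have least: "\<exists>k\<ge>j. hnat k \<in> B j" for j using Binf[of j] infinite_hnat[OF Bh] by blast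
  define lst where "lst j = (LEAST k. j \<le> k \<and> hnat k \<in> B j)" for j
  have lst: "j \<le> lst j" "hnat (lst j) \<in> B j" "\<And>m. j \<le> m ==> hnat m \<in> B j ==> lst j \<le> m" for j
  proof -
    obtain k where "j \<le> k \<and> hnat k \<in> B j" using least by blast
    then have "j \<le> lst j \<and> hnat (lst j) \<in> B j" unfolding lst_def by (rule LeastI)
    then show "j \<le> lst j" "hnat (lst j) \<in> B j" by blast+
    show "lst j \<le> m" if "j \<le> m" "hnat m \<in> B j" for m unfolding lst_def by (rule Least_le) (use that in blast)
  qed
  have Jlst: "hnat n \<in> elts J' ==> \<exists>j. n = lst j" for n
  proof -
    assume "hnat n \<in> elts J'"
    then have "P (hnat n)" using eJ by blast
    then obtain j where j: "j \<le> n" "hnat n \<in> B j" "\<forall>m<n. j \<le> m --> hnat m \<notin> B j" using P[of n] by blast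
    have "lst j \<le> n" using lst(3)[OF j(1,2)] .
    moreover have "\<not> lst j < n" using j(3) lst(1,2)[of j] by blast
    ultimately have "n = lst j" by simp
    then show "\<exists>j. n = lst j" by blast
  qed
  have lstJ: "hnat (lst j) \<in> elts J'" for j
  proof -
    have "\<forall>m<lst j. j \<le> m --> hnat m \<notin> B j" 
    proof (intro allI impI notI)
      fix m assume m: "m < lst j" "j \<le> m" "hnat m \<in> B j"
      show False using lst(3)[OF m(2,3)] m(1) by simp
    qed
    then have "P (hnat (lst j))" unfolding P using lst(1,2)[of j] by blast
    moreover have "hnat (lst j) \<in> elts J" using lst(2)[of j] unfolding Bj by blast
    ultimately show ?thesis unfolding eJ by blast
  qed
  have "infinite (elts J')"
  proof -
    have "elts J' \<subseteq> range hnat" using eJ J(2) by auto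
    then show ?thesis using infinite_hnat[of "elts J'"] lstJ lst(1) by meson
  qed
  moreover have "finite {n \<in> elts J'. Q (hnat l) n} \<or> finite {n \<in> elts J'. \<not> Q (hnat l) n}" for l
  proof -
    \<comment> \<open>The sets B j decrease, so only elements chosen for some j <= l can fall
      outside B (l + 1).\<close>
    have "elts J' - B (Suc l) \<subseteq> hnat ` lst ` {..l}"
    proof
      fix n assume n: "n \<in> elts J' - B (Suc l)"
      then obtain k where k: "n = hnat k" using eJ J(2) by auto
      then obtain j where j: "k = lst j" using Jlst[of k] n by blast
      have "\<not> Suc l \<le> j" using lst(2)[of j] Bmono[of "Suc l" j] n k j by blast
      then show "n \<in> hnat ` lst ` {..l}" using k j by simp
    qed
    then have fin: "finite (elts J' - B (Suc l))" using finite_subset by blast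
    show ?thesis
    proof (cases "b l")
      case True
      then have "{n \<in> elts J'. \<not> Q (hnat l) n} \<subseteq> elts J' - B (Suc l)" unfolding BS by blast
      then show ?thesis using fin finite_subset by blast
    next
      case False
      then have "{n \<in> elts J'. Q (hnat l) n} \<subseteq> elts J' - B (Suc l)" unfolding BS by blast
      then show ?thesis using fin finite_subset by blast
    qed
  qed
  ultimately show ?thesis using JM eJ by (intro bexI[of _ J'] conjI ballI) auto
qed

lemma decide:
  assumes Q: "dfn M (\<lambda>s. Q (s 0) (s 1))" and J: "J \<in> M" "elts J \<subseteq> elts homega" "infinite (elts J)"
    and I: "I \<in> M" "countable_in M (elts I)"
  shows "\<exists>J'\<in>M. elts J' \<subseteq> elts J \<and> infinite (elts J') \<and>
    (\<forall>i\<in>elts I. finite {n \<in> elts J'. Q i n} \<or> finite {n \<in> elts J'. \<not> Q i n})"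
proof -
  obtain e g where e: "e \<in> M" "\<forall>x\<in>elts I. \<forall>y. hpair x y \<in> elts e <-> y = hnat (g x)" "inj_on g (elts I)"
    using countable_inE[OF I(2)] by blast
  have D: "dfn M (\<lambda>s. \<exists>i\<in>elts I. hpair i (s 0) \<in> elts e \<and> Q i (s 1))"
    by (intro bex dfn_conj mem dff_hpair var elem I(1) e(1) dfn_comp2[where Q = Q, OF Q])
  obtain J' where J': "J' \<in> M" "elts J' \<subseteq> elts J" "infinite (elts J')"
    "\<forall>j\<in>elts homega. finite {n \<in> elts J'. \<exists>i\<in>elts I. hpair i j \<in> elts e \<and> Q i n} \<or>
      finite {n \<in> elts J'. \<not> (\<exists>i\<in>elts I. hpair i j \<in> elts e \<and> Q i n)}"
    using decide_omega[where Q = "\<lambda>j n. \<exists>i\<in>elts I. hpair i j \<in> elts e \<and> Q i n", OF D J] by blast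
  have "finite {n \<in> elts J'. Q i n} \<or> finite {n \<in> elts J'. \<not> Q i n}" if i: "i \<in> elts I" for i
  proof -
    have eq: "(\<exists>k\<in>elts I. hpair k (hnat (g i)) \<in> elts e \<and> Q k n) <-> Q i n" for n
    proof
      assume "\<exists>k\<in>elts I. hpair k (hnat (g i)) \<in> elts e \<and> Q k n"
      then obtain k where k: "k \<in> elts I" "hpair k (hnat (g i)) \<in> elts e" "Q k n" by blast
      then have "g i = g k" using e(2) by auto
      then show "Q i n" using e(3) i k inj_onD by metis
    next
      assume "Q i n"
      then show "\<exists>k\<in>elts I. hpair k (hnat (g i)) \<in> elts e \<and> Q k n" using e(2) i by auto
    qed
    have "hnat (g i) \<in> elts homega" by simp
    then show ?thesis using J'(4) unfolding eq[symmetric] by blast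
  qed
  then show ?thesis using J' by blast
qed

end

section \<open>Genericity applied to sequences of finite sets\<close>

context hechler
begin

text \<open>The \<open>n\<close>-th member of the sequence of finite sets coded by \<open>Fs\<close> is \<open>{m. hpair n m \<in> elts Fs}\<close>.\<close>

definition hit :: "hc => hc => hc => hc => bool" where
  "hit Fs z n \<alpha> <-> (\<exists>m. hpair n m \<in> elts Fs \<and> m \<notin> elts z \<and> m \<in> elts (a \<alpha>))"

text \<open>Restriction to \<delta> keeps the rows below \<delta>, so the sets with these indices
  can be recovered in the intermediate model.\<close>

lemma elts_a_Hd:
  assumes \<delta>: "\<delta> \<in> elts w1" and \<beta>: "\<beta> \<in> elts \<delta>"
  shows "hpair \<beta> m \<in> elts (hUn (hset (Hd \<delta>))) <-> m \<in> elts (a \<beta>)"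
proof -
  have "countable (Hd \<delta>)" unfolding Hd_def by (rule countable_subset[OF _ countable_elts[of "fs \<delta>"]]) blast
  then have "elts (hUn (hset (Hd \<delta>))) = \<Union> (elts ` Hd \<delta>)" by simp
  moreover have "(\<exists>x\<in>Hd \<delta>. hpair \<beta> m \<in> elts x) <-> (\<exists>x\<in>H. hpair \<beta> m \<in> elts x)"
  proof
    assume "\<exists>x\<in>H. hpair \<beta> m \<in> elts x"
    then obtain x where x: "x \<in> H" "hpair \<beta> m \<in> elts x" by blast
    then have "hrestrict x \<delta> \<in> Hd \<delta>" "hpair \<beta> m \<in> elts (hrestrict x \<delta>)" using hrestrict_Hd[OF x(1) \<delta>] \<beta> by simp_all
    then show "\<exists>x\<in>Hd \<delta>. hpair \<beta> m \<in> elts x" by blast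
  qed (auto simp: Hd_def)
  ultimately show ?thesis unfolding a_iff by blast
qed

text \<open>\<open>Ls\<close> is the sequence of the remainders F_n - z, and \<open>h\<close> lists
  the earlier sets that have been removed from them. Each pattern copies a whole reduced remainder
  into row \<delta>; by \<open>avoid\<close> and \<open>lim\<close> almost all of them miss any
  finitely many earlier sets and numbers, so infinitely many are contained in
  \<open>a \<delta>\<close>.\<close>

lemma select_absorbed:
  assumes \<delta>: "\<delta> \<in> elts w1" "infinite (elts \<delta>)"
    and J: "J \<in> Nd \<delta>" "elts J \<subseteq> elts homega" and Ls: "Ls \<in> Nd \<delta>" "elts Ls \<subseteq> hprod (elts homega) (elts homega)"
    and fin: "\<And>n. finite {m. hpair n m \<in> elts Ls}" and lim: "\<And>m. finite {n \<in> elts J. hpair n m \<in> elts Ls}"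
    and h: "h \<in> elts (hfin \<delta>)" and J_inf: "infinite (elts J)"
    and avoid: "\<And>\<beta>. \<beta> \<in> elts \<delta> ==> finite {n \<in> elts J. \<exists>m. hpair n m \<in> elts Ls \<and> (\<forall>\<gamma>\<in>elts h. m \<notin> elts (a \<gamma>)) \<and> m \<in> elts (a \<beta>)}"
  shows "infinite {n \<in> elts J. \<forall>m. hpair n m \<in> elts Ls \<and> (\<forall>\<gamma>\<in>elts h. m \<notin> elts (a \<gamma>)) --> m \<in> elts (a \<delta>)}"
proof -
  interpret T: tmo "Nd \<delta>" by (rule Nd_D(1)[OF \<delta>])
  have MN: "x \<in> Nd \<delta>" if "x \<in> M" for x using Nd_D(2)[OF \<delta>] that by blast
  define V where "V = hUn (hset (Hd \<delta>))"
  have VN: "V \<in> Nd \<delta>" unfolding V_def using Nd_D(3)[OF \<delta>] by simp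
  have hs: "elts h \<subseteq> elts \<delta>" "finite (elts h)" using h by simp_all
  have dM: "\<delta> \<in> M" using w1D[OF \<delta>(1)] .
  have hN: "h \<in> Nd \<delta>" using T.transD[OF h MN[OF hfin_closed[OF dM]]] .
  define y where "y n m <-> hpair n m \<in> elts Ls \<and> (\<forall>\<gamma>\<in>elts h. hpair \<gamma> m \<notin> elts V)" for n m
  have y: "y n m <-> hpair n m \<in> elts Ls \<and> (\<forall>\<gamma>\<in>elts h. m \<notin> elts (a \<gamma>))" for n m
    unfolding y_def V_def using elts_a_Hd[OF \<delta>(1)] hs(1) by blast
  have dy: "dfn (Nd \<delta>) (\<lambda>s. y (s 0) (s 1))" unfolding y_def
    by (intro dfn_conj T.ball dfn_not T.mem T.dff_hpair T.var T.elem Ls(1) hN VN)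
  have "\<exists>k\<ge>n0. hnat k \<in> {n \<in> elts J. \<forall>m. y n m --> m \<in> elts (a \<delta>)}" for n0
  proof -
    define W where "W = hset {w \<in> elts R. \<exists>n\<in>elts J. n \<notin> elts (hnat n0) \<and>
      (\<forall>z\<in>elts w. \<exists>m\<in>elts homega. z = hpair \<delta> m \<and> y n m) \<and> (\<forall>m\<in>elts homega. y n m --> hpair \<delta> m \<in> elts w)}"
    have WN: "W \<in> Nd \<delta>" unfolding W_def
      by (rule T.sep[OF MN[OF R_closed]])
        (intro T.bex T.ball dfn_conj dfn_not dfn_imp T.mem T.eq T.dff_hpair T.elem T.var J(1) MN[OF hnat_closed] MN[OF dM] MN[OF homega_closed]
          dfn_comp2[where Q = y, OF dy])
    note eW = elts_sep[OF W_def]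
    have "\<exists>w\<in>elts W. elts w \<subseteq> elts U"
    proof (rule generic_pattern[OF \<delta> WN])
      show "elts W \<subseteq> elts R" unfolding eW by blast
      have Wd: "\<alpha> = \<delta>" if wW: "w \<in> elts W" and p: "hpair \<alpha> m \<in> elts w" for w \<alpha> m
      proof -
        obtain n where "\<forall>z\<in>elts w. \<exists>m\<in>elts homega. z = hpair \<delta> m \<and> y n m" using wW unfolding eW by blast
        then show ?thesis using p by force
      qed
      show "\<alpha> \<notin> elts \<delta>" if "w \<in> elts W" "hpair \<alpha> m \<in> elts w" for w \<alpha> m using Wd[OF that] by simp
      show "\<alpha> = \<beta>" if "w \<in> elts W" "hpair \<alpha> m \<in> elts w" "hpair \<beta> m \<in> elts w" for w \<alpha> \<beta> m
        using Wd[OF that(1,2)] Wd[OF that(1,3)] by simp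
      show "\<exists>w\<in>elts W. \<forall>\<alpha> m. hpair \<alpha> m \<in> elts w --> m \<notin> K \<and> (\<forall>\<beta>\<in>F. m \<notin> elts (a \<beta>))"
        if F: "finite F" "F \<subseteq> elts \<delta>" "finite K" for F K
      proof -
        have 1: "finite (\<Union>\<beta>\<in>F. {n \<in> elts J. \<exists>m. y n m \<and> m \<in> elts (a \<beta>)})"
        proof (rule finite_UN_I[OF F(1)])
          fix \<beta> assume "\<beta> \<in> F"
          then show "finite {n \<in> elts J. \<exists>m. y n m \<and> m \<in> elts (a \<beta>)}" unfolding y using avoid F(2) by (simp add: conj_assoc subset_iff)
        qed
        have 2: "finite (\<Union>m\<in>K. {n \<in> elts J. hpair n m \<in> elts Ls})" by (rule finite_UN_I[OF F(3)]) (rule lim)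
        have 3: "finite (elts (hnat n0))" by (rule finite_elts_hnat)
        note inf = Diff_infinite_finite[OF finite_UnI[OF finite_UnI[OF 1 2] 3] J_inf]
        obtain n where n: "n \<in> elts J - (((\<Union>\<beta>\<in>F. {n \<in> elts J. \<exists>m. y n m \<and> m \<in> elts (a \<beta>)}) \<union> (\<Union>m\<in>K. {n \<in> elts J. hpair n m \<in> elts Ls})) \<union> elts (hnat n0))"
          using infinite_imp_nonempty[OF inf] by blast
        define w where "w = hset (hpair \<delta> ` {m. y n m})"
        have fy: "finite {m. y n m}" by (rule finite_subset[OF _ fin[of n]]) (auto simp: y)
        have ew: "elts w = hpair \<delta> ` {m. y n m}" unfolding w_def using fy by (simp add: countable_finite)
        have yo: "m \<in> elts homega" if "y n m" for m using that Ls(2) unfolding y by auto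
        have "w \<in> elts R" unfolding fs_iff ew using fy \<delta>(1) yo by auto
        moreover have "\<exists>n\<in>elts J. n \<notin> elts (hnat n0) \<and>
          (\<forall>z\<in>elts w. \<exists>m\<in>elts homega. z = hpair \<delta> m \<and> y n m) \<and> (\<forall>m\<in>elts homega. y n m --> hpair \<delta> m \<in> elts w)"
        proof (intro bexI[of _ n] conjI)
          show "n \<in> elts J" "n \<notin> elts (hnat n0)" using n by blast+
          show "\<forall>z\<in>elts w. \<exists>m\<in>elts homega. z = hpair \<delta> m \<and> y n m" unfolding ew using yo by blast
          show "\<forall>m\<in>elts homega. y n m --> hpair \<delta> m \<in> elts w" unfolding ew by blast
        qed
        ultimately have "w \<in> elts W" unfolding eW by blast
        moreover have "m \<notin> K \<and> (\<forall>\<beta>\<in>F. m \<notin> elts (a \<beta>))" if hm: "hpair \<alpha> m \<in> elts w" for \<alpha> m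
        proof -
          have ym: "y n m" using hm unfolding ew by auto
          then have "hpair n m \<in> elts Ls" unfolding y by blast
          then show ?thesis using n ym by blast
        qed
        ultimately show ?thesis by blast
      qed
    qed
    then obtain w n where w: "elts w \<subseteq> elts U" "n \<in> elts J" "n \<notin> elts (hnat n0)" "\<forall>m\<in>elts homega. y n m --> hpair \<delta> m \<in> elts w"
      unfolding eW by blast
    then obtain k where k: "n = hnat k" using J(2) by auto
    have "m \<in> elts (a \<delta>)" if ym: "y n m" for m
    proof -
      have "m \<in> elts homega" using ym Ls(2) unfolding y by auto
      then show ?thesis using w(1,4) ym unfolding elts_a by blast
    qed
    then show ?thesis using w k by (intro exI[of _ k]) auto
  qed
  moreover have "{n \<in> elts J. \<forall>m. y n m --> m \<in> elts (a \<delta>)} \<subseteq> range hnat" using J(2) by auto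
  ultimately have "infinite {n \<in> elts J. \<forall>m. y n m --> m \<in> elts (a \<delta>)}" using infinite_hnat by blast
  then show ?thesis unfolding y .
qed

text \<open>Each pattern puts one number of a remainder into every row from \<open>K0\<close>,
  different numbers into different rows. As the remainders stay large after removal of finitely many
  earlier sets, there is room for such a choice.\<close>

lemma select_spread:
  assumes \<delta>: "\<delta> \<in> elts w1" "infinite (elts \<delta>)"
    and J: "J \<in> Nd \<delta>" "elts J \<subseteq> elts homega" and Ls: "Ls \<in> Nd \<delta>" "elts Ls \<subseteq> hprod (elts homega) (elts homega)"
    and fin: "\<And>n. finite {m. hpair n m \<in> elts Ls}" and J_inf: "infinite (elts J)"
    and spread: "\<And>h c. h \<in> elts (hfin \<delta>) ==> finite {n \<in> elts J. card {m. hpair n m \<in> elts Ls \<and> (\<forall>\<gamma>\<in>elts h. m \<notin> elts (a \<gamma>))} < c}"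
    and K0: "finite K0" "K0 \<subseteq> elts w1" "K0 \<inter> elts \<delta> = {}"
  shows "\<exists>k\<ge>n0. hnat k \<in> elts J \<and> (\<forall>\<alpha>\<in>K0. \<exists>m. hpair (hnat k) m \<in> elts Ls \<and> m \<in> elts (a \<alpha>))"
proof -
  interpret T: tmo "Nd \<delta>" by (rule Nd_D(1)[OF \<delta>])
  have MN: "x \<in> Nd \<delta>" if "x \<in> M" for x using Nd_D(2)[OF \<delta>] that by blast
  have dM: "\<delta> \<in> M" using w1D[OF \<delta>(1)] .
  define \<kappa> where "\<kappa> = hset K0"
  have ek: "elts \<kappa> = K0" unfolding \<kappa>_def using K0(1) by (simp add: countable_finite)
  have "\<kappa> \<in> M" unfolding \<kappa>_def by (rule finite_closed[OF K0(1)]) (use K0(2) w1D in blast)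
  then have kN: "\<kappa> \<in> Nd \<delta>" by (rule MN)
  define W where "W = hset {w \<in> elts R. \<exists>n\<in>elts J. n \<notin> elts (hnat n0) \<and>
    (\<forall>\<alpha>\<in>elts \<kappa>. \<exists>m\<in>elts homega. hpair \<alpha> m \<in> elts w) \<and>
    (\<forall>z\<in>elts w. \<exists>\<alpha>\<in>elts \<kappa>. \<exists>m\<in>elts homega. z = hpair \<alpha> m \<and> hpair n m \<in> elts Ls) \<and>
    (\<forall>\<alpha>\<in>elts \<kappa>. \<forall>\<beta>\<in>elts \<kappa>. \<forall>m\<in>elts homega. hpair \<alpha> m \<in> elts w \<and> hpair \<beta> m \<in> elts w --> \<alpha> = \<beta>)}"
  have WN: "W \<in> Nd \<delta>" unfolding W_def
    by (rule T.sep[OF MN[OF R_closed]])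
      (intro T.bex T.ball dfn_conj dfn_not dfn_imp T.mem T.eq T.dff_hpair T.elem T.var J(1) Ls(1) kN MN[OF hnat_closed] MN[OF homega_closed])
  note eW = elts_sep[OF W_def]
  have Wm: "\<alpha> \<in> K0 \<and> m \<in> elts homega" if wW: "w \<in> elts W" and p: "hpair \<alpha> m \<in> elts w" for w \<alpha> m
  proof -
    obtain n where "\<forall>z\<in>elts w. \<exists>\<alpha>\<in>elts \<kappa>. \<exists>m\<in>elts homega. z = hpair \<alpha> m \<and> hpair n m \<in> elts Ls" using wW unfolding eW by blast
    then obtain \<alpha>' m' where "\<alpha>' \<in> elts \<kappa>" "m' \<in> elts homega" "hpair \<alpha> m = hpair \<alpha>' m'" using p by blast
    then show ?thesis unfolding ek by simp
  qed
  have "\<exists>w\<in>elts W. elts w \<subseteq> elts U"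
  proof (rule generic_pattern[OF \<delta> WN])
    show "elts W \<subseteq> elts R" unfolding eW by blast
    show "\<alpha> \<notin> elts \<delta>" if "w \<in> elts W" "hpair \<alpha> m \<in> elts w" for w \<alpha> m using Wm[OF that] K0(3) by blast
    show "\<alpha> = \<beta>" if w: "w \<in> elts W" "hpair \<alpha> m \<in> elts w" "hpair \<beta> m \<in> elts w" for w \<alpha> \<beta> m
    proof -
      have "\<forall>\<alpha>\<in>elts \<kappa>. \<forall>\<beta>\<in>elts \<kappa>. \<forall>m\<in>elts homega. hpair \<alpha> m \<in> elts w \<and> hpair \<beta> m \<in> elts w --> \<alpha> = \<beta>"
        using w(1) unfolding eW by blast
      then show ?thesis using Wm[OF w(1,2)] Wm[OF w(1,3)] w(2,3) unfolding ek by blast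
    qed
    show "\<exists>w\<in>elts W. \<forall>\<alpha> m. hpair \<alpha> m \<in> elts w --> m \<notin> K \<and> (\<forall>\<beta>\<in>F. m \<notin> elts (a \<beta>))"
      if F: "finite F" "F \<subseteq> elts \<delta>" "finite K" for F K
    proof -
      define h where "h = hset F"
      have eh: "elts h = F" unfolding h_def using F(1) by (simp add: countable_finite)
      have h: "h \<in> elts (hfin \<delta>)" using F eh by simp
      define Y where "Y n = {m. hpair n m \<in> elts Ls \<and> (\<forall>\<gamma>\<in>elts h. m \<notin> elts (a \<gamma>))}" for n
      have fY: "finite (Y n)" for n unfolding Y_def by (rule finite_subset[OF _ fin[of n]]) blast
      have 3: "finite (elts (hnat n0))" by (rule finite_elts_hnat)
      note inf = Diff_infinite_finite[OF finite_UnI[OF spread[OF h, of "card K0 + card K"] 3] J_inf]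
      \<comment> \<open>Enough elements remain to give each index in \<open>K0\<close> its own
        number outside \<open>K\<close>.\<close>
      obtain n where n: "n \<in> elts J" "n \<notin> elts (hnat n0)" "\<not> card (Y n) < card K0 + card K"
        using infinite_imp_nonempty[OF inf] unfolding Y_def by blast
      have le: "card K0 \<le> card (Y n - K)" using diff_card_le_card_Diff[OF F(3), of "Y n"] n(3) by linarith
      have "finite (Y n - K)" using fY by simp
      from card_le_inj[OF K0(1) this le] obtain \<phi> where \<phi>: "\<phi> ` K0 \<subseteq> Y n - K" "inj_on \<phi> K0" by (elim exE conjE)
      define w where "w = hset ((\<lambda>\<alpha>. hpair \<alpha> (\<phi> \<alpha>)) ` K0)"
      have ew: "elts w = (\<lambda>\<alpha>. hpair \<alpha> (\<phi> \<alpha>)) ` K0" unfolding w_def using K0(1) by (simp add: countable_finite)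
      have \<phi>L: "hpair n (\<phi> \<alpha>) \<in> elts Ls" if "\<alpha> \<in> K0" for \<alpha> using \<phi>(1) that unfolding Y_def by blast
      then have \<phi>o: "\<phi> \<alpha> \<in> elts homega" if "\<alpha> \<in> K0" for \<alpha> using Ls(2) that hpair_in_hprod by blast
      have "w \<in> elts R" unfolding fs_iff ew
      proof (intro conjI ballI)
        show "finite ((\<lambda>\<alpha>. hpair \<alpha> (\<phi> \<alpha>)) ` K0)" using K0(1) by simp
        fix z assume "z \<in> (\<lambda>\<alpha>. hpair \<alpha> (\<phi> \<alpha>)) ` K0"
        then obtain \<alpha> where "\<alpha> \<in> K0" "z = hpair \<alpha> (\<phi> \<alpha>)" by blast
        then show "\<exists>\<alpha>\<in>elts w1. \<exists>m. z = hpair \<alpha> (hnat m)" using \<phi>o[of \<alpha>] K0(2) by auto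
      qed
      moreover have "\<exists>n\<in>elts J. n \<notin> elts (hnat n0) \<and>
        (\<forall>\<alpha>\<in>elts \<kappa>. \<exists>m\<in>elts homega. hpair \<alpha> m \<in> elts w) \<and>
        (\<forall>z\<in>elts w. \<exists>\<alpha>\<in>elts \<kappa>. \<exists>m\<in>elts homega. z = hpair \<alpha> m \<and> hpair n m \<in> elts Ls) \<and>
        (\<forall>\<alpha>\<in>elts \<kappa>. \<forall>\<beta>\<in>elts \<kappa>. \<forall>m\<in>elts homega. hpair \<alpha> m \<in> elts w \<and> hpair \<beta> m \<in> elts w --> \<alpha> = \<beta>)"
        unfolding ek
      proof (intro bexI[of _ n] conjI n(1,2))
        show "\<forall>\<alpha>\<in>K0. \<exists>m\<in>elts homega. hpair \<alpha> m \<in> elts w" unfolding ew using \<phi>o by blast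
        show "\<forall>z\<in>elts w. \<exists>\<alpha>\<in>K0. \<exists>m\<in>elts homega. z = hpair \<alpha> m \<and> hpair n m \<in> elts Ls" unfolding ew using \<phi>o \<phi>L by blast
        show "\<forall>\<alpha>\<in>K0. \<forall>\<beta>\<in>K0. \<forall>m\<in>elts homega. hpair \<alpha> m \<in> elts w \<and> hpair \<beta> m \<in> elts w --> \<alpha> = \<beta>"
        proof (intro ballI impI)
          fix \<alpha> \<beta> m assume h: "\<alpha> \<in> K0" "\<beta> \<in> K0" "hpair \<alpha> m \<in> elts w \<and> hpair \<beta> m \<in> elts w"
          then have "m = \<phi> \<alpha>" "m = \<phi> \<beta>" unfolding ew by auto
          then show "\<alpha> = \<beta>" using inj_onD[OF \<phi>(2) _ h(1,2)] by simp
        qed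
      qed
      ultimately have "w \<in> elts W" unfolding eW by blast
      moreover have "m \<notin> K \<and> (\<forall>\<beta>\<in>F. m \<notin> elts (a \<beta>))" if hm: "hpair \<alpha> m \<in> elts w" for \<alpha> m
      proof -
        have "m \<in> Y n - K" using hm \<phi>(1) unfolding ew by auto
        then show ?thesis unfolding Y_def eh by blast
      qed
      ultimately show ?thesis by blast
    qed
  qed
  then obtain w n where w: "elts w \<subseteq> elts U" "n \<in> elts J" "n \<notin> elts (hnat n0)" "\<forall>\<alpha>\<in>K0. \<exists>m\<in>elts homega. hpair \<alpha> m \<in> elts w"
    "\<forall>z\<in>elts w. \<exists>\<alpha>\<in>K0. \<exists>m\<in>elts homega. z = hpair \<alpha> m \<and> hpair n m \<in> elts Ls"
    unfolding eW ek by blast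
  then obtain k where k: "n = hnat k" using J(2) by auto
  have "\<exists>m. hpair n m \<in> elts Ls \<and> m \<in> elts (a \<alpha>)" if \<alpha>: "\<alpha> \<in> K0" for \<alpha>
  proof -
    obtain m where m: "m \<in> elts homega" "hpair \<alpha> m \<in> elts w" using w(4) \<alpha> by blast
    then obtain \<alpha>' m' where "hpair \<alpha> m = hpair \<alpha>' m'" "hpair n m' \<in> elts Ls" using w(5) by blast
    then have "hpair n m \<in> elts Ls" by simp
    moreover have "m \<in> elts (a \<alpha>)" unfolding elts_a using m w(1) by blast
    ultimately show ?thesis by blast
  qed
  then show ?thesis using w(2,3) k by (intro exI[of _ k]) auto
qed

end

lemma finite_hnat_bounded:
  assumes "finite X" "X \<subseteq> range hnat" shows "\<exists>n. X \<subseteq> elts (hnat n)"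
proof -
  obtain C where C: "finite C" "X = hnat ` C" using finite_subset_image[OF assms] by blast
  obtain n where n: "\<And>k. k \<in> C ==> k < n" using C(1) finite_nat_bounded[of C] by auto
  have "X \<subseteq> elts (hnat n)" unfolding elts_hnat C(2) using n by auto
  then show ?thesis by blast
qed

lemma infinite_homega: "infinite (elts homega)"
  using infinite_hnat[of "range hnat"] by auto

context hechler
begin

lemma hit_decided:
  assumes inf: "infinite J" and dec: "\<And>\<alpha>. \<alpha> \<in> K0 ==> finite {n \<in> J. \<not> hit Fs z n \<alpha>}" and K0: "finite K0"
  shows "infinite {n \<in> J. \<forall>\<alpha>\<in>K0. hit Fs z n \<alpha>}"
proof -
  have "finite (\<Union>\<alpha>\<in>K0. {n \<in> J. \<not> hit Fs z n \<alpha>})" by (rule finite_UN_I[OF K0 dec])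
  from Diff_infinite_finite[OF this inf] have "infinite (J - (\<Union>\<alpha>\<in>K0. {n \<in> J. \<not> hit Fs z n \<alpha>}))" .
  moreover have "J - (\<Union>\<alpha>\<in>K0. {n \<in> J. \<not> hit Fs z n \<alpha>}) \<subseteq> {n \<in> J. \<forall>\<alpha>\<in>K0. hit Fs z n \<alpha>}" by blast
  ultimately show ?thesis using finite_subset by blast
qed

text \<open>There are two cases. Either, after removing finitely many of the sets \<open>a \<beta>\<close> with \<open>\<beta> \<in> \<delta>\<close>, the rest
  eventually avoids each of them, and then \<open>a \<delta>\<close> absorbs the rest along a subsequence; or the rest is always of
  unbounded size, and then the sets \<open>a \<alpha>\<close> with \<open>\<alpha> \<notin> \<delta>\<close> can be hit simultaneously.\<close>

lemma select:
  assumes Fs: "Fs \<in> NG" "elts Fs \<subseteq> hprod (elts homega) (elts homega)" and fin: "\<And>n. finite {m. hpair n m \<in> elts Fs}"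
  shows "\<exists>J z. J \<in> NG \<and> elts J \<subseteq> elts homega \<and> infinite (elts J) \<and> z \<in> NG \<and> elts z \<subseteq> elts homega \<and>
    (\<forall>m\<in>elts z. finite {n \<in> elts J. hpair n m \<notin> elts Fs}) \<and> (\<forall>m. m \<notin> elts z --> finite {n \<in> elts J. hpair n m \<in> elts Fs}) \<and>
    (\<forall>K0. finite K0 \<and> K0 \<subseteq> elts w1 \<and> (\<forall>\<alpha>\<in>K0. infinite {n \<in> elts J. hit Fs z n \<alpha>}) -->
      infinite {n \<in> elts J. \<forall>\<alpha>\<in>K0. hit Fs z n \<alpha>})"
proof -
  have ww: "hprd homega homega \<in> M" "countable_in M (elts (hprd homega homega))"
    using countable_in_hprd[OF homega_closed countable_in_homega homega_closed countable_in_homega] by simp_all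
  obtain \<delta> where \<delta>: "\<delta> \<in> elts w1" "infinite (elts \<delta>)" and FsT: "Fs \<in> Nd \<delta>"
    using countable_bounded[OF Fs(1) _ ww] Fs(2) by auto
  interpret T: tmo "Nd \<delta>" by (rule Nd_D(1)[OF \<delta>])
  have MN: "x \<in> Nd \<delta>" if "x \<in> M" for x using Nd_D(2)[OF \<delta>] that by blast
  have dM: "\<delta> \<in> M" using w1D[OF \<delta>(1)] .
  have DF: "dfn (Nd \<delta>) (\<lambda>s. hpair (s 1) (s 0) \<in> elts Fs)" by (intro T.mem T.dff_rules FsT)
  have cw: "countable_in (Nd \<delta>) (elts homega)" by (rule countable_in_mono[OF countable_in_homega Nd_D(2)[OF \<delta>]])
  obtain J1 where J1: "J1 \<in> Nd \<delta>" "elts J1 \<subseteq> elts homega" "infinite (elts J1)"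
    "\<forall>m\<in>elts homega. finite {n \<in> elts J1. hpair n m \<in> elts Fs} \<or> finite {n \<in> elts J1. hpair n m \<notin> elts Fs}"
    using T.decide[where Q = "\<lambda>m n. hpair n m \<in> elts Fs", OF DF T.omegaM subset_refl infinite_homega T.omegaM cw] by (elim bexE conjE)
  \<comment> \<open>The pointwise limit along \<open>J1\<close>: its elements belong to almost all
    F_n, and every other number to only finitely many.\<close>
  define z where "z = hset {m \<in> elts homega. \<not> finite {n \<in> elts J1. hpair n m \<in> elts Fs}}"
  note ez = elts_sep[OF z_def]
  have zT: "z \<in> Nd \<delta>" unfolding z_def
    by (rule T.sep[OF T.omegaM]) (intro dfn_not T.dfn_finite_sep T.mem T.dff_hpair T.var T.elem FsT J1(1))
  have zw: "elts z \<subseteq> elts homega" unfolding ez by blast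
  have lim1: "finite {n \<in> elts J1. hpair n m \<notin> elts Fs}" if "m \<in> elts z" for m using that J1(4) unfolding ez by blast
  have lim2: "finite {n \<in> elts J1. hpair n m \<in> elts Fs}" if mz: "m \<notin> elts z" for m
  proof (cases "m \<in> elts homega")
    case True then show ?thesis using mz unfolding ez by blast
  next
    case False
    then have "{n \<in> elts J1. hpair n m \<in> elts Fs} = {}" using Fs(2) by auto
    then show ?thesis by (simp only: finite.emptyI)
  qed
  define Ls where "Ls = hset {p \<in> elts Fs. \<forall>n\<in>elts homega. \<forall>m\<in>elts z. p \<noteq> hpair n m}"
  note eL = elts_sep[OF Ls_def]
  have LsT: "Ls \<in> Nd \<delta>" unfolding Ls_def
    by (rule T.sep[OF FsT]) (intro T.dfn_rules T.dff_rules zT T.omegaM)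
  have Lw: "elts Ls \<subseteq> hprod (elts homega) (elts homega)" using Fs(2) unfolding eL by blast
  have L: "hpair n m \<in> elts Ls <-> hpair n m \<in> elts Fs \<and> m \<notin> elts z" for n m
  proof -
    have "n \<in> elts homega" if "hpair n m \<in> elts Fs" using Fs(2) that by auto
    then show ?thesis unfolding eL by auto
  qed
  have finL: "finite {m. hpair n m \<in> elts Ls}" for n by (rule finite_subset[OF _ fin[of n]]) (use L in blast)
  define V where "V = hUn (hset (Hd \<delta>))"
  have VN: "V \<in> Nd \<delta>" unfolding V_def using Nd_D(3)[OF \<delta>] by simp
  \<comment> \<open>Question (\<beta>, h): does the remainder, reduced by the sets with index in h,
    meet \<open>a \<beta>\<close>? There are countably many questions, so one infinite set
    \<open>J\<close> decides them all. \<open>V\<close> provides the sets \<open>a \<beta>\<close>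
    within the intermediate model.\<close>
  define Q where "Q i n <-> (\<exists>\<beta>\<in>elts \<delta>. \<exists>h\<in>elts (hfin \<delta>). i = hpair \<beta> h \<and>
    (\<exists>m\<in>elts homega. hpair n m \<in> elts Ls \<and> (\<forall>\<gamma>\<in>elts h. hpair \<gamma> m \<notin> elts V) \<and> hpair \<beta> m \<in> elts V))" for i n
  define meets where "meets \<beta> h n <-> (\<exists>m. hpair n m \<in> elts Ls \<and> (\<forall>\<gamma>\<in>elts h. m \<notin> elts (a \<gamma>)) \<and> m \<in> elts (a \<beta>))" for \<beta> h n
  have Q: "Q (hpair \<beta> h) n <-> meets \<beta> h n" if bh: "\<beta> \<in> elts \<delta>" "h \<in> elts (hfin \<delta>)" for \<beta> h n
  proof -
    have hs: "elts h \<subseteq> elts \<delta>" using bh(2) by simp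
    have av: "hpair \<gamma> m \<in> elts V <-> m \<in> elts (a \<gamma>)" if "\<gamma> \<in> elts \<delta>" for \<gamma> m unfolding V_def by (rule elts_a_Hd[OF \<delta>(1) that])
    have "Q (hpair \<beta> h) n <-> (\<exists>m\<in>elts homega. hpair n m \<in> elts Ls \<and> (\<forall>\<gamma>\<in>elts h. hpair \<gamma> m \<notin> elts V) \<and> hpair \<beta> m \<in> elts V)"
      unfolding Q_def using bh by (auto simp del: elts_homega)
    also have "\<dots> <-> (\<exists>m\<in>elts homega. hpair n m \<in> elts Ls \<and> (\<forall>\<gamma>\<in>elts h. m \<notin> elts (a \<gamma>)) \<and> m \<in> elts (a \<beta>))"
      using av bh(1) hs by (intro bex_cong refl conj_cong ball_cong) blast+
    also have "\<dots> <-> meets \<beta> h n" unfolding meets_def using a_sub by blast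
    finally show ?thesis .
  qed
  have DQ: "dfn (Nd \<delta>) (\<lambda>s. Q (s 0) (s 1))" unfolding Q_def
    by (intro T.dfn_rules T.dff_rules LsT VN MN[OF dM] MN[OF hfin_closed[OF dM]] T.omegaM)
  define I where "I = hprd \<delta> (hfin \<delta>)"
  have I: "I \<in> Nd \<delta>" "countable_in (Nd \<delta>) (elts I)"
  proof -
    have cd: "countable_in M (elts \<delta>)" using w1_cnt \<delta>(1) by blast
    have "I \<in> M" unfolding I_def using dM hfin_closed by simp
    then show "I \<in> Nd \<delta>" by (rule MN)
    have "countable_in M (elts I)" unfolding I_def
      by (rule countable_in_hprd[OF dM cd hfin_closed[OF dM] countable_in_hfin[OF dM cd]])
    then show "countable_in (Nd \<delta>) (elts I)" by (rule countable_in_mono[OF _ Nd_D(2)[OF \<delta>]])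
  qed
  obtain J where J: "J \<in> Nd \<delta>" "elts J \<subseteq> elts J1" "infinite (elts J)"
    "\<forall>i\<in>elts I. finite {n \<in> elts J. Q i n} \<or> finite {n \<in> elts J. \<not> Q i n}"
    using T.decide[where Q = Q, OF DQ J1(1-3) I] by (elim bexE conjE)
  have Jw: "elts J \<subseteq> elts homega" using J(2) J1(2) by blast
  have dec: "finite {n \<in> elts J. meets \<beta> h n} \<or> finite {n \<in> elts J. \<not> meets \<beta> h n}" if "\<beta> \<in> elts \<delta>" "h \<in> elts (hfin \<delta>)" for \<beta> h
  proof -
    have "hpair \<beta> h \<in> elts I" unfolding I_def elts_hprd hpair_in_hprod using that by (rule conjI)
    then show ?thesis using J(4) unfolding Q[OF that, symmetric] by (rule bspec[rotated])
  qed
  have he: "hempty \<in> elts (hfin \<delta>)" by simp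
  have hit: "hit Fs z n \<alpha> <-> meets \<alpha> hempty n" for n \<alpha> unfolding hit_def meets_def L by auto
  have limL: "finite {n \<in> elts J. hpair n m \<in> elts Ls}" for m
  proof (cases "m \<in> elts z")
    case True
    then have "{n \<in> elts J. hpair n m \<in> elts Ls} = {}" unfolding L by blast
    then show ?thesis by (simp only: finite.emptyI)
  next
    case False
    show ?thesis by (rule finite_subset[OF _ lim2[OF False]]) (use J(2) L in blast)
  qed
  have JN: "J \<in> NG" by (rule Nd_sub_NG[OF \<delta> J(1) homega_closed Jw])
  have zN: "z \<in> NG" by (rule Nd_sub_NG[OF \<delta> zT homega_closed zw])
  have LN: "Ls \<in> NG" by (rule Nd_sub_NG[OF \<delta> LsT ww(1)]) (use Lw in simp)
  have limJ: "\<forall>m\<in>elts z. finite {n \<in> X. hpair n m \<notin> elts Fs}" "\<forall>m. m \<notin> elts z --> finite {n \<in> X. hpair n m \<in> elts Fs}"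
    if X: "X \<subseteq> elts J" for X
  proof -
    show "\<forall>m\<in>elts z. finite {n \<in> X. hpair n m \<notin> elts Fs}"
    proof
      fix m assume m: "m \<in> elts z"
      show "finite {n \<in> X. hpair n m \<notin> elts Fs}" by (rule finite_subset[OF _ lim1[OF m]]) (use J(2) X in blast)
    qed
    show "\<forall>m. m \<notin> elts z --> finite {n \<in> X. hpair n m \<in> elts Fs}"
    proof (intro allI impI)
      fix m assume m: "m \<notin> elts z"
      show "finite {n \<in> X. hpair n m \<in> elts Fs}" by (rule finite_subset[OF _ lim2[OF m]]) (use J(2) X in blast)
    qed
  qed
  show ?thesis
  proof (cases "\<exists>h\<in>elts (hfin \<delta>). \<forall>\<beta>\<in>elts \<delta>. finite {n \<in> elts J. meets \<beta> h n}")
    case True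
    then obtain h where h: "h \<in> elts (hfin \<delta>)" "\<forall>\<beta>\<in>elts \<delta>. finite {n \<in> elts J. meets \<beta> h n}" by blast
    have hs: "elts h \<subseteq> elts \<delta>" "finite (elts h)" using h(1) by simp_all
    have avoid: "finite {n \<in> elts J. \<exists>m. hpair n m \<in> elts Ls \<and> (\<forall>\<gamma>\<in>elts h. m \<notin> elts (a \<gamma>)) \<and> m \<in> elts (a \<beta>)}" if "\<beta> \<in> elts \<delta>" for \<beta>
      using h(2) that unfolding meets_def by blast
    have inf: "infinite {n \<in> elts J. \<forall>m. hpair n m \<in> elts Ls \<and> (\<forall>\<gamma>\<in>elts h. m \<notin> elts (a \<gamma>)) --> m \<in> elts (a \<delta>)}"
      by (rule select_absorbed[OF \<delta> J(1) Jw LsT Lw finL limL h(1) J(3) avoid])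
    \<comment> \<open>Along \<open>J2\<close> the remainders are covered by the sets from
      \<open>h\<close> together with \<open>a \<delta>\<close>, so any further member of the family
      contains only finitely many numbers of all these remainders.\<close>
    define J2 where "J2 = hset {n \<in> elts J. \<forall>m\<in>elts homega. hpair n m \<in> elts Ls \<and> (\<forall>\<gamma>\<in>elts h. hpair \<gamma> m \<notin> elts U) --> hpair \<delta> m \<in> elts U}"
    have e2: "elts J2 = {n \<in> elts J. \<forall>m. hpair n m \<in> elts Ls \<and> (\<forall>\<gamma>\<in>elts h. m \<notin> elts (a \<gamma>)) --> m \<in> elts (a \<delta>)}"
    proof -
      have "elts J2 = {n \<in> elts J. \<forall>m\<in>elts homega. hpair n m \<in> elts Ls \<and> (\<forall>\<gamma>\<in>elts h. hpair \<gamma> m \<notin> elts U) --> hpair \<delta> m \<in> elts U}"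
        by (rule elts_sep[OF J2_def])
      also have "\<dots> = {n \<in> elts J. \<forall>m\<in>elts homega. hpair n m \<in> elts Ls \<and> (\<forall>\<gamma>\<in>elts h. m \<notin> elts (a \<gamma>)) --> m \<in> elts (a \<delta>)}"
        unfolding elts_a by blast
      also have "\<dots> = {n \<in> elts J. \<forall>m. hpair n m \<in> elts Ls \<and> (\<forall>\<gamma>\<in>elts h. m \<notin> elts (a \<gamma>)) --> m \<in> elts (a \<delta>)}"
      proof -
        have "m \<in> elts homega" if "hpair n m \<in> elts Ls" for n m using that Lw hpair_in_hprod by blast
        then show ?thesis by blast
      qed
      finally show ?thesis .
    qed
    have hN: "h \<in> NG" using NN.transD[OF h(1) ground_sub_NG[OF hfin_closed[OF dM]]] .
    have dN: "\<delta> \<in> NG" by (rule ground_sub_NG[OF dM])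
    have J2N: "J2 \<in> NG" unfolding J2_def
      by (rule NN.sep[OF JN]) (intro NN.dfn_rules NN.dff_rules LN hN U_NG NN.omegaM dN)
    have J2: "elts J2 \<subseteq> elts homega" "infinite (elts J2)" "elts J2 \<subseteq> elts J" using inf Jw unfolding e2 by blast+
    have D3: "dfn NG (\<lambda>s. \<exists>m\<in>elts homega. hpair (s 1) m \<in> elts Ls \<and> hpair (s 0) m \<in> elts U)"
      by (intro NN.dfn_rules NN.dff_rules LN U_NG NN.omegaM)
    have sd: "hset {\<delta>} \<in> NG" "elts (hset {\<delta>}) = {\<delta>}" using dN by simp_all
    have csd: "countable_in NG (elts (hset {\<delta>}))" by (rule NN.finite_countable_in[OF sd(1)]) (simp add: sd(2))
    \<comment> \<open>The index \<delta> itself is not among the questions decided by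
      \<open>J\<close>, so hits of \<open>a \<delta>\<close> are decided by a further
      thinning.\<close>
    obtain J3 where J3: "J3 \<in> NG" "elts J3 \<subseteq> elts J2" "infinite (elts J3)"
      "\<forall>i\<in>elts (hset {\<delta>}). finite {n \<in> elts J3. \<exists>m\<in>elts homega. hpair n m \<in> elts Ls \<and> hpair i m \<in> elts U} \<or>
        finite {n \<in> elts J3. \<not> (\<exists>m\<in>elts homega. hpair n m \<in> elts Ls \<and> hpair i m \<in> elts U)}"
      using NN.decide[where Q = "\<lambda>i n. \<exists>m\<in>elts homega. hpair n m \<in> elts Ls \<and> hpair i m \<in> elts U", OF D3 J2N J2(1,2) sd(1) csd]
      by (elim bexE conjE)
    have J3J: "elts J3 \<subseteq> elts J" using J3(2) J2(3) by blast
    have hitU: "hit Fs z n \<alpha> <-> (\<exists>m\<in>elts homega. hpair n m \<in> elts Ls \<and> hpair \<alpha> m \<in> elts U)" for n \<alpha>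
      unfolding hit_def elts_a L by blast
    have dec3: "finite {n \<in> elts J3. hit Fs z n \<alpha>} \<or> finite {n \<in> elts J3. \<not> hit Fs z n \<alpha>}" if \<alpha>: "\<alpha> \<in> elts w1" for \<alpha>
    proof -
      consider "\<alpha> \<in> elts \<delta>" | "\<alpha> = \<delta>" | "\<alpha> \<notin> elts \<delta>" "\<alpha> \<noteq> \<delta>" by blast
      then show ?thesis
      proof cases
        case 1
        have "finite {n \<in> elts J. hit Fs z n \<alpha>} \<or> finite {n \<in> elts J. \<not> hit Fs z n \<alpha>}" using dec[OF 1 he] unfolding hit .
        moreover have "{n \<in> elts J3. hit Fs z n \<alpha>} \<subseteq> {n \<in> elts J. hit Fs z n \<alpha>}" "{n \<in> elts J3. \<not> hit Fs z n \<alpha>} \<subseteq> {n \<in> elts J. \<not> hit Fs z n \<alpha>}"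
          using J3J by blast+
        ultimately show ?thesis using finite_subset by metis
      next
        case 2 then show ?thesis using J3(4) unfolding hitU sd(2) by simp
      next
        case 3
        define P where "P = (\<Union>\<gamma>\<in>elts h. elts (a \<alpha>) \<inter> elts (a \<gamma>)) \<union> (elts (a \<alpha>) \<inter> elts (a \<delta>))"
        have "finite P" unfolding P_def
        proof (intro finite_UnI finite_UN_I hs(2))
          show "finite (elts (a \<alpha>) \<inter> elts (a \<delta>))" by (rule a_disjoint[OF \<alpha> \<delta>(1) 3(2)])
          fix \<gamma> assume g: "\<gamma> \<in> elts h"
          then have "\<gamma> \<in> elts w1" "\<alpha> \<noteq> \<gamma>" using hs(1) w1_sub[OF \<delta>(1)] 3(1) by blast+
          then show "finite (elts (a \<alpha>) \<inter> elts (a \<gamma>))" using a_disjoint[OF \<alpha>] by blast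
        qed
        then have "finite (\<Union>m\<in>P. {n \<in> elts J. hpair n m \<in> elts Ls})" by (rule finite_UN_I) (rule limL)
        moreover have "{n \<in> elts J3. hit Fs z n \<alpha>} \<subseteq> (\<Union>m\<in>P. {n \<in> elts J. hpair n m \<in> elts Ls})"
        proof
          fix n assume n: "n \<in> {n \<in> elts J3. hit Fs z n \<alpha>}"
          then obtain m where m: "hpair n m \<in> elts Ls" "m \<in> elts (a \<alpha>)" unfolding hit_def L by blast
          have "n \<in> elts J2" using n J3(2) by blast
          then have "(\<forall>\<gamma>\<in>elts h. m \<notin> elts (a \<gamma>)) --> m \<in> elts (a \<delta>)" using m(1) unfolding e2 by blast
          then have "m \<in> P" unfolding P_def using m(2) by blast
          then show "n \<in> (\<Union>m\<in>P. {n \<in> elts J. hpair n m \<in> elts Ls})" using m(1) n J3J by blast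
        qed
        ultimately show ?thesis using finite_subset by blast
      qed
    qed
    have sim: "infinite {n \<in> elts J3. \<forall>\<alpha>\<in>K0. hit Fs z n \<alpha>}"
      if K0: "finite K0 \<and> K0 \<subseteq> elts w1 \<and> (\<forall>\<alpha>\<in>K0. infinite {n \<in> elts J3. hit Fs z n \<alpha>})" for K0
      by (rule hit_decided[OF J3(3)]) (use K0 dec3 in blast)+
    show ?thesis
    proof (rule exI[of _ J3], rule exI[of _ z], intro conjI J3(1,3) zN zw limJ[OF J3J])
      show "elts J3 \<subseteq> elts homega" using J3J Jw by blast
      show "\<forall>K0. finite K0 \<and> K0 \<subseteq> elts w1 \<and> (\<forall>\<alpha>\<in>K0. infinite {n \<in> elts J3. hit Fs z n \<alpha>}) -->
        infinite {n \<in> elts J3. \<forall>\<alpha>\<in>K0. hit Fs z n \<alpha>}" by (intro allI impI) (rule sim)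
    qed
  next
    case False
    \<comment> \<open>Whatever finite \<open>h\<close> has been removed, some
      \<open>a \<beta>\<close> is met infinitely often, hence, being decided, almost always.
      Removing it as well takes at least one element from almost every remainder, which gives the
      induction on c.\<close>
    have spread: "finite {n \<in> elts J. card {m. hpair n m \<in> elts Ls \<and> (\<forall>\<gamma>\<in>elts h. m \<notin> elts (a \<gamma>))} < c}"
      if "h \<in> elts (hfin \<delta>)" for h c
      using that
    proof (induction c arbitrary: h)
      case 0
      have "{n \<in> elts J. card {m. hpair n m \<in> elts Ls \<and> (\<forall>\<gamma>\<in>elts h. m \<notin> elts (a \<gamma>))} < 0} = {}" by simp
      then show ?case by (simp only: finite.emptyI)
    next
      case (Suc c)
      define Y where "Y h n = {m. hpair n m \<in> elts Ls \<and> (\<forall>\<gamma>\<in>elts h. m \<notin> elts (a \<gamma>))}" for h n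
      have fY: "finite (Y h n)" for h n unfolding Y_def by (rule finite_subset[OF _ finL[of n]]) blast
      obtain \<beta> where \<beta>: "\<beta> \<in> elts \<delta>" "infinite {n \<in> elts J. meets \<beta> h n}" using False Suc.prems by blast
      then have f1: "finite {n \<in> elts J. \<not> meets \<beta> h n}" using dec[OF \<beta>(1) Suc.prems] by blast
      define h' where "h' = hun h (hset {\<beta>})"
      have eh: "elts h' = insert \<beta> (elts h)" unfolding h'_def by simp
      have "h' \<in> elts (hfin \<delta>)" using Suc.prems \<beta>(1) by (simp add: eh)
      from Suc.IH[OF this] have f2: "finite {n \<in> elts J. card (Y h' n) < c}" unfolding Y_def .
      have "{n \<in> elts J. card (Y h n) < Suc c} \<subseteq> {n \<in> elts J. \<not> meets \<beta> h n} \<union> {n \<in> elts J. card (Y h' n) < c}"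
      proof
        fix n assume n: "n \<in> {n \<in> elts J. card (Y h n) < Suc c}"
        show "n \<in> {n \<in> elts J. \<not> meets \<beta> h n} \<union> {n \<in> elts J. card (Y h' n) < c}"
        proof (cases "meets \<beta> h n")
          case True
          then obtain m where m: "m \<in> Y h n" "m \<in> elts (a \<beta>)" unfolding meets_def Y_def by blast
          have "Y h' n \<subseteq> Y h n - {m}" using m(2) unfolding Y_def eh by blast
          then have "Y h' n \<subset> Y h n" using m(1) by blast
          then have "card (Y h' n) < card (Y h n)" by (rule psubset_card_mono[OF fY])
          then show ?thesis using n by simp
        qed (use n in blast)
      qed
      then show ?case using f1 f2 finite_subset[OF _ finite_UnI[OF f1 f2]] unfolding Y_def by blast
    qed
    have sim: "infinite {n \<in> elts J. \<forall>\<alpha>\<in>K0. hit Fs z n \<alpha>}"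
      if K0: "finite K0 \<and> K0 \<subseteq> elts w1 \<and> (\<forall>\<alpha>\<in>K0. infinite {n \<in> elts J. hit Fs z n \<alpha>})" for K0
    proof -
      \<comment> \<open>The finitely many n at which an index of \<open>K0\<close> below \<delta> is
        missed; the remaining indices are treated beyond these n.\<close>
      define E where "E = (\<Union>\<alpha>\<in>K0 \<inter> elts \<delta>. {n \<in> elts J. \<not> hit Fs z n \<alpha>})"
      have "finite E" unfolding E_def
      proof (rule finite_UN_I)
        show "finite (K0 \<inter> elts \<delta>)" using K0 by blast
        fix \<alpha> assume \<alpha>: "\<alpha> \<in> K0 \<inter> elts \<delta>"
        then have "finite {n \<in> elts J. hit Fs z n \<alpha>} \<or> finite {n \<in> elts J. \<not> hit Fs z n \<alpha>}" using dec[of \<alpha>, OF _ he] unfolding hit by blast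
        then show "finite {n \<in> elts J. \<not> hit Fs z n \<alpha>}" using K0 \<alpha> by blast
      qed
      moreover have "E \<subseteq> range hnat" using Jw unfolding E_def by auto
      ultimately obtain b where b: "E \<subseteq> elts (hnat b)" using finite_hnat_bounded by blast
      have "\<exists>k\<ge>n0. hnat k \<in> {n \<in> elts J. \<forall>\<alpha>\<in>K0. hit Fs z n \<alpha>}" for n0
      proof -
        have K1: "finite (K0 - elts \<delta>)" "K0 - elts \<delta> \<subseteq> elts w1" "(K0 - elts \<delta>) \<inter> elts \<delta> = {}" using K0 by blast+
        obtain k where k: "k \<ge> max n0 b" "hnat k \<in> elts J" "\<forall>\<alpha>\<in>K0 - elts \<delta>. \<exists>m. hpair (hnat k) m \<in> elts Ls \<and> m \<in> elts (a \<alpha>)"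
          using select_spread[OF \<delta> J(1) Jw LsT Lw finL J(3) spread K1, of "max n0 b"] by blast
        have "hnat k \<notin> E" using b k(1) by auto
        then have "hit Fs z (hnat k) \<alpha>" if "\<alpha> \<in> K0 \<inter> elts \<delta>" for \<alpha> using that k(2) unfolding E_def by blast
        moreover have "hit Fs z (hnat k) \<alpha>" if "\<alpha> \<in> K0 - elts \<delta>" for \<alpha> using that k(3) unfolding hit_def L by blast
        ultimately show ?thesis using k(1,2) by (intro exI[of _ k]) auto
      qed
      moreover have "{n \<in> elts J. \<forall>\<alpha>\<in>K0. hit Fs z n \<alpha>} \<subseteq> range hnat" using Jw by auto
      ultimately show ?thesis using infinite_hnat by blast
    qed
    show ?thesis
    proof (rule exI[of _ J], rule exI[of _ z], intro conjI JN Jw J(3) zN zw limJ[OF subset_refl])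
      show "\<forall>K0. finite K0 \<and> K0 \<subseteq> elts w1 \<and> (\<forall>\<alpha>\<in>K0. infinite {n \<in> elts J. hit Fs z n \<alpha>}) -->
        infinite {n \<in> elts J. \<forall>\<alpha>\<in>K0. hit Fs z n \<alpha>}" by (intro allI impI) (rule sim)
    qed
  qed
qed

end

section \<open>Pseudocompactness of the hyperspace\<close>

sublocale hechler \<subseteq> RN: real_model "generic_ext M (Pc w1) G"
  by unfold_locales (intro ground_sub_NG QQ_closed RADD_closed RMUL_closed)+

context hechler
begin

abbreviation "POs \<equiv> Psi_opens_in NG A"
abbreviation "CLs \<equiv> CL_in NG (Psi_points A) POs"
abbreviation "VOs \<equiv> vietoris_opens_in NG (Psi_points A) POs"

lemma A_mem: "x \<in> elts A ==> x \<in> NG \<and> elts x \<subseteq> elts homega \<and> infinite (elts x) \<and> x \<notin> elts homega"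
proof -
  assume "x \<in> elts A"
  then obtain \<alpha> where \<alpha>: "\<alpha> \<in> elts w1" "x = a \<alpha>" unfolding elts_A by blast
  have inf: "infinite (elts x)" using a_infinite[OF \<alpha>(1)] \<alpha>(2) by simp
  have "x \<notin> elts homega"
  proof
    assume "x \<in> elts homega"
    then obtain n where "x = hnat n" by auto
    then show False using inf by (simp add: elts_hnat del: hnat.simps)
  qed
  then show ?thesis using a_NG'[OF \<alpha>(1)] a_sub \<alpha>(2) inf by blast
qed

lemma open_cofinite:
  assumes "V \<in> POs" "x \<in> elts V" "x \<in> elts A"
  shows "finite (elts x - elts V)"
proof -
  obtain n where "{x} \<union> (elts x - elts (hnat n)) \<subseteq> elts V" using assms unfolding Psi_opens_in_def by blast
  then have "elts x - elts V \<subseteq> elts (hnat n)" by blast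
  moreover have "finite (elts (hnat n))" by (rule finite_elts_hnat)
  ultimately show ?thesis using finite_subset by blast
qed

text \<open>Natural numbers are isolated, so only members of the family outside F matter; each of
  them has a neighbourhood missing F once its intersection with F is finite.\<close>

lemma CLI:
  assumes F: "F \<in> NG" "elts F \<noteq> {}" "elts F \<subseteq> Psi_points A"
    and closed: "\<And>x. x \<in> elts A ==> x \<notin> elts F ==> finite (elts x \<inter> elts F)"
  shows "F \<in> CLs"
proof -
  define V where "V = hset {x \<in> elts (hun A homega). x \<notin> elts F}"
  have VN: "V \<in> NG" unfolding V_def
    by (rule NN.sep[OF NN.hun_closed[OF A_NG NN.omegaM]]) (intro dfn_not NN.mem NN.var NN.elem F(1))
  note elts_sep[OF V_def]
  then have eV: "elts V = Psi_points A - elts F" unfolding Psi_points_def elts_hun by blast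
  have "\<exists>n. {x} \<union> (elts x - elts (hnat n)) \<subseteq> elts V" if x: "x \<in> elts V \<inter> elts A" for x
  proof -
    have xA: "x \<in> elts A" "x \<notin> elts F" using x eV by blast+
    have xw: "elts x \<subseteq> elts homega" using A_mem xA(1) by blast
    then have "elts x \<inter> elts F \<subseteq> range hnat" by auto
    then obtain n where "elts x \<inter> elts F \<subseteq> elts (hnat n)" using finite_hnat_bounded[OF closed[OF xA]] by blast
    then have "{x} \<union> (elts x - elts (hnat n)) \<subseteq> elts V" using x xw unfolding eV Psi_points_def by blast
    then show ?thesis by blast
  qed
  then have "V \<in> POs" unfolding Psi_opens_in_def using VN eV by blast
  then show ?thesis unfolding CL_in_def using F eV by blast
qed

lemma hfin_NG: "F \<in> elts (hfin homega) ==> F \<in> NG"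
  using NN.transD[OF _ NN.hfin_closed[OF NN.omegaM]] .

lemma finite_CL: "F \<in> elts (hfin homega) ==> F \<noteq> hempty ==> F \<in> CLs"
proof (rule CLI)
  assume F: "F \<in> elts (hfin homega)" "F \<noteq> hempty"
  have fF: "elts F \<subseteq> elts homega" "finite (elts F)" using F(1) unfolding elts_hfin by blast+
  show "F \<in> NG" using F(1) by (rule hfin_NG)
  show "elts F \<noteq> {}" using F(2) by simp
  show "elts F \<subseteq> Psi_points A" using fF unfolding Psi_points_def by blast
  show "finite (elts x \<inter> elts F)" for x using fF by blast
qed

lemma accumulation_point:
  assumes Fs: "Fs \<in> NG" "elts Fs \<subseteq> hprod (elts homega) (elts homega)"
    and \<Phi>: "\<And>n. n \<in> elts homega ==> \<Phi> n \<in> elts (hfin homega) \<and> \<Phi> n \<noteq> hempty"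
    and row: "\<And>n m. n \<in> elts homega ==> hpair n m \<in> elts Fs <-> m \<in> elts (\<Phi> n)"
  shows "\<exists>K\<in>CLs. \<forall>N V. (\<forall>i\<le>N. V i \<in> POs) \<and> K \<in> vietoris_basic CLs N V -->
    infinite {n \<in> elts homega. \<Phi> n \<in> vietoris_basic CLs N V}"
proof -
  have finrow: "finite {m. hpair n m \<in> elts Fs}" for n
  proof (cases "n \<in> elts homega")
    case True
    have "finite (elts (\<Phi> n))" using \<Phi>[OF True] unfolding elts_hfin by blast
    then show ?thesis unfolding row[OF True] by simp
  next
    case False
    then have "{m. hpair n m \<in> elts Fs} = {}" using Fs(2) by auto
    then show ?thesis by (simp only: finite.emptyI)
  qed
  obtain J z where JN: "J \<in> NG" and Jw: "elts J \<subseteq> elts homega" and Jinf: "infinite (elts J)"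
    and zN: "z \<in> NG" and zw: "elts z \<subseteq> elts homega"
    and lim1: "\<forall>m\<in>elts z. finite {n \<in> elts J. hpair n m \<notin> elts Fs}" and lim2: "\<forall>m. m \<notin> elts z --> finite {n \<in> elts J. hpair n m \<in> elts Fs}"
    and sim: "\<forall>K0. finite K0 \<and> K0 \<subseteq> elts w1 \<and> (\<forall>\<alpha>\<in>K0. infinite {n \<in> elts J. hit Fs z n \<alpha>}) -->
      infinite {n \<in> elts J. \<forall>\<alpha>\<in>K0. hit Fs z n \<alpha>}"
    using select[OF Fs finrow] by (elim exE conjE)
  define hits where "hits n x <-> (\<exists>m\<in>elts homega. hpair n m \<in> elts Fs \<and> m \<notin> elts z \<and> m \<in> elts x)" for n x
  have hits: "hits n (a \<alpha>) <-> hit Fs z n \<alpha>" for n \<alpha> unfolding hits_def hit_def using a_sub by blast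
  define inK where "inK x <-> x \<in> elts z \<or> x \<in> elts A \<and> (infinite {m \<in> elts x. m \<in> elts z} \<or> infinite {n \<in> elts J. hits n x})" for x
  define K where "K = hset {x \<in> elts (hun A homega). inK x}"
  have dh: "dfn NG (\<lambda>s. hits (s 0) (s 1))" unfolding hits_def
    by (intro NN.bex dfn_conj dfn_not NN.mem NN.dff_hpair NN.elem NN.var Fs(1) zN NN.omegaM)
  have KN: "K \<in> NG" unfolding K_def inK_def
    by (rule NN.sep[OF NN.hun_closed[OF A_NG NN.omegaM]])
      (intro NN.dfn_rules NN.dfn_finite_sep NN.dff_rules JN zN A_NG dfn_comp2[where Q = hits, OF dh])
  note elts_sep[OF K_def]
  then have eK: "elts K = {x. inK x}" unfolding inK_def elts_hun using zw by blast
  have Kw: "m \<in> elts K <-> m \<in> elts z" if "m \<in> elts homega" for m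
    unfolding eK inK_def using A_mem that by blast
  have KA: "x \<in> elts K <-> infinite (elts x \<inter> elts z) \<or> infinite {n \<in> elts J. hits n x}" if x: "x \<in> elts A" for x
  proof -
    have "{m \<in> elts x. m \<in> elts z} = elts x \<inter> elts z" by blast
    moreover have "x \<notin> elts z" using A_mem[OF x] zw by blast
    ultimately show ?thesis unfolding eK inK_def using x by simp
  qed
  have finU: "finite {n \<in> elts J. \<exists>m\<in>X. hpair n m \<in> elts Fs \<and> m \<notin> elts z}" if X: "finite X" for X
  proof (rule finite_subset)
    show "{n \<in> elts J. \<exists>m\<in>X. hpair n m \<in> elts Fs \<and> m \<notin> elts z} \<subseteq> (\<Union>m\<in>X - elts z. {n \<in> elts J. hpair n m \<in> elts Fs})" by blast
    show "finite (\<Union>m\<in>X - elts z. {n \<in> elts J. hpair n m \<in> elts Fs})" by (rule finite_UN_I) (use X lim2 in blast)+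
  qed
  \<comment> \<open>A member of the family that is hit only finitely often contains only finitely
    many numbers of the remainders, because each F_n is finite.\<close>
  have thin: "finite X" if X: "X \<subseteq> {m. m \<notin> elts z \<and> (\<exists>n\<in>elts J. hpair n m \<in> elts Fs)}" "X \<subseteq> elts (a \<alpha>)" and fh: "finite {n \<in> elts J. hits n (a \<alpha>)}" for X \<alpha>
  proof (rule finite_subset)
    show "X \<subseteq> (\<Union>n\<in>{n \<in> elts J. hits n (a \<alpha>)}. {m. hpair n m \<in> elts Fs})"
    proof
      fix m assume m: "m \<in> X"
      then obtain n where n: "m \<notin> elts z" "n \<in> elts J" "hpair n m \<in> elts Fs" using X(1) by blast
      have ma: "m \<in> elts (a \<alpha>)" using m X(2) by blast
      then have "m \<in> elts homega" using a_sub by blast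
      then have "hits n (a \<alpha>)" unfolding hits_def using n ma by blast
      then show "m \<in> (\<Union>n\<in>{n \<in> elts J. hits n (a \<alpha>)}. {m. hpair n m \<in> elts Fs})" using n by blast
    qed
    show "finite (\<Union>n\<in>{n \<in> elts J. hits n (a \<alpha>)}. {m. hpair n m \<in> elts Fs})" by (rule finite_UN_I[OF fh finrow])
  qed
  \<comment> \<open>If \<open>K\<close> were empty, then z would be empty, and by maximality the
    numbers of all F_n along \<open>J\<close> would form a finite set. Each of them belongs to only
    finitely many F_n, although no F_n is empty.\<close>
  have Kne: "elts K \<noteq> {}"
  proof
    assume e: "elts K = {}"
    have ze: "m \<notin> elts z" for m using e Kw zw by blast
    define X where "X = hset {m \<in> elts homega. \<exists>n\<in>elts J. hpair n m \<in> elts Fs}"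
    have XN: "X \<in> NG" unfolding X_def
      by (rule NN.sep[OF NN.omegaM]) (intro NN.bex NN.mem NN.dff_hpair NN.elem NN.var Fs(1) JN)
    note eX = elts_sep[OF X_def]
    have "finite (elts X)"
    proof (rule maximal[OF XN])
      show "elts X \<subseteq> elts homega" unfolding eX by blast
      fix \<alpha> assume "\<alpha> \<in> elts w1"
      then have "a \<alpha> \<in> elts A" unfolding elts_A by blast
      then have fh: "finite {n \<in> elts J. hits n (a \<alpha>)}" using KA e by blast
      show "finite (elts X \<inter> elts (a \<alpha>))" by (rule thin[OF _ _ fh]) (use ze eX in blast)+
    qed
    from finU[OF this] have "finite {n \<in> elts J. \<exists>m\<in>elts X. hpair n m \<in> elts Fs \<and> m \<notin> elts z}" .
    moreover have "elts J \<subseteq> {n \<in> elts J. \<exists>m\<in>elts X. hpair n m \<in> elts Fs \<and> m \<notin> elts z}"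
    proof
      fix n assume n: "n \<in> elts J"
      then have nw: "n \<in> elts homega" using Jw by blast
      then obtain m where m: "m \<in> elts (\<Phi> n)" using \<Phi> elts_eq_empty by blast
      then have p: "hpair n m \<in> elts Fs" using row[OF nw] by blast
      then have "m \<in> elts homega" using Fs(2) hpair_in_hprod by blast
      then have "m \<in> elts X" unfolding eX using p n by blast
      then show "n \<in> {n \<in> elts J. \<exists>m\<in>elts X. hpair n m \<in> elts Fs \<and> m \<notin> elts z}" using n p ze by blast
    qed
    ultimately show False using Jinf finite_subset by blast
  qed
  have KC: "K \<in> CLs"
  proof (rule CLI[OF KN Kne])
    show "elts K \<subseteq> Psi_points A" unfolding eK inK_def Psi_points_def using zw by blast
    fix x assume x: "x \<in> elts A" "x \<notin> elts K"
    have "elts x \<inter> elts K \<subseteq> elts x \<inter> elts z" using A_mem[OF x(1)] Kw by blast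
    moreover have "finite (elts x \<inter> elts z)" using KA[OF x(1)] x(2) by blast
    ultimately show "finite (elts x \<inter> elts K)" using finite_subset by blast
  qed
  show ?thesis
  proof (intro bexI[OF _ KC] allI impI)
    fix N V assume h: "(\<forall>i\<le>N. V i \<in> POs) \<and> K \<in> vietoris_basic CLs N V"
    then have Vo: "V i \<in> POs" if "i \<le> N" for i using that by blast
    have up: "elts K \<subseteq> (\<Union>i\<le>N. elts (V i))" and low: "i \<le> N ==> elts K \<inter> elts (V i) \<noteq> {}" for i
      using h unfolding vietoris_basic_def by blast+
    define UU where "UU = hset (V ` {..N})"
    have eU: "elts UU = V ` {..N}" unfolding UU_def by (simp add: countable_finite)
    have UN: "UU \<in> NG" unfolding UU_def by (rule NN.finite_closed) (use Vo in \<open>auto simp: Psi_opens_in_def\<close>)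
    define Z where "Z = hset {m \<in> elts homega. (\<exists>n\<in>elts J. hpair n m \<in> elts Fs) \<and> (\<forall>u\<in>elts UU. m \<notin> elts u)}"
    have ZN: "Z \<in> NG" unfolding Z_def
      by (rule NN.sep[OF NN.omegaM]) (intro NN.bex NN.ball dfn_conj dfn_not NN.mem NN.dff_hpair NN.elem NN.var Fs(1) JN UN)
    note eZ = elts_sep[OF Z_def]
    have Zz: "m \<notin> elts z" if "m \<in> elts Z" for m
    proof
      assume m: "m \<in> elts z"
      then have "m \<in> elts K" using zw Kw by blast
      then obtain i where "i \<le> N" "m \<in> elts (V i)" using up by blast
      then show False using that unfolding eZ eU by blast
    qed
    \<comment> \<open>Maximality applies because a member of the family in \<open>K\<close> is
      almost contained in some \<open>V i\<close>, which \<open>Z\<close> avoids, while a member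
      outside \<open>K\<close> is hit only finitely often.\<close>
    have "finite (elts Z)"
    proof (rule maximal[OF ZN])
      show "elts Z \<subseteq> elts homega" unfolding eZ by blast
      fix \<alpha> assume \<alpha>: "\<alpha> \<in> elts w1"
      then have aA: "a \<alpha> \<in> elts A" unfolding elts_A by blast
      show "finite (elts Z \<inter> elts (a \<alpha>))"
      proof (cases "a \<alpha> \<in> elts K")
        case True
        then obtain i where i: "i \<le> N" "a \<alpha> \<in> elts (V i)" using up by blast
        have "elts Z \<inter> elts (a \<alpha>) \<subseteq> elts (a \<alpha>) - elts (V i)" using i(1) unfolding eZ eU by blast
        then show ?thesis using open_cofinite[OF Vo[OF i(1)] i(2) aA] finite_subset by blast
      next
        case False
        then have fh: "finite {n \<in> elts J. hits n (a \<alpha>)}" using KA[OF aA] by blast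
        show ?thesis by (rule thin[OF _ _ fh]) (use Zz eZ in blast)+
      qed
    qed
    from finU[OF this] have E0: "finite {n \<in> elts J. \<exists>m\<in>elts Z. hpair n m \<in> elts Fs \<and> m \<notin> elts z}" .
    \<comment> \<open>The pair consists of finitely many indices to be hit simultaneously and
      finitely many exceptional n; together they guarantee that F_n meets
      \<open>V i\<close>.\<close>
    define ok where "ok i p <-> finite (fst p) \<and> fst p \<subseteq> elts w1 \<and> (\<forall>\<alpha>\<in>fst p. infinite {n \<in> elts J. hit Fs z n \<alpha>}) \<and> finite (snd p) \<and>
      (\<forall>n\<in>elts J. n \<notin> snd p \<and> (\<forall>\<alpha>\<in>fst p. hit Fs z n \<alpha>) --> (\<exists>m\<in>elts (V i). hpair n m \<in> elts Fs))" for i and p :: "hc set \<times> hc set"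
    have "\<forall>i\<in>{..N}. \<exists>p. ok i p"
    proof
      fix i assume "i \<in> {..N}"
      then have i: "i \<le> N" by simp
      obtain x where x: "x \<in> elts K" "x \<in> elts (V i)" using low[OF i] by blast
      \<comment> \<open>If \<open>V i\<close> contains an element of z, nothing has to be hit, since
        almost all F_n contain that element.\<close>
      have nat_case: "\<exists>p. ok i p"
        if m: "m \<in> elts z" "m \<in> elts (V i)" for m
        by (rule exI[of _ "({}, {n \<in> elts J. hpair n m \<notin> elts Fs})"]) (use m lim1 in \<open>auto simp: ok_def\<close>)
      show "\<exists>p. ok i p"
      proof (cases "x \<in> elts z")
        case True then show ?thesis using nat_case x(2) by blast
      next
        case False
        then have xA: "x \<in> elts A" using x(1) unfolding eK inK_def by blast
        note cof = open_cofinite[OF Vo[OF i] x(2) xA]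
        show ?thesis
        proof (cases "infinite (elts x \<inter> elts z)")
          case True
          \<comment> \<open>\<open>V i\<close> contains almost all of x and x meets z in an infinite
            set, so this case reduces to the previous one.\<close>
          from Diff_infinite_finite[OF cof this] obtain m where "m \<in> (elts x \<inter> elts z) - (elts x - elts (V i))"
            using infinite_imp_nonempty by blast
          then show ?thesis using nat_case[of m] by blast
        next
          case False
          then have ih: "infinite {n \<in> elts J. hits n x}" using KA[OF xA] x(1) by blast
          obtain \<alpha> where \<alpha>: "\<alpha> \<in> elts w1" "x = a \<alpha>" using xA unfolding elts_A by blast
          have "\<exists>m\<in>elts (V i). hpair n m \<in> elts Fs"
            if n: "n \<in> elts J" "n \<notin> {n \<in> elts J. \<exists>m\<in>elts x - elts (V i). hpair n m \<in> elts Fs \<and> m \<notin> elts z}" "hit Fs z n \<alpha>" for n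
          proof -
            obtain m where m: "hpair n m \<in> elts Fs" "m \<notin> elts z" "m \<in> elts x" using n(3) \<alpha>(2) unfolding hit_def by blast
            then have "m \<in> elts (V i)" using n(1,2) by blast
            then show ?thesis using m(1) by blast
          qed
          moreover have "infinite {n \<in> elts J. hit Fs z n \<alpha>}" using ih unfolding \<alpha>(2) hits .
          ultimately show ?thesis using \<alpha>(1) finU[OF cof] unfolding ok_def
            by (intro exI[of _ "({\<alpha>}, {n \<in> elts J. \<exists>m\<in>elts x - elts (V i). hpair n m \<in> elts Fs \<and> m \<notin> elts z})"]) simp
        qed
      qed
    qed
    from bchoice[OF this] obtain p where pp: "\<forall>i\<in>{..N}. ok i (p i)"
      by (elim exE)
    have p: "finite (fst (p i))" "fst (p i) \<subseteq> elts w1" "\<forall>\<alpha>\<in>fst (p i). infinite {n \<in> elts J. hit Fs z n \<alpha>}" "finite (snd (p i))"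
      "\<forall>n\<in>elts J. n \<notin> snd (p i) \<and> (\<forall>\<alpha>\<in>fst (p i). hit Fs z n \<alpha>) --> (\<exists>m\<in>elts (V i). hpair n m \<in> elts Fs)"
      if i: "i \<le> N" for i
    proof -
      have "i \<in> {..N}" using i by simp
      note q = bspec[OF pp this, unfolded ok_def]
      show "finite (fst (p i))" by (rule conjunct1[OF q])
      note q = conjunct2[OF q]
      show "fst (p i) \<subseteq> elts w1" by (rule conjunct1[OF q])
      note q = conjunct2[OF q]
      show "\<forall>\<alpha>\<in>fst (p i). infinite {n \<in> elts J. hit Fs z n \<alpha>}" by (rule conjunct1[OF q])
      note q = conjunct2[OF q]
      show "finite (snd (p i))" by (rule conjunct1[OF q])
      show "\<forall>n\<in>elts J. n \<notin> snd (p i) \<and> (\<forall>\<alpha>\<in>fst (p i). hit Fs z n \<alpha>) --> (\<exists>m\<in>elts (V i). hpair n m \<in> elts Fs)" by (rule conjunct2[OF q])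
    qed
    define K0 where "K0 = (\<Union>i\<le>N. fst (p i))"
    define E where "E = (\<Union>i\<le>N. snd (p i)) \<union> {n \<in> elts J. \<exists>m\<in>elts Z. hpair n m \<in> elts Fs \<and> m \<notin> elts z}"
    have "finite K0" unfolding K0_def by (rule finite_UN_I) (use p(1) in auto)
    moreover have "K0 \<subseteq> elts w1" unfolding K0_def using p(2) by blast
    moreover have "\<forall>\<alpha>\<in>K0. infinite {n \<in> elts J. hit Fs z n \<alpha>}" unfolding K0_def using p(3) by blast
    ultimately have inf: "infinite {n \<in> elts J. \<forall>\<alpha>\<in>K0. hit Fs z n \<alpha>}" using sim by blast
    have "finite (\<Union>i\<le>N. snd (p i))" by (rule finite_UN_I) (use p(4) in auto)
    then have "finite E" unfolding E_def using E0 by (rule finite_UnI)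
    from Diff_infinite_finite[OF this inf] have inf2: "infinite ({n \<in> elts J. \<forall>\<alpha>\<in>K0. hit Fs z n \<alpha>} - E)" .
    have "{n \<in> elts J. \<forall>\<alpha>\<in>K0. hit Fs z n \<alpha>} - E \<subseteq> {n \<in> elts homega. \<Phi> n \<in> vietoris_basic CLs N V}"
    proof
      fix n assume n: "n \<in> {n \<in> elts J. \<forall>\<alpha>\<in>K0. hit Fs z n \<alpha>} - E"
      then have nJ: "n \<in> elts J" and nw: "n \<in> elts homega" using Jw by blast+
      have 1: "\<Phi> n \<in> CLs" using \<Phi>[OF nw] finite_CL by blast
      have 2: "elts (\<Phi> n) \<subseteq> (\<Union>i\<le>N. elts (V i))"
      proof
        fix m assume "m \<in> elts (\<Phi> n)"
        then have pm: "hpair n m \<in> elts Fs" using row[OF nw] by blast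
        then have mw: "m \<in> elts homega" using Fs(2) hpair_in_hprod by blast
        show "m \<in> (\<Union>i\<le>N. elts (V i))"
        proof (rule ccontr)
          assume "m \<notin> (\<Union>i\<le>N. elts (V i))"
          then have "m \<in> elts Z" unfolding eZ eU using pm nJ mw by blast
          then show False using n pm Zz nJ unfolding E_def by blast
        qed
      qed
      have 3: "\<forall>i\<le>N. elts (\<Phi> n) \<inter> elts (V i) \<noteq> {}"
      proof (intro allI impI)
        fix i assume i: "i \<le> N"
        have "n \<notin> snd (p i)" "\<forall>\<alpha>\<in>fst (p i). hit Fs z n \<alpha>" using n i unfolding E_def K0_def by blast+
        then obtain m where "m \<in> elts (V i)" "hpair n m \<in> elts Fs" using p(5)[OF i] nJ by blast
        then show "elts (\<Phi> n) \<inter> elts (V i) \<noteq> {}" using row[OF nw] by blast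
      qed
      show "n \<in> {n \<in> elts homega. \<Phi> n \<in> vietoris_basic CLs N V}" unfolding vietoris_basic_def using nw 1 2 3 by blast
    qed
    then show "infinite {n \<in> elts homega. \<Phi> n \<in> vietoris_basic CLs N V}" using inf2 finite_subset by blast
  qed
qed

text \<open>The two codes are those of the rationals \<open>k\<close> and \<open>-k\<close>.\<close>

definition far :: "hc => hc => hc => bool" where
  "far f k F <-> (\<exists>y\<in>elts RN.RS. hpair F y \<in> elts f \<and>
    (hpair k (hpair hempty (hsucc hempty)) \<in> elts y \<or> hpair hempty (hpair k (hsucc hempty)) \<notin> elts y))"

text \<open>One inequality is strict and the other is not because cuts are strict lower sets: -k is
  missing from the cut of r exactly if r <= -k.\<close>

lemma far_iff:
  assumes f: "hfun f CLs" and F: "F \<in> CLs" and r: "r \<in> RN.K" "f \<cdot> F = dcut r"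
  shows "far f (hnat k) F <-> real k < r \<or> r \<le> - real k"
proof -
  have c: "hpair (hnat k) (hpair hempty (hsucc hempty)) = rcode k 0 0" "hpair hempty (hpair (hnat k) (hsucc hempty)) = rcode 0 k 0"
    unfolding rcode_def by simp_all
  have q: "rcode k 0 0 \<in> elts QQ" "rcode 0 k 0 \<in> elts QQ" unfolding elts_QQ by blast+
  have "far f (hnat k) F <-> (rcode k 0 0 \<in> elts (dcut r) \<or> rcode 0 k 0 \<notin> elts (dcut r))"
    unfolding far_def c happ_iff[OF f F] r(2) using imageI[OF r(1), of dcut] unfolding RN.elts_RS by metis
  also have "\<dots> <-> real k < r \<or> r \<le> - real k" unfolding elts_cut using q by auto
  finally show ?thesis .
qed

lemma dfn_far: "f \<in> NG ==> dfn NG (\<lambda>s. far f (s 0) (s 1))"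
  unfolding far_def
  by (intro NN.dfn_rules NN.dff_rules NN.dff_hsucc RN.RS_closed NN.hempty_closed)

text \<open>Inside the extension the sequence is chosen by taking the finite set with the least
  number in an enumeration of all finite sets that lies in the ground model.\<close>

lemma far_sequence:
  assumes f: "f \<in> NG" and ex: "\<And>k. \<exists>F\<in>elts (hfin homega). F \<noteq> hempty \<and> far f (hnat k) F"
  shows "\<exists>\<Phi> Fs. Fs \<in> NG \<and> elts Fs \<subseteq> hprod (elts homega) (elts homega) \<and>
    (\<forall>n\<in>elts homega. \<Phi> n \<in> elts (hfin homega) \<and> \<Phi> n \<noteq> hempty \<and> far f n (\<Phi> n)) \<and>
    (\<forall>n\<in>elts homega. \<forall>m. hpair n m \<in> elts Fs <-> m \<in> elts (\<Phi> n))"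
proof -
  obtain e g where e: "e \<in> M" "\<forall>x\<in>elts (hfin homega). \<forall>y. hpair x y \<in> elts e <-> y = hnat (g x)" "inj_on g (elts (hfin homega))"
    using countable_inE[OF countable_in_hfin[OF homega_closed countable_in_homega]] by blast
  define C where "C n F <-> F \<in> elts (hfin homega) \<and> F \<noteq> hempty \<and> far f n F" for n F
  define first where "first n F <-> C n F \<and> (\<forall>F'\<in>elts (hfin homega). C n F' -->
    (\<exists>i\<in>elts homega. \<exists>j\<in>elts homega. hpair F i \<in> elts e \<and> hpair F' j \<in> elts e \<and> j \<notin> elts i))" for n F
  have first: "first n F <-> C n F \<and> (\<forall>F'. C n F' --> g F \<le> g F')" for n F
  proof -
    have "(\<exists>i\<in>elts homega. \<exists>j\<in>elts homega. hpair F i \<in> elts e \<and> hpair F' j \<in> elts e \<and> j \<notin> elts i) <-> g F \<le> g F'"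
      if FF: "F \<in> elts (hfin homega)" "F' \<in> elts (hfin homega)" for F F'
    proof -
      have "hpair F i \<in> elts e <-> i = hnat (g F)" "hpair F' i \<in> elts e <-> i = hnat (g F')" for i using e(2) FF by blast+
      then show ?thesis by (simp add: not_less)
    qed
    then show ?thesis unfolding first_def C_def by blast
  qed
  have uniq: "F = F'" if h: "first n F" "first n F'" for n F F'
  proof -
    have "C n F" "C n F'" "g F \<le> g F'" "g F' \<le> g F" using h unfolding first by blast+
    then show ?thesis using inj_onD[OF e(3), of F F'] unfolding C_def by simp
  qed
  have ex1: "\<exists>F. first n F" if n: "n \<in> elts homega" for n
  proof -
    obtain k where k: "n = hnat k" using n by auto
    have "\<exists>F. C n F" using ex[of k] unfolding C_def k by blast
    then obtain F where "C n F" "\<And>F'. C n F' ==> g F \<le> g F'" using ex_has_least_nat[of "C n" _ g] by blast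
    then show ?thesis unfolding first by blast
  qed
  define \<Phi> where "\<Phi> n = (SOME F. first n F)" for n
  have \<Phi>: "first n (\<Phi> n)" if "n \<in> elts homega" for n unfolding \<Phi>_def by (rule someI_ex[OF ex1[OF that]])
  have dC: "dfn NG (\<lambda>s. C (s 0) (s 1))" unfolding C_def
    by (intro NN.dfn_rules NN.dff_rules NN.hfin_closed NN.omegaM NN.hempty_closed dfn_comp2[where Q = "far f", OF dfn_far[OF f]])
  have dF: "dfn NG (\<lambda>s. first (s 0) (s 1))" unfolding first_def
    by (intro dfn_conj dfn_not dfn_imp NN.bex NN.ball NN.mem NN.dff_hpair NN.elem NN.var NN.hfin_closed NN.omegaM ground_sub_NG[OF e(1)]
      dfn_comp2[where Q = C, OF dC])
  define Fs where "Fs = hset {p \<in> elts (hprd homega homega). \<exists>n\<in>elts homega. \<exists>m\<in>elts homega. \<exists>F\<in>elts (hfin homega).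
    p = hpair n m \<and> m \<in> elts F \<and> first n F}"
  note eF = elts_sep[OF Fs_def]
  have FN: "Fs \<in> NG" unfolding Fs_def
    by (rule NN.sep[OF NN.hprd_closed[OF NN.omegaM NN.omegaM]])
      (intro NN.dfn_rules NN.dff_rules NN.hfin_closed NN.omegaM dfn_comp2[where Q = first, OF dF])
  have Fsub: "elts Fs \<subseteq> hprod (elts homega) (elts homega)" unfolding eF elts_hprd by blast
  have row: "hpair n m \<in> elts Fs <-> m \<in> elts (\<Phi> n)" if n: "n \<in> elts homega" for n m
  proof
    assume "hpair n m \<in> elts Fs"
    then obtain n' m' F where h: "hpair n m = hpair n' m'" "m' \<in> elts F" "first n' F" unfolding eF by blast
    then show "m \<in> elts (\<Phi> n)" using uniq[OF \<Phi>[OF n], of F] by simp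
  next
    assume m: "m \<in> elts (\<Phi> n)"
    have F: "\<Phi> n \<in> elts (hfin homega)" using \<Phi>[OF n] unfolding first C_def by blast
    then have mw: "m \<in> elts homega" using m unfolding elts_hfin by blast
    then have "hpair n m \<in> elts (hprd homega homega)" using n unfolding elts_hprd hpair_in_hprod by blast
    then show "hpair n m \<in> elts Fs" unfolding eF using n mw F m \<Phi>[OF n] by blast
  qed
  have "\<Phi> n \<in> elts (hfin homega) \<and> \<Phi> n \<noteq> hempty \<and> far f n (\<Phi> n)" if n: "n \<in> elts homega" for n
    using \<Phi>[OF n] unfolding first C_def by blast
  then show ?thesis using FN Fsub row by (intro exI[of _ \<Phi>] exI[of _ Fs] conjI ballI allI) blast+
qed

text \<open>The values beyond k form an open set, so its preimage contains a basic Vietoris set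
  around x. Since omega is dense in the space, a natural number can be picked from each of the
  finitely many open sets, and these numbers form a finite member.\<close>

lemma far_finite:
  assumes cont: "continuous_in NG CLs VOs (elts RN.RS) (order_opens_in NG RN.RS RN.ltf) f"
    and unb: "\<exists>x\<in>CLs. hpair (f \<cdot> x) (dcut (- real k)) \<in> elts RN.ltf \<or> hpair (dcut (real k)) (f \<cdot> x) \<in> elts RN.ltf"
  shows "\<exists>F\<in>elts (hfin homega). F \<noteq> hempty \<and> far f (hnat k) F"
proof -
  have f: "hfun f CLs" "\<And>x. x \<in> CLs ==> f \<cdot> x \<in> elts RN.RS" using cont unfolding continuous_in_def fun_in_def by blast+
  have ck: "dcut (- real k) \<in> elts RN.RS" "dcut (real k) \<in> elts RN.RS"
    unfolding RN.elts_RS using RN.K_minus_nat[of k] RN.K_of_nat[of k] by blast+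
  note kK = RN.K_minus_nat[of k] RN.K_of_nat[of k]
  define V where "V = hset {y \<in> elts RN.RS. hpair y (dcut (- real k)) \<in> elts RN.ltf \<or> hpair (dcut (real k)) y \<in> elts RN.ltf}"
  note eV = elts_sep[OF V_def]
  have VN: "V \<in> NG" unfolding V_def
    by (rule NN.sep[OF RN.RS_closed])
      (intro dfn_disj NN.mem NN.dff_hpair NN.elem NN.var NN.transD[OF ck(1) RN.RS_closed] NN.transD[OF ck(2) RN.RS_closed] RN.op_closed(3))
  have Vcut: "dcut r \<in> elts V <-> r < - real k \<or> real k < r" if r: "r \<in> RN.K" for r
    unfolding eV RN.elts_RS using r RN.lt_cut[OF r kK(1)] RN.lt_cut[OF kK(2) r] by blast
  have sub1: "{y \<in> elts RN.RS. hpair (dcut s) y \<in> elts RN.ltf \<and> hpair y (dcut t) \<in> elts RN.ltf} \<subseteq> elts V"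
    if st: "s \<in> RN.K" "t \<in> RN.K" "t \<le> - real k \<or> real k \<le> s" for s t
  proof
    fix y assume y: "y \<in> {y \<in> elts RN.RS. hpair (dcut s) y \<in> elts RN.ltf \<and> hpair y (dcut t) \<in> elts RN.ltf}"
    then obtain u where u: "u \<in> RN.K" "y = dcut u" unfolding RN.elts_RS by blast
    then have "s < u" "u < t" using y RN.lt_cut[OF st(1) u(1)] RN.lt_cut[OF u(1) st(2)] by blast+
    then have "u < - real k \<or> real k < u" using st(3) by linarith
    then show "y \<in> elts V" unfolding u(2) Vcut[OF u(1)] .
  qed
  have "V \<in> order_opens_in NG RN.RS RN.ltf"
    unfolding order_opens_in_def
  proof (intro CollectI conjI VN ballI)
    show "elts V \<subseteq> elts RN.RS" unfolding eV by blast
    fix y assume y: "y \<in> elts V"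
    then obtain r where r: "r \<in> RN.K" "y = dcut r" unfolding eV RN.elts_RS by blast
    have "r < - real k \<or> real k < r" using y unfolding r(2) Vcut[OF r(1)] .
    \<comment> \<open>An open interval around r that stays beyond k: one end is k or -k, the other
      lies at distance 1 from r on the unbounded side.\<close>
    then obtain s t where st: "s \<in> RN.K" "t \<in> RN.K" "s < r" "r < t" "t \<le> - real k \<or> real k \<le> s"
    proof
      assume "r < - real k"
      then show thesis using that[of "r + - real 1" "- real k"] RN.K_add[OF r(1) RN.K_minus_nat[of 1]] kK(1) by simp
    next
      assume "real k < r"
      then show thesis using that[of "real k" "r + real 1"] RN.K_add[OF r(1) RN.K_of_nat[of 1]] kK(2) by simp
    qed
    show "\<exists>a\<in>elts RN.RS. \<exists>b\<in>elts RN.RS. hpair a y \<in> elts RN.ltf \<and> hpair y b \<in> elts RN.ltf \<and>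
      {y \<in> elts RN.RS. hpair a y \<in> elts RN.ltf \<and> hpair y b \<in> elts RN.ltf} \<subseteq> elts V"
    proof (rule bexI[of _ "dcut s"], rule bexI[of _ "dcut t"], intro conjI sub1 st(1,2,5))
      show "hpair (dcut s) y \<in> elts RN.ltf" "hpair y (dcut t) \<in> elts RN.ltf"
        unfolding r(2) using RN.lt_cut[OF st(1) r(1)] RN.lt_cut[OF r(1) st(2)] st(3,4) by blast+
      show "dcut t \<in> elts RN.RS" "dcut s \<in> elts RN.RS" unfolding RN.elts_RS using st(1,2) by blast+
    qed
  qed
  then obtain W where W: "W \<in> VOs" "elts W = {x \<in> CLs. f \<cdot> x \<in> elts V}"
    using cont unfolding continuous_in_def by blast
  obtain x where x: "x \<in> CLs" "hpair (f \<cdot> x) (dcut (- real k)) \<in> elts RN.ltf \<or> hpair (dcut (real k)) (f \<cdot> x) \<in> elts RN.ltf"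
    using unb by blast
  have "x \<in> elts W" unfolding W(2) eV using x f(2)[OF x(1)] by blast
  then obtain N B where B: "\<forall>i\<le>N. B i \<in> POs" "x \<in> vietoris_basic CLs N B" "vietoris_basic CLs N B \<subseteq> elts W"
    using W(1) unfolding vietoris_opens_in_def by blast
  have "\<exists>m. m \<in> elts (B i) \<and> m \<in> elts homega" if i: "i \<le> N" for i
  proof -
    have Bo: "B i \<in> POs" using B(1) i by blast
    obtain y where y: "y \<in> elts (B i)" using B(2) i unfolding vietoris_basic_def by blast
    show ?thesis
    proof (cases "y \<in> elts A")
      case True
      have "infinite (elts y)" using A_mem[OF True] by blast
      from Diff_infinite_finite[OF open_cofinite[OF Bo y True] this] obtain m where "m \<in> elts y - (elts y - elts (B i))"
        using infinite_imp_nonempty by blast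
      then show ?thesis using A_mem[OF True] by blast
    next
      case False
      have "elts (B i) \<subseteq> Psi_points A" using Bo unfolding Psi_opens_in_def by blast
      then show ?thesis using y False unfolding Psi_points_def by blast
    qed
  qed
  then obtain m where m: "\<And>i. i \<le> N ==> m i \<in> elts (B i) \<and> m i \<in> elts homega" by metis
  define F where "F = hset (m ` {..N})"
  have eF: "elts F = m ` {..N}" unfolding F_def by (simp add: countable_finite)
  have F: "F \<in> elts (hfin homega)" unfolding elts_hfin mem_Collect_eq eF using m by blast
  have "F \<noteq> hempty" using eF by auto
  note FC = finite_CL[OF F this]
  have "F \<in> vietoris_basic CLs N B" unfolding vietoris_basic_def
  proof (intro CollectI conjI FC allI impI)
    show "elts F \<subseteq> (\<Union>i\<le>N. elts (B i))" unfolding eF using m by auto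
    fix i assume i: "i \<le> N"
    then have "m i \<in> elts F" "m i \<in> elts (B i)" unfolding eF using m by auto
    then show "elts F \<inter> elts (B i) \<noteq> {}" by blast
  qed
  then have fV: "f \<cdot> F \<in> elts V" using B(3) W(2) by blast
  obtain r where r: "r \<in> RN.K" "f \<cdot> F = dcut r" using f(2)[OF FC] unfolding RN.elts_RS by blast
  have "r < - real k \<or> real k < r" using fV unfolding r(2) Vcut[OF r(1)] .
  then have "far f (hnat k) F" unfolding far_iff[OF f(1) FC r] by auto
  then show ?thesis using F \<open>F \<noteq> hempty\<close> by blast
qed

theorem pseudocompact: "pseudocompact_in NG CLs VOs"
  unfolding pseudocompact_in_def
proof (rule exI[of _ RN.RS], rule exI[of _ RN.addf], rule exI[of _ RN.mulf], rule exI[of _ "dcut 0"], rule exI[of _ "dcut 1"],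
    rule exI[of _ RN.ltf], intro conjI RN.complete_field allI impI)
  fix f assume cont: "continuous_in NG CLs VOs (elts RN.RS) (order_opens_in NG RN.RS RN.ltf) f"
  have f: "f \<in> NG" "hfun f CLs" "\<And>x. x \<in> CLs ==> f \<cdot> x \<in> elts RN.RS" using cont unfolding continuous_in_def fun_in_def by blast+
  show "\<exists>a\<in>elts RN.RS. \<exists>b\<in>elts RN.RS. \<forall>x\<in>CLs. \<not> hpair (f \<cdot> x) a \<in> elts RN.ltf \<and> \<not> hpair b (f \<cdot> x) \<in> elts RN.ltf"
  proof (rule ccontr)
    assume nb: "\<not> ?thesis"
    have "\<exists>F\<in>elts (hfin homega). F \<noteq> hempty \<and> far f (hnat k) F" for k
    proof (rule far_finite[OF cont])
      have "dcut (- real k) \<in> elts RN.RS" "dcut (real k) \<in> elts RN.RS"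
        unfolding RN.elts_RS using RN.K_minus_nat[of k] RN.K_of_nat[of k] by blast+
      then show "\<exists>x\<in>CLs. hpair (f \<cdot> x) (dcut (- real k)) \<in> elts RN.ltf \<or> hpair (dcut (real k)) (f \<cdot> x) \<in> elts RN.ltf"
        using nb by blast
    qed
    from far_sequence[OF f(1) this] obtain \<Phi> Fs where Fs: "Fs \<in> NG" "elts Fs \<subseteq> hprod (elts homega) (elts homega)"
      and \<Phi>: "\<forall>n\<in>elts homega. \<Phi> n \<in> elts (hfin homega) \<and> \<Phi> n \<noteq> hempty \<and> far f n (\<Phi> n)"
      and row: "\<forall>n\<in>elts homega. \<forall>m. hpair n m \<in> elts Fs <-> m \<in> elts (\<Phi> n)" by (elim exE conjE)
    have "\<exists>K\<in>CLs. \<forall>N V. (\<forall>i\<le>N. V i \<in> POs) \<and> K \<in> vietoris_basic CLs N V -->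
      infinite {n \<in> elts homega. \<Phi> n \<in> vietoris_basic CLs N V}"
      by (rule accumulation_point[OF Fs]) (use \<Phi> row in blast)+
    then obtain K where K: "K \<in> CLs" "\<And>N V. (\<forall>i\<le>N. V i \<in> POs) ==> K \<in> vietoris_basic CLs N V ==>
      infinite {n \<in> elts homega. \<Phi> n \<in> vietoris_basic CLs N V}" by blast
    obtain r where r: "r \<in> RN.K" "f \<cdot> K = dcut r" using f(3)[OF K(1)] unfolding RN.elts_RS by blast
    \<comment> \<open>The interval from -k to k is a neighbourhood of the value at \<open>K\<close>,
      so infinitely many F_n are mapped into it; but for n >= k the value at F_n lies
      outside.\<close>
    obtain k where k: "\<bar>r\<bar> < real k" using reals_Archimedean2 by blast
    note kK = RN.K_minus_nat[of k] RN.K_of_nat[of k]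
    have ck: "dcut (- real k) \<in> elts RN.RS" "dcut (real k) \<in> elts RN.RS" unfolding RN.elts_RS using kK by blast+
    define V where "V = hset {y \<in> elts RN.RS. hpair (dcut (- real k)) y \<in> elts RN.ltf \<and> hpair y (dcut (real k)) \<in> elts RN.ltf}"
    note eV = elts_sep[OF V_def]
    have VN: "V \<in> NG" unfolding V_def
      by (rule NN.sep[OF RN.RS_closed])
        (intro dfn_conj NN.mem NN.dff_hpair NN.elem NN.var NN.transD[OF ck(1) RN.RS_closed] NN.transD[OF ck(2) RN.RS_closed] RN.op_closed(3))
    have "V \<in> order_opens_in NG RN.RS RN.ltf"
      unfolding order_opens_in_def
    proof (intro CollectI conjI VN ballI)
      show "elts V \<subseteq> elts RN.RS" unfolding eV by blast
      fix y assume "y \<in> elts V"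
      then show "\<exists>a\<in>elts RN.RS. \<exists>b\<in>elts RN.RS. hpair a y \<in> elts RN.ltf \<and> hpair y b \<in> elts RN.ltf \<and>
        {y \<in> elts RN.RS. hpair a y \<in> elts RN.ltf \<and> hpair y b \<in> elts RN.ltf} \<subseteq> elts V"
        using ck unfolding eV by blast
    qed
    then obtain W where W: "W \<in> VOs" "elts W = {x \<in> CLs. f \<cdot> x \<in> elts V}"
      using cont unfolding continuous_in_def by blast
    have "hpair (dcut (- real k)) (f \<cdot> K) \<in> elts RN.ltf" "hpair (f \<cdot> K) (dcut (real k)) \<in> elts RN.ltf"
      unfolding r(2) RN.lt_cut[OF kK(1) r(1)] RN.lt_cut[OF r(1) kK(2)] using k by linarith+
    then have "K \<in> elts W" unfolding W(2) eV using K(1) f(3)[OF K(1)] by blast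
    then obtain N B where B: "\<forall>i\<le>N. B i \<in> POs" "K \<in> vietoris_basic CLs N B" "vietoris_basic CLs N B \<subseteq> elts W"
      using W(1) unfolding vietoris_opens_in_def by blast
    from K(2)[OF B(1,2)] have inf: "infinite {n \<in> elts homega. \<Phi> n \<in> vietoris_basic CLs N B}" .
    have "{n \<in> elts homega. \<Phi> n \<in> vietoris_basic CLs N B} \<subseteq> range hnat" by auto
    then obtain n where n: "n \<ge> k" "\<Phi> (hnat n) \<in> vietoris_basic CLs N B" using infinite_hnat inf by blast
    have nw: "hnat n \<in> elts homega" by simp
    have PC: "\<Phi> (hnat n) \<in> CLs" using \<Phi> nw finite_CL by blast
    obtain s where s: "s \<in> RN.K" "f \<cdot> \<Phi> (hnat n) = dcut s" using f(3)[OF PC] unfolding RN.elts_RS by blast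
    have "dcut s \<in> elts V" using n(2) B(3) W(2) s(2) by auto
    then have "- real k < s" "s < real k" unfolding eV using RN.lt_cut[OF kK(1) s(1)] RN.lt_cut[OF s(1) kK(2)] by blast+
    moreover have "real n < s \<or> s \<le> - real n" using \<Phi> nw far_iff[OF f(2) PC s] by blast
    ultimately show False using n(1) by simp
  qed
qed

end

theorem theorem4p1:
  fixes M :: "hc set"
  assumes "countable M"
    and "transitive_class M"
    and "models_ZFC M"
    and "\<not> CH_in M"
  shows "\<exists>w1 P Ple Pone Q Qle Qone.
    omega1_in M w1 \<and>
    fs_iteration_in M w1 P Ple Pone Q Qle Qone \<and>
    ccc_in M (P \<cdot> w1) (Ple \<cdot> w1) \<and>
    (\<forall>G. generic M (P \<cdot> w1) (Ple \<cdot> w1) G \<longrightarrow>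
      (let N = generic_ext M (P \<cdot> w1) G in
        \<exists>A\<in>N. almost_disjoint_in N A \<and>
          (\<exists>k. omega1_in N k \<and> equipollent_in N (elts A) (elts k)) \<and>
          MAD_in N A \<and>
          pseudocompact_in N
            (CL_in N (Psi_points A) (Psi_opens_in N A))
            (vietoris_opens_in N (Psi_points A) (Psi_opens_in N A))))"
proof -
  interpret zfc M by (rule models_ZFC_zfc) fact+
  obtain w1 where "omega1_in M w1" using omega1_ex by blast
  then interpret omega1_model M w1 by unfold_locales
  have "let N = generic_ext M (itP \<cdot> w1) G in
      \<exists>A\<in>N. almost_disjoint_in N A \<and>
        (\<exists>k. omega1_in N k \<and> equipollent_in N (elts A) (elts k)) \<and>
        MAD_in N A \<and>
        pseudocompact_in N
          (CL_in N (Psi_points A) (Psi_opens_in N A))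
          (vietoris_opens_in N (Psi_points A) (Psi_opens_in N A))"
    if "generic M (itP \<cdot> w1) (itle \<cdot> w1) G" for G
  proof -
    interpret hechler M w1 G by unfold_locales (rule that)
    show ?thesis
      unfolding Let_def it_app(1)[of w1, simplified]
      using A_NG A_almost_disjoint w1_preserved A_equipollent A_MAD pseudocompact by blast
  qed
  then show ?thesis using \<open>omega1_in M w1\<close> iteration iteration_ccc by blast
qed

end
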